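(* Assume $n\ge2$. There exist a function $\psi\in\mathrm{Lip}(1,\tfrac12)$ on $\mathbb R^{n-1}\times\mathbb R$ with $D_t^{1/2}\psi\notin\mathrm{BMO}_{\mathrm{par}}$, with associated domain $\Omega_\psi=\{(x,x_n,t):x_n>\psi(x,t)\}$, an admissible direction $\nu$ for $\Omega_\psi$, and a function $f$ on $\partial\Omega_\psi$ whose pull-back $f\circ\pi_{e_n}$ belongs to $C^\infty_c(\mathbb R^{n-1}\times\mathbb R)$, such that $$\|\nabla_y(f\circ\pi_{e_n})\|_{L^p}+\|D_t^{1/2}(f\circ\pi_{e_n})\|_{L^p}<\infty\quad\text{for every }1<p<\infty,$$ but $$\|\nabla_y(f\circ\pi_\nu)\|_{L^2}+\|D_t^{1/2}(f\circ\pi_\nu)\|_{L^2}=\infty .$$ The failure is confined to the half-derivative: for every $\psi\in\mathrm{Lip}(1,\tfrac12)$ (no further hypothesis on $\psi$), every direction $\nu$ admissible for $\Omega_\psi$, every $1\le p\le\infty$ and every measurable $f$ on $\partial\Omega_\psi$ one has $$\|\nabla_y(f\circ\pi_\nu)\|_{L^p}\approx\|\nabla_y(f\circ\pi_{e_n})\|_{L^p},$$ with constants independent of $f$.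
   Context: A function $\psi$ on $\mathbb R^{n-1}\times\mathbb R$ is $\mathrm{Lip}(1,\tfrac12)$ if for some $\ell<\infty$, $|\psi(y,s)-\psi(u,\varsigma)|\le\ell(|y-u|+|s-\varsigma|^{1/2})$ for all $(y,s),(u,\varsigma)$. $D_t^{1/2}$ is the operator acting in the time variable with Fourier symbol $|\tau|^{1/2}$. The parabolic norm is $\|(Y,s)\|=(|Y|^2+|s|)^{1/2}$, and $\mathrm{BMO}_{\mathrm{par}}$ is bounded mean oscillation over parabolic balls of $\mathbb R^{n-1}\times\mathbb R$. Let $\ell_0=\|\nabla_y\psi\|_{L^\infty}$. A unit vector $\nu\in\mathbb S^{n-1}\subset\mathbb R^n$ is admissible for $\Omega_\psi$ if $\angle(\nu,e_n)<\arctan(1/\ell_0)$ (with $\arctan(1/0)=\pi/2$). For such $\nu$, fix a linear isometry $Q:\mathbb R^{n-1}\to\nu^\perp$ (the choice is immaterial for the norms; the standard one if $\nu=e_n$). Then there is a unique $\psi_\nu$ with $\Omega_\psi=\{(Qy+r\nu,t):r>\psi_\nu(y,t)\}$, and $\pi_\nu(y,t)=(Qy+\psi_\nu(y,t)\nu,t)$; in particular $\pi_{e_n}(y,t)=(y,\psi(y,t),t)$. All $L^p$ norms are over $\mathbb R^{n-1}\times\mathbb R$ with Lebesgue measure. The spatial gradient norm of a measurable pull-back is understood as $+\infty$ unless its time slices belong to $W^{1,1}_{\mathrm{loc}}(\mathbb R^{n-1})$ for almost every time and its spatial weak gradient belongs to $L^p$. *)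

theory Defs
  imports "HOL-Probability.Essential_Supremum"
begin

text \<open>
  Throughout, the space \<open>\<real>\<^sup>n\<^sup>-\<^sup>1\<close> is an arbitrary Euclidean space \<open>'a\<close> (of dimension at least one), the
  ambient \<open>\<real>\<^sup>n\<close> is \<open>'a \<times> real\<close> with \<open>e\<^sub>n = (0, 1)\<close>, and the last factor of
  \<open>('a \<times> real) \<times> real\<close> and of \<open>'a \<times> real\<close> (in the domain of \<open>\<psi>\<close>) is time.
\<close>

section \<open>Test functions\<close>

primrec Ck :: "nat \<Rightarrow> ('a::euclidean_space \<Rightarrow> real) \<Rightarrow> bool" where
  "Ck 0 f \<longleftrightarrow> continuous_on UNIV f"
| "Ck (Suc k) f \<longleftrightarrow>
     (\<forall>x. f differentiable (at x)) \<and> (\<forall>v. Ck k (\<lambda>x. frechet_derivative f (at x) v))"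

definition test_functions :: "('a::euclidean_space \<Rightarrow> real) set" where
  "test_functions = {\<phi>. (\<forall>k. Ck k \<phi>) \<and> compact (closure {x. \<phi> x \<noteq> 0})}"

definition locally_integrable :: "('a::euclidean_space \<Rightarrow> 'b::euclidean_space) \<Rightarrow> bool" where
  "locally_integrable u \<longleftrightarrow> (\<forall>K. compact K \<longrightarrow> set_integrable lebesgue K u)"


section \<open>Lebesgue norms and the spatial gradient\<close>

definition Lp_norm :: "ennreal \<Rightarrow> ('a::euclidean_space \<Rightarrow> 'b::euclidean_space) \<Rightarrow> ennreal" where
  "Lp_norm p F =
     (if p = \<infinity> then esssup lebesgue (\<lambda>x. ennreal (norm (F x)))
      else let I = (\<integral>\<^sup>+ x. ennreal (norm (F x) powr enn2real p) \<partial>lebesgue) in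
        if I = \<infinity> then \<infinity> else ennreal (enn2real I powr (1 / enn2real p)))"

text \<open>\<open>u \<in> W\<^sup>1\<^sup>,\<^sup>1\<^sub>l\<^sub>o\<^sub>c\<close> with weak gradient \<open>G\<close>.\<close>

definition has_weak_gradient :: "('a::euclidean_space \<Rightarrow> real) \<Rightarrow> ('a \<Rightarrow> 'a) \<Rightarrow> bool" where
  "has_weak_gradient u G \<longleftrightarrow>
     locally_integrable u \<and> locally_integrable G \<and>
     (\<forall>\<phi>\<in>test_functions. \<forall>v.
        (LINT x|lebesgue. u x * frechet_derivative \<phi> (at x) v) = - (LINT x|lebesgue. (G x \<bullet> v) * \<phi> x))"

text \<open>
  The infimum runs over the representatives of the spatial weak gradient; these agree almost
  everywhere, so it is just the norm of the gradient. If there is no weak gradient, the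
  infimum is over the empty set and equals \<open>\<infinity>\<close>.
\<close>

definition spatial_grad_norm :: "ennreal \<Rightarrow> ('a::euclidean_space \<times> real \<Rightarrow> real) \<Rightarrow> ennreal" where
  "spatial_grad_norm p g =
     (INF G \<in> {G. G \<in> borel_measurable lebesgue \<and>
                  (AE t in lebesgue. has_weak_gradient (\<lambda>y. g (y, t)) (\<lambda>y. G (y, t)))}.
        Lp_norm p G)"


section \<open>The half-order time derivative\<close>

text \<open>
  The multiplier \<open>\<bar>\<tau>\<bar>\<^sup>1\<^sup>/\<^sup>2\<close> on test functions, with \<open>\<tau>\<close> the angular frequency. The outer integral is
  real because the symbol is even, so taking the real part only changes the type.
\<close>

definition half_time_deriv :: "('a::euclidean_space \<times> real \<Rightarrow> real) \<Rightarrow> 'a \<times> real \<Rightarrow> real" where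
  "half_time_deriv \<phi> = (\<lambda>(y, t).
     Re (1 / (2 * of_real pi) *
       (LINT \<tau>|lborel. of_real (sqrt \<bar>\<tau>\<bar>) * cis (\<tau> * t) *
          (LINT s|lborel. cis (- \<tau> * s) * of_real (\<phi> (y, s))))))"

text \<open>
  \<open>D\<^sub>t\<^sup>1\<^sup>/\<^sup>2 g = h\<close> in the sense of distributions, tested against the class \<open>T\<close>. The pairing of \<open>g\<close> with
  \<open>D\<^sub>t\<^sup>1\<^sup>/\<^sup>2 \<phi>\<close> is integrated in space first, then in time. For bounded, compactly supported \<open>g\<close> this
  is the joint integral. For \<open>g\<close> in \<open>Lip(1,1/2)\<close> the order matters: \<open>g\<close> may grow like \<open>\<bar>t\<bar>\<^sup>1\<^sup>/\<^sup>2\<close> while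
  \<open>D\<^sub>t\<^sup>1\<^sup>/\<^sup>2 \<phi>\<close> only decays like \<open>\<bar>t\<bar>\<^sup>-\<^sup>3\<^sup>/\<^sup>2\<close>, but if \<open>\<phi>\<close> has integral zero then the spatial integral
  gains the factor \<open>\<bar>t\<bar>\<^sup>-\<^sup>1\<^sup>/\<^sup>2\<close> needed for absolute convergence in time. So for \<open>g\<close> in \<open>Lip(1,1/2)\<close>
  the class \<open>T\<close> of test functions with integral zero is used, i.e. \<open>D\<^sub>t\<^sup>1\<^sup>/\<^sup>2 g\<close> is defined modulo
  constants, which is what membership in BMO requires.
\<close>

definition weak_half_time_deriv ::
    "('a::euclidean_space \<times> real \<Rightarrow> real) set \<Rightarrow> ('a \<times> real \<Rightarrow> real) \<Rightarrow> ('a \<times> real \<Rightarrow> real) \<Rightarrow> bool" where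
  "weak_half_time_deriv T g h \<longleftrightarrow>
     locally_integrable h \<and>
     (\<forall>\<phi>\<in>T.
        (AE t in lebesgue. integrable lebesgue (\<lambda>y. g (y, t) * half_time_deriv \<phi> (y, t))) \<and>
        integrable lebesgue (\<lambda>t. LINT y|lebesgue. g (y, t) * half_time_deriv \<phi> (y, t)) \<and>
        (LINT t|lebesgue. LINT y|lebesgue. g (y, t) * half_time_deriv \<phi> (y, t)) =
          (LINT z|lebesgue. h z * \<phi> z))"

text \<open>As for the gradient, the infimum is over almost everywhere equal representatives.\<close>

definition half_time_deriv_norm :: "ennreal \<Rightarrow> ('a::euclidean_space \<times> real \<Rightarrow> real) \<Rightarrow> ennreal" where
  "half_time_deriv_norm p g = (INF h \<in> {h. weak_half_time_deriv test_functions g h}. Lp_norm p h)"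


section \<open>Parabolic BMO and \<open>Lip(1,1/2)\<close>\<close>

definition par_norm :: "'a::euclidean_space \<times> real \<Rightarrow> real" where
  "par_norm = (\<lambda>(y, s). sqrt ((norm y)\<^sup>2 + \<bar>s\<bar>))"

definition par_ball :: "'a::euclidean_space \<times> real \<Rightarrow> real \<Rightarrow> ('a \<times> real) set" where
  "par_ball z \<rho> = {w. par_norm (w - z) < \<rho>}"

definition average :: "('a::euclidean_space \<times> real) set \<Rightarrow> ('a \<times> real \<Rightarrow> real) \<Rightarrow> real" where
  "average B b = (LINT z:B|lebesgue. b z) / measure lebesgue B"

definition BMO_par :: "('a::euclidean_space \<times> real \<Rightarrow> real) set" where
  "BMO_par = {b. locally_integrable b \<and>
     (\<exists>C. \<forall>z. \<forall>\<rho>>0. average (par_ball z \<rho>) (\<lambda>w. \<bar>b w - average (par_ball z \<rho>) b\<bar>) \<le> C)}"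

definition half_time_deriv_in_BMO_par :: "('a::euclidean_space \<times> real \<Rightarrow> real) \<Rightarrow> bool" where
  "half_time_deriv_in_BMO_par \<psi> \<longleftrightarrow>
     (\<exists>b\<in>BMO_par. weak_half_time_deriv {\<phi>\<in>test_functions. (LINT z|lebesgue. \<phi> z) = 0} \<psi> b)"

definition Lip_1_half :: "('a::euclidean_space \<times> real \<Rightarrow> real) set" where
  "Lip_1_half = {\<psi>. \<exists>l. \<forall>y s u r. \<bar>\<psi> (y, s) - \<psi> (u, r)\<bar> \<le> l * (norm (y - u) + sqrt \<bar>s - r\<bar>)}"


section \<open>Graph domains and admissible directions\<close>

definition graph_domain :: "('a::euclidean_space \<times> real \<Rightarrow> real) \<Rightarrow> (('a \<times> real) \<times> real) set" where
  "graph_domain \<psi> = {((x, xn), t). xn > \<psi> (x, t)}"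

definition e\<^sub>n :: "'a::euclidean_space \<times> real" where
  "e\<^sub>n = (0, 1)"

text \<open>
  In \<open>admissible\<close>, the convention \<open>arctan (1 / 0) = \<pi> / 2\<close> needs a case distinction.
  For \<open>\<psi>\<close> in \<open>Lip(1,1/2)\<close> the norm \<open>l\<^sub>0\<close> is finite.
\<close>

definition admissible :: "('a::euclidean_space \<times> real \<Rightarrow> real) \<Rightarrow> 'a \<times> real \<Rightarrow> bool" where
  "admissible \<psi> \<nu> \<longleftrightarrow> norm \<nu> = 1 \<and>
     (let l\<^sub>0 = spatial_grad_norm \<infinity> \<psi> in
       arccos (\<nu> \<bullet> e\<^sub>n) < (if l\<^sub>0 = 0 then pi / 2 else arctan (enn2real (1 / l\<^sub>0))))"

definition isometry_onto_perp :: "'a::euclidean_space \<times> real \<Rightarrow> ('a \<Rightarrow> 'a \<times> real) \<Rightarrow> bool" where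
  "isometry_onto_perp \<nu> Q \<longleftrightarrow>
     linear Q \<and> (\<forall>y. norm (Q y) = norm y) \<and> range Q = {x. x \<bullet> \<nu> = 0}"

definition dir_graph_fun ::
    "('a::euclidean_space \<times> real \<Rightarrow> real) \<Rightarrow> 'a \<times> real \<Rightarrow> ('a \<Rightarrow> 'a \<times> real) \<Rightarrow> 'a \<times> real \<Rightarrow> real" where
  "dir_graph_fun \<psi> \<nu> Q =
     (THE \<psi>'. graph_domain \<psi> = {(Q y + r *\<^sub>R \<nu>, t) | y r t. r > \<psi>' (y, t)})"

definition dir_graph_map ::
    "('a::euclidean_space \<times> real \<Rightarrow> real) \<Rightarrow> 'a \<times> real \<Rightarrow> ('a \<Rightarrow> 'a \<times> real) \<Rightarrow>
     'a \<times> real \<Rightarrow> ('a \<times> real) \<times> real" where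
  "dir_graph_map \<psi> \<nu> Q = (\<lambda>(y, t). (Q y + dir_graph_fun \<psi> \<nu> Q (y, t) *\<^sub>R \<nu>, t))"

definition graph_map :: "('a::euclidean_space \<times> real \<Rightarrow> real) \<Rightarrow> 'a \<times> real \<Rightarrow> ('a \<times> real) \<times> real" where
  "graph_map \<psi> = (\<lambda>(y, t). ((y, \<psi> (y, t)), t))"

lemma ex_isometry_onto_perp:
  fixes \<nu> :: "'a::euclidean_space \<times> real"
  assumes "norm \<nu> = 1"
  shows "\<exists>Q. isometry_onto_perp \<nu> Q"
proof -
  have "\<nu> \<noteq> 0" using assms by auto
  then have "dim {x. \<nu> \<bullet> x = 0} = DIM('a)"
    by (simp add: dim_hyperplane)
  then have "dim (UNIV :: 'a set) = dim {x. x \<bullet> \<nu> = 0}"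
    by (simp add: inner_commute)
  moreover have "subspace {x. x \<bullet> \<nu> = 0}"
    using subspace_hyperplane[of \<nu>] by (simp add: inner_commute)
  ultimately obtain Q :: "'a \<Rightarrow> 'a \<times> real"
    where "linear Q" "Q ` UNIV = {x. x \<bullet> \<nu> = 0}" "\<And>x. x \<in> UNIV \<Longrightarrow> norm (Q x) = norm x"
    using isometry_subspaces[OF subspace_UNIV] by metis
  then show ?thesis
    unfolding isometry_onto_perp_def by blast
qed

lemma isometry_onto_perp_standard: "isometry_onto_perp e\<^sub>n (\<lambda>y. (y, 0))"
  unfolding isometry_onto_perp_def e\<^sub>n_def
  by (auto simp: linear_iff norm_Pair)

lemma dir_graph_map_standard: "dir_graph_map \<psi> e\<^sub>n (\<lambda>y. (y, 0)) = graph_map \<psi>"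
proof -
  have eq: "{((y, 0) + r *\<^sub>R e\<^sub>n, t) | y r t. r > g (y, t)} = graph_domain g"
    for g :: "'a \<times> real \<Rightarrow> real"
    unfolding graph_domain_def e\<^sub>n_def by auto
  have inj: "g = \<psi>" if "graph_domain \<psi> = graph_domain g" for g
  proof (rule ext)
    fix z :: "'a \<times> real"
    obtain y t where z: "z = (y, t)" by (cases z)
    have "r > \<psi> z \<longleftrightarrow> r > g z" for r
      using that unfolding z graph_domain_def set_eq_iff by auto
    then show "g z = \<psi> z"
      by (metis less_irrefl linorder_cases)
  qed
  have "dir_graph_fun \<psi> e\<^sub>n (\<lambda>y. (y, 0)) = \<psi>"
    unfolding dir_graph_fun_def eq
    by (rule the_equality) (auto dest: inj)
  then show ?thesis
    unfolding dir_graph_map_def graph_map_def by (auto simp: e\<^sub>n_def)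
qed

end

theory Submission
  imports Defs "HOL-Probability.Characteristic_Functions" "HOL-Probability.Sinc_Integral"
begin

text \<open>
  The gradient. The pull-backs of \<open>f\<close> in two admissible directions differ by a change of variables that
  at each fixed time is bi-Lipschitz in space, uniformly in time: \<open>l\<^sub>0\<close> bounds the Lipschitz constant of
  the time slices of \<open>\<psi>\<close>, and the angle condition says that the line in direction \<open>\<nu>\<close> through a boundary
  point leaves the graph at a positive rate. A bi-Lipschitz map \<open>\<Psi>\<close> preserves Sobolev functions, with
  gradients comparable up to constants: the chain rule holds for mollifications of \<open>u\<close>, and the
  mollifications may be removed because \<open>\<Psi>\<close> distorts Lebesgue measure by at most a constant factor
  (\<open>emeasure_vimage_Lipschitz_inverse\<close>, by Vitali's covering theorem). The chain rule uses the derivatives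
  of \<open>\<Psi>\<close> only in the coordinate directions and only along one null sequence of increments. These exist
  almost everywhere (\<open>direction_derivatives_exist\<close>), since on each line a Lipschitz function is an
  indefinite integral, so its difference quotients are Cauchy in \<open>L\<^sup>1\<close>. The result is
  \<open>composition_weak_gradient\<close>, and then \<open>gradient_norms_comparable_admissible\<close>.

  The half-order derivative. Let \<open>\<psi>\<close> be the lacunary series \<open>\<Sum> 2\<^sup>-\<^sup>j cos (4\<^sup>j t)\<close>, cut off in time and constant
  in space. It is Hoelder continuous of order one half, hence in \<open>Lip(1,1/2)\<close>, but half a derivative turns its
  coefficients into numbers of modulus one, which do not tend to zero as the Fourier coefficients of a
  locally integrable function must. This shows that \<open>D\<^sub>t\<^sup>1\<^sup>/\<^sup>2 \<psi>\<close> is not a locally integrable function, let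
  alone in BMO. Let \<open>f\<close> not depend on the height and be the horizontal coordinate along a unit vector
  \<open>e\<close>, cut off in space and time. Its vertical pull-back is a test function. Seen from a direction tilted
  towards \<open>e\<close>, the boundary point over \<open>(y, t)\<close> is displaced along \<open>e\<close> by a multiple of \<open>\<psi>\<close>, so near the
  origin the pull-back is a linear function of \<open>y\<close> plus a multiple of \<open>\<psi>\<close>, times the cut-off in time.
  Integrating in \<open>y\<close> against an even test function removes the linear part and leaves the lacunary series.
  Both failures are instances of \<open>no_weak_half_time_deriv\<close>.
\<close>

section \<open>Calculus of smooth functions\<close>

lemma Ck_SucI:
  fixes f :: "'a::euclidean_space \<Rightarrow> real"
  assumes "\<And>x. (f has_derivative f' x) (at x)" "\<And>v. Ck k (\<lambda>x. f' x v)"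
  shows "Ck (Suc k) f"
proof -
  have "frechet_derivative f (at x) = f' x" for x
    using frechet_derivative_at[OF assms(1)] by simp
  then show ?thesis
    using assms by (auto simp: differentiable_def)
qed

lemma Ck_SucD:
  fixes f :: "'a::euclidean_space \<Rightarrow> real"
  assumes "Ck (Suc k) f"
  shows "(f has_derivative frechet_derivative f (at x)) (at x)"
    and "Ck k (\<lambda>x. frechet_derivative f (at x) v)"
  using assms by (auto simp: frechet_derivative_works)

lemma Ck_lower:
  fixes f :: "'a::euclidean_space \<Rightarrow> real"
  shows "Ck (Suc k) f \<Longrightarrow> Ck k f"
proof (induction k arbitrary: f)
  case 0
  then show ?case
    by (auto simp: continuous_on_eq_continuous_at intro!: differentiable_imp_continuous_within)
next
  case (Suc k)
  show ?case
    by (rule Ck_SucI[OF Ck_SucD(1)[OF Suc.prems]]) (rule Suc.IH[OF Ck_SucD(2)[OF Suc.prems]])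
qed

lemma Ck_imp_continuous:
  fixes f :: "'a::euclidean_space \<Rightarrow> real"
  shows "Ck k f \<Longrightarrow> continuous_on UNIV f"
proof (induction k)
  case (Suc k)
  then show ?case using Ck_lower by blast
qed simp

lemma Ck_const [simp]: "Ck k (\<lambda>x::'a::euclidean_space. c)"
proof (induction k arbitrary: c)
  case (Suc k)
  show ?case
    by (rule Ck_SucI[where f' = "\<lambda>x v. 0"]) (auto simp: Suc)
qed simp

lemma Ck_bounded_linear:
  fixes f :: "'a::euclidean_space \<Rightarrow> real"
  assumes "bounded_linear f"
  shows "Ck k f"
proof (cases k)
  case 0
  then show ?thesis using assms by (simp add: linear_continuous_on)
next
  case (Suc m)
  show ?thesis unfolding Suc
    by (rule Ck_SucI[where f' = "\<lambda>x. f"]) (auto intro: bounded_linear_imp_has_derivative assms)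
qed

lemma Ck_add:
  fixes f g :: "'a::euclidean_space \<Rightarrow> real"
  shows "Ck k f \<Longrightarrow> Ck k g \<Longrightarrow> Ck k (\<lambda>x. f x + g x)"
proof (induction k arbitrary: f g)
  case 0
  then show ?case by (simp add: continuous_on_add)
next
  case (Suc k)
  show ?case
    by (rule Ck_SucI[OF has_derivative_add[OF Ck_SucD(1)[OF Suc.prems(1)] Ck_SucD(1)[OF Suc.prems(2)]]])
       (intro Suc.IH Ck_SucD(2)[OF Suc.prems(1)] Ck_SucD(2)[OF Suc.prems(2)])
qed

lemma Ck_mult:
  fixes f g :: "'a::euclidean_space \<Rightarrow> real"
  shows "Ck k f \<Longrightarrow> Ck k g \<Longrightarrow> Ck k (\<lambda>x. f x * g x)"
proof (induction k arbitrary: f g)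
  case 0
  then show ?case by (simp add: continuous_on_mult)
next
  case (Suc k)
  show ?case
    by (rule Ck_SucI[OF has_derivative_mult[OF Ck_SucD(1)[OF Suc.prems(1)] Ck_SucD(1)[OF Suc.prems(2)]]])
       (intro Ck_add Suc.IH Ck_SucD(2)[OF Suc.prems(1)] Ck_SucD(2)[OF Suc.prems(2)]
         Ck_lower[OF Suc.prems(1)] Ck_lower[OF Suc.prems(2)])
qed

lemma Ck_sum:
  fixes f :: "'i \<Rightarrow> 'a::euclidean_space \<Rightarrow> real"
  shows "(\<And>i. i \<in> I \<Longrightarrow> Ck k (f i)) \<Longrightarrow> Ck k (\<lambda>x. \<Sum>i\<in>I. f i x)"
  by (induction I rule: infinite_finite_induct) (auto intro: Ck_add)

lemma Ck_compose_real:
  fixes q :: "'a::euclidean_space \<Rightarrow> real"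
  shows "Ck k P \<Longrightarrow> Ck k q \<Longrightarrow> Ck k (\<lambda>x. P (q x))"
proof (induction k arbitrary: P)
  case 0
  then show ?case
    using continuous_on_compose2[of UNIV P UNIV q] by auto
next
  case (Suc k)
  have lin: "linear (frechet_derivative P (at s))" for s
    using Ck_SucD(1)[OF Suc.prems(1)] has_derivative_linear by blast
  have 1: "((\<lambda>x. P (q x)) has_derivative
      (\<lambda>v. frechet_derivative P (at (q x)) 1 * frechet_derivative q (at x) v)) (at x)" for x
  proof -
    have "((\<lambda>x. P (q x)) has_derivative
      (\<lambda>v. frechet_derivative P (at (q x)) (frechet_derivative q (at x) v))) (at x)"
      using has_derivative_compose[OF Ck_SucD(1)[OF Suc.prems(2)] Ck_SucD(1)[OF Suc.prems(1)]] by simp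
    moreover have "frechet_derivative P (at (q x)) w = frechet_derivative P (at (q x)) 1 * w" for w
      using linear_scale[OF lin, of "q x" w 1] by simp
    ultimately show ?thesis by (metis (no_types, lifting) ext)
  qed
  show ?case
    by (rule Ck_SucI[OF 1])
       (intro Ck_mult Suc.IH[of "\<lambda>s. frechet_derivative P (at s) 1"] Ck_SucD(2)[OF Suc.prems(2)]
          Ck_SucD(2)[OF Suc.prems(1)] Ck_lower[OF Suc.prems(2)])
qed

lemma Ck_compose_affine:
  fixes f :: "'b::euclidean_space \<Rightarrow> real" and L :: "'a::euclidean_space \<Rightarrow> 'b"
  assumes L: "bounded_linear L"
  shows "Ck k f \<Longrightarrow> Ck k (\<lambda>x. f (c + L x))"
proof (induction k arbitrary: f)
  case 0
  have "continuous_on UNIV (\<lambda>x. c + L x)"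
    by (intro continuous_intros linear_continuous_on L)
  then show ?case using 0 continuous_on_compose2[of UNIV f UNIV "\<lambda>x. c + L x"] by auto
next
  case (Suc k)
  have "((\<lambda>x. f (c + L x)) has_derivative (\<lambda>v. frechet_derivative f (at (c + L x)) (L v))) (at x)" for x
  proof -
    have "((\<lambda>x. c + L x) has_derivative L) (at x)"
      by (auto intro!: derivative_eq_intros bounded_linear_imp_has_derivative L)
    from has_derivative_compose[OF this Ck_SucD(1)[OF Suc.prems]] show ?thesis by simp
  qed
  then show ?case
    by (rule Ck_SucI) (intro Suc.IH[of "\<lambda>x. frechet_derivative f (at x) _"] Ck_SucD(2)[OF Suc.prems])
qed

lemma Ck_inverse:
  fixes g :: "'a::euclidean_space \<Rightarrow> real"
  assumes nz: "\<And>x. g x \<noteq> 0"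
  shows "Ck k g \<Longrightarrow> Ck k (\<lambda>x. inverse (g x))"
proof (induction k)
  case 0
  then show ?case using nz by (simp add: continuous_on_inverse)
next
  case (Suc k)
  have "((\<lambda>x. inverse (g x)) has_derivative
      (\<lambda>v. - 1 * (inverse (g x) * frechet_derivative g (at x) v * inverse (g x)))) (at x)" for x
    using Deriv.has_derivative_inverse[OF nz Ck_SucD(1)[OF Suc.prems]] by simp
  then show ?case
    by (rule Ck_SucI)
       (intro Ck_mult Ck_const Suc.IH Ck_lower[OF Suc.prems] Ck_SucD(2)[OF Suc.prems])
qed

subsection \<open>A plateau function\<close>

text \<open>The powers of \<open>1 / x\<close> are carried along because the derivative of \<open>exp (- 1 / x)\<close> produces them.\<close>

definition flat :: "nat \<Rightarrow> real \<Rightarrow> real" where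
  "flat m x = (if x > 0 then (1 / x) ^ m * exp (- (1 / x)) else 0)"

lemma flat_nonneg: "0 \<le> flat m x"
  by (auto simp: flat_def)

text \<open>At order \<open>m + 1\<close> this bounds the difference quotients of \<open>flat m\<close> at zero.\<close>

lemma flat_le: "\<bar>flat m x\<bar> \<le> fact (Suc m) * \<bar>x\<bar>"
proof (cases "x > 0")
  case True
  define y where "y = 1 / x"
  have y: "y > 0" using True by (simp add: y_def)
  have "y ^ Suc m / fact (Suc m) \<le> exp y"
  proof -
    have "(\<lambda>n. y ^ n / fact n) sums exp y"
      using exp_converges[of y] by (simp add: divide_inverse mult.commute)
    then have "(\<Sum>n\<in>{Suc m}. y ^ n / fact n) \<le> exp y"
      using y by (metis (mono_tags, lifting) sums_unique sums_summable sum_le_suminf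
          finite.intros finite_insert divide_nonneg_nonneg fact_ge_zero less_imp_le zero_le_power)
    then show ?thesis by simp
  qed
  then have "y ^ m * y * exp (- y) \<le> fact (Suc m)"
    by (simp only: exp_minus power_Suc) (simp add: field_simps del: fact_Suc)
  then have "y ^ m * exp (- y) \<le> fact (Suc m) / y"
    using y by (simp add: field_simps)
  then show ?thesis
    using True y by (simp add: flat_def y_def)
next
  case False
  have "0 \<le> fact (Suc m) * \<bar>x\<bar>" by (rule mult_nonneg_nonneg[OF fact_ge_zero abs_ge_zero])
  then show ?thesis using False by (simp only: flat_def if_False abs_zero)
qed

lemma flat_has_derivative:
  "(flat m has_real_derivative (- real m * flat (Suc m) x + flat (m + 2) x)) (at x)"
proof -
  consider "x > 0" | "x < 0" | "x = 0" by linarith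
  then show ?thesis
  proof cases
    case 1
    have d: "((\<lambda>x. 1 / x) has_real_derivative (- ((1 / x)^2))) (at x)"
      using 1 by (auto intro!: derivative_eq_intros simp: power2_eq_square)
    have val: "real m * (- (y^2) * y ^ (m - Suc 0)) * e + (e * (- (- (y^2)))) * y ^ m
        = - real m * (y ^ Suc m * e) + y ^ (m + 2) * e" for y e :: real
      by (cases m) (simp_all add: power2_eq_square algebra_simps)
    have D: "((\<lambda>x. (1 / x) ^ m * exp (- (1 / x))) has_real_derivative
        (- real m * flat (Suc m) x + flat (m + 2) x)) (at x)"
      using DERIV_cong[OF DERIV_mult[OF DERIV_power[OF d] DERIV_fun_exp[OF DERIV_minus[OF d]]] val] 1
      by (simp only: flat_def if_True)
    have ev: "\<forall>\<^sub>F y in nhds x. flat m y = (1 / y) ^ m * exp (- (1 / y))"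
      using eventually_nhds_in_open[of "{0<..}" x] 1 by (auto simp: flat_def elim!: eventually_mono)
    show ?thesis by (rule iffD2[OF DERIV_cong_ev[OF refl ev refl] D])
  next
    case 2
    have ev: "\<forall>\<^sub>F y in nhds x. flat m y = (\<lambda>_. 0) y"
      using eventually_nhds_in_open[of "{..<0}" x] 2 by (auto simp: flat_def elim!: eventually_mono)
    have z: "- real m * flat (Suc m) x + flat (m + 2) x = 0"
      using 2 by (simp add: flat_def)
    show ?thesis
      by (rule iffD2[OF DERIV_cong_ev[OF refl ev z] DERIV_const])
  next
    case 3
    have "(\<lambda>h. (flat m (0 + h) - flat m 0) / h) \<midarrow>0\<rightarrow> 0"
    proof (rule Lim_null_comparison[where g = "\<lambda>h. fact (Suc (Suc m)) * \<bar>h\<bar>"])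
      have "(flat m (0 + h) - flat m 0) / h = flat (Suc m) h" for h
        by (auto simp: flat_def)
      then show "\<forall>\<^sub>F h in at 0. norm ((flat m (0 + h) - flat m 0) / h) \<le> fact (Suc (Suc m)) * \<bar>h\<bar>"
        using flat_le[of "Suc m"] by (intro always_eventually allI) (simp del: fact_Suc)
      show "(\<lambda>h. fact (Suc (Suc m)) * \<bar>h\<bar> :: real) \<midarrow>0\<rightarrow> 0"
        by (auto intro!: tendsto_eq_intros)
    qed
    then show ?thesis using 3 by (simp add: DERIV_def flat_def)
  qed
qed

lemma Ck_flat: "Ck k (flat m)"
proof (induction k arbitrary: m)
  case 0
  have "isCont (flat m) x" for x using flat_has_derivative DERIV_isCont by blast
  then show ?case by (simp add: continuous_on_eq_continuous_at)
next
  case (Suc k)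
  show ?case
    by (rule Ck_SucI[OF flat_has_derivative[unfolded has_field_derivative_def]])
       (intro Ck_mult Ck_add Suc Ck_const)
qed

definition plateau :: "real \<Rightarrow> real" where
  "plateau s = flat 0 (2 - s) * inverse (flat 0 (2 - s) + flat 0 (s - 1))"

lemma plateau_denominator_pos: "flat 0 (2 - s) + flat 0 (s - 1) > 0"
  by (auto simp: flat_def add_pos_pos)

lemma Ck_plateau: "Ck k plateau"
proof -
  have 1: "Ck k (\<lambda>s. flat 0 (2 + - s))"
    by (rule Ck_compose_affine) (auto intro: Ck_flat bounded_linear_minus bounded_linear_ident)
  have 2: "Ck k (\<lambda>s. flat 0 (- 1 + s))"
    by (rule Ck_compose_affine) (auto intro: Ck_flat bounded_linear_minus bounded_linear_ident)
  have "flat 0 (2 + - s) + flat 0 (- 1 + s) \<noteq> 0" for s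
    using plateau_denominator_pos[of s] by simp
  then have "Ck k (\<lambda>s. flat 0 (2 + - s) * inverse (flat 0 (2 + - s) + flat 0 (- 1 + s)))"
    by (intro Ck_mult Ck_inverse Ck_add 1 2)
  then show ?thesis by (simp add: plateau_def[abs_def])
qed

lemma plateau_eq_1: "s \<le> 1 \<Longrightarrow> plateau s = 1"
  using plateau_denominator_pos[of s] by (auto simp: plateau_def flat_def)

lemma plateau_eq_0: "s \<ge> 2 \<Longrightarrow> plateau s = 0"
  by (auto simp: plateau_def flat_def)

lemma plateau_nonneg: "0 \<le> plateau s"
  using plateau_denominator_pos[of s] by (auto simp: plateau_def flat_nonneg)

lemma plateau_le_1: "plateau s \<le> 1"
  using plateau_denominator_pos[of s] flat_nonneg[of 0 "s - 1"]
  by (auto simp: plateau_def field_simps)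

section \<open>Test functions and integration by parts\<close>

abbreviation smooth :: "('a::euclidean_space \<Rightarrow> real) \<Rightarrow> bool" where
  "smooth f \<equiv> (\<forall>k. Ck k f)"

lemma smooth_has_derivative:
  "smooth f \<Longrightarrow> (f has_derivative frechet_derivative f (at x)) (at x)"
  using Ck_SucD(1)[of 0] by blast

lemma smooth_derivative: "smooth f \<Longrightarrow> smooth (\<lambda>x. frechet_derivative f (at x) v)"
  using Ck_SucD(2) by blast

lemma smooth_continuous: "smooth f \<Longrightarrow> continuous_on A f"
  using Ck_imp_continuous continuous_on_subset by blast

lemma smooth_measurable [measurable_dest]: "smooth f \<Longrightarrow> f \<in> borel_measurable borel"
  by (intro borel_measurable_continuous_onI smooth_continuous)

lemma smooth_derivative_linear: "smooth f \<Longrightarrow> linear (frechet_derivative f (at x))"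
  using smooth_has_derivative has_derivative_linear by blast

lemma test_functions_iff:
  "\<phi> \<in> test_functions \<longleftrightarrow> smooth \<phi> \<and> (\<exists>R>0. \<forall>x. norm x > R \<longrightarrow> \<phi> x = 0)"
proof
  assume "\<phi> \<in> test_functions"
  then have "bounded (closure {x. \<phi> x \<noteq> 0})" and s: "smooth \<phi>"
    by (auto simp: test_functions_def compact_imp_bounded)
  then obtain R where "R > 0" "\<forall>x \<in> closure {x. \<phi> x \<noteq> 0}. norm x \<le> R"
    by (auto simp: bounded_pos)
  then have "\<forall>x. norm x > R \<longrightarrow> \<phi> x = 0"
    using closure_subset[of "{x. \<phi> x \<noteq> 0}"] by fastforce
  with s \<open>R > 0\<close> show "smooth \<phi> \<and> (\<exists>R>0. \<forall>x. norm x > R \<longrightarrow> \<phi> x = 0)" by blast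
next
  assume a: "smooth \<phi> \<and> (\<exists>R>0. \<forall>x. norm x > R \<longrightarrow> \<phi> x = 0)"
  then obtain R where "\<forall>x. norm x > R \<longrightarrow> \<phi> x = 0" by blast
  then have "{x. \<phi> x \<noteq> 0} \<subseteq> cball 0 R"
    by (force simp: not_less[symmetric])
  then have "closure {x. \<phi> x \<noteq> 0} \<subseteq> cball 0 R"
    by (simp add: closure_minimal)
  then have "compact (closure {x. \<phi> x \<noteq> 0})"
    by (meson bounded_cball bounded_subset closed_closure compact_eq_bounded_closed)
  with a show "\<phi> \<in> test_functions" by (simp add: test_functions_def)
qed

lemma test_smooth: "\<phi> \<in> test_functions \<Longrightarrow> smooth \<phi>"
  by (simp add: test_functions_iff)

lemma test_support:
  assumes "\<phi> \<in> test_functions"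
  obtains R where "R > 0" "\<And>x. norm x > R \<Longrightarrow> \<phi> x = 0"
  using assms by (auto simp: test_functions_iff)

lemma test_derivative:
  assumes "\<phi> \<in> test_functions"
  shows "(\<lambda>x. frechet_derivative \<phi> (at x) v) \<in> test_functions"
proof -
  obtain R where R: "R > 0" "\<And>x. norm x > R \<Longrightarrow> \<phi> x = 0" using test_support[OF assms] by blast
  have "frechet_derivative \<phi> (at x) v = 0" if x: "norm x > R" for x
  proof -
    have "open {y. norm y > R}" by (simp add: open_Collect_less continuous_on_norm)
    then have "((\<lambda>y. 0) has_derivative frechet_derivative \<phi> (at x)) (at x)"
      using has_derivative_transform_within_open[OF smooth_has_derivative[OF test_smooth[OF assms]]]
        x R(2) by fastforce
    then have "frechet_derivative \<phi> (at x) = (\<lambda>h. 0)"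
      using has_derivative_unique has_derivative_const by blast
    then show ?thesis by simp
  qed
  then show ?thesis
    using R(1) smooth_derivative[OF test_smooth[OF assms]] by (auto simp: test_functions_iff)
qed

lemma test_mult:
  assumes "smooth u" "\<phi> \<in> test_functions"
  shows "(\<lambda>x. u x * \<phi> x) \<in> test_functions"
  using assms by (fastforce simp: test_functions_iff intro!: Ck_mult)

lemma test_scale: "\<phi> \<in> test_functions \<Longrightarrow> (\<lambda>x. c * \<phi> x) \<in> test_functions"
  using test_mult[of "\<lambda>x. c"] by simp

lemma test_add:
  assumes "\<phi> \<in> test_functions" "\<eta> \<in> test_functions"
  shows "(\<lambda>x. \<phi> x + \<eta> x) \<in> test_functions"
proof -
  obtain R where R: "R > 0" "\<And>x. norm x > R \<Longrightarrow> \<phi> x = 0" using test_support[OF assms(1)] by blast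
  obtain R' where R': "R' > 0" "\<And>x. norm x > R' \<Longrightarrow> \<eta> x = 0" using test_support[OF assms(2)] by blast
  have "\<forall>x. norm x > max R R' \<longrightarrow> \<phi> x + \<eta> x = 0" using R R' by auto
  moreover have "max R R' > 0" using R by auto
  ultimately show ?thesis
    using assms by (auto simp: test_functions_iff intro!: Ck_add)
qed

lemma test_reflect:
  assumes "\<phi> \<in> test_functions"
  shows "(\<lambda>y. \<phi> (x - y)) \<in> test_functions"
proof -
  obtain R where R: "R > 0" "\<And>x. norm x > R \<Longrightarrow> \<phi> x = 0" using test_support[OF assms] by blast
  have "Ck k (\<lambda>y. \<phi> (x + - y))" for k
    by (rule Ck_compose_affine) (auto intro: bounded_linear_minus bounded_linear_ident
         simp: test_smooth[OF assms])
  moreover have "\<phi> (x - y) = 0" if "norm y > R + norm x" for y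
    using that norm_triangle_ineq2[of y x] by (intro R(2)) (simp add: norm_minus_commute)
  moreover have "R + norm x > 0" using R by (simp add: add_pos_nonneg)
  ultimately show ?thesis by (auto simp: test_functions_iff)
qed

lemma test_continuous: "\<phi> \<in> test_functions \<Longrightarrow> continuous_on A \<phi>"
  by (simp add: smooth_continuous test_smooth)

lemma test_measurable: "\<phi> \<in> test_functions \<Longrightarrow> \<phi> \<in> borel_measurable borel"
  by (simp add: smooth_measurable test_smooth)

lemma test_bounded:
  assumes "\<phi> \<in> test_functions"
  obtains M where "M > 0" "\<And>x. \<bar>\<phi> x\<bar> \<le> M"
proof -
  obtain R where R: "R > 0" "\<And>x. norm x > R \<Longrightarrow> \<phi> x = 0" using test_support[OF assms] by blast
  have "bounded (\<phi> ` cball 0 R)"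
    by (intro compact_imp_bounded compact_continuous_image test_continuous[OF assms] compact_cball)
  then obtain M where M: "M > 0" "\<And>x. x \<in> cball 0 R \<Longrightarrow> norm (\<phi> x) \<le> M"
    by (auto simp: bounded_pos)
  have "\<bar>\<phi> x\<bar> \<le> M" for x
    using M(2)[of x] M(1) R(2)[of x] by (cases "norm x > R") auto
  with M(1) that show ?thesis by blast
qed

lemma integrable_bounded_ball_support:
  fixes f :: "'a::euclidean_space \<Rightarrow> 'b::{banach,second_countable_topology}"
  assumes "f \<in> borel_measurable borel" "\<And>x. norm x \<le> R \<Longrightarrow> norm (f x) \<le> M" "\<And>x. norm x > R \<Longrightarrow> f x = 0"
  shows "integrable lborel f"
proof (rule Bochner_Integration.integrable_bound)
  show "integrable lborel (\<lambda>x. M * indicator (cball (0::'a) R) x :: real)"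
    using emeasure_lborel_cball_finite[of "0::'a" R]
    by (intro integrable_mult_right integrable_real_indicator) auto
  show "AE x in lborel. norm (f x) \<le> norm (M * indicator (cball 0 R) x)"
    using assms(2,3) by (intro AE_I2) (force simp: indicator_def not_less[symmetric])
qed (use assms in auto)

lemma test_integrable:
  assumes "\<phi> \<in> test_functions"
  shows "integrable lborel \<phi>"
proof -
  obtain R where R: "R > 0" "\<And>x. norm x > R \<Longrightarrow> \<phi> x = 0" using test_support[OF assms] by blast
  obtain M where M: "\<And>x. \<bar>\<phi> x\<bar> \<le> M" using test_bounded[OF assms] by blast
  show ?thesis
    by (rule integrable_bounded_ball_support[of _ R M]) (use R M test_measurable[OF assms] in auto)
qed

lemma lborel_distr_translation: "distr lborel borel (\<lambda>x. x + c) = (lborel :: 'a::euclidean_space measure)"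
  using lborel_distr_plus[of c] by (subst add.commute[abs_def])

lemma lborel_integral_translation:
  fixes f :: "'a::euclidean_space \<Rightarrow> 'b::{banach,second_countable_topology}"
  assumes "f \<in> borel_measurable borel"
  shows "(LINT x|lborel. f (x + c)) = (LINT x|lborel. f x)"
  by (subst lborel_distr_translation[of c, symmetric], subst integral_distr) (use assms in auto)

lemma lborel_integrable_translation:
  fixes f :: "'a::euclidean_space \<Rightarrow> 'b::{banach,second_countable_topology}"
  assumes "integrable lborel f"
  shows "integrable lborel (\<lambda>x. f (x + c))"
proof -
  have "integrable (distr lborel borel (\<lambda>x. x + c)) f"
    using assms by (simp add: lborel_distr_translation)
  then show ?thesis by (subst (asm) integrable_distr_eq) (use assms in auto)
qed

lemma lborel_nn_integral_translation:
  fixes f :: "'a::euclidean_space \<Rightarrow> ennreal"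
  assumes "f \<in> borel_measurable borel"
  shows "(\<integral>\<^sup>+x. f (x + c) \<partial>lborel) = (\<integral>\<^sup>+x. f x \<partial>lborel)"
  by (subst (2) lborel_distr_translation[of c, symmetric], subst nn_integral_distr) (use assms in auto)

lemma lborel_distr_reflection: "distr lborel borel (\<lambda>x. c - x) = (lborel :: 'a::euclidean_space measure)"
  using lborel_affine[of "-1" c] by (simp add: density_1)

lemma lborel_integral_reflection:
  fixes f :: "'a::euclidean_space \<Rightarrow> 'b::{banach,second_countable_topology}"
  assumes "f \<in> borel_measurable borel"
  shows "(LINT x|lborel. f (c - x)) = (LINT x|lborel. f x)"
  by (subst (2) lborel_distr_reflection[of c, symmetric], subst integral_distr) (use assms in auto)

lemma smooth_mean_value:
  fixes f :: "'a::euclidean_space \<Rightarrow> real"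
  assumes "smooth f"
  obtains \<theta> where "0 < \<theta>" "\<theta> < 1" "f (x + v) - f x = frechet_derivative f (at (x + \<theta> *\<^sub>R v)) v"
proof -
  define g where "g s = f (x + s *\<^sub>R v)" for s :: real
  have d: "(g has_real_derivative frechet_derivative f (at (x + s *\<^sub>R v)) v) (at s)" for s
  proof -
    have "((\<lambda>s. x + s *\<^sub>R v) has_derivative (\<lambda>h. h *\<^sub>R v)) (at s)"
      by (auto intro!: derivative_eq_intros)
    from has_derivative_compose[OF this smooth_has_derivative[OF assms]]
    have "(g has_derivative (\<lambda>h. frechet_derivative f (at (x + s *\<^sub>R v)) (h *\<^sub>R v))) (at s)"
      by (simp add: g_def[abs_def])
    then show ?thesis
      by (rule has_derivative_imp_has_field_derivative)
         (simp add: linear_scale[OF smooth_derivative_linear[OF assms]])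
  qed
  obtain z where "z > 0" "z < 1" "g 1 - g 0 = (1 - 0) * frechet_derivative f (at (x + z *\<^sub>R v)) v"
    using MVT2[of 0 1 g "\<lambda>s. frechet_derivative f (at (x + s *\<^sub>R v)) v"] d by auto
  then show ?thesis using that by (auto simp: g_def)
qed

lemma test_lipschitz_along:
  assumes "\<phi> \<in> test_functions"
  obtains M where "M > 0" "\<And>x s. \<bar>\<phi> (x + s *\<^sub>R v) - \<phi> x\<bar> \<le> M * \<bar>s\<bar>"
proof -
  obtain M where M: "M > 0" "\<And>x. \<bar>frechet_derivative \<phi> (at x) v\<bar> \<le> M"
    using test_bounded[OF test_derivative[OF assms]] by blast
  have "\<bar>\<phi> (x + s *\<^sub>R v) - \<phi> x\<bar> \<le> M * \<bar>s\<bar>" for x s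
  proof -
    obtain \<theta> where "\<phi> (x + s *\<^sub>R v) - \<phi> x = frechet_derivative \<phi> (at (x + \<theta> *\<^sub>R s *\<^sub>R v)) (s *\<^sub>R v)"
      using smooth_mean_value[OF test_smooth[OF assms]] by blast
    also have "\<dots> = s * frechet_derivative \<phi> (at (x + \<theta> *\<^sub>R s *\<^sub>R v)) v"
      using linear_scale[OF smooth_derivative_linear[OF test_smooth[OF assms]]] by simp
    finally show ?thesis
      using M(2) by (simp add: abs_mult mult.commute[of M] mult_left_mono)
  qed
  with M(1) that show ?thesis by blast
qed

lemma difference_quotient_LIMSEQ:
  fixes f :: "'a::euclidean_space \<Rightarrow> real"
  assumes "(f has_derivative D) (at x)" "h \<longlonglongrightarrow> 0" "\<And>n. h n \<noteq> 0"
  shows "(\<lambda>n. (f (x + h n *\<^sub>R v) - f x) / h n) \<longlonglongrightarrow> D v"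
proof -
  have l: "linear D" using assms has_derivative_linear by blast
  have "((\<lambda>s. x + s *\<^sub>R v) has_derivative (\<lambda>h. h *\<^sub>R v)) (at 0)"
    by (auto intro!: derivative_eq_intros)
  from has_derivative_compose[OF this, of f D] assms(1)
  have "((\<lambda>s. f (x + s *\<^sub>R v)) has_derivative (\<lambda>h. D (h *\<^sub>R v))) (at 0)" by simp
  then have "((\<lambda>s. f (x + s *\<^sub>R v)) has_real_derivative D v) (at 0)"
    by (rule has_derivative_imp_has_field_derivative) (simp add: linear_scale[OF l])
  then have "((\<lambda>s. (f (x + s *\<^sub>R v) - f x) / s) \<longlongrightarrow> D v) (at 0)"
    by (simp add: DERIV_def)
  moreover have "filterlim h (at 0) sequentially"
    using assms by (simp add: filterlim_at)
  ultimately show ?thesis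
    using filterlim_compose by fast
qed

text \<open>
  Moving the difference quotient from one factor to the other is just translation invariance
  of Lebesgue measure, so an almost everywhere derivative along a single null sequence is a
  weak derivative, as long as the quotients stay locally bounded.
\<close>

lemma integration_by_parts_difference_quotients:
  fixes W :: "'a::euclidean_space \<Rightarrow> real"
  assumes [measurable]: "W \<in> borel_measurable borel" "D \<in> borel_measurable borel"
    and h: "h \<longlonglongrightarrow> 0" "\<And>n. h n > 0" "\<And>n. h n \<le> 1"
    and bdd: "\<And>R. \<exists>C. \<forall>x. norm x \<le> R \<longrightarrow> \<bar>W x\<bar> \<le> C"
    and lip: "\<And>R. \<exists>C. \<forall>x n. norm x \<le> R \<longrightarrow> \<bar>W (x + h n *\<^sub>R v) - W x\<bar> \<le> C * h n"
    and lim: "AE x in lborel. (\<lambda>n. (W (x + h n *\<^sub>R v) - W x) / h n) \<longlonglongrightarrow> D x"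
    and \<phi>: "\<phi> \<in> test_functions"
  shows "(LINT x|lborel. W x * frechet_derivative \<phi> (at x) v) = - (LINT x|lborel. D x * \<phi> x)"
proof -
  have [measurable]: "\<phi> \<in> borel_measurable borel" using test_measurable[OF \<phi>] .
  define g where "g x = frechet_derivative \<phi> (at x) v" for x
  have [measurable]: "g \<in> borel_measurable borel"
    unfolding g_def[abs_def] using test_measurable[OF test_derivative[OF \<phi>]] .
  obtain R where R: "R > 0" "\<And>x. norm x > R \<Longrightarrow> \<phi> x = 0" using test_support[OF \<phi>] by blast
  define R' where "R' = R + norm v"
  have R': "norm x > R' \<Longrightarrow> \<phi> x = 0 \<and> \<phi> (x - h n *\<^sub>R v) = 0" for x n
  proof -
    assume a: "norm x > R'"
    have "norm (h n *\<^sub>R v) \<le> norm v" using h(2)[of n] h(3)[of n] by (simp add: mult_left_le_one_le)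
    then have "norm (x - h n *\<^sub>R v) > R"
      using a norm_triangle_ineq2[of x "h n *\<^sub>R v"] unfolding R'_def by linarith
    moreover have "norm x > R" using a norm_ge_zero[of v] unfolding R'_def by linarith
    ultimately show ?thesis using R by auto
  qed
  obtain M where M: "M > 0" "\<And>x s. \<bar>\<phi> (x + s *\<^sub>R v) - \<phi> x\<bar> \<le> M * \<bar>s\<bar>"
    using test_lipschitz_along[OF \<phi>] by blast
  obtain B where B: "B > 0" "\<And>x. \<bar>\<phi> x\<bar> \<le> B" using test_bounded[OF \<phi>] by blast
  obtain C where C: "\<And>x. norm x \<le> R' \<Longrightarrow> \<bar>W x\<bar> \<le> C" using bdd by blast
  obtain C' where C': "\<And>x n. norm x \<le> R' \<Longrightarrow> \<bar>W (x + h n *\<^sub>R v) - W x\<bar> \<le> C' * h n" using lip by blast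
  have ind: "integrable lborel (\<lambda>x. c * indicator (cball (0::'a) R') x :: real)" for c
    using emeasure_lborel_cball_finite[of "0::'a" R']
    by (intro integrable_mult_right integrable_real_indicator) auto
  have "0 \<le> R'" using R unfolding R'_def by (simp add: add_nonneg_nonneg)
  have C0: "0 \<le> C" using C[of 0] \<open>0 \<le> R'\<close> by (metis abs_ge_zero norm_zero order_trans)
  have C'0: "0 \<le> C'" using C'[of 0 0] h(2)[of 0] \<open>0 \<le> R'\<close>
    by (metis abs_ge_zero norm_zero order_trans zero_le_mult_iff less_imp_not_less linorder_not_le order.strict_iff_not)
  have swap: "(LINT x|lborel. (W (x + h n *\<^sub>R v) - W x) / h n * \<phi> x) =
      (LINT x|lborel. W x * ((\<phi> (x - h n *\<^sub>R v) - \<phi> x) / h n))" for n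
  proof -
    have i1: "integrable lborel (\<lambda>x. W x * \<phi> x)"
      by (rule integrable_bounded_ball_support[of _ R' "C * B"])
         (auto simp: abs_mult R' C C0 B(2) intro!: mult_mono)
    have i2: "integrable lborel (\<lambda>x. W x * \<phi> (x - h n *\<^sub>R v))"
      by (rule integrable_bounded_ball_support[of _ R' "C * B"])
         (auto simp: abs_mult R' C C0 B(2) intro!: mult_mono)
    have i3: "integrable lborel (\<lambda>x. W (x + h n *\<^sub>R v) * \<phi> x)"
      using lborel_integrable_translation[OF i2, of "h n *\<^sub>R v"] by simp
    have "(LINT x|lborel. (W (x + h n *\<^sub>R v) - W x) / h n * \<phi> x) =
       ((LINT x|lborel. W (x + h n *\<^sub>R v) * \<phi> x) - (LINT x|lborel. W x * \<phi> x)) / h n"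
    proof -
      have e: "(W (x + h n *\<^sub>R v) - W x) / h n * \<phi> x = (W (x + h n *\<^sub>R v) * \<phi> x - W x * \<phi> x) / h n" for x
        by (simp add: left_diff_distrib)
      show ?thesis by (simp only: e integral_divide_zero Bochner_Integration.integral_diff[OF i3 i1])
    qed
    also have "(LINT x|lborel. W (x + h n *\<^sub>R v) * \<phi> x) = (LINT x|lborel. W x * \<phi> (x - h n *\<^sub>R v))"
      using lborel_integral_translation[of "\<lambda>x. W x * \<phi> (x - h n *\<^sub>R v)" "h n *\<^sub>R v"] by simp
    also have "((LINT x|lborel. W x * \<phi> (x - h n *\<^sub>R v)) - (LINT x|lborel. W x * \<phi> x)) / h n =
       (LINT x|lborel. W x * ((\<phi> (x - h n *\<^sub>R v) - \<phi> x) / h n))"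
    proof -
      have e: "W x * ((\<phi> (x - h n *\<^sub>R v) - \<phi> x) / h n) = (W x * \<phi> (x - h n *\<^sub>R v) - W x * \<phi> x) / h n" for x
        by (simp add: right_diff_distrib)
      show ?thesis by (simp only: e integral_divide_zero Bochner_Integration.integral_diff[OF i2 i1])
    qed
    finally show ?thesis .
  qed
  have "(\<lambda>n. LINT x|lborel. (W (x + h n *\<^sub>R v) - W x) / h n * \<phi> x) \<longlonglongrightarrow> (LINT x|lborel. D x * \<phi> x)"
  proof (rule integral_dominated_convergence[where w = "\<lambda>x::'a. C' * B * indicator (cball 0 R') x"])
    show "integrable lborel (\<lambda>x::'a. C' * B * indicator (cball 0 R') x)" by (rule ind)
    show "AE x in lborel. (\<lambda>n. (W (x + h n *\<^sub>R v) - W x) / h n * \<phi> x) \<longlonglongrightarrow> D x * \<phi> x"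
      using lim by eventually_elim (intro tendsto_intros)
    show "AE x in lborel. norm ((W (x + h n *\<^sub>R v) - W x) / h n * \<phi> x) \<le> C' * B * indicator (cball 0 R') x" for n
    proof (rule AE_I2)
      fix x
      show "norm ((W (x + h n *\<^sub>R v) - W x) / h n * \<phi> x) \<le> C' * B * indicator (cball 0 R') x"
      proof (cases "norm x > R'")
        case False
        then have "\<bar>W (x + h n *\<^sub>R v) - W x\<bar> / h n \<le> C'"
          using C'[of x n] h(2)[of n] by (simp add: field_simps)
        then have "\<bar>W (x + h n *\<^sub>R v) - W x\<bar> / h n * \<bar>\<phi> x\<bar> \<le> C' * B"
          using B C'0 h(2)[of n] by (intro mult_mono) auto
        then show ?thesis using False h(2)[of n] by (simp add: abs_mult)
      qed (simp add: R')
    qed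
  qed auto
  moreover have "(\<lambda>n. LINT x|lborel. W x * ((\<phi> (x - h n *\<^sub>R v) - \<phi> x) / h n))
      \<longlonglongrightarrow> (LINT x|lborel. W x * - g x)"
  proof (rule integral_dominated_convergence[where w = "\<lambda>x::'a. C * M * indicator (cball 0 R') x"])
    show "integrable lborel (\<lambda>x::'a. C * M * indicator (cball 0 R') x)" by (rule ind)
    show "AE x in lborel. (\<lambda>n. W x * ((\<phi> (x - h n *\<^sub>R v) - \<phi> x) / h n)) \<longlonglongrightarrow> W x * - g x"
    proof (rule AE_I2)
      fix x
      have "(\<lambda>n. (\<phi> (x + (- h n) *\<^sub>R v) - \<phi> x) / (- h n)) \<longlonglongrightarrow> g x"
        unfolding g_def using h less_imp_neq[OF h(2)]
        by (intro difference_quotient_LIMSEQ smooth_has_derivative test_smooth[OF \<phi>]) (auto intro: tendsto_eq_intros)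
      then have "(\<lambda>n. - ((\<phi> (x + (- h n) *\<^sub>R v) - \<phi> x) / (- h n))) \<longlonglongrightarrow> - g x"
        by (rule tendsto_minus)
      then show "(\<lambda>n. W x * ((\<phi> (x - h n *\<^sub>R v) - \<phi> x) / h n)) \<longlonglongrightarrow> W x * - g x"
        by (intro tendsto_mult tendsto_const) simp
    qed
    show "AE x in lborel. norm (W x * ((\<phi> (x - h n *\<^sub>R v) - \<phi> x) / h n)) \<le> C * M * indicator (cball 0 R') x" for n
    proof (rule AE_I2)
      fix x
      show "norm (W x * ((\<phi> (x - h n *\<^sub>R v) - \<phi> x) / h n)) \<le> C * M * indicator (cball 0 R') x"
      proof (cases "norm x > R'")
        case False
        have "\<bar>\<phi> (x - h n *\<^sub>R v) - \<phi> x\<bar> / h n \<le> M"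
          using M(2)[of x "- h n"] h(2)[of n] by (simp add: field_simps)
        then have "\<bar>W x\<bar> * (\<bar>\<phi> (x - h n *\<^sub>R v) - \<phi> x\<bar> / h n) \<le> C * M"
          using C[of x] False C0 h(2)[of n] by (intro mult_mono) auto
        then show ?thesis using False h(2)[of n] by (simp add: abs_mult)
      qed (use R'[of x n] in simp)
    qed
  qed auto
  ultimately have "(LINT x|lborel. D x * \<phi> x) = (LINT x|lborel. W x * - g x)"
    unfolding swap using LIMSEQ_unique by blast
  then show ?thesis by (simp add: g_def)
qed

lemma smooth_integration_by_parts:
  fixes u :: "'a::euclidean_space \<Rightarrow> real"
  assumes u: "smooth u" and \<phi>: "\<phi> \<in> test_functions"
  shows "(LINT x|lborel. u x * frechet_derivative \<phi> (at x) v)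
       = - (LINT x|lborel. frechet_derivative u (at x) v * \<phi> x)"
proof (rule integration_by_parts_difference_quotients[where h = "\<lambda>n. 1 / real (Suc n)", OF _ _ _ _ _ _ _ _ \<phi>])
  show "u \<in> borel_measurable borel" "(\<lambda>x. frechet_derivative u (at x) v) \<in> borel_measurable borel"
    using smooth_measurable[OF u] smooth_measurable[OF smooth_derivative[OF u]] .
  show "(\<lambda>n. 1 / real (Suc n)) \<longlonglongrightarrow> 0" using LIMSEQ_inverse_real_of_nat by (simp add: field_simps)
  have loc: "\<exists>C. \<forall>x. norm x \<le> R \<longrightarrow> \<bar>w x\<bar> \<le> C" if "smooth w" for R and w :: "'a \<Rightarrow> real"
  proof -
    have "bounded (w ` cball 0 R)"
      by (intro compact_imp_bounded compact_continuous_image smooth_continuous[OF that] compact_cball)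
    then show ?thesis by (force simp: bounded_iff)
  qed
  show "\<exists>C. \<forall>x. norm x \<le> R \<longrightarrow> \<bar>u x\<bar> \<le> C" for R using loc[OF u] .
  show "\<exists>C. \<forall>x n. norm x \<le> R \<longrightarrow> \<bar>u (x + (1 / real (Suc n)) *\<^sub>R v) - u x\<bar> \<le> C * (1 / real (Suc n))" for R
  proof -
    obtain C where C: "\<And>x. norm x \<le> R + norm v \<Longrightarrow> \<bar>frechet_derivative u (at x) v\<bar> \<le> C"
      using loc[OF smooth_derivative[OF u]] by blast
    have "\<bar>u (x + s *\<^sub>R v) - u x\<bar> \<le> C * s" if "norm x \<le> R" "0 < s" "s \<le> 1" for x s
    proof -
      obtain \<theta> where \<theta>: "0 < \<theta>" "\<theta> < 1"
        "u (x + s *\<^sub>R v) - u x = frechet_derivative u (at (x + \<theta> *\<^sub>R s *\<^sub>R v)) (s *\<^sub>R v)"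
        using smooth_mean_value[OF u] by blast
      have "norm (x + \<theta> *\<^sub>R s *\<^sub>R v) \<le> norm x + \<theta> * s * norm v"
        using norm_triangle_ineq[of x "\<theta> *\<^sub>R s *\<^sub>R v"] \<theta> that by (simp add: abs_mult)
      moreover have "\<theta> * s * norm v \<le> norm v"
        using \<theta> that by (simp add: mult_left_le_one_le mult_le_one)
      ultimately have "\<bar>frechet_derivative u (at (x + \<theta> *\<^sub>R s *\<^sub>R v)) v\<bar> \<le> C"
        using that by (intro C) linarith
      then show ?thesis
        using \<theta>(3) linear_scale[OF smooth_derivative_linear[OF u]] that
        by (simp add: abs_mult mult.commute mult_left_mono)
    qed
    from this[of _ "1 / real (Suc _)"] show ?thesis
      by (intro exI[of _ C] allI impI) (simp del: of_nat_Suc)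
  qed
  show "AE x in lborel. (\<lambda>n. (u (x + (1 / real (Suc n)) *\<^sub>R v) - u x) / (1 / real (Suc n)))
      \<longlonglongrightarrow> frechet_derivative u (at x) v"
    using LIMSEQ_inverse_real_of_nat
    by (intro AE_I2 difference_quotient_LIMSEQ smooth_has_derivative[OF u]) (auto simp: field_simps)
qed auto

lemma test_derivative_integral_0:
  "\<phi> \<in> test_functions \<Longrightarrow> (LINT x|lborel. frechet_derivative \<phi> (at x) v) = 0"
  using smooth_integration_by_parts[of "\<lambda>x. 1" \<phi> v] by simp

section \<open>Mollification\<close>

lemma translation_L1_approx:
  fixes f g :: "'a::euclidean_space \<Rightarrow> 'b::{banach,second_countable_topology}"
  assumes f: "integrable lborel f" and g: "integrable lborel g"
  shows "(LINT x|lborel. norm (f (x + z) - f x))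
    \<le> (LINT x|lborel. norm (g (x + z) - g x)) + 2 * (LINT x|lborel. norm (f x - g x))"
proof -
  have [measurable]: "f \<in> borel_measurable borel" "g \<in> borel_measurable borel"
    using f g by auto
  have ineq: "norm (a - b) \<le> norm (c - d) + norm (a - c) + norm (b - d)" for a b c d :: 'b
  proof -
    have "a - b = (c - d) + (a - c) - (b - d)" by simp
    then show ?thesis
      by (metis norm_triangle_ineq norm_triangle_le_diff add_right_mono)
  qed
  note i = lborel_integrable_translation[OF f, of z] lborel_integrable_translation[OF g, of z] f g
  have "(LINT x|lborel. norm (f (x + z) - f x)) \<le>
     (LINT x|lborel. norm (g (x + z) - g x) + norm (f (x + z) - g (x + z)) + norm (f x - g x))"
    using i
    by (intro integral_mono integrable_norm Bochner_Integration.integrable_add Bochner_Integration.integrable_diff)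
       (assumption | rule ineq)+
  also have "\<dots> = (LINT x|lborel. norm (g (x + z) - g x)) + (LINT x|lborel. norm (f (x + z) - g (x + z)))
      + (LINT x|lborel. norm (f x - g x))"
    using i by simp
  also have "(LINT x|lborel. norm (f (x + z) - g (x + z))) = (LINT x|lborel. norm (f x - g x))"
    by (rule lborel_integral_translation[of "\<lambda>x. norm (f x - g x)"]) measurable
  finally show ?thesis by simp
qed

text \<open>
  The translation moduli of two functions differ by at most twice their distance in \<open>L\<^sup>1\<close>, so
  continuity of translation passes to limits in \<open>L\<^sup>1\<close>.
\<close>

lemma translation_L1_limit:
  fixes f :: "'a::euclidean_space \<Rightarrow> 'b::{banach,second_countable_topology}"
  assumes f: "integrable lborel f"
    and g: "\<And>e. e > 0 \<Longrightarrow> \<exists>g. integrable lborel g \<and> (LINT x|lborel. norm (f x - g x)) < e \<and>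
      ((\<lambda>z. LINT x|lborel. norm (g (x + z) - g x)) \<longlongrightarrow> 0) (at 0)"
  shows "((\<lambda>z. LINT x|lborel. norm (f (x + z) - f x)) \<longlongrightarrow> 0) (at 0)"
proof (rule tendstoI)
  fix e :: real assume e: "e > 0"
  obtain g where g: "integrable lborel g" "(LINT x|lborel. norm (f x - g x)) < e / 3"
      "((\<lambda>z. LINT x|lborel. norm (g (x + z) - g x)) \<longlongrightarrow> 0) (at 0)"
    using g[of "e / 3"] e by auto
  have "\<forall>\<^sub>F z in at 0. dist (LINT x|lborel. norm (g (x + z) - g x)) 0 < e / 3"
    using tendstoD[OF g(3), of "e / 3"] e by simp
  then show "\<forall>\<^sub>F z in at 0. dist (LINT x|lborel. norm (f (x + z) - f x)) 0 < e"
  proof eventually_elim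
    case (elim z)
    have "0 \<le> (LINT x|lborel. norm (f (x + z) - f x))" by simp
    with elim g(2) translation_L1_approx[OF f g(1), of z] show ?case
      by (simp add: dist_real_def)
  qed
qed

text \<open>
  For an open set, the overlap of the set with its translate tends to the full measure by
  dominated convergence; other sets are approximated by open ones.
\<close>

lemma translation_L1_open:
  fixes U :: "'a::euclidean_space set"
  assumes U: "open U" and fin: "emeasure lborel U < \<infinity>"
  shows "((\<lambda>z. LINT x|lborel. \<bar>indicator U (x + z) - indicator U x :: real\<bar>) \<longlongrightarrow> 0) (at 0)"
proof (unfold tendsto_at_iff_sequentially o_def, safe)
  fix z :: "nat \<Rightarrow> 'a" assume z: "z \<longlonglongrightarrow> 0"
  have [measurable]: "U \<in> sets borel" using U by simp
  have i: "integrable lborel (indicator U :: 'a \<Rightarrow> real)"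
    using fin by (intro integrable_real_indicator) auto
  have it: "integrable lborel (\<lambda>x. indicator U (x + z n) :: real)" for n
    by (rule lborel_integrable_translation[OF i])
  have im: "integrable lborel (\<lambda>x. indicator U x * indicator U (x + z n) :: real)" for n
    by (rule Bochner_Integration.integrable_bound[OF i]) (auto simp: indicator_def)
  have "(\<lambda>n. LINT x|lborel. indicator U x * indicator U (x + z n) :: real)
      \<longlonglongrightarrow> (LINT x|lborel. (indicator U x :: real))"
  proof (rule integral_dominated_convergence[OF _ _ i])
    show "AE x in lborel. (\<lambda>n. indicator U x * indicator U (x + z n) :: real) \<longlonglongrightarrow> indicator U x"
    proof (rule AE_I2)
      fix x
      show "(\<lambda>n. indicator U x * indicator U (x + z n) :: real) \<longlonglongrightarrow> indicator U x"
      proof (cases "x \<in> U")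
        case True
        have "(\<lambda>n. x + z n) \<longlonglongrightarrow> x" using tendsto_add[OF tendsto_const z, of x] by simp
        then have "\<forall>\<^sub>F n in sequentially. x + z n \<in> U"
          using U True by (simp add: topological_tendstoD)
        then have "\<forall>\<^sub>F n in sequentially. indicator U x * indicator U (x + z n) = (1::real)"
          using True by (auto elim: eventually_mono)
        then show ?thesis using True by (simp add: tendsto_eventually)
      qed simp
    qed
  qed (auto simp: indicator_def)
  then have "(\<lambda>n. 2 * (LINT x|lborel. (indicator U x :: real)) -
      2 * (LINT x|lborel. indicator U x * indicator U (x + z n))) \<longlonglongrightarrow>
      2 * (LINT x|lborel. (indicator U x :: real)) - 2 * (LINT x|lborel. (indicator U x :: real))"
    by (intro tendsto_intros)
  moreover have "(LINT x|lborel. \<bar>indicator U (x + z n) - indicator U x :: real\<bar>) =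
     2 * (LINT x|lborel. (indicator U x :: real)) - 2 * (LINT x|lborel. indicator U x * indicator U (x + z n))" for n
  proof -
    have "(LINT x|lborel. \<bar>indicator U (x + z n) - indicator U x :: real\<bar>) =
      (LINT x|lborel. (indicator U (x + z n) + indicator U x) - 2 * (indicator U x * indicator U (x + z n)) :: real)"
      by (intro Bochner_Integration.integral_cong) (auto simp: indicator_def)
    also have "\<dots> = (LINT x|lborel. (indicator U (x + z n) :: real)) + (LINT x|lborel. (indicator U x :: real))
       - 2 * (LINT x|lborel. indicator U x * indicator U (x + z n))"
      by (simp only: Bochner_Integration.integral_diff[OF Bochner_Integration.integrable_add[OF it i] integrable_mult_right[OF im]]
         Bochner_Integration.integral_add[OF it i] integral_mult_right_zero)
    also have "(LINT x|lborel. (indicator U (x + z n) :: real)) = (LINT x|lborel. indicator U x)"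
      by (rule lborel_integral_translation) simp
    finally show ?thesis by simp
  qed
  ultimately show "(\<lambda>n. LINT x|lborel. \<bar>indicator U (x + z n) - indicator U x :: real\<bar>) \<longlonglongrightarrow> 0"
    by simp
qed

lemma translation_L1_continuous:
  fixes f :: "'a::euclidean_space \<Rightarrow> 'b::{banach,second_countable_topology}"
  assumes "integrable lborel f"
  shows "((\<lambda>z. LINT x|lborel. norm (f (x + z) - f x)) \<longlongrightarrow> 0) (at 0)"
  using assms
proof (induction rule: integrable_induct)
  case (base A c)
  then have A[measurable]: "A \<in> sets borel" by simp
  have iA: "integrable lborel (\<lambda>x. indicator A x *\<^sub>R c)" using base by simp
  show ?case
  proof (rule translation_L1_limit[OF iA])
    fix e :: real assume e: "e > 0"
    define e' where "e' = e / (norm c + 1)"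
    have e': "e' > 0" using e by (simp add: e'_def add_nonneg_pos)
    obtain U where U: "open U" "A \<subseteq> U" "emeasure lborel (U - A) < ennreal e'"
      using outer_regular_lborel[OF A e'] by blast
    then have [measurable]: "U \<in> sets borel" by simp
    have "emeasure lborel U = emeasure lborel A + emeasure lborel (U - A)"
      using U by (subst plus_emeasure) (auto simp: Un_absorb1)
    then have fin: "emeasure lborel U < \<infinity>"
      using base U(3) by (auto simp: less_top[symmetric] top_unique)
    have iU: "integrable lborel (\<lambda>x. indicator U x *\<^sub>R c)" using fin by simp
    have "(LINT x|lborel. norm (indicator A x *\<^sub>R c - indicator U x *\<^sub>R c)) =
       (LINT x|lborel. indicator (U - A) x * norm c)"
      using U(2) by (intro Bochner_Integration.integral_cong) (auto simp: indicator_def)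
    also have "\<dots> = measure lborel (U - A) * norm c" by simp
    also have "\<dots> \<le> e' * norm c"
      using U(3) e' by (intro mult_right_mono) (auto simp: measure_def less_imp_le intro!: enn2real_leI)
    also have "\<dots> < e"
    proof -
      have "0 < 1 + norm c" by (simp add: add_pos_nonneg)
      then show ?thesis using e by (simp add: e'_def pos_divide_less_eq algebra_simps)
    qed
    finally have 1: "(LINT x|lborel. norm (indicator A x *\<^sub>R c - indicator U x *\<^sub>R c)) < e" .
    have "((\<lambda>z. (LINT x|lborel. \<bar>indicator U (x + z) - indicator U x :: real\<bar>) * norm c) \<longlongrightarrow> 0 * norm c) (at 0)"
      by (intro tendsto_intros translation_L1_open U fin)
    moreover have "(LINT x|lborel. \<bar>indicator U (x + z) - indicator U x :: real\<bar>) * norm c =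
      (LINT x|lborel. norm (indicator U (x + z) *\<^sub>R c - indicator U x *\<^sub>R c))" for z
      by (simp add: scaleR_left_diff_distrib[symmetric])
    ultimately show "\<exists>g. integrable lborel g \<and> (LINT x|lborel. norm (indicator A x *\<^sub>R c - g x)) < e \<and>
      ((\<lambda>z. LINT x|lborel. norm (g (x + z) - g x)) \<longlongrightarrow> 0) (at 0)"
      using 1 iU by (intro exI[of _ "\<lambda>x. indicator U x *\<^sub>R c"]) simp
  qed
next
  case (add f g)
  have [measurable]: "f \<in> borel_measurable borel" "g \<in> borel_measurable borel"
    using add.hyps by auto
  note i = lborel_integrable_translation[OF add.hyps(1)] lborel_integrable_translation[OF add.hyps(2)] add.hyps
  have lim: "((\<lambda>z. (LINT x|lborel. norm (f (x + z) - f x)) + (LINT x|lborel. norm (g (x + z) - g x))) \<longlongrightarrow> 0) (at 0)"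
    using tendsto_add[OF add.IH] by simp
  have "(LINT x|lborel. norm (f (x + z) + g (x + z) - (f x + g x)))
      \<le> (LINT x|lborel. norm (f (x + z) - f x)) + (LINT x|lborel. norm (g (x + z) - g x))" for z
  proof -
    have "(LINT x|lborel. norm (f (x + z) + g (x + z) - (f x + g x)))
      \<le> (LINT x|lborel. norm (f (x + z) - f x) + norm (g (x + z) - g x))"
      using i by (intro integral_mono) (auto intro: norm_diff_triangle_ineq)
    then show ?thesis using i by simp
  qed
  then show ?case
    by (intro Lim_null_comparison[OF _ lim] always_eventually allI) simp
next
  case (lim f s)
  show ?case
  proof (rule translation_L1_limit[OF lim.hyps(4)])
    fix e :: real assume e: "e > 0"
    have [measurable]: "f \<in> borel_measurable borel" "\<And>i. s i \<in> borel_measurable borel"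
      using lim.hyps(1,4) by auto
    have "(\<lambda>i. LINT x|lborel. norm (f x - s i x)) \<longlonglongrightarrow> (LINT x|(lborel::'a measure). 0::real)"
    proof (rule integral_dominated_convergence[where w = "\<lambda>x. 3 * norm (f x)"])
      show "integrable lborel (\<lambda>x. 3 * norm (f x))" using lim.hyps(4) by simp
      show "AE x in lborel. (\<lambda>i. norm (f x - s i x)) \<longlonglongrightarrow> 0"
      proof (rule AE_I2)
        fix x
        have "(\<lambda>i. norm (f x - s i x)) \<longlonglongrightarrow> norm (f x - f x)"
          using lim.hyps(2)[of x] by (intro tendsto_intros) auto
        then show "(\<lambda>i. norm (f x - s i x)) \<longlonglongrightarrow> 0" by simp
      qed
      show "AE x in lborel. norm (norm (f x - s i x)) \<le> 3 * norm (f x)" for i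
      proof (rule AE_I2)
        fix x
        show "norm (norm (f x - s i x)) \<le> 3 * norm (f x)"
          using lim.hyps(3)[of x i] norm_triangle_ineq4[of "f x" "s i x"] by simp
      qed
    qed auto
    then have "(\<lambda>i. LINT x|lborel. norm (f x - s i x)) \<longlonglongrightarrow> 0" by simp
    from order_tendstoD(2)[OF this e] obtain i where "(LINT x|lborel. norm (f x - s i x)) < e"
      by (auto simp: eventually_sequentially)
    then show "\<exists>g. integrable lborel g \<and> (LINT x|lborel. norm (f x - g x)) < e \<and>
      ((\<lambda>z. LINT x|lborel. norm (g (x + z) - g x)) \<longlongrightarrow> 0) (at 0)"
      using lim.hyps(1) lim.IH by blast
  qed
qed

subsection \<open>Mollifiers\<close>

lemma smooth_norm_square: "smooth (\<lambda>x::'a::euclidean_space. (norm x)\<^sup>2)"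
proof
  fix k
  have "Ck k (\<lambda>x::'a. \<Sum>b\<in>Basis. (x \<bullet> b) * (x \<bullet> b))"
    by (intro Ck_sum Ck_mult Ck_bounded_linear bounded_linear_inner_left)
  moreover have "(\<lambda>x::'a. (norm x)\<^sup>2) = (\<lambda>x. \<Sum>b\<in>Basis. (x \<bullet> b) * (x \<bullet> b))"
    by (rule ext, subst power2_norm_eq_inner, rule euclidean_inner)
  ultimately show "Ck k (\<lambda>x::'a. (norm x)\<^sup>2)" by (simp only:)
qed

definition bump :: "real \<Rightarrow> 'a::euclidean_space \<Rightarrow> real" where
  "bump c x = plateau (c * (norm x)\<^sup>2)"

lemma bump_test:
  assumes "c > 0"
  shows "(bump c :: 'a::euclidean_space \<Rightarrow> real) \<in> test_functions"
proof -
  have "smooth (\<lambda>x::'a. plateau (c * (norm x)\<^sup>2))"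
    by (rule allI, rule Ck_compose_real[OF Ck_plateau], rule Ck_mult[OF Ck_const smooth_norm_square[rule_format]])
  moreover have "plateau (c * (norm x)\<^sup>2) = 0" if "norm x > sqrt (2 / c)" for x :: 'a
  proof (rule plateau_eq_0)
    have "(norm x)\<^sup>2 > (sqrt (2 / c))\<^sup>2"
      using that assms by (intro power_strict_mono) auto
    then show "2 \<le> c * (norm x)\<^sup>2"
      using assms by (simp add: field_simps)
  qed
  ultimately show ?thesis
    using assms by (auto simp: test_functions_iff bump_def[abs_def] intro!: exI[of _ "sqrt (2 / c)"])
qed

lemma bump_nonneg: "0 \<le> bump c x" and bump_le_1: "bump c x \<le> 1" and bump_minus: "bump c (- x) = bump c x"
  by (simp_all add: bump_def plateau_nonneg plateau_le_1)

lemma bump_eq_1: "c * (norm x)\<^sup>2 \<le> 1 \<Longrightarrow> bump c x = 1"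
  by (simp add: bump_def plateau_eq_1)

lemma test_integral_pos:
  fixes \<phi> :: "'a::euclidean_space \<Rightarrow> real"
  assumes \<phi>: "\<phi> \<in> test_functions" and nonneg: "\<And>x. 0 \<le> \<phi> x" and 0: "\<phi> 0 > 0"
  shows "(LINT x|lborel. \<phi> x) > 0"
proof (rule ccontr)
  assume "\<not> ?thesis"
  then have "(LINT x|lborel. \<phi> x) = 0" using nonneg by (simp add: not_less antisym integral_nonneg)
  then have "AE x in lborel. \<phi> x = 0"
    using integral_nonneg_eq_0_iff_AE[OF test_integrable[OF \<phi>]] nonneg by simp
  then have "AE x in lebesgue. x \<in> {x. \<phi> x = 0}" by (simp add: AE_completion)
  moreover have "closed {x. \<phi> x = 0}"
    by (intro closed_Collect_eq test_continuous[OF \<phi>] continuous_on_const)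
  ultimately have "0 \<in> {x. \<phi> x = 0}" using mem_closed_if_AE_lebesgue by blast
  then show False using 0 by simp
qed

lemma mollifier_exists:
  fixes h :: real
  assumes h: "h > 0"
  obtains \<eta> :: "'a::euclidean_space \<Rightarrow> real" where "\<eta> \<in> test_functions" "\<And>x. 0 \<le> \<eta> x"
    "\<And>x. norm x \<ge> h \<Longrightarrow> \<eta> x = 0" "(LINT x|lborel. \<eta> x) = 1"
proof -
  define \<beta> :: "'a \<Rightarrow> real" where "\<beta> = bump (4 / h\<^sup>2)"
  have t: "\<beta> \<in> test_functions" unfolding \<beta>_def by (rule bump_test) (use h in simp)
  have z: "\<beta> x = 0" if "norm x \<ge> h" for x
  proof -
    have "h\<^sup>2 \<le> (norm x)\<^sup>2" using that h by (intro power_mono) auto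
    then have "2 * h\<^sup>2 \<le> 4 * (norm x)\<^sup>2" using zero_le_power2[of "norm x"] by linarith
    then show ?thesis unfolding \<beta>_def bump_def using h by (intro plateau_eq_0) (simp add: field_simps)
  qed
  have pos: "0 < (LINT x|lborel. \<beta> x)"
    by (rule test_integral_pos[OF t]) (simp_all add: \<beta>_def bump_nonneg bump_eq_1)
  show ?thesis
    by (rule that[of "\<lambda>x. (1 / (LINT x|lborel. \<beta> x)) * \<beta> x"])
       (use pos z test_scale[OF t, of "1 / (LINT x|lborel. \<beta> x)"] in \<open>auto simp: \<beta>_def bump_nonneg\<close>)
qed

lemma test_linear_expansion:
  assumes "\<phi> \<in> test_functions"
  shows "frechet_derivative \<phi> (at x) v = (\<Sum>b\<in>Basis. (v \<bullet> b) * frechet_derivative \<phi> (at x) b)"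
proof -
  have l: "linear (frechet_derivative \<phi> (at x))"
    using smooth_derivative_linear[OF test_smooth[OF assms]] .
  have "frechet_derivative \<phi> (at x) v = frechet_derivative \<phi> (at x) (\<Sum>b\<in>Basis. (v \<bullet> b) *\<^sub>R b)"
    by (simp add: euclidean_representation)
  also have "\<dots> = (\<Sum>b\<in>Basis. (v \<bullet> b) * frechet_derivative \<phi> (at x) b)"
    by (simp add: linear_sum[OF l] linear_scale[OF l])
  finally show ?thesis .
qed

lemma test_derivative_bounded:
  assumes "\<phi> \<in> test_functions"
  obtains M where "M > 0" "\<And>x v. \<bar>frechet_derivative \<phi> (at x) v\<bar> \<le> M * norm v"
proof -
  have "\<forall>b. \<exists>M. \<forall>x. \<bar>frechet_derivative \<phi> (at x) b\<bar> \<le> M"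
    using test_bounded[OF test_derivative[OF assms]] by metis
  then obtain M where M: "\<And>b x. \<bar>frechet_derivative \<phi> (at x) b\<bar> \<le> M b" by metis
  define S where "S = (\<Sum>b\<in>Basis. M b) + 1"
  have M0: "0 \<le> M b" for b using M[where b = b and x = undefined] abs_ge_zero order_trans by blast
  have "\<bar>frechet_derivative \<phi> (at x) v\<bar> \<le> S * norm v" for x v
  proof -
    have "\<bar>frechet_derivative \<phi> (at x) v\<bar> \<le> (\<Sum>b\<in>Basis. \<bar>(v \<bullet> b) * frechet_derivative \<phi> (at x) b\<bar>)"
      unfolding test_linear_expansion[OF assms, of x v] by (rule sum_abs)
    also have "\<dots> \<le> (\<Sum>b\<in>Basis. norm v * M b)"
      by (intro sum_mono) (auto simp: abs_mult Basis_le_norm intro!: mult_mono M)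
    also have "\<dots> = norm v * (\<Sum>b\<in>Basis. M b)" by (simp add: sum_distrib_left)
    also have "\<dots> \<le> norm v * S" by (intro mult_left_mono) (auto simp: S_def)
    finally show ?thesis by (simp add: mult.commute)
  qed
  moreover have "S > 0" using M0 by (simp add: S_def add_nonneg_pos sum_nonneg)
  ultimately show ?thesis using that by blast
qed

lemma test_lipschitz:
  assumes "\<phi> \<in> test_functions"
  obtains M where "M > 0" "\<And>x v. \<bar>\<phi> (x + v) - \<phi> x\<bar> \<le> M * norm v"
  using test_derivative_bounded[OF assms] smooth_mean_value[OF test_smooth[OF assms]] by metis

lemma test_taylor:
  assumes \<phi>: "\<phi> \<in> test_functions"
  obtains M where "M > 0"
    "\<And>x v. \<bar>\<phi> (x + v) - \<phi> x - frechet_derivative \<phi> (at x) v\<bar> \<le> M * norm v * norm v"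
proof -
  have "\<forall>b. \<exists>M>0. \<forall>x v. \<bar>frechet_derivative \<phi> (at (x + v)) b - frechet_derivative \<phi> (at x) b\<bar> \<le> M * norm v"
    using test_lipschitz[OF test_derivative[OF \<phi>]] by metis
  then obtain M where M: "\<And>b. M b > 0"
    "\<And>b x v. \<bar>frechet_derivative \<phi> (at (x + v)) b - frechet_derivative \<phi> (at x) b\<bar> \<le> M b * norm v"
    by metis
  define S where "S = (\<Sum>b\<in>Basis. M b) + 1"
  have "\<bar>\<phi> (x + v) - \<phi> x - frechet_derivative \<phi> (at x) v\<bar> \<le> S * norm v * norm v" for x v
  proof -
    obtain \<theta> where \<theta>: "0 < \<theta>" "\<theta> < 1" "\<phi> (x + v) - \<phi> x = frechet_derivative \<phi> (at (x + \<theta> *\<^sub>R v)) v"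
      using smooth_mean_value[OF test_smooth[OF \<phi>]] .
    have "\<phi> (x + v) - \<phi> x - frechet_derivative \<phi> (at x) v =
      (\<Sum>b\<in>Basis. (v \<bullet> b) * (frechet_derivative \<phi> (at (x + \<theta> *\<^sub>R v)) b - frechet_derivative \<phi> (at x) b))"
      unfolding \<theta>(3) test_linear_expansion[OF \<phi>, of _ v] by (simp add: sum_subtractf right_diff_distrib)
    also have "\<bar>\<dots>\<bar> \<le> (\<Sum>b\<in>Basis. \<bar>(v \<bullet> b) * (frechet_derivative \<phi> (at (x + \<theta> *\<^sub>R v)) b - frechet_derivative \<phi> (at x) b)\<bar>)"
      by (rule sum_abs)
    also have "\<dots> \<le> (\<Sum>b\<in>Basis. norm v * (M b * norm v))"
    proof (intro sum_mono)
      fix b :: 'a assume b: "b \<in> Basis"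
      have "\<bar>frechet_derivative \<phi> (at (x + \<theta> *\<^sub>R v)) b - frechet_derivative \<phi> (at x) b\<bar> \<le> M b * norm (\<theta> *\<^sub>R v)"
        by (rule M)
      also have "\<dots> \<le> M b * norm v"
        using \<theta> M(1)[of b] by (intro mult_left_mono) (auto simp: mult_left_le_one_le)
      finally show "\<bar>(v \<bullet> b) * (frechet_derivative \<phi> (at (x + \<theta> *\<^sub>R v)) b - frechet_derivative \<phi> (at x) b)\<bar>
          \<le> norm v * (M b * norm v)"
        using b by (auto simp: abs_mult Basis_le_norm intro!: mult_mono)
    qed
    also have "\<dots> = (\<Sum>b\<in>Basis. M b) * (norm v * norm v)"
      by (simp add: sum_distrib_left sum_distrib_right mult_ac)
    also have "\<dots> \<le> S * (norm v * norm v)"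
      by (intro mult_right_mono) (auto simp: S_def)
    finally show ?thesis by (simp add: mult.assoc)
  qed
  moreover have "S > 0" using M(1) by (simp add: S_def add_nonneg_pos sum_nonneg less_imp_le)
  ultimately show ?thesis using that by blast
qed

definition mollify :: "('a::euclidean_space \<Rightarrow> real) \<Rightarrow> ('a \<Rightarrow> 'b::euclidean_space) \<Rightarrow> 'a \<Rightarrow> 'b" where
  "mollify \<eta> u x = (LINT y|lborel. \<eta> (x - y) *\<^sub>R u y)"

abbreviation locally_integrable_lborel :: "('a::euclidean_space \<Rightarrow> 'b::euclidean_space) \<Rightarrow> bool" where
  "locally_integrable_lborel u \<equiv> (\<forall>R. set_integrable lborel (cball 0 R) u)"

lemma integrable_test_scaleR:
  fixes u :: "'a::euclidean_space \<Rightarrow> 'b::euclidean_space"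
  assumes [measurable]: "u \<in> borel_measurable borel" and u: "locally_integrable_lborel u"
    and \<phi>: "\<phi> \<in> test_functions"
  shows "integrable lborel (\<lambda>y. \<phi> y *\<^sub>R u y)"
proof -
  have [measurable]: "\<phi> \<in> borel_measurable borel" using test_measurable[OF \<phi>] .
  obtain R where R: "\<And>x. norm x > R \<Longrightarrow> \<phi> x = 0" using test_support[OF \<phi>] by blast
  obtain M where M: "M > 0" "\<And>x. \<bar>\<phi> x\<bar> \<le> M" using test_bounded[OF \<phi>] by blast
  have "integrable lborel (\<lambda>y. M *\<^sub>R (indicator (cball 0 R) y *\<^sub>R u y))"
    using u unfolding set_integrable_def by (intro integrable_scaleR_right) blast
  then show ?thesis
  proof (rule Bochner_Integration.integrable_bound)
    show "AE y in lborel. norm (\<phi> y *\<^sub>R u y) \<le> norm (M *\<^sub>R (indicator (cball 0 R) y *\<^sub>R u y))"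
    proof (rule AE_I2)
      fix y
      show "norm (\<phi> y *\<^sub>R u y) \<le> norm (M *\<^sub>R (indicator (cball 0 R) y *\<^sub>R u y))"
      proof (cases "norm y > R")
        case False
        then show ?thesis using M by (auto simp: mult_right_mono)
      qed (simp add: R)
    qed
  qed measurable
qed

lemma mollify_integrable:
  fixes u :: "'a::euclidean_space \<Rightarrow> 'b::euclidean_space"
  assumes "u \<in> borel_measurable borel" "locally_integrable_lborel u" "\<eta> \<in> test_functions"
  shows "integrable lborel (\<lambda>y. \<eta> (x - y) *\<^sub>R u y)"
  using integrable_test_scaleR[OF assms(1,2) test_reflect[OF assms(3)]] .

lemma mollify_alt:
  fixes u :: "'a::euclidean_space \<Rightarrow> 'b::euclidean_space"
  assumes [measurable]: "u \<in> borel_measurable borel" "\<eta> \<in> borel_measurable borel"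
  shows "mollify \<eta> u x = (LINT y|lborel. \<eta> y *\<^sub>R u (x - y))"
  unfolding mollify_def
  using lborel_integral_reflection[of "\<lambda>y. \<eta> (x - y) *\<^sub>R u y" x] by simp

text \<open>
  The Taylor remainder of \<open>\<eta>\<close> is quadratic uniformly in the base point, and for bounded increments only
  the values of \<open>u\<close> on a fixed ball are involved.
\<close>

lemma mollify_has_derivative:
  fixes u :: "'a::euclidean_space \<Rightarrow> real"
  assumes [measurable]: "u \<in> borel_measurable borel" and u: "locally_integrable_lborel u"
    and \<eta>: "\<eta> \<in> test_functions"
  shows "(mollify \<eta> u has_derivative (\<lambda>k. LINT y|lborel. frechet_derivative \<eta> (at (x - y)) k * u y)) (at x)"
proof -
  have [measurable]: "\<eta> \<in> borel_measurable borel" using test_measurable[OF \<eta>] .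
  have int0: "integrable lborel (\<lambda>y. \<eta> (x - y) * u y)" for x
    using mollify_integrable[OF assms(1) u \<eta>] by simp
  have int1: "integrable lborel (\<lambda>y. frechet_derivative \<eta> (at (x - y)) k * u y)" for x k
    using mollify_integrable[OF assms(1) u test_derivative[OF \<eta>]] by simp
  let ?L = "\<lambda>k. LINT y|lborel. frechet_derivative \<eta> (at (x - y)) k * u y"
  have lin: "linear (frechet_derivative \<eta> (at z))" for z
    using smooth_derivative_linear[OF test_smooth[OF \<eta>]] .
  have "linear ?L"
  proof (rule linearI)
    fix k l
    have "frechet_derivative \<eta> (at (x - y)) (k + l) * u y =
      frechet_derivative \<eta> (at (x - y)) k * u y + frechet_derivative \<eta> (at (x - y)) l * u y" for y
      using linear_add[OF lin] by (simp add: distrib_right)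
    then show "?L (k + l) = ?L k + ?L l"
      using int1 by simp
  next
    fix r k
    have "frechet_derivative \<eta> (at (x - y)) (r *\<^sub>R k) * u y =
      r * (frechet_derivative \<eta> (at (x - y)) k * u y)" for y
      using linear_scale[OF lin] by simp
    then show "?L (r *\<^sub>R k) = r *\<^sub>R ?L k" by (simp only: integral_mult_right_zero real_scaleR_def)
  qed
  then have bl: "bounded_linear ?L" by (rule linear_conv_bounded_linear[THEN iffD1])
  obtain R where R: "R > 0" "\<And>x. norm x > R \<Longrightarrow> \<eta> x = 0" using test_support[OF \<eta>] by blast
  obtain M where M: "M > 0" "\<And>x v. \<bar>\<eta> (x + v) - \<eta> x - frechet_derivative \<eta> (at x) v\<bar> \<le> M * norm v * norm v"
    using test_taylor[OF \<eta>] by blast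
  have dz: "frechet_derivative \<eta> (at z) k = 0" if "norm z > R" for z k
  proof -
    have "((\<lambda>_. 0) has_derivative frechet_derivative \<eta> (at z)) (at z)"
      using has_derivative_transform_within_open[OF smooth_has_derivative[OF test_smooth[OF \<eta>]], of "{y. norm y > R}" z "\<lambda>_. 0"]
        that R(2) by (simp add: open_Collect_less continuous_on_norm)
    then show ?thesis using has_derivative_unique has_derivative_const by metis
  qed
  define R' where "R' = R + norm x + 1"
  define A where "A = (LINT y|lborel. indicator (cball 0 R') y * \<bar>u y\<bar>)"
  have iA: "integrable lborel (\<lambda>y. indicator (cball 0 R') y * \<bar>u y\<bar>)"
    using u[rule_format, of R', THEN set_integrable_abs] by (simp add: set_integrable_def)
  have A: "A \<ge> 0" unfolding A_def by (intro integral_nonneg_AE AE_I2) simp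
  have key: "\<bar>mollify \<eta> u (x + k) - mollify \<eta> u x - ?L k\<bar> \<le> M * A * norm k * norm k" if k: "norm k \<le> 1" for k
  proof -
    have "mollify \<eta> u (x + k) - mollify \<eta> u x - ?L k =
      (LINT y|lborel. (\<eta> (x + k - y) * u y - \<eta> (x - y) * u y) - frechet_derivative \<eta> (at (x - y)) k * u y)"
      unfolding mollify_def real_scaleR_def
      by (simp only: Bochner_Integration.integral_diff[OF Bochner_Integration.integrable_diff[OF int0 int0] int1]
          Bochner_Integration.integral_diff[OF int0 int0])
    also have "norm \<dots> \<le> (LINT y|lborel. (M * norm k * norm k) * (indicator (cball 0 R') y * \<bar>u y\<bar>))"
    proof (rule Bochner_Integration.integral_norm_bound_integral)
      fix y
      have e: "(\<eta> (x + k - y) * u y - \<eta> (x - y) * u y) - frechet_derivative \<eta> (at (x - y)) k * u y =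
        (\<eta> ((x - y) + k) - \<eta> (x - y) - frechet_derivative \<eta> (at (x - y)) k) * u y"
        by (simp add: algebra_simps)
      show "norm ((\<eta> (x + k - y) * u y - \<eta> (x - y) * u y) - frechet_derivative \<eta> (at (x - y)) k * u y)
         \<le> (M * norm k * norm k) * (indicator (cball 0 R') y * \<bar>u y\<bar>)"
      proof (cases "norm y > R'")
        case True
        have "norm (x - y) > R + 1"
          using True norm_triangle_ineq2[of y x] unfolding R'_def by (simp add: norm_minus_commute)
        moreover from this have "norm ((x - y) + k) > R"
          using k norm_triangle_ineq2[of "x - y" "- k"] by simp
        ultimately have "\<eta> ((x - y) + k) - \<eta> (x - y) - frechet_derivative \<eta> (at (x - y)) k = 0"
          using R dz by simp
        then show ?thesis unfolding e using M(1) by simp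
      next
        case False
        then show ?thesis unfolding e using M(2)[of "x - y" k] by (simp add: abs_mult mult_right_mono)
      qed
    qed (intro Bochner_Integration.integrable_diff int0 int1 integrable_mult_right iA)+
    also have "\<dots> = M * A * norm k * norm k" by (simp add: A_def)
    finally show ?thesis by simp
  qed
  show ?thesis
  proof (unfold has_derivative_at_alt, intro conjI bl allI impI)
    fix e :: real assume e: "e > 0"
    define d where "d = min 1 (e / (M * A + 1))"
    have MA: "M * A + 1 > 0" using M(1) A by (simp add: add_nonneg_pos)
    have d: "d > 0" using e MA by (simp add: d_def)
    show "\<exists>d>0. \<forall>y. norm (y - x) < d \<longrightarrow> norm (mollify \<eta> u y - mollify \<eta> u x - ?L (y - x)) \<le> e * norm (y - x)"
    proof (intro exI[of _ d] conjI d allI impI)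
      fix y assume y: "norm (y - x) < d"
      have "norm (y - x) \<le> e / (M * A + 1)" using y by (simp add: d_def)
      then have "(M * A + 1) * norm (y - x) \<le> e"
        using MA by (simp add: pos_le_divide_eq mult.commute)
      then have "M * A * norm (y - x) \<le> e"
        using norm_ge_zero[of "y - x"] unfolding distrib_right by linarith
      then have "M * A * norm (y - x) * norm (y - x) \<le> e * norm (y - x)"
        by (rule mult_right_mono) simp
      then show "norm (mollify \<eta> u y - mollify \<eta> u x - ?L (y - x)) \<le> e * norm (y - x)"
        using key[of "y - x"] y by (simp add: d_def)
    qed
  qed
qed

text \<open>
  A mollification averages translates, so by Fubini's theorem its error is an average of translation
  moduli. The kernel is only assumed to be integrable and bounded, which includes the normalised indicator of
  an interval.
\<close>

lemma mollify_L1: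
  fixes u :: "'a::euclidean_space \<Rightarrow> 'b::euclidean_space"
  assumes u: "integrable lborel u" and i\<eta>: "integrable lborel \<eta>" "\<And>x. \<eta> x \<le> M"
    and \<eta>: "\<And>x. 0 \<le> \<eta> x"
    "\<And>x. norm x \<ge> h \<Longrightarrow> \<eta> x = 0" "(LINT x|lborel. \<eta> x) = 1"
    and e: "0 \<le> e" "\<And>z. norm z < h \<Longrightarrow> (LINT x|lborel. norm (u (x + z) - u x)) \<le> e"
  shows "(\<integral>\<^sup>+x. norm (mollify \<eta> u x - u x) \<partial>lborel) \<le> ennreal e"
proof -
  have [measurable]: "u \<in> borel_measurable borel" using u by simp
  have [measurable]: "\<eta> \<in> borel_measurable borel" using i\<eta>(1) by simp
  have pt: "ennreal (norm (mollify \<eta> u x - u x)) \<le> (\<integral>\<^sup>+y. ennreal (\<eta> y) * norm (u (x - y) - u x) \<partial>lborel)" for x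
  proof -
    have i1: "integrable lborel (\<lambda>y. \<eta> y *\<^sub>R u (x - y))"
    proof (rule Bochner_Integration.integrable_bound)
      have "integrable (distr lborel borel (\<lambda>y. x - y)) u"
        unfolding lborel_distr_reflection by (rule u)
      then have "integrable lborel (\<lambda>y. u (x - y))" by (subst (asm) integrable_distr_eq) auto
      then show "integrable lborel (\<lambda>y. M *\<^sub>R u (x - y))" by simp
      show "AE y in lborel. norm (\<eta> y *\<^sub>R u (x - y)) \<le> norm (M *\<^sub>R u (x - y))"
        using i\<eta>(2) \<eta>(1) by (intro AE_I2) (simp, meson abs_ge_self abs_of_nonneg mult_right_mono norm_ge_zero order_trans)
    qed measurable
    have i2: "integrable lborel (\<lambda>y. \<eta> y *\<^sub>R u x)"
      using i\<eta>(1) by simp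
    have "mollify \<eta> u x - u x = (LINT y|lborel. \<eta> y *\<^sub>R u (x - y)) - (LINT y|lborel. \<eta> y *\<^sub>R u x)"
      using \<eta>(3) i\<eta>(1) by (simp add: mollify_alt)
    also have "\<dots> = (LINT y|lborel. \<eta> y *\<^sub>R (u (x - y) - u x))"
      using i1 i2 by (simp add: scaleR_right_diff_distrib)
    finally have "ennreal (norm (mollify \<eta> u x - u x)) \<le> (\<integral>\<^sup>+y. norm (\<eta> y *\<^sub>R (u (x - y) - u x)) \<partial>lborel)"
      using integral_norm_bound_ennreal[of lborel "\<lambda>y. \<eta> y *\<^sub>R (u (x - y) - u x)"] i1 i2
      by (simp add: scaleR_right_diff_distrib)
    also have "\<dots> = (\<integral>\<^sup>+y. ennreal (\<eta> y) * norm (u (x - y) - u x) \<partial>lborel)"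
      by (intro nn_integral_cong) (simp add: \<eta>(1) ennreal_mult)
    finally show ?thesis .
  qed
  have "(\<integral>\<^sup>+x. norm (mollify \<eta> u x - u x) \<partial>lborel)
     \<le> (\<integral>\<^sup>+x. \<integral>\<^sup>+y. ennreal (\<eta> y) * norm (u (x - y) - u x) \<partial>lborel \<partial>lborel)"
    by (intro nn_integral_mono pt)
  also have "\<dots> = (\<integral>\<^sup>+y. \<integral>\<^sup>+x. ennreal (\<eta> y) * norm (u (x - y) - u x) \<partial>lborel \<partial>lborel)"
    by (rule lborel_pair.Fubini') measurable
  also have "\<dots> \<le> (\<integral>\<^sup>+y. ennreal (\<eta> y) * ennreal e \<partial>lborel)"
  proof (intro nn_integral_mono)
    fix y
    have "(\<integral>\<^sup>+x. ennreal (norm (u (x - y) - u x)) \<partial>lborel) \<le> ennreal e" if "norm y < h"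
    proof -
      have "integrable lborel (\<lambda>x. norm (u (x + - y) - u x))"
        by (intro integrable_norm Bochner_Integration.integrable_diff lborel_integrable_translation u)
      then have "(\<integral>\<^sup>+x. ennreal (norm (u (x - y) - u x)) \<partial>lborel) = ennreal (LINT x|lborel. norm (u (x + - y) - u x))"
        by (subst nn_integral_eq_integral) auto
      also have "\<dots> \<le> ennreal e" using e(2)[of "- y"] that by (intro ennreal_leI) simp
      finally show ?thesis .
    qed
    moreover have "(\<integral>\<^sup>+x. ennreal (\<eta> y) * norm (u (x - y) - u x) \<partial>lborel) =
        ennreal (\<eta> y) * (\<integral>\<^sup>+x. ennreal (norm (u (x - y) - u x)) \<partial>lborel)"
      by (rule nn_integral_cmult) measurable
    ultimately show "(\<integral>\<^sup>+x. ennreal (\<eta> y) * norm (u (x - y) - u x) \<partial>lborel) \<le> ennreal (\<eta> y) * ennreal e"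
      using \<eta>(2)[of y] by (cases "norm y < h") (auto intro: mult_left_mono)
  qed
  also have "\<dots> = (\<integral>\<^sup>+y. ennreal (\<eta> y) \<partial>lborel) * ennreal e"
    by (rule nn_integral_multc) measurable
  also have "(\<integral>\<^sup>+y. ennreal (\<eta> y) \<partial>lborel) = 1"
    using nn_integral_eq_integral[OF i\<eta>(1)] \<eta>(1,3) by simp
  finally show ?thesis by simp
qed

text \<open>
  Convergence on a ball only involves the function on a slightly larger ball, so local
  integrability suffices after cutting off.
\<close>

lemma mollify_approximates:
  fixes u :: "'a::euclidean_space \<Rightarrow> 'b::euclidean_space"
  assumes [measurable]: "u \<in> borel_measurable borel" and u: "locally_integrable_lborel u" and e: "e > 0"
  obtains h where "h > 0" "h \<le> 1" "\<And>\<eta>. \<eta> \<in> test_functions \<Longrightarrow> (\<And>x. 0 \<le> \<eta> x) \<Longrightarrow>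
    (\<And>x. norm x \<ge> h \<Longrightarrow> \<eta> x = 0) \<Longrightarrow> (LINT x|lborel. \<eta> x) = 1 \<Longrightarrow>
    (\<integral>\<^sup>+x\<in>cball 0 R. norm (mollify \<eta> u x - u x) \<partial>lborel) \<le> ennreal e"
proof -
  define w where "w x = indicator (cball 0 (R + 1)) x *\<^sub>R u x" for x
  have iw: "integrable lborel w" using u unfolding w_def[abs_def] set_integrable_def by blast
  have "\<forall>\<^sub>F z in at 0. dist (LINT x|lborel. norm (w (x + z) - w x)) 0 < e"
    using tendstoD[OF translation_L1_continuous[OF iw] e] .
  then obtain d where d: "d > 0" "\<And>z. z \<noteq> 0 \<Longrightarrow> norm z < d \<Longrightarrow> (LINT x|lborel. norm (w (x + z) - w x)) < e"
    by (auto simp: eventually_at dist_real_def)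
  show ?thesis
  proof (rule that[of "min d 1"])
    fix \<eta> :: "'a \<Rightarrow> real"
    assume \<eta>: "\<eta> \<in> test_functions" "\<And>x. 0 \<le> \<eta> x" "\<And>x. norm x \<ge> min d 1 \<Longrightarrow> \<eta> x = 0" "(LINT x|lborel. \<eta> x) = 1"
    obtain Mb where Mb: "\<And>x. \<bar>\<eta> x\<bar> \<le> Mb" using test_bounded[OF \<eta>(1)] by blast
    have eq: "mollify \<eta> u x = mollify \<eta> w x" if "norm x \<le> R" for x
      unfolding mollify_def
    proof (intro Bochner_Integration.integral_cong refl)
      fix y
      have "\<eta> (x - y) = 0" if "norm y > R + 1"
        using \<eta>(3)[of "x - y"] that \<open>norm x \<le> R\<close> norm_triangle_ineq2[of y x] by (simp add: norm_minus_commute)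
      then show "\<eta> (x - y) *\<^sub>R u y = \<eta> (x - y) *\<^sub>R w y"
        by (cases "norm y > R + 1") (auto simp: w_def)
    qed
    have "(\<integral>\<^sup>+x\<in>cball 0 R. norm (mollify \<eta> u x - u x) \<partial>lborel) \<le> (\<integral>\<^sup>+x. norm (mollify \<eta> w x - w x) \<partial>lborel)"
      by (intro nn_integral_mono) (auto simp: eq w_def indicator_def)
    also have "\<dots> \<le> ennreal e"
    proof (rule mollify_L1[OF iw test_integrable[OF \<eta>(1)] _ \<eta>(2-4)])
      show "\<eta> x \<le> Mb" for x using Mb[of x] by simp
      show "(LINT x|lborel. norm (w (x + z) - w x)) \<le> e" if "norm z < min d 1" for z
        using d(2)[of z] that e by (cases "z = 0") auto
    qed (use e in auto)
    finally show "(\<integral>\<^sup>+x\<in>cball 0 R. norm (mollify \<eta> u x - u x) \<partial>lborel) \<le> ennreal e" .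
  qed (use d in auto)
qed

lemma mollify_locally_bounded:
  fixes u :: "'a::euclidean_space \<Rightarrow> 'b::euclidean_space"
  assumes [measurable]: "u \<in> borel_measurable borel" and u: "locally_integrable_lborel u"
    and \<eta>: "\<eta> \<in> test_functions"
  shows "\<exists>C. \<forall>x. norm x \<le> R \<longrightarrow> norm (mollify \<eta> u x) \<le> C"
proof -
  obtain S where S: "S > 0" "\<And>x. norm x > S \<Longrightarrow> \<eta> x = 0" using test_support[OF \<eta>] by blast
  obtain M where M: "M > 0" "\<And>x. \<bar>\<eta> x\<bar> \<le> M" using test_bounded[OF \<eta>] by blast
  have i: "integrable lborel (\<lambda>y. M * norm (indicator (cball 0 (R + S)) y *\<^sub>R u y))"
    using u unfolding set_integrable_def by (intro integrable_mult_right integrable_norm) blast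
  have "norm (mollify \<eta> u x) \<le> (LINT y|lborel. M * norm (indicator (cball 0 (R + S)) y *\<^sub>R u y))" if "norm x \<le> R" for x
    unfolding mollify_def
  proof (rule Bochner_Integration.integral_norm_bound_integral[OF mollify_integrable[OF assms(1) u \<eta>] i])
    fix y
    have "\<eta> (x - y) = 0" if "norm y > R + S"
      using S(2)[of "x - y"] that \<open>norm x \<le> R\<close> norm_triangle_ineq2[of y x] by (simp add: norm_minus_commute)
    then show "norm (\<eta> (x - y) *\<^sub>R u y) \<le> M * norm (indicator (cball 0 (R + S)) y *\<^sub>R u y)"
      using M by (cases "norm y > R + S") (auto simp: mult_right_mono)
  qed
  then show ?thesis by blast
qed

text \<open>
  The Borel version of \<open>has_weak_gradient\<close>: with Borel data, compositions and iterated integrals stay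
  measurable.
\<close>

definition weak_gradient_lborel :: "('a::euclidean_space \<Rightarrow> real) \<Rightarrow> ('a \<Rightarrow> 'a) \<Rightarrow> bool" where
  "weak_gradient_lborel u G \<longleftrightarrow> u \<in> borel_measurable borel \<and> G \<in> borel_measurable borel \<and>
    locally_integrable_lborel u \<and> locally_integrable_lborel G \<and>
    (\<forall>\<phi>\<in>test_functions. \<forall>v.
      (LINT x|lborel. u x * frechet_derivative \<phi> (at x) v) = - (LINT x|lborel. (G x \<bullet> v) * \<phi> x))"

text \<open>The weak gradient is tested against the reflected kernel \<open>\<lambda>y. \<eta> (x - y)\<close>.\<close>

lemma mollify_weak_gradient:
  assumes uG: "weak_gradient_lborel u G" and \<eta>: "\<eta> \<in> test_functions"
  shows "(mollify \<eta> u has_derivative (\<lambda>k. mollify \<eta> G x \<bullet> k)) (at x)"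
proof -
  have [measurable]: "u \<in> borel_measurable borel" "G \<in> borel_measurable borel"
    and lu: "locally_integrable_lborel u" and lG: "locally_integrable_lborel G"
    and w: "\<And>\<phi> v. \<phi> \<in> test_functions \<Longrightarrow>
      (LINT x|lborel. u x * frechet_derivative \<phi> (at x) v) = - (LINT x|lborel. (G x \<bullet> v) * \<phi> x)"
    using uG by (auto simp: weak_gradient_lborel_def)
  have "(LINT y|lborel. frechet_derivative \<eta> (at (x - y)) k * u y) = mollify \<eta> G x \<bullet> k" for k
  proof -
    define \<phi> where "\<phi> y = \<eta> (x - y)" for y
    have \<phi>: "\<phi> \<in> test_functions" unfolding \<phi>_def[abs_def] by (rule test_reflect[OF \<eta>])
    have "frechet_derivative \<phi> (at y) k = - frechet_derivative \<eta> (at (x - y)) k" for y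
    proof -
      have "((\<lambda>y. x - y) has_derivative (\<lambda>k. - k)) (at y)" by (auto intro!: derivative_eq_intros)
      from has_derivative_compose[OF this smooth_has_derivative[OF test_smooth[OF \<eta>]]]
      have "(\<phi> has_derivative (\<lambda>k. frechet_derivative \<eta> (at (x - y)) (- k))) (at y)"
        by (simp add: \<phi>_def[abs_def])
      then have "frechet_derivative \<phi> (at y) = (\<lambda>k. frechet_derivative \<eta> (at (x - y)) (- k))"
        using frechet_derivative_at by metis
      then show ?thesis
        using linear_neg[OF smooth_derivative_linear[OF test_smooth[OF \<eta>]]] by simp
    qed
    then have "(LINT y|lborel. frechet_derivative \<eta> (at (x - y)) k * u y) =
        - (LINT y|lborel. u y * frechet_derivative \<phi> (at y) k)"
      by (simp add: mult.commute)
    also have "\<dots> = (LINT y|lborel. (G y \<bullet> k) * \<phi> y)" using w[OF \<phi>] by simp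
    also have "\<dots> = (LINT y|lborel. (\<eta> (x - y) *\<^sub>R G y) \<bullet> k)"
      by (simp add: \<phi>_def mult.commute)
    also have "\<dots> = mollify \<eta> G x \<bullet> k"
      unfolding mollify_def by (intro integral_inner_left mollify_integrable lG \<eta>) measurable
    finally show ?thesis .
  qed
  then show ?thesis using mollify_has_derivative[OF _ lu \<eta>, of x] by simp
qed

text \<open>The mollifications are Lipschitz with the same constant, and by continuity they converge pointwise.\<close>

lemma bounded_weak_gradient_imp_Lipschitz:
  assumes uG: "weak_gradient_lborel u G" and cont: "continuous_on UNIV u"
    and K: "AE x in lborel. norm (G x) \<le> K"
  shows "\<bar>u x - u y\<bar> \<le> K * norm (x - y)"
proof -
  have [measurable]: "u \<in> borel_measurable borel" "G \<in> borel_measurable borel"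
    and lu: "locally_integrable_lborel u" and lG: "locally_integrable_lborel G"
    using uG by (auto simp: weak_gradient_lborel_def)
  have near: "\<bar>u x - u y\<bar> \<le> K * norm (x - y) + 2 * e" if e: "e > 0" for e
  proof -
    have "\<exists>d>0. \<forall>w. dist w z < d \<longrightarrow> dist (u w) (u z) < e" for z
      using cont e by (auto simp: continuous_on_iff)
    then obtain d1 d2 where d: "d1 > 0" "d2 > 0" "\<And>w. dist w x < d1 \<Longrightarrow> dist (u w) (u x) < e"
        "\<And>w. dist w y < d2 \<Longrightarrow> dist (u w) (u y) < e"
      by metis
    obtain \<eta> :: "'a \<Rightarrow> real" where \<eta>: "\<eta> \<in> test_functions" "\<And>x. 0 \<le> \<eta> x"
      "\<And>x. norm x \<ge> min d1 d2 \<Longrightarrow> \<eta> x = 0" "(LINT x|lborel. \<eta> x) = 1"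
      using mollifier_exists[of "min d1 d2"] d by auto
    have [measurable]: "\<eta> \<in> borel_measurable borel" using test_measurable[OF \<eta>(1)] .
    have close: "\<bar>mollify \<eta> u z - u z\<bar> \<le> e" if z: "\<And>w. dist w z < min d1 d2 \<Longrightarrow> dist (u w) (u z) < e" for z
    proof -
      have i0: "integrable lborel (\<lambda>y. \<eta> (z - y))" by (rule test_integrable[OF test_reflect[OF \<eta>(1)]])
      have i1: "integrable lborel (\<lambda>y. \<eta> (z - y) * u y)" using mollify_integrable[OF _ lu \<eta>(1)] by simp
      have one: "(LINT y|lborel. \<eta> (z - y)) = 1" using lborel_integral_reflection[of \<eta> z] \<eta>(4) by simp
      have "mollify \<eta> u z - u z = (LINT y|lborel. \<eta> (z - y) * u y - \<eta> (z - y) * u z)"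
        using i0 i1 one by (simp add: mollify_def)
      also have "norm \<dots> \<le> (LINT y|lborel. \<eta> (z - y) * e)"
      proof (rule Bochner_Integration.integral_norm_bound_integral)
        fix w
        have "\<bar>\<eta> (z - w)\<bar> * \<bar>u w - u z\<bar> \<le> \<eta> (z - w) * e"
        proof (cases "norm (z - w) \<ge> min d1 d2")
          case True
          then show ?thesis using \<eta>(3) by simp
        next
          case False
          then have "\<bar>u w - u z\<bar> < e" using z[of w] by (auto simp: dist_norm norm_minus_commute not_le)
          then show ?thesis using \<eta>(2)[of "z - w"] by (simp add: mult_left_mono)
        qed
        then show "norm (\<eta> (z - w) * u w - \<eta> (z - w) * u z) \<le> \<eta> (z - w) * e"
          by (simp add: right_diff_distrib[symmetric] abs_mult)
      qed (use i0 i1 in auto)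
      also have "\<dots> = e" using i0 one by simp
      finally show ?thesis by simp
    qed
    have "norm (mollify \<eta> u x - mollify \<eta> u y) \<le> K * norm (x - y)"
    proof (rule differentiable_bound[of UNIV "mollify \<eta> u" "\<lambda>x k. mollify \<eta> G x \<bullet> k"])
      show "(mollify \<eta> u has_derivative (\<lambda>k. mollify \<eta> G z \<bullet> k)) (at z within UNIV)" for z
        using mollify_weak_gradient[OF uG \<eta>(1)] by simp
      show "onorm (\<lambda>k. mollify \<eta> G z \<bullet> k) \<le> K" for z
      proof (rule onorm_le)
        fix k
        have i0: "integrable lborel (\<lambda>y. \<eta> (z - y))" by (rule test_integrable[OF test_reflect[OF \<eta>(1)]])
        have one: "(LINT y|lborel. \<eta> (z - y)) = 1" using lborel_integral_reflection[of \<eta> z] \<eta>(4) by simp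
        have "norm (mollify \<eta> G z) \<le> (LINT y|lborel. norm (\<eta> (z - y) *\<^sub>R G y))"
          unfolding mollify_def by (rule integral_norm_bound)
        also have "\<dots> \<le> (LINT y|lborel. \<eta> (z - y) * K)"
        proof (rule integral_mono_AE)
          show "integrable lborel (\<lambda>y. norm (\<eta> (z - y) *\<^sub>R G y))"
            by (intro integrable_norm mollify_integrable lG \<eta>(1)) measurable
          show "AE y in lborel. norm (\<eta> (z - y) *\<^sub>R G y) \<le> \<eta> (z - y) * K"
            using K by eventually_elim (simp add: \<eta>(2) mult_left_mono)
        qed (use i0 in simp)
        also have "\<dots> = K" using i0 one by simp
        finally have "norm (mollify \<eta> G z) \<le> K" .
        then show "norm (mollify \<eta> G z \<bullet> k) \<le> K * norm k"
          using Cauchy_Schwarz_ineq2[of "mollify \<eta> G z" k] mult_right_mono[of "norm (mollify \<eta> G z)" K "norm k"]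
          by (simp add: mult.commute)
      qed
    qed auto
    moreover have "\<bar>mollify \<eta> u x - u x\<bar> \<le> e" "\<bar>mollify \<eta> u y - u y\<bar> \<le> e"
      using close[of x] close[of y] d(3,4) by auto
    ultimately show ?thesis by (simp add: abs_le_iff)
  qed
  show ?thesis
  proof (rule field_le_epsilon)
    fix e :: real assume "e > 0"
    then show "\<bar>u x - u y\<bar> \<le> K * norm (x - y) + e" using near[of "e / 2"] by simp
  qed
qed

section \<open>Lipschitz maps and Lebesgue measure\<close>

lemma Lipschitz_image_ball:
  fixes \<Theta> :: "'a::euclidean_space \<Rightarrow> 'a"
  assumes L: "L > 0" "\<And>x y. norm (\<Theta> x - \<Theta> y) \<le> L * norm (x - y)"
    and r: "r \<ge> 0"
  shows "\<Theta> ` ball x r \<subseteq> ball (\<Theta> x) (L * r)"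
    and "emeasure lborel (ball (\<Theta> x) (L * r)) = ennreal (L ^ DIM('a)) * emeasure lborel (ball x r)"
proof -
  show "\<Theta> ` ball x r \<subseteq> ball (\<Theta> x) (L * r)"
  proof (rule image_subsetI)
    fix y assume "y \<in> ball x r"
    then have "L * norm (x - y) < L * r" using L(1) by (simp add: dist_norm)
    then show "\<Theta> y \<in> ball (\<Theta> x) (L * r)" using L(2)[of x y] by (simp add: dist_norm)
  qed
  have *: "emeasure lborel (ball c s) = ennreal (s ^ DIM('a)) * emeasure lborel (ball (0 :: 'a) 1)"
    if "s \<ge> 0" for c :: 'a and s
    using emeasure_lebesgue_ball_conv_unit_ball[OF that, of c] by simp
  show "emeasure lborel (ball (\<Theta> x) (L * r)) = ennreal (L ^ DIM('a)) * emeasure lborel (ball x r)"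
    using L r by (simp add: *[of r] *[of "L * r"] power_mult_distrib ennreal_mult mult.assoc)
qed

text \<open>
  The preimage of a set under a map with Lipschitz inverse is a Lipschitz image. An open set is,
  up to a null set, a disjoint union of small balls by Vitali's covering theorem, and null sets go
  to null sets.
\<close>

lemma emeasure_vimage_Lipschitz_inverse:
  fixes \<Psi> \<Theta> :: "'a::euclidean_space \<Rightarrow> 'a"
  assumes L: "L > 0" "\<And>x y. norm (\<Theta> x - \<Theta> y) \<le> L * norm (x - y)"
    and inv: "\<And>x. \<Psi> (\<Theta> x) = x" "\<And>y. \<Theta> (\<Psi> y) = y"
    and [measurable]: "\<Psi> \<in> borel_measurable borel" and A[measurable]: "A \<in> sets borel"
  shows "emeasure lborel (\<Psi> -` A) \<le> ennreal (L ^ DIM('a)) * emeasure lborel A"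
proof -
  have m: "\<Psi> -` B \<in> sets borel" if "B \<in> sets borel" for B
    using measurable_sets_borel[OF \<open>\<Psi> \<in> borel_measurable borel\<close> that] by simp
  have vim: "\<Psi> -` B = \<Theta> ` B" for B
    using inv by (auto simp: image_iff) metis
  have null: "\<Psi> -` N \<in> null_sets lborel" if N: "N \<in> null_sets lborel" for N
  proof -
    have "negligible N" using N by (simp add: negligible_iff_null_sets null_sets_completionI)
    then have "negligible (\<Theta> ` N)"
    proof (rule negligible_locally_Lipschitz_image[rotated])
      fix x
      show "\<exists>T B. open T \<and> x \<in> T \<and> (\<forall>y\<in>N \<inter> T. norm (\<Theta> y - \<Theta> x) \<le> B * norm (y - x))"
        using L(2) by (intro exI[of _ UNIV] exI[of _ L]) auto
    qed simp
    then have "\<Psi> -` N \<in> null_sets lebesgue"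
      by (simp add: vim negligible_iff_null_sets)
    moreover have "\<Psi> -` N \<in> sets borel" using m[of N] null_setsD2[OF N] by simp
    ultimately show ?thesis unfolding null_sets_def by simp
  qed
  have op: "emeasure lborel (\<Psi> -` U) \<le> ennreal (L ^ DIM('a)) * emeasure lborel U" if U: "open U" for U
  proof -
    define K where "K = {(x, r). r > 0 \<and> ball x r \<subseteq> U}"
    have "\<exists>i. i \<in> K \<and> x \<in> ball (fst i) (snd i) \<and> snd i < d" if "x \<in> U" "0 < d" for x d
    proof -
      obtain e where "e > 0" "ball x e \<subseteq> U" using openE[OF U \<open>x \<in> U\<close>] by blast
      then show ?thesis using that(2)
        by (intro exI[of _ "(x, min e (d / 2))"]) (auto simp: K_def)
    qed
    from Vitali_covering_theorem_balls[OF this]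
    obtain C where C: "countable C" "C \<subseteq> K"
      "pairwise (\<lambda>i j. disjnt (ball (fst i) (snd i)) (ball (fst j) (snd j))) C"
      "negligible (U - (\<Union>i \<in> C. ball (fst i) (snd i)))" by blast
    define I where "I = to_nat_on C ` C"
    define B where "B n = (if n \<in> I then ball (fst (from_nat_into C n)) (snd (from_nat_into C n)) else {})" for n
    define B' where "B' n = (if n \<in> I then ball (\<Theta> (fst (from_nat_into C n))) (L * snd (from_nat_into C n)) else {})" for n
    have inC: "from_nat_into C n \<in> C" if "n \<in> I" for n
      using that C(1) by (auto simp: I_def)
    have UB: "(\<Union>n. B n) = (\<Union>i \<in> C. ball (fst i) (snd i))"
    proof (intro equalityI subsetI)
      fix x assume "x \<in> (\<Union>n. B n)"
      then show "x \<in> (\<Union>i \<in> C. ball (fst i) (snd i))"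
        using inC by (auto simp: B_def split: if_splits)
    next
      fix x assume "x \<in> (\<Union>i \<in> C. ball (fst i) (snd i))"
      then obtain i where i: "i \<in> C" "x \<in> ball (fst i) (snd i)" by blast
      then have "x \<in> B (to_nat_on C i)" using C(1) by (simp add: B_def I_def)
      then show "x \<in> (\<Union>n. B n)" by blast
    qed
    have disj: "disjoint_family B"
      unfolding disjoint_family_on_def
    proof (intro ballI impI)
      fix m n :: nat assume mn: "m \<noteq> n"
      show "B m \<inter> B n = {}"
      proof (cases "m \<in> I \<and> n \<in> I")
        case True
        then have "from_nat_into C m \<noteq> from_nat_into C n"
          using mn C(1) by (auto simp: I_def)
        then show ?thesis
          using pairwiseD[OF C(3) inC inC] True by (simp add: B_def disjnt_def)
      qed (auto simp: B_def)
    qed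
    have [measurable]: "B n \<in> sets borel" "B' n \<in> sets borel" for n by (simp_all add: B_def B'_def)
    have "U - (\<Union>n. B n) \<in> sets borel"
      using U by (intro sets.Diff sets.countable_UN) auto
    then have N: "U - (\<Union>n. B n) \<in> null_sets lborel"
      using C(4) unfolding UB by (auto simp: negligible_iff_null_sets null_sets_def)
    have pos: "snd (from_nat_into C n) \<ge> 0" if "n \<in> I" for n
      using inC[OF that] C(2) by (auto simp: K_def)
    have "\<Psi> -` U \<subseteq> (\<Union>n. B' n) \<union> \<Psi> -` (U - (\<Union>n. B n))"
    proof
      fix y assume y: "y \<in> \<Psi> -` U"
      show "y \<in> (\<Union>n. B' n) \<union> \<Psi> -` (U - (\<Union>n. B n))"
      proof (cases "\<exists>n. \<Psi> y \<in> B n")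
        case True
        then obtain n where n: "\<Psi> y \<in> B n" by blast
        then have nI: "n \<in> I" by (auto simp: B_def split: if_splits)
        have "\<Theta> (\<Psi> y) \<in> \<Theta> ` ball (fst (from_nat_into C n)) (snd (from_nat_into C n))"
          using n nI by (intro imageI) (simp add: B_def)
        then have "\<Theta> (\<Psi> y) \<in> ball (\<Theta> (fst (from_nat_into C n))) (L * snd (from_nat_into C n))"
          by (rule subsetD[OF Lipschitz_image_ball(1)[OF L pos[OF nI]]])
        then have "y \<in> B' n" using nI by (simp add: B'_def inv(2))
        then show ?thesis by blast
      qed (use y in blast)
    qed
    then have "emeasure lborel (\<Psi> -` U) \<le> emeasure lborel ((\<Union>n. B' n) \<union> \<Psi> -` (U - (\<Union>n. B n)))"
      using null[OF N] by (intro emeasure_mono) auto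
    also have "\<dots> = emeasure lborel (\<Union>n. B' n)"
      using null[OF N] by (intro emeasure_Un_null_set) auto
    also have "\<dots> \<le> (\<Sum>n. emeasure lborel (B' n))"
      by (intro emeasure_subadditive_countably) auto
    also have "\<dots> = (\<Sum>n. ennreal (L ^ DIM('a)) * emeasure lborel (B n))"
    proof (intro suminf_cong)
      fix n
      show "emeasure lborel (B' n) = ennreal (L ^ DIM('a)) * emeasure lborel (B n)"
        using Lipschitz_image_ball(2)[OF L pos] by (auto simp: B_def B'_def)
    qed
    also have "\<dots> = ennreal (L ^ DIM('a)) * (\<Sum>n. emeasure lborel (B n))" by simp
    also have "(\<Sum>n. emeasure lborel (B n)) = emeasure lborel (\<Union>n. B n)"
      using disj by (intro suminf_emeasure) auto
    also have "ennreal (L ^ DIM('a)) * \<dots> \<le> ennreal (L ^ DIM('a)) * emeasure lborel U"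
    proof (intro mult_left_mono emeasure_mono)
      have "ball (fst i) (snd i) \<subseteq> U" if "i \<in> C" for i
      proof -
        have "i \<in> K" using that C(2) by blast
        then show ?thesis by (simp add: K_def case_prod_beta)
      qed
      then show "(\<Union>n. B n) \<subseteq> U" unfolding UB by (intro UN_least)
    qed (use U in auto)
    finally show ?thesis .
  qed
  show ?thesis
  proof (rule ennreal_le_epsilon)
    fix e :: real assume e: "0 < e"
    define e' where "e' = e / L ^ DIM('a)"
    have e': "e' > 0" using e L(1) by (simp add: e'_def)
    obtain U where U: "open U" "A \<subseteq> U" "emeasure lborel (U - A) < ennreal e'"
      using outer_regular_lborel[OF A e'] by blast
    have "emeasure lborel (\<Psi> -` A) \<le> emeasure lborel (\<Psi> -` U)"
      using U m[of U] by (intro emeasure_mono) auto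
    also have "\<dots> \<le> ennreal (L ^ DIM('a)) * emeasure lborel U" by (rule op[OF U(1)])
    also have "emeasure lborel U = emeasure lborel A + emeasure lborel (U - A)"
      using U by (subst plus_emeasure) (auto simp: Un_absorb1)
    also have "ennreal (L ^ DIM('a)) * \<dots> \<le> ennreal (L ^ DIM('a)) * (emeasure lborel A + ennreal e')"
      using U(3) by (intro mult_left_mono add_left_mono) auto
    also have "\<dots> = ennreal (L ^ DIM('a)) * emeasure lborel A + ennreal e"
      using L(1) e e' by (simp add: distrib_left ennreal_mult[symmetric] e'_def)
    finally show "emeasure lborel (\<Psi> -` A) \<le> ennreal (L ^ DIM('a)) * emeasure lborel A + ennreal e" .
  qed
qed

lemma nn_integral_Lipschitz_inverse:
  fixes \<Psi> \<Theta> :: "'a::euclidean_space \<Rightarrow> 'a"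
  assumes L: "L > 0" "\<And>x y. norm (\<Theta> x - \<Theta> y) \<le> L * norm (x - y)"
    and inv: "\<And>x. \<Psi> (\<Theta> x) = x" "\<And>y. \<Theta> (\<Psi> y) = y"
    and [measurable]: "\<Psi> \<in> borel_measurable borel" "f \<in> borel_measurable borel"
  shows "(\<integral>\<^sup>+y. f (\<Psi> y) \<partial>lborel) \<le> ennreal (L ^ DIM('a)) * (\<integral>\<^sup>+x. f x \<partial>lborel)"
proof -
  have "(\<integral>\<^sup>+y. f (\<Psi> y) \<partial>lborel) = (\<integral>\<^sup>+x. f x \<partial>distr lborel borel \<Psi>)"
    by (subst nn_integral_distr) auto
  also have "\<dots> \<le> (\<integral>\<^sup>+x. f x \<partial>scale_measure (ennreal (L ^ DIM('a))) lborel)"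
  proof (rule nn_integral_mono_measure)
    show "distr lborel borel \<Psi> \<le> scale_measure (ennreal (L ^ DIM('a))) lborel"
      using emeasure_vimage_Lipschitz_inverse[OF L inv]
      by (subst le_measure) (auto simp: emeasure_distr)
  qed simp
  also have "\<dots> = ennreal (L ^ DIM('a)) * (\<integral>\<^sup>+x. f x \<partial>lborel)"
    by (rule nn_integral_scale_measure) simp
  finally show ?thesis .
qed

lemma AE_Lipschitz_inverse:
  fixes \<Psi> \<Theta> :: "'a::euclidean_space \<Rightarrow> 'a"
  assumes L: "L > 0" "\<And>x y. norm (\<Theta> x - \<Theta> y) \<le> L * norm (x - y)"
    and inv: "\<And>x. \<Psi> (\<Theta> x) = x" "\<And>y. \<Theta> (\<Psi> y) = y"
    and [measurable]: "\<Psi> \<in> borel_measurable borel" and ae: "AE x in lborel. P x"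
  shows "AE y in lborel. P (\<Psi> y)"
proof -
  obtain N where N: "{x. \<not> P x} \<subseteq> N" "N \<in> sets borel" "emeasure lborel N = 0"
    using ae by (auto elim!: AE_E)
  have "emeasure lborel (\<Psi> -` N) = 0"
    using emeasure_vimage_Lipschitz_inverse[OF L inv _ N(2)] N(3) by simp
  moreover have "\<Psi> -` N \<in> sets borel"
    using measurable_sets_borel[OF \<open>\<Psi> \<in> borel_measurable borel\<close> N(2)] by simp
  ultimately show ?thesis
    using N(1) by (intro AE_I[of _ _ "\<Psi> -` N"]) auto
qed

section \<open>Almost everywhere derivatives of Lipschitz functions\<close>

text \<open>
  After adding a multiple of the identity, a Lipschitz function of one variable is an increasing
  bi-Lipschitz bijection of the line. Lebesgue measure transported by its inverse is then
  absolutely continuous, and its density is the derivative.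
\<close>

lemma Lipschitz_indefinite_integral:
  fixes u :: "real \<Rightarrow> real"
  assumes L: "L \<ge> 0" "\<And>x y. \<bar>u x - u y\<bar> \<le> L * \<bar>x - y\<bar>"
  obtains w where "w \<in> borel_measurable borel" "locally_integrable_lborel w"
    "\<And>a b. a \<le> b \<Longrightarrow> u b - u a = (LINT x|lborel. indicator {a..b} x * w x)"
proof -
  \<comment> \<open>The slope of \<open>F\<close> is at least one, so the inverse of \<open>F\<close> exists and is Lipschitz.\<close>
  define F where "F x = u x + (L + 1) * x" for x
  have lower: "y - x \<le> F y - F x" if "x \<le> y" for x y
    using L(2)[of y x] that by (simp add: F_def algebra_simps abs_le_iff)
  have Lip: "\<bar>F x - F y\<bar> \<le> (2 * L + 1) * \<bar>x - y\<bar>" for x y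
  proof -
    have "F x - F y = (u x - u y) + (L + 1) * (x - y)" by (simp add: F_def algebra_simps)
    also have "\<bar>\<dots>\<bar> \<le> L * \<bar>x - y\<bar> + (L + 1) * \<bar>x - y\<bar>"
      using L by (intro order_trans[OF abs_triangle_ineq] add_mono) (auto simp: abs_mult)
    finally show ?thesis by (simp add: algebra_simps)
  qed
  have mono: "strict_mono F"
    using lower by (intro strict_monoI) (smt (verit))
  have cont: "continuous_on UNIV F"
    using Lip L(1) by (intro lipschitz_on_continuous_on[of "2 * L + 1"] lipschitz_onI) (auto simp: dist_real_def)
  have "surj F"
  proof (rule surjI)
    fix y
    have "\<exists>x. F x = y"
    proof -
      define a where "a = - \<bar>y - F 0\<bar>"
      define b where "b = \<bar>y - F 0\<bar>"
      have "F a \<le> y" using lower[of a 0] by (simp add: a_def)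
      moreover have "y \<le> F b" using lower[of 0 b] by (simp add: b_def)
      moreover have "a \<le> b" by (simp add: a_def b_def)
      ultimately show ?thesis
        using IVT'[of F a y b] continuous_on_subset[OF cont] by auto
    qed
    then show "F (SOME x. F x = y) = y" by (rule someI_ex)
  qed
  then have bij: "bij F" using mono by (simp add: bij_def strict_mono_imp_inj_on)
  define H where "H = inv F"
  have H: "F (H y) = y" "H (F x) = x" for x y
    using bij by (simp_all add: H_def bij_is_surj surj_f_inv_f bij_is_inj inv_f_f)
  have "mono H"
  proof (rule monoI)
    fix x y :: real assume "x \<le> y"
    then show "H x \<le> H y" using H strict_mono_less_eq[OF mono] by metis
  qed
  then have [measurable]: "H \<in> borel_measurable borel" by (rule borel_measurable_mono)
  have L': "2 * L + 1 > 0" using L(1) by simp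
  define \<mu> where "\<mu> = distr lborel borel H"
  have "absolutely_continuous lborel \<mu>"
    unfolding absolutely_continuous_def
  proof
    fix N assume N: "N \<in> null_sets (lborel :: real measure)"
    then have "emeasure lborel (H -` N) \<le> ennreal ((2 * L + 1) ^ DIM(real)) * emeasure lborel N"
      using Lip by (intro emeasure_vimage_Lipschitz_inverse[OF L' _ H(2,1)]) auto
    then show "N \<in> null_sets \<mu>"
      using N by (auto simp: null_sets_def \<mu>_def emeasure_distr)
  qed
  then obtain f where f[measurable]: "f \<in> borel_measurable lborel" and f\<mu>: "density lborel f = \<mu>"
    using sigma_finite_measure.Radon_Nikodym[OF sigma_finite_lborel, of \<mu>] by (auto simp: \<mu>_def)
  have I: "(\<integral>\<^sup>+x. f x * indicator {a..b} x \<partial>lborel) = ennreal (F b - F a)" if "a \<le> b" for a b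
  proof -
    have "(\<integral>\<^sup>+x. f x * indicator {a..b} x \<partial>lborel) = emeasure (density lborel f) {a..b}"
      by (subst emeasure_density) auto
    also have "\<dots> = emeasure lborel (H -` {a..b})" by (simp add: f\<mu> \<mu>_def emeasure_distr)
    also have "H -` {a..b} = {F a..F b}"
      using H strict_mono_less_eq[OF mono] by (auto simp: vimage_def) metis+
    also have "emeasure lborel {F a..F b} = ennreal (F b - F a)"
      using that strict_mono_less_eq[OF mono] by simp
    finally show ?thesis .
  qed
  have fin: "AE x in lborel. f x \<noteq> \<infinity>"
  proof -
    have "AE x in lborel. \<forall>n::nat. f x * indicator {- real n..real n} x \<noteq> \<infinity>"
      by (intro AE_all_countable[THEN iffD2] allI nn_integral_PInf_AE) (auto simp: I)
    then show ?thesis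
    proof eventually_elim
      case (elim x)
      obtain n :: nat where "\<bar>x\<bar> \<le> real n" using real_arch_simple by blast
      then have "x \<in> {- real n..real n}" by auto
      then show ?case using elim[rule_format, of n] by simp
    qed
  qed
  define g where "g x = enn2real (f x)" for x
  have [measurable]: "g \<in> borel_measurable borel" unfolding g_def by simp
  have hb: "has_bochner_integral lborel (\<lambda>x. indicator {a..b} x * g x) (F b - F a)" if "a \<le> b" for a b
  proof (rule has_bochner_integral_nn_integral)
    have "(\<integral>\<^sup>+x. ennreal (indicator {a..b} x * g x) \<partial>lborel) = (\<integral>\<^sup>+x. f x * indicator {a..b} x \<partial>lborel)"
      using fin by (intro nn_integral_cong_AE) (auto simp: g_def indicator_def less_top elim: eventually_mono)
    then show "(\<integral>\<^sup>+x. ennreal (indicator {a..b} x * g x) \<partial>lborel) = ennreal (F b - F a)"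
      using I[OF that] by simp
    show "0 \<le> F b - F a" using lower[OF that] that by simp
  qed (auto simp: g_def)
  have hc: "has_bochner_integral lborel (\<lambda>x. indicator {a..b} x * (L + 1)) ((b - a) * (L + 1))" if "a \<le> b" for a b
    using that by (intro has_bochner_integral_mult_left) (auto simp: has_bochner_integral_iff)
  have hw: "has_bochner_integral lborel (\<lambda>x. indicator {a..b} x * (g x - (L + 1))) (u b - u a)" if "a \<le> b" for a b
    using has_bochner_integral_diff[OF hb[OF that] hc[OF that]]
    by (simp add: right_diff_distrib F_def algebra_simps)
  show ?thesis
  proof (rule that[of "\<lambda>x. g x - (L + 1)"])
    show "locally_integrable_lborel (\<lambda>x. g x - (L + 1))"
    proof
      fix R :: real
      have "cball 0 R = {-R..R}" by (auto simp: cball_def dist_real_def)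
      then show "set_integrable lborel (cball 0 R) (\<lambda>x. g x - (L + 1))"
        using hw[of "-R" R] by (cases "R \<ge> 0") (auto simp: set_integrable_def has_bochner_integral_iff)
    qed
    show "u b - u a = (LINT x|lborel. indicator {a..b} x * (g x - (L + 1)))" if "a \<le> b" for a b
      using hw[OF that] by (simp add: has_bochner_integral_iff)
  qed measurable
qed

text \<open>The difference quotient is the average of the derivative over a short interval, that is, a mollification.\<close>

lemma Lipschitz_difference_quotients_L1:
  fixes u :: "real \<Rightarrow> real"
  assumes L: "L \<ge> 0" "\<And>x y. \<bar>u x - u y\<bar> \<le> L * \<bar>x - y\<bar>" and e: "e > 0"
  obtains d where "d > 0" "\<And>h h'. 0 < h \<Longrightarrow> h < d \<Longrightarrow> 0 < h' \<Longrightarrow> h' < d \<Longrightarrow>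
    (\<integral>\<^sup>+s\<in>{0..1}. \<bar>(u (s + h) - u s) / h - (u (s + h') - u s) / h'\<bar> \<partial>lborel) \<le> ennreal e"
proof -
  obtain w where [measurable]: "w \<in> borel_measurable borel" and lw: "locally_integrable_lborel w"
    and w: "\<And>a b. a \<le> b \<Longrightarrow> u b - u a = (LINT x|lborel. indicator {a..b} x * w x)"
    using Lipschitz_indefinite_integral[OF L] by blast
  have [measurable]: "u \<in> borel_measurable borel"
    using L by (intro borel_measurable_continuous_onI lipschitz_on_continuous_on[of L] lipschitz_onI) (auto simp: dist_real_def)
  define v where "v x = indicator (cball 0 2) x *\<^sub>R w x" for x
  have [measurable]: "v \<in> borel_measurable borel" unfolding v_def[abs_def] by (intro borel_measurable_scaleR borel_measurable_indicator) auto
  have iv: "integrable lborel v" using lw unfolding v_def[abs_def] set_integrable_def by blast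
  have "\<forall>\<^sub>F z in at 0. dist (LINT x|lborel. norm (v (x + z) - v x)) 0 < e / 2"
    using tendstoD[OF translation_L1_continuous[OF iv], of "e / 2"] e by simp
  then obtain d where d: "d > 0" "\<And>z. z \<noteq> 0 \<Longrightarrow> norm z < d \<Longrightarrow> (LINT x|lborel. norm (v (x + z) - v x)) < e / 2"
    by (auto simp: eventually_at dist_real_def)
  have one: "(\<integral>\<^sup>+s\<in>{0..1}. \<bar>(u (s + h) - u s) / h - v s\<bar> \<partial>lborel) \<le> ennreal (e / 2)"
    if h: "0 < h" "h < min d 1 / 2" for h
  proof -
    define \<eta> where "\<eta> y = indicator {-h..0} y / h" for y :: real
    have i\<eta>: "integrable lborel \<eta>" unfolding \<eta>_def[abs_def] using h(1) by (intro integrable_divide integrable_real_indicator) auto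
    have eq: "(u (s + h) - u s) / h = mollify \<eta> v s" if s: "s \<in> {0..1}" for s
    proof -
      have "mollify \<eta> v s = (LINT y|lborel. (indicator {s..s + h} y * w y) / h)"
        unfolding mollify_def
        using s h by (intro Bochner_Integration.integral_cong) (auto simp: \<eta>_def v_def indicator_def dist_real_def)
      also have "\<dots> = (u (s + h) - u s) / h"
        using h w[of s "s + h"] by simp
      finally show ?thesis by simp
    qed
    have "(\<integral>\<^sup>+s\<in>{0..1}. \<bar>(u (s + h) - u s) / h - v s\<bar> \<partial>lborel) \<le> (\<integral>\<^sup>+s. norm (mollify \<eta> v s - v s) \<partial>lborel)"
      by (intro nn_integral_mono) (auto simp: indicator_def eq)
    also have "\<dots> \<le> ennreal (e / 2)"
    proof (rule mollify_L1[OF iv i\<eta>, where M = "1 / h" and h = "min d 1"])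
      show "\<eta> x \<le> 1 / h" "0 \<le> \<eta> x" for x using h by (auto simp: \<eta>_def indicator_def)
      show "\<eta> x = 0" if "min d 1 \<le> norm x" for x using that h by (auto simp: \<eta>_def indicator_def)
      show "(LINT x|lborel. \<eta> x) = 1" unfolding \<eta>_def using h by simp
      show "0 \<le> e / 2" using e by simp
      show "(LINT x|lborel. norm (v (x + z) - v x)) \<le> e / 2" if "norm z < min d 1" for z
        using d(2)[of z] that e by (cases "z = 0") auto
    qed
    finally show ?thesis .
  qed
  show ?thesis
  proof (rule that[of "min d 1 / 2"])
    fix h h' assume h: "0 < h" "h < min d 1 / 2" and h': "0 < h'" "h' < min d 1 / 2"
    have "(\<integral>\<^sup>+s\<in>{0..1}. \<bar>(u (s + h) - u s) / h - (u (s + h') - u s) / h'\<bar> \<partial>lborel)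
      \<le> (\<integral>\<^sup>+s. ennreal \<bar>(u (s + h) - u s) / h - v s\<bar> * indicator {0..1} s + ennreal \<bar>(u (s + h') - u s) / h' - v s\<bar> * indicator {0..1} s \<partial>lborel)"
      by (intro nn_integral_mono)
         (auto simp: indicator_def ennreal_plus[symmetric] simp del: ennreal_plus intro!: ennreal_leI)
    also have "\<dots> = (\<integral>\<^sup>+s\<in>{0..1}. \<bar>(u (s + h) - u s) / h - v s\<bar> \<partial>lborel) + (\<integral>\<^sup>+s\<in>{0..1}. \<bar>(u (s + h') - u s) / h' - v s\<bar> \<partial>lborel)"
      by (rule nn_integral_add) measurable
    also have "\<dots> \<le> ennreal (e / 2) + ennreal (e / 2)"
      by (intro add_mono one h h')
    also have "\<dots> = ennreal e" using e by (simp add: ennreal_plus[symmetric] del: ennreal_plus)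
    finally show "(\<integral>\<^sup>+s\<in>{0..1}. \<bar>(u (s + h) - u s) / h - (u (s + h') - u s) / h'\<bar> \<partial>lborel) \<le> ennreal e" .
  qed (use d in auto)
qed

text \<open>
  By translation invariance an integral over space may be averaged along the direction of
  differentiation, which reduces the statement to the lines in that direction.
\<close>

lemma direction_difference_quotients_Cauchy:
  fixes u :: "'c::euclidean_space \<Rightarrow> real"
  assumes [measurable]: "u \<in> borel_measurable borel"
    and L: "L \<ge> 0" "\<And>z s. \<bar>u (z + s *\<^sub>R v) - u z\<bar> \<le> L * \<bar>s\<bar>" and e: "e > 0"
  obtains d where "d > 0" "\<And>h h'. 0 < h \<Longrightarrow> h < d \<Longrightarrow> 0 < h' \<Longrightarrow> h' < d \<Longrightarrow>
    (\<integral>\<^sup>+z\<in>cball 0 R. \<bar>(u (z + h *\<^sub>R v) - u z) / h - (u (z + h' *\<^sub>R v) - u z) / h'\<bar> \<partial>lborel) \<le> ennreal e"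
proof -
  define q where "q h h' z = \<bar>(u (z + h *\<^sub>R v) - u z) / h - (u (z + h' *\<^sub>R v) - u z) / h'\<bar>" for h h' z
  have [measurable]: "q h h' \<in> borel_measurable borel" for h h'
    unfolding q_def[abs_def] by measurable
  have qb: "q h h' z \<le> 2 * L" if "h > 0" "h' > 0" for h h' z
  proof -
    have "\<bar>(u (z + k *\<^sub>R v) - u z) / k\<bar> \<le> L" if "k > 0" for k
      using L(2)[of z k] that by (simp add: field_simps)
    from this[OF that(1)] this[OF that(2)] show ?thesis unfolding q_def by linarith
  qed
  have "\<exists>d>0. \<forall>h h'. 0 < h \<longrightarrow> h < d \<longrightarrow> 0 < h' \<longrightarrow> h' < d \<longrightarrow> (\<integral>\<^sup>+z\<in>cball 0 R. q h h' z \<partial>lborel) \<le> ennreal e"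
  proof (rule ccontr)
    assume n: "\<not> ?thesis"
    have "\<exists>h h'. 0 < h \<and> h < 1 / real (Suc n) \<and> 0 < h' \<and> h' < 1 / real (Suc n) \<and>
        ennreal e < (\<integral>\<^sup>+z\<in>cball 0 R. q h h' z \<partial>lborel)" for n
    proof -
      have "0 < 1 / real (Suc n)" by simp
      with n show ?thesis by (meson not_le)
    qed
    then obtain h h' where h: "\<And>n. 0 < h n" "\<And>n. h n < 1 / real (Suc n)" "\<And>n. 0 < h' n" "\<And>n. h' n < 1 / real (Suc n)"
      "\<And>n. ennreal e < (\<integral>\<^sup>+z\<in>cball 0 R. q (h n) (h' n) z \<partial>lborel)"
      by metis
    define I where "I n z = (\<integral>\<^sup>+s\<in>{0..1}. ennreal (q (h n) (h' n) (z + s *\<^sub>R v)) \<partial>(lborel :: real measure))" for n z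
    have [measurable]: "I n \<in> borel_measurable borel" for n
      unfolding I_def[abs_def] by measurable
    define B where "B = (cball 0 (R + norm v) :: 'c set)"
    have [measurable]: "B \<in> sets borel" "cball 0 R \<in> sets borel" by (simp_all add: B_def)
    have le: "(\<integral>\<^sup>+z\<in>cball 0 R. q (h n) (h' n) z \<partial>lborel) \<le> (\<integral>\<^sup>+z. I n z * indicator B z \<partial>lborel)" for n
    proof -
      have "(\<integral>\<^sup>+z\<in>cball 0 R. q (h n) (h' n) z \<partial>lborel)
         = (\<integral>\<^sup>+s\<in>{0..1}. (\<integral>\<^sup>+z\<in>cball 0 R. q (h n) (h' n) z \<partial>lborel) \<partial>(lborel :: real measure))"
        by (subst nn_integral_cmult) auto
      also have "\<dots> \<le> (\<integral>\<^sup>+s. (\<integral>\<^sup>+z. ennreal (q (h n) (h' n) (z + s *\<^sub>R v)) * indicator {0..1} s * indicator B z \<partial>lborel) \<partial>(lborel :: real measure))"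
      proof (intro nn_integral_mono)
        fix s :: real
        have "(\<integral>\<^sup>+z\<in>cball 0 R. q (h n) (h' n) z \<partial>lborel)
           \<le> (\<integral>\<^sup>+z. ennreal (q (h n) (h' n) (z + s *\<^sub>R v)) * indicator B z \<partial>lborel)" if s: "s \<in> {0..1}"
        proof -
          have "(\<integral>\<^sup>+z\<in>cball 0 R. q (h n) (h' n) z \<partial>lborel) =
            (\<integral>\<^sup>+z. ennreal (q (h n) (h' n) (z + s *\<^sub>R v)) * indicator (cball 0 R) (z + s *\<^sub>R v) \<partial>lborel)"
            by (rule lborel_nn_integral_translation[symmetric, of "\<lambda>z. ennreal (q (h n) (h' n) z) * indicator (cball 0 R) z"]) measurable
          also have "\<dots> \<le> (\<integral>\<^sup>+z. ennreal (q (h n) (h' n) (z + s *\<^sub>R v)) * indicator B z \<partial>lborel)"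
          proof (intro nn_integral_mono mult_left_mono)
            fix z
            have "norm z \<le> norm (z + s *\<^sub>R v) + norm (s *\<^sub>R v)"
              using norm_triangle_ineq4[of "z + s *\<^sub>R v" "s *\<^sub>R v"] by simp
            moreover have "norm (s *\<^sub>R v) \<le> norm v" using s by (simp add: mult_left_le_one_le)
            ultimately show "indicator (cball 0 R) (z + s *\<^sub>R v) \<le> (indicator B z :: ennreal)"
              by (auto simp: indicator_def B_def)
          qed simp
          finally show ?thesis .
        qed
        then show "(\<integral>\<^sup>+z\<in>cball 0 R. q (h n) (h' n) z \<partial>lborel) * indicator {0..1} s
           \<le> (\<integral>\<^sup>+z. ennreal (q (h n) (h' n) (z + s *\<^sub>R v)) * indicator {0..1} s * indicator B z \<partial>lborel)"
          by (auto simp: indicator_def)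
      qed
      also have "\<dots> = (\<integral>\<^sup>+z. (\<integral>\<^sup>+s. ennreal (q (h n) (h' n) (z + s *\<^sub>R v)) * indicator {0..1} s * indicator B z \<partial>(lborel :: real measure)) \<partial>lborel)"
        by (rule lborel_pair.Fubini') measurable
      also have "\<dots> = (\<integral>\<^sup>+z. I n z * indicator B z \<partial>lborel)"
        unfolding I_def by (intro nn_integral_cong nn_integral_multc) measurable
      finally show ?thesis .
    qed
    have Ib: "I n z \<le> ennreal (2 * L)" for n z
    proof -
      have "I n z \<le> (\<integral>\<^sup>+s\<in>{0..1}. ennreal (2 * L) \<partial>(lborel :: real measure))"
        unfolding I_def by (intro nn_integral_mono mult_right_mono ennreal_leI qb h) simp
      also have "\<dots> = ennreal (2 * L)" by (subst nn_integral_cmult_indicator) auto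
      finally show ?thesis .
    qed
    have I0: "(\<lambda>n. I n z) \<longlonglongrightarrow> 0" for z
    proof (rule order_tendstoI)
      fix a :: ennreal assume a: "0 < a"
      then obtain b where b: "0 < b" "b < a" using dense by blast
      define a' where "a' = enn2real b"
      have "b < top" using b(2) top_greatest by (rule less_le_trans)
      then have a': "0 < a'" "ennreal a' < a" using b by (auto simp: a'_def enn2real_positive_iff)
      have Lu: "\<bar>u (z + s *\<^sub>R v) - u (z + r *\<^sub>R v)\<bar> \<le> L * \<bar>s - r\<bar>" for s r
        using L(2)[of "z + r *\<^sub>R v" "s - r"] by (simp add: scaleR_left_diff_distrib)
      obtain d where d: "d > 0" "\<And>h h'. 0 < h \<Longrightarrow> h < d \<Longrightarrow> 0 < h' \<Longrightarrow> h' < d \<Longrightarrow>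
        (\<integral>\<^sup>+s\<in>{0..1}. \<bar>(u (z + (s + h) *\<^sub>R v) - u (z + s *\<^sub>R v)) / h - (u (z + (s + h') *\<^sub>R v) - u (z + s *\<^sub>R v)) / h'\<bar> \<partial>lborel) \<le> ennreal a'"
        using Lipschitz_difference_quotients_L1[OF L(1) Lu a'(1)] by blast
      have "\<forall>\<^sub>F n in sequentially. 1 / real (Suc n) < d"
        using order_tendstoD(2)[OF LIMSEQ_inverse_real_of_nat d(1)] by (simp add: inverse_eq_divide)
      then show "\<forall>\<^sub>F n in sequentially. I n z < a"
      proof eventually_elim
        case (elim n)
        have "I n z \<le> ennreal a'"
          using d(2)[of "h n" "h' n"] h(1-4)[of n] elim
          by (simp add: I_def q_def scaleR_left_distrib add_ac)
        then show ?case using a'(2) by (rule le_less_trans)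
      qed
    qed (simp add: less_eq_ennreal_def)
    have "(\<lambda>n. \<integral>\<^sup>+z. I n z * indicator B z \<partial>lborel) \<longlonglongrightarrow> (\<integral>\<^sup>+z. 0 \<partial>(lborel :: 'c measure))"
    proof (rule nn_integral_dominated_convergence[where w = "\<lambda>z. ennreal (2 * L) * indicator B z"])
      show "(\<integral>\<^sup>+z. ennreal (2 * L) * indicator B z \<partial>lborel) < \<infinity>"
        using emeasure_lborel_cball_finite[of 0 "R + norm v"]
        by (subst nn_integral_cmult_indicator) (auto simp: B_def ennreal_mult_less_top)
      show "AE z in lborel. I n z * indicator B z \<le> ennreal (2 * L) * indicator B z" for n
        by (intro AE_I2 mult_right_mono Ib) simp
      show "AE z in lborel. (\<lambda>n. I n z * indicator B z) \<longlonglongrightarrow> 0"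
      proof (rule AE_I2)
        fix z
        show "(\<lambda>n. I n z * indicator B z) \<longlonglongrightarrow> 0"
          using I0[of z] by (cases "z \<in> B") auto
      qed
    qed measurable
    then have "(\<lambda>n. \<integral>\<^sup>+z. I n z * indicator B z \<partial>lborel) \<longlonglongrightarrow> 0" by simp
    from order_tendstoD(2)[OF this, of "ennreal e"] e
    obtain n where "(\<integral>\<^sup>+z. I n z * indicator B z \<partial>lborel) < ennreal e"
      by (auto simp: eventually_sequentially)
    with le[of n] h(5)[of n] show False by (meson leD less_le_trans less_trans not_le)
  qed
  then show ?thesis using that unfolding q_def by blast
qed

text \<open>
  Difference quotients that are Cauchy in \<open>L\<^sup>1\<close> on balls converge almost everywhere along increments
  that are chosen so small that the consecutive differences are summable. Finitely many functions can
  share the increments. This much of Rademacher's theorem is enough for the chain rule.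
\<close>

lemma direction_derivatives_exist:
  fixes u :: "'i \<Rightarrow> 'c::euclidean_space \<Rightarrow> real"
  assumes fin: "finite J" and [measurable]: "\<And>i. i \<in> J \<Longrightarrow> u i \<in> borel_measurable borel"
    and L: "L \<ge> 0" "\<And>i z s. i \<in> J \<Longrightarrow> \<bar>u i (z + s *\<^sub>R v i) - u i z\<bar> \<le> L * \<bar>s\<bar>"
  obtains h D where "h \<longlonglongrightarrow> 0" "\<And>n::nat. h n > 0" "\<And>n. h n \<le> 1"
    "\<And>i. i \<in> J \<Longrightarrow> D i \<in> borel_measurable borel"
    "AE z in lborel. \<forall>i\<in>J. (\<lambda>n. (u i (z + h n *\<^sub>R v i) - u i z) / h n) \<longlonglongrightarrow> D i z"
proof -
  define Q where "Q i h z = (u i (z + h *\<^sub>R v i) - u i z) / h" for i h z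
  have [measurable]: "Q i h \<in> borel_measurable borel" if "i \<in> J" for i h
    unfolding Q_def[abs_def] using that by measurable
  have "\<exists>d>0. \<forall>h h'. 0 < h \<longrightarrow> h < d \<longrightarrow> 0 < h' \<longrightarrow> h' < d \<longrightarrow>
      (\<integral>\<^sup>+z\<in>cball 0 (real k). \<bar>Q i h z - Q i h' z\<bar> \<partial>lborel) \<le> ennreal ((1 / 2) ^ k)" if iJ: "i \<in> J" for i k
  proof -
    have "0 < (1 / 2 :: real) ^ k" by simp
    obtain d where d: "d > 0" "\<And>h h'. 0 < h \<Longrightarrow> h < d \<Longrightarrow> 0 < h' \<Longrightarrow> h' < d \<Longrightarrow>
      (\<integral>\<^sup>+z\<in>cball 0 (real k). \<bar>Q i h z - Q i h' z\<bar> \<partial>lborel) \<le> ennreal ((1 / 2) ^ k)"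
      unfolding Q_def
      by (rule direction_difference_quotients_Cauchy[OF assms(2)[OF iJ] L(1) L(2)[OF iJ] \<open>0 < (1 / 2 :: real) ^ k\<close>, of "real k"])
         blast
    show ?thesis by (rule exI[of _ d]) (use d in simp)
  qed
  then have "\<forall>i k. \<exists>d. i \<in> J \<longrightarrow> d > 0 \<and> (\<forall>h h'. 0 < h \<longrightarrow> h < d \<longrightarrow> 0 < h' \<longrightarrow> h' < d \<longrightarrow>
      (\<integral>\<^sup>+z\<in>cball 0 (real k). \<bar>Q i h z - Q i h' z\<bar> \<partial>lborel) \<le> ennreal ((1 / 2) ^ k))"
    by blast
  then obtain d where "\<forall>i k. i \<in> J \<longrightarrow> d i k > 0 \<and> (\<forall>h h'. 0 < h \<longrightarrow> h < d i k \<longrightarrow> 0 < h' \<longrightarrow> h' < d i k \<longrightarrow>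
      (\<integral>\<^sup>+z\<in>cball 0 (real k). \<bar>Q i h z - Q i h' z\<bar> \<partial>lborel) \<le> ennreal ((1 / 2) ^ k))"
    unfolding choice_iff by (elim exE)
  then have d: "\<And>i k. i \<in> J \<Longrightarrow> d i k > 0"
    "\<And>i k h h'. i \<in> J \<Longrightarrow> 0 < h \<Longrightarrow> h < d i k \<Longrightarrow> 0 < h' \<Longrightarrow> h' < d i k \<Longrightarrow>
      (\<integral>\<^sup>+z\<in>cball 0 (real k). \<bar>Q i h z - Q i h' z\<bar> \<partial>lborel) \<le> ennreal ((1 / 2) ^ k)"
    by simp_all
  define A where "A n = insert 1 ((\<lambda>(i, k). d i k) ` (J \<times> {..n}))" for n :: nat
  have A: "finite (A n)" "A n \<noteq> {}" for n using fin by (auto simp: A_def)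
  define h where "h n = min (Min (A n) / 2) (1 / real (Suc n))" for n
  have Apos: "Min (A n) > 0" for n
    using A d(1) by (subst Min_gr_iff) (auto simp: A_def)
  have hpos: "h n > 0" for n using Apos[of n] by (simp add: h_def)
  have h1: "h n \<le> 1 / real (Suc n)" for n by (simp add: h_def)
  have hd: "h n < d i k" if "i \<in> J" "k \<le> n" for n i k
  proof -
    have "Min (A n) \<le> d i k" using that by (intro Min_le A) (force simp: A_def)
    then show ?thesis using Apos[of n] by (simp add: h_def min_def)
  qed
  have h0: "h \<longlonglongrightarrow> 0"
  proof (rule Lim_null_comparison)
    show "\<forall>\<^sub>F n in sequentially. norm (h n) \<le> 1 / real (Suc n)" using hpos h1 by (simp add: less_imp_le)
    show "(\<lambda>n. 1 / real (Suc n)) \<longlonglongrightarrow> 0" using LIMSEQ_inverse_real_of_nat by (simp add: inverse_eq_divide)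
  qed
  have conv: "AE z in lborel. convergent (\<lambda>n. Q i (h n) z)" if i[simp]: "i \<in> J" for i
  proof -
    define g where "g k z = ennreal \<bar>Q i (h k) z - Q i (h (Suc k)) z\<bar> * indicator (cball 0 (real k)) z" for k z
    have [measurable]: "cball 0 (real k) \<in> sets borel" for k by simp
    have [measurable]: "g k \<in> borel_measurable borel" for k
      unfolding g_def[abs_def] using i by measurable
    have gk: "(\<integral>\<^sup>+z. g k z \<partial>lborel) \<le> ennreal ((1 / 2) ^ k)" for k
      unfolding g_def using hpos hd[OF i] by (intro d(2)[OF i]) auto
    have "(\<integral>\<^sup>+z. (\<Sum>k. g k z) \<partial>lborel) = (\<Sum>k. \<integral>\<^sup>+z. g k z \<partial>lborel)"
      by (rule nn_integral_suminf) measurable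
    also have "\<dots> \<le> (\<Sum>k. ennreal ((1 / 2) ^ k))"
      by (intro suminf_le gk) auto
    also have "\<dots> = ennreal (\<Sum>k. (1 / 2) ^ k)" by (intro suminf_ennreal2) (auto intro: summable_geometric)
    finally have "(\<integral>\<^sup>+z. (\<Sum>k. g k z) \<partial>lborel) < \<infinity>"
      using le_less_trans ennreal_less_top by (metis infinity_ennreal_def)
    then have "AE z in lborel. (\<Sum>k. g k z) \<noteq> \<infinity>"
      by (intro nn_integral_PInf_AE) auto
    then show ?thesis
    proof eventually_elim
      case (elim z)
      obtain m :: nat where m: "norm z \<le> real m" using real_arch_simple by blast
      define c where "c n = (Q i (h (n + m)) z)" for n
      have "summable (\<lambda>n. \<bar>c (Suc n) - c n\<bar>)"
      proof -
        have "(\<Sum>n. ennreal \<bar>c (Suc n) - c n\<bar>) \<le> (\<Sum>k. g k z)"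
        proof -
          have "(\<Sum>n. ennreal \<bar>c (Suc n) - c n\<bar>) = (\<Sum>n. g (n + m) z)"
            using m by (intro suminf_cong) (auto simp: g_def c_def indicator_def abs_minus_commute)
          also have "\<dots> \<le> (\<Sum>n. g (n + m) z) + (\<Sum>n<m. g n z)" by simp
          also have "\<dots> = (\<Sum>k. g k z)" by (rule suminf_offset[symmetric]) simp
          finally show ?thesis .
        qed
        then show ?thesis
          using elim by (intro summable_suminf_not_top) (auto simp: top_unique)
      qed
      then have "summable (\<lambda>n. c (Suc n) - c n)"
        by (rule summable_rabs_cancel)
      then have "convergent (\<lambda>n. \<Sum>k<n. c (Suc k) - c k)"
        by (simp add: summable_iff_convergent)
      then have "convergent (\<lambda>n. c n - c 0)" by (simp add: sum_lessThan_telescope)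
      then have "convergent (\<lambda>n. (c n - c 0) + c 0)" by (intro convergent_add convergent_const)
      then have "convergent (\<lambda>n. Q i (h (n + m)) z)" by (simp only: c_def diff_add_cancel)
      then show ?case by (rule convergent_ignore_initial_segment[THEN iffD1])
    qed
  qed
  show ?thesis
  proof (rule that[of h "\<lambda>i z. lim (\<lambda>n. Q i (h n) z)"])
    show "h n \<le> 1" for n using h1[of n] by (rule order_trans) simp
    show "AE z in lborel. \<forall>i\<in>J. (\<lambda>n. (u i (z + h n *\<^sub>R v i) - u i z) / h n) \<longlonglongrightarrow> lim (\<lambda>n. Q i (h n) z)"
      using AE_finite_allI[OF fin conv]
      unfolding convergent_LIMSEQ_iff by (simp only: Q_def)
    show "(\<lambda>z. lim (\<lambda>n. Q i (h n) z)) \<in> borel_measurable borel" if [simp]: "i \<in> J" for i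
      by (rule borel_measurable_lim_metric) simp
  qed (use h0 hpos in auto)
qed

section \<open>Weak gradients under bi-Lipschitz changes of variables\<close>

text \<open>The inner function enters only through a sequence of increments whose quotients converge.\<close>

lemma tendsto_chain_rule_sequence:
  fixes f :: "'a::real_normed_vector \<Rightarrow> real"
  assumes f: "(f has_derivative D) (at x)" and k: "\<And>n. k n \<noteq> 0"
    and h: "h \<longlonglongrightarrow> 0" "\<And>n. h n > 0"
    and lim: "(\<lambda>n. (1 / h n) *\<^sub>R k n) \<longlonglongrightarrow> d"
  shows "(\<lambda>n. (f (x + k n) - f x) / h n) \<longlonglongrightarrow> D d"
proof -
  have bl: "bounded_linear D" using f by (rule has_derivative_bounded_linear)
  have "(\<lambda>n. h n *\<^sub>R ((1 / h n) *\<^sub>R k n)) \<longlonglongrightarrow> 0 *\<^sub>R d"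
    by (intro tendsto_intros h lim)
  moreover have "h n *\<^sub>R ((1 / h n) *\<^sub>R k n) = k n" for n using h(2)[of n] by simp
  ultimately have k0: "k \<longlonglongrightarrow> 0" by simp
  have "filterlim k (at 0) sequentially" using k0 k by (simp add: filterlim_at)
  moreover have "((\<lambda>v. norm (f (x + v) - f x - D v) / norm v) \<longlongrightarrow> 0) (at 0)"
    using f by (simp add: has_derivative_at)
  ultimately have "(\<lambda>n. norm (f (x + k n) - f x - D (k n)) / norm (k n)) \<longlonglongrightarrow> 0"
    using filterlim_compose by fast
  then have "(\<lambda>n. norm (f (x + k n) - f x - D (k n)) / norm (k n) * norm ((1 / h n) *\<^sub>R k n)) \<longlonglongrightarrow> 0 * norm d"
    by (intro tendsto_intros lim)
  moreover have "norm (f (x + k n) - f x - D (k n)) / norm (k n) * norm ((1 / h n) *\<^sub>R k n)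
      = norm ((f (x + k n) - f x - D (k n)) / h n)" for n
    using k[of n] h(2)[of n] by simp
  ultimately have "(\<lambda>n. norm ((f (x + k n) - f x - D (k n)) / h n)) \<longlonglongrightarrow> 0"
    by (simp only: mult_zero_left)
  then have "(\<lambda>n. (f (x + k n) - f x - D (k n)) / h n) \<longlonglongrightarrow> 0"
    by (rule tendsto_norm_zero_cancel)
  moreover have "(\<lambda>n. D ((1 / h n) *\<^sub>R k n)) \<longlonglongrightarrow> D d"
    by (rule bounded_linear.tendsto[OF bl lim])
  ultimately have "(\<lambda>n. (f (x + k n) - f x - D (k n)) / h n + D ((1 / h n) *\<^sub>R k n)) \<longlonglongrightarrow> 0 + D d"
    by (rule tendsto_add)
  moreover have "(f (x + k n) - f x - D (k n)) / h n + D ((1 / h n) *\<^sub>R k n) = (f (x + k n) - f x) / h n" for n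
    using linear_scale[OF bounded_linear.linear[OF bl]] by (simp add: diff_divide_distrib)
  ultimately show ?thesis by simp
qed

lemma norm_pullback_gradient_le:
  fixes g :: "'a::euclidean_space" and d :: "'a \<Rightarrow> 'a" and L :: real
  assumes "0 \<le> L" "\<And>i. i \<in> Basis \<Longrightarrow> norm (d i) \<le> L"
  shows "norm (\<Sum>i\<in>Basis. (g \<bullet> d i) *\<^sub>R i) \<le> DIM('a) * L * norm g"
proof -
  have "norm (\<Sum>i\<in>Basis. (g \<bullet> d i) *\<^sub>R i) \<le> (\<Sum>i\<in>Basis. norm ((g \<bullet> d i) *\<^sub>R i))"
    by (rule norm_sum)
  also have "\<dots> \<le> (\<Sum>i\<in>(Basis :: 'a set). norm g * L)"
  proof (rule sum_mono)
    fix i :: 'a assume i: "i \<in> Basis"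
    have "\<bar>g \<bullet> d i\<bar> \<le> norm g * norm (d i)" by (rule Cauchy_Schwarz_ineq2)
    also have "\<dots> \<le> norm g * L" using assms i by (intro mult_left_mono) auto
    finally show "norm ((g \<bullet> d i) *\<^sub>R i) \<le> norm g * L" using i by simp
  qed
  finally show ?thesis by (simp add: mult_ac)
qed

locale biLipschitz =
  fixes \<Psi> \<Theta> :: "'a::euclidean_space \<Rightarrow> 'a" and L :: real
  assumes L: "L > 0"
    and \<Psi>_Lipschitz: "\<And>x y. norm (\<Psi> x - \<Psi> y) \<le> L * norm (x - y)"
    and \<Theta>_Lipschitz: "\<And>x y. norm (\<Theta> x - \<Theta> y) \<le> L * norm (x - y)"
    and inverse: "\<And>x. \<Psi> (\<Theta> x) = x" "\<And>y. \<Theta> (\<Psi> y) = y"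
begin

lemma continuous: "continuous_on A \<Psi>"
proof -
  have "L-lipschitz_on A \<Psi>"
    using \<Psi>_Lipschitz L by (intro lipschitz_onI) (auto simp: dist_norm)
  then show ?thesis by (rule lipschitz_on_continuous_on)
qed

lemma measurable [measurable]: "\<Psi> \<in> borel_measurable borel"
  by (intro borel_measurable_continuous_onI continuous)

definition radius :: "real \<Rightarrow> real" where "radius R = norm (\<Psi> 0) + L * R"

lemma norm_le_radius:
  assumes "norm y \<le> R"
  shows "norm (\<Psi> y) \<le> radius R"
proof -
  have "norm (\<Psi> y) \<le> norm (\<Psi> 0) + norm (\<Psi> y - \<Psi> 0)"
    by (metis add.commute diff_add_cancel norm_triangle_ineq)
  also have "norm (\<Psi> y - \<Psi> 0) \<le> L * norm y" using \<Psi>_Lipschitz[of y 0] by simp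
  also have "\<dots> \<le> L * R" using assms L by simp
  finally show ?thesis by (simp add: radius_def)
qed

lemma nn_integral_compose_le:
  assumes [measurable]: "f \<in> borel_measurable borel"
  shows "(\<integral>\<^sup>+y. f (\<Psi> y) \<partial>lborel) \<le> ennreal (L ^ DIM('a)) * (\<integral>\<^sup>+x. f x \<partial>lborel)"
  by (rule nn_integral_Lipschitz_inverse[OF L \<Theta>_Lipschitz inverse measurable assms])

lemma nn_integral_ball_compose_le:
  assumes [measurable]: "f \<in> borel_measurable borel"
  shows "(\<integral>\<^sup>+y\<in>cball 0 R. f (\<Psi> y) \<partial>lborel) \<le> ennreal (L ^ DIM('a)) * (\<integral>\<^sup>+x\<in>cball 0 (radius R). f x \<partial>lborel)"
proof -
  have [measurable]: "cball 0 (radius R) \<in> sets borel" by simp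
  have "(\<integral>\<^sup>+y\<in>cball 0 R. f (\<Psi> y) \<partial>lborel) \<le> (\<integral>\<^sup>+y. f (\<Psi> y) * indicator (cball 0 (radius R)) (\<Psi> y) \<partial>lborel)"
    using norm_le_radius by (intro nn_integral_mono) (auto simp: indicator_def)
  also have "\<dots> \<le> ennreal (L ^ DIM('a)) * (\<integral>\<^sup>+x\<in>cball 0 (radius R). f x \<partial>lborel)"
    by (rule nn_integral_compose_le) measurable
  finally show ?thesis .
qed

lemma locally_integrable_compose:
  fixes w :: "'a \<Rightarrow> 'b::euclidean_space"
  assumes [measurable]: "w \<in> borel_measurable borel" and w: "locally_integrable_lborel w"
  shows "locally_integrable_lborel (\<lambda>y. w (\<Psi> y))"
proof
  fix R
  have [measurable]: "cball 0 R \<in> sets borel" for R :: real by simp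
  have e: "(\<integral>\<^sup>+x. ennreal (norm (indicator (cball 0 R) x *\<^sub>R v x)) \<partial>lborel) = (\<integral>\<^sup>+x\<in>cball 0 R. ennreal (norm (v x)) \<partial>lborel)"
    for R and v :: "'a \<Rightarrow> 'b"
    by (intro nn_integral_cong) (auto simp: indicator_def)
  have "(\<integral>\<^sup>+y\<in>cball 0 R. norm (w (\<Psi> y)) \<partial>lborel) \<le> ennreal (L ^ DIM('a)) * (\<integral>\<^sup>+x\<in>cball 0 (radius R). norm (w x) \<partial>lborel)"
    by (rule nn_integral_ball_compose_le) measurable
  also have "\<dots> < \<infinity>"
    using w[rule_format, of "radius R"] unfolding set_integrable_def integrable_iff_bounded e
    by (simp add: ennreal_mult_less_top)
  finally show "set_integrable lborel (cball 0 R) (\<lambda>y. w (\<Psi> y))"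
    unfolding set_integrable_def integrable_iff_bounded e by simp
qed

text \<open>For a mollified function the chain rule holds pointwise wherever the inner map is differentiable.\<close>

lemma mollified_composition_integration_by_parts:
  assumes uG: "weak_gradient_lborel u G" and \<eta>: "\<eta> \<in> test_functions" and \<phi>: "\<phi> \<in> test_functions"
    and h: "h \<longlonglongrightarrow> 0" "\<And>n. h n > 0" "\<And>n. h n \<le> 1"
    and i: "i \<noteq> 0" and [measurable]: "D \<in> borel_measurable borel"
    and lim: "AE y in lborel. (\<lambda>n. (1 / h n) *\<^sub>R (\<Psi> (y + h n *\<^sub>R i) - \<Psi> y)) \<longlonglongrightarrow> D y"
  shows "(LINT y|lborel. mollify \<eta> u (\<Psi> y) * frechet_derivative \<phi> (at y) i)
      = - (LINT y|lborel. (mollify \<eta> G (\<Psi> y) \<bullet> D y) * \<phi> y)"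
proof -
  have [measurable]: "u \<in> borel_measurable borel" "G \<in> borel_measurable borel"
    and lu: "locally_integrable_lborel u" and lG: "locally_integrable_lborel G"
    using uG by (auto simp: weak_gradient_lborel_def)
  have [measurable]: "\<eta> \<in> borel_measurable borel" using test_measurable[OF \<eta>] .
  have d: "(mollify \<eta> u has_derivative (\<lambda>k. mollify \<eta> G x \<bullet> k)) (at x)" for x
    by (rule mollify_weak_gradient[OF uG \<eta>])
  have "continuous_on UNIV (mollify \<eta> u)"
    by (intro continuous_at_imp_continuous_on ballI has_derivative_continuous[OF d])
  then have [measurable]: "mollify \<eta> u \<in> borel_measurable borel" by (rule borel_measurable_continuous_onI)
  have [measurable]: "mollify \<eta> G \<in> borel_measurable borel"
    unfolding mollify_def[abs_def] by measurable
  show ?thesis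
  proof (rule integration_by_parts_difference_quotients[OF _ _ h _ _ _ \<phi>])
    show "\<exists>C. \<forall>y. norm y \<le> R \<longrightarrow> \<bar>mollify \<eta> u (\<Psi> y)\<bar> \<le> C" for R
    proof -
      obtain C where "\<forall>x. norm x \<le> radius R \<longrightarrow> norm (mollify \<eta> u x) \<le> C"
        using mollify_locally_bounded[OF \<open>u \<in> borel_measurable borel\<close> lu \<eta>, of "radius R"] by blast
      then show ?thesis using norm_le_radius by (intro exI[of _ C]) simp
    qed
    show "\<exists>C. \<forall>y n. norm y \<le> R \<longrightarrow> \<bar>mollify \<eta> u (\<Psi> (y + h n *\<^sub>R i)) - mollify \<eta> u (\<Psi> y)\<bar> \<le> C * h n" for R
    proof -
      define R' where "R' = radius (R + norm i)"
      obtain C where C: "\<And>x. norm x \<le> R' \<Longrightarrow> norm (mollify \<eta> G x) \<le> C"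
        using mollify_locally_bounded[OF \<open>G \<in> borel_measurable borel\<close> lG \<eta>, of R'] by blast
      have "\<bar>mollify \<eta> u (\<Psi> (y + h n *\<^sub>R i)) - mollify \<eta> u (\<Psi> y)\<bar> \<le> (C * L * norm i) * h n" if y: "norm y \<le> R" for y n
      proof -
        have hn: "norm (h n *\<^sub>R i) \<le> norm i" using h(2,3)[of n] by (simp add: mult_left_le_one_le)
        have "norm (y + h n *\<^sub>R i) \<le> R + norm i" "norm y \<le> R + norm i"
          using y hn norm_triangle_ineq[of y "h n *\<^sub>R i"] norm_ge_zero[of i] by linarith+
        from this[THEN norm_le_radius]
        have "norm (\<Psi> (y + h n *\<^sub>R i)) \<le> R'" "norm (\<Psi> y) \<le> R'"
          unfolding R'_def .
        then have "norm (mollify \<eta> u (\<Psi> (y + h n *\<^sub>R i)) - mollify \<eta> u (\<Psi> y)) \<le> C * norm (\<Psi> (y + h n *\<^sub>R i) - \<Psi> y)"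
        proof (intro differentiable_bound[of "cball 0 R'" "mollify \<eta> u" "\<lambda>x k. mollify \<eta> G x \<bullet> k"])
          fix x :: 'a assume x: "x \<in> cball 0 R'"
          show "(mollify \<eta> u has_derivative (\<lambda>k. mollify \<eta> G x \<bullet> k)) (at x within cball 0 R')"
            using d has_derivative_at_withinI by blast
          show "onorm (\<lambda>k. mollify \<eta> G x \<bullet> k) \<le> C"
          proof (rule onorm_le)
            fix k
            show "norm (mollify \<eta> G x \<bullet> k) \<le> C * norm k"
              using Cauchy_Schwarz_ineq2[of "mollify \<eta> G x" k] mult_right_mono[OF C[of x], of "norm k"] x by simp
          qed
        qed auto
        also have "\<dots> \<le> C * (L * norm (h n *\<^sub>R i))"
        proof (rule mult_left_mono)
          show "norm (\<Psi> (y + h n *\<^sub>R i) - \<Psi> y) \<le> L * norm (h n *\<^sub>R i)"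
            using \<Psi>_Lipschitz[of "y + h n *\<^sub>R i" y] by simp
          show "0 \<le> C" using C[of "\<Psi> y"] \<open>norm (\<Psi> y) \<le> R'\<close> norm_ge_zero order_trans by blast
        qed
        finally show ?thesis using h(2)[of n] by (simp add: mult_ac)
      qed
      then show ?thesis by blast
    qed
    show "AE y in lborel. (\<lambda>n. (mollify \<eta> u (\<Psi> (y + h n *\<^sub>R i)) - mollify \<eta> u (\<Psi> y)) / h n)
        \<longlonglongrightarrow> mollify \<eta> G (\<Psi> y) \<bullet> D y"
      using lim
    proof eventually_elim
      case (elim y)
      have "\<Psi> (y + h n *\<^sub>R i) - \<Psi> y \<noteq> 0" for n
      proof
        assume "\<Psi> (y + h n *\<^sub>R i) - \<Psi> y = 0"
        then have "\<Theta> (\<Psi> (y + h n *\<^sub>R i)) = \<Theta> (\<Psi> y)" by simp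
        then show False using i h(2)[of n] by (simp add: inverse)
      qed
      from tendsto_chain_rule_sequence[OF d[of "\<Psi> y"] this h(1,2) elim] show ?case by simp
    qed
  qed measurable
qed

lemma AE_direction_derivative_bound:
  assumes lim: "AE y in lborel. (\<lambda>n. (1 / h n) *\<^sub>R (\<Psi> (y + h n *\<^sub>R i) - \<Psi> y)) \<longlonglongrightarrow> D y"
    and h: "\<And>n. h n > 0"
  shows "AE y in lborel. norm (D y) \<le> L * norm i"
  using lim
proof eventually_elim
  case (elim y)
  have "norm ((1 / h n) *\<^sub>R (\<Psi> (y + h n *\<^sub>R i) - \<Psi> y)) \<le> L * norm i" for n
  proof -
    have "norm ((1 / h n) *\<^sub>R v) = norm v / h n" for v :: 'a using h[of n] by simp
    moreover have "norm (\<Psi> (y + h n *\<^sub>R i) - \<Psi> y) \<le> (L * norm i) * h n"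
      using \<Psi>_Lipschitz[of "y + h n *\<^sub>R i" y] h[of n] by (simp add: mult_ac)
    ultimately show ?thesis using h[of n] by (simp only: pos_divide_le_eq)
  qed
  then show ?case
    by (intro LIMSEQ_le_const2[OF tendsto_norm[OF elim]]) auto
qed

text \<open>
  The identity for mollifications passes to the limit: they converge in \<open>L\<^sup>1\<close> on balls, composition with
  \<open>\<Psi>\<close> preserves this because it distorts measure by at most a constant factor, and \<open>D\<close> is bounded.
\<close>

lemma composition_integration_by_parts:
  assumes uG: "weak_gradient_lborel u G" and \<phi>: "\<phi> \<in> test_functions"
    and h: "h \<longlonglongrightarrow> 0" "\<And>n. h n > 0" "\<And>n. h n \<le> 1"
    and i: "norm i = 1" and D[measurable]: "D \<in> borel_measurable borel"
    and lim: "AE y in lborel. (\<lambda>n. (1 / h n) *\<^sub>R (\<Psi> (y + h n *\<^sub>R i) - \<Psi> y)) \<longlonglongrightarrow> D y"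
  shows "integrable lborel (\<lambda>y. (G (\<Psi> y) \<bullet> D y) * \<phi> y)"
    and "(LINT y|lborel. u (\<Psi> y) * frechet_derivative \<phi> (at y) i) = - (LINT y|lborel. (G (\<Psi> y) \<bullet> D y) * \<phi> y)"
proof -
  have [measurable]: "u \<in> borel_measurable borel" "G \<in> borel_measurable borel"
    and lu: "locally_integrable_lborel u" and lG: "locally_integrable_lborel G"
    using uG by (auto simp: weak_gradient_lborel_def)
  have [measurable]: "\<phi> \<in> borel_measurable borel" using test_measurable[OF \<phi>] .
  define g where "g y = frechet_derivative \<phi> (at y) i" for y
  have gt: "g \<in> test_functions" unfolding g_def[abs_def] by (rule test_derivative[OF \<phi>])
  have [measurable]: "g \<in> borel_measurable borel" using test_measurable[OF gt] .
  have DL: "AE y in lborel. norm (D y) \<le> L"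
    using AE_direction_derivative_bound[OF lim h(2)] i by simp
  have intG: "integrable lborel (\<lambda>y. (V (\<Psi> y) \<bullet> D y) * \<phi> y)"
    if [measurable]: "V \<in> borel_measurable borel" and V: "locally_integrable_lborel V" for V :: "'a \<Rightarrow> 'a"
  proof -
    have "integrable lborel (\<lambda>y. \<phi> y *\<^sub>R V (\<Psi> y))"
      by (intro integrable_test_scaleR locally_integrable_compose V \<phi>) measurable
    then have "integrable lborel (\<lambda>y. L * norm (\<phi> y *\<^sub>R V (\<Psi> y)))"
      by (intro integrable_mult_right integrable_norm)
    then show ?thesis
    proof (rule Bochner_Integration.integrable_bound)
      show "AE y in lborel. norm ((V (\<Psi> y) \<bullet> D y) * \<phi> y) \<le> norm (L * norm (\<phi> y *\<^sub>R V (\<Psi> y)))"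
        using DL
      proof eventually_elim
        case (elim y)
        have "\<bar>V (\<Psi> y) \<bullet> D y\<bar> \<le> norm (V (\<Psi> y)) * norm (D y)" by (rule Cauchy_Schwarz_ineq2)
        also have "\<dots> \<le> norm (V (\<Psi> y)) * L" using elim by (intro mult_left_mono) auto
        finally have "\<bar>V (\<Psi> y) \<bullet> D y\<bar> * \<bar>\<phi> y\<bar> \<le> norm (V (\<Psi> y)) * L * \<bar>\<phi> y\<bar>" by (rule mult_right_mono) simp
        then show ?case using L by (simp add: abs_mult mult_ac)
      qed
    qed measurable
  qed
  show "integrable lborel (\<lambda>y. (G (\<Psi> y) \<bullet> D y) * \<phi> y)" by (rule intG) (use lG in auto)
  have intu: "integrable lborel (\<lambda>y. w (\<Psi> y) * g y)"
    if [measurable]: "w \<in> borel_measurable borel" and w: "locally_integrable_lborel w" for w :: "'a \<Rightarrow> real"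
    using integrable_test_scaleR[OF _ locally_integrable_compose[OF _ w] gt] by (simp add: mult.commute)
  obtain R where R: "R > 0" "\<And>y. norm y > R \<Longrightarrow> \<phi> y = 0" using test_support[OF \<phi>] by blast
  obtain R2 where R2: "R2 > 0" "\<And>y. norm y > R2 \<Longrightarrow> g y = 0" using test_support[OF gt] by blast
  define S where "S = max R R2"
  have S: "norm y > S \<Longrightarrow> \<phi> y = 0" "norm y > S \<Longrightarrow> g y = 0" for y using R R2 by (auto simp: S_def)
  obtain M1 where M1: "M1 > 0" "\<And>y. \<bar>\<phi> y\<bar> \<le> M1" using test_bounded[OF \<phi>] by blast
  obtain M2 where M2: "M2 > 0" "\<And>y. \<bar>g y\<bar> \<le> M2" using test_bounded[OF gt] by blast
  define M where "M = max M1 M2"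
  have M: "M > 0" "\<bar>\<phi> y\<bar> \<le> M" "\<bar>g y\<bar> \<le> M" for y
    using M1 M2 by (auto simp: M_def le_max_iff_disj)
  define X where "X = (LINT y|lborel. u (\<Psi> y) * g y) + (LINT y|lborel. (G (\<Psi> y) \<bullet> D y) * \<phi> y)"
  define K where "K = L ^ DIM('a) * (M + L * M)"
  have K: "K > 0" unfolding K_def using L M(1) by (intro mult_pos_pos add_pos_pos) auto
  \<comment> \<open>\<open>X\<close> is the defect in the claimed identity; replacing \<open>u\<close> by a mollification makes it vanish.\<close>
  have bound: "\<bar>X\<bar> \<le> K * e" if e: "e > 0" for e
  proof -
    obtain d1 where d1: "d1 > 0" "\<And>\<eta>. \<eta> \<in> test_functions \<Longrightarrow> (\<And>x. 0 \<le> \<eta> x) \<Longrightarrow>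
      (\<And>x. norm x \<ge> d1 \<Longrightarrow> \<eta> x = 0) \<Longrightarrow> (LINT x|lborel. \<eta> x) = 1 \<Longrightarrow>
      (\<integral>\<^sup>+x\<in>cball 0 (radius S). norm (mollify \<eta> u x - u x) \<partial>lborel) \<le> ennreal e"
      by (rule mollify_approximates[OF \<open>u \<in> borel_measurable borel\<close> lu e, of "radius S"]) blast
    obtain d2 where d2: "d2 > 0" "\<And>\<eta>. \<eta> \<in> test_functions \<Longrightarrow> (\<And>x. 0 \<le> \<eta> x) \<Longrightarrow>
      (\<And>x. norm x \<ge> d2 \<Longrightarrow> \<eta> x = 0) \<Longrightarrow> (LINT x|lborel. \<eta> x) = 1 \<Longrightarrow>
      (\<integral>\<^sup>+x\<in>cball 0 (radius S). norm (mollify \<eta> G x - G x) \<partial>lborel) \<le> ennreal e"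
      by (rule mollify_approximates[OF \<open>G \<in> borel_measurable borel\<close> lG e, of "radius S"]) blast
    obtain \<eta> :: "'a \<Rightarrow> real" where \<eta>: "\<eta> \<in> test_functions" "\<And>x. 0 \<le> \<eta> x"
      "\<And>x. norm x \<ge> min d1 d2 \<Longrightarrow> \<eta> x = 0" "(LINT x|lborel. \<eta> x) = 1"
      using mollifier_exists[of "min d1 d2"] d1(1) d2(1) by auto
    have [measurable]: "\<eta> \<in> borel_measurable borel" using test_measurable[OF \<eta>(1)] .
    define U where "U = mollify \<eta> u"
    define V where "V = mollify \<eta> G"
    have eu: "(\<integral>\<^sup>+x\<in>cball 0 (radius S). norm (U x - u x) \<partial>lborel) \<le> ennreal e"
      unfolding U_def by (rule d1(2)) (use \<eta> in auto)
    have eG: "(\<integral>\<^sup>+x\<in>cball 0 (radius S). norm (V x - G x) \<partial>lborel) \<le> ennreal e"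
      unfolding V_def by (rule d2(2)) (use \<eta> in auto)
    have [measurable]: "V \<in> borel_measurable borel" "U \<in> borel_measurable borel"
      unfolding V_def U_def mollify_def[abs_def] by measurable
    have loc: "locally_integrable_lborel f"
      if [measurable]: "f \<in> borel_measurable borel" and "\<And>R. \<exists>C. \<forall>x. norm x \<le> R \<longrightarrow> norm (f x) \<le> C"
      for f :: "'a \<Rightarrow> 'b::euclidean_space"
    proof
      fix R :: real
      obtain C where C: "\<And>x. norm x \<le> R \<Longrightarrow> norm (f x) \<le> C" using \<open>\<exists>C. \<forall>x. norm x \<le> R \<longrightarrow> norm (f x) \<le> C\<close> by blast
      have [measurable]: "cball 0 R \<in> sets borel" by simp
      show "set_integrable lborel (cball 0 R) f"
        unfolding set_integrable_def by (rule integrable_bounded_ball_support[of _ R C]) (use C in auto)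
    qed
    have lU: "locally_integrable_lborel U"
      by (rule loc[OF \<open>U \<in> borel_measurable borel\<close>], unfold U_def)
         (rule mollify_locally_bounded[OF \<open>u \<in> borel_measurable borel\<close> lu \<eta>(1)])
    have lV: "locally_integrable_lborel V"
      by (rule loc[OF \<open>V \<in> borel_measurable borel\<close>], unfold V_def)
         (rule mollify_locally_bounded[OF \<open>G \<in> borel_measurable borel\<close> lG \<eta>(1)])
    have "i \<noteq> 0" using i by auto
    have Ueq: "(LINT y|lborel. U (\<Psi> y) * g y) = - (LINT y|lborel. (V (\<Psi> y) \<bullet> D y) * \<phi> y)"
      unfolding U_def V_def g_def
      by (rule mollified_composition_integration_by_parts[OF uG \<eta>(1) \<phi> h \<open>i \<noteq> 0\<close> D lim])
    have iu: "integrable lborel (\<lambda>y. u (\<Psi> y) * g y)" "integrable lborel (\<lambda>y. U (\<Psi> y) * g y)"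
      by (rule intu; use lu lU in simp)+
    have iG: "integrable lborel (\<lambda>y. (G (\<Psi> y) \<bullet> D y) * \<phi> y)" "integrable lborel (\<lambda>y. (V (\<Psi> y) \<bullet> D y) * \<phi> y)"
      by (rule intG; use lG lV in simp)+
    define E where "E y = (u (\<Psi> y) * g y - U (\<Psi> y) * g y) + ((G (\<Psi> y) \<bullet> D y) * \<phi> y - (V (\<Psi> y) \<bullet> D y) * \<phi> y)" for y
    have iE: "integrable lborel E" unfolding E_def[abs_def]
      by (intro Bochner_Integration.integrable_add Bochner_Integration.integrable_diff iu iG)
    have "X = (LINT y|lborel. E y)"
      using Ueq unfolding X_def E_def
      by (simp only: Bochner_Integration.integral_add[OF Bochner_Integration.integrable_diff[OF iu] Bochner_Integration.integrable_diff[OF iG]]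
           Bochner_Integration.integral_diff[OF iu] Bochner_Integration.integral_diff[OF iG])
    then have "ennreal \<bar>X\<bar> \<le> (\<integral>\<^sup>+y. norm (E y) \<partial>lborel)"
      using integral_norm_bound_ennreal[OF iE] by simp
    also have "\<dots> \<le> (\<integral>\<^sup>+y. ennreal M * (ennreal (norm (U (\<Psi> y) - u (\<Psi> y))) * indicator (cball 0 S) y)
       + ennreal (L * M) * (ennreal (norm (V (\<Psi> y) - G (\<Psi> y))) * indicator (cball 0 S) y) \<partial>lborel)"
    proof (rule nn_integral_mono_AE)
      show "AE y in lborel. ennreal (norm (E y)) \<le> ennreal M * (ennreal (norm (U (\<Psi> y) - u (\<Psi> y))) * indicator (cball 0 S) y)
       + ennreal (L * M) * (ennreal (norm (V (\<Psi> y) - G (\<Psi> y))) * indicator (cball 0 S) y)"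
        using DL
      proof eventually_elim
        case (elim y)
        show ?case
        proof (cases "norm y > S")
          case True
          then show ?thesis using S by (simp add: E_def)
        next
          case False
          have "E y = (u (\<Psi> y) - U (\<Psi> y)) * g y + ((G (\<Psi> y) - V (\<Psi> y)) \<bullet> D y) * \<phi> y"
            by (simp add: E_def algebra_simps)
          then have "\<bar>E y\<bar> \<le> \<bar>u (\<Psi> y) - U (\<Psi> y)\<bar> * \<bar>g y\<bar> + \<bar>(G (\<Psi> y) - V (\<Psi> y)) \<bullet> D y\<bar> * \<bar>\<phi> y\<bar>"
            by (simp add: abs_mult[symmetric])
          also have "\<dots> \<le> \<bar>u (\<Psi> y) - U (\<Psi> y)\<bar> * M + (norm (G (\<Psi> y) - V (\<Psi> y)) * L) * M"
          proof (intro add_mono mult_mono M)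
            have "\<bar>(G (\<Psi> y) - V (\<Psi> y)) \<bullet> D y\<bar> \<le> norm (G (\<Psi> y) - V (\<Psi> y)) * norm (D y)"
              by (rule Cauchy_Schwarz_ineq2)
            also have "\<dots> \<le> norm (G (\<Psi> y) - V (\<Psi> y)) * L" using elim by (intro mult_left_mono) auto
            finally show "\<bar>(G (\<Psi> y) - V (\<Psi> y)) \<bullet> D y\<bar> \<le> norm (G (\<Psi> y) - V (\<Psi> y)) * L" .
          qed (use L in auto)
          finally have "\<bar>E y\<bar> \<le> M * \<bar>U (\<Psi> y) - u (\<Psi> y)\<bar> + (L * M) * norm (V (\<Psi> y) - G (\<Psi> y))"
            by (simp add: abs_minus_commute norm_minus_commute mult_ac)
          from ennreal_leI[OF this] show ?thesis
            using False M(1) L by (simp add: ennreal_plus ennreal_mult)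
        qed
      qed
    qed
    also have "\<dots> = ennreal M * (\<integral>\<^sup>+y\<in>cball 0 S. norm (U (\<Psi> y) - u (\<Psi> y)) \<partial>lborel)
       + ennreal (L * M) * (\<integral>\<^sup>+y\<in>cball 0 S. norm (V (\<Psi> y) - G (\<Psi> y)) \<partial>lborel)"
    proof -
      have [measurable]: "cball 0 S \<in> sets borel" by simp
      show ?thesis by (subst nn_integral_add; (subst nn_integral_cmult)?; (subst nn_integral_cmult)?) measurable
    qed
    also have "\<dots> \<le> ennreal M * (ennreal (L ^ DIM('a)) * ennreal e) + ennreal (L * M) * (ennreal (L ^ DIM('a)) * ennreal e)"
    proof (intro add_mono mult_left_mono)
      show "(\<integral>\<^sup>+y\<in>cball 0 S. norm (U (\<Psi> y) - u (\<Psi> y)) \<partial>lborel) \<le> ennreal (L ^ DIM('a)) * ennreal e"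
        by (rule order_trans[OF nn_integral_ball_compose_le mult_left_mono[OF eu]]) auto
      show "(\<integral>\<^sup>+y\<in>cball 0 S. norm (V (\<Psi> y) - G (\<Psi> y)) \<partial>lborel) \<le> ennreal (L ^ DIM('a)) * ennreal e"
        by (rule order_trans[OF nn_integral_ball_compose_le mult_left_mono[OF eG]]) auto
    qed auto
    also have "\<dots> = ennreal (K * e)"
      using M(1) L e by (simp add: ennreal_mult[symmetric] ennreal_plus[symmetric] K_def algebra_simps del: ennreal_plus)
    finally show ?thesis using K e by (simp add: ennreal_le_iff)
  qed
  have "\<bar>X\<bar> \<le> 0"
  proof (rule field_le_epsilon)
    fix e :: real assume "e > 0"
    then show "\<bar>X\<bar> \<le> 0 + e" using bound[of "e / K"] K by simp
  qed
  then show "(LINT y|lborel. u (\<Psi> y) * frechet_derivative \<phi> (at y) i) = - (LINT y|lborel. (G (\<Psi> y) \<bullet> D y) * \<phi> y)"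
    by (simp add: X_def g_def)
qed

theorem composition_weak_gradient:
  assumes uG: "weak_gradient_lborel u G"
    and h: "h \<longlonglongrightarrow> 0" "\<And>n. h n > 0" "\<And>n. h n \<le> 1"
    and D[measurable]: "\<And>i. i \<in> Basis \<Longrightarrow> D i \<in> borel_measurable borel"
    and lim: "\<And>i. i \<in> Basis \<Longrightarrow> AE y in lborel. (\<lambda>n. (1 / h n) *\<^sub>R (\<Psi> (y + h n *\<^sub>R i) - \<Psi> y)) \<longlonglongrightarrow> D i y"
  shows "weak_gradient_lborel (\<lambda>y. u (\<Psi> y)) (\<lambda>y. \<Sum>i\<in>Basis. (G (\<Psi> y) \<bullet> D i y) *\<^sub>R i)"
    and "AE y in lborel. norm (\<Sum>i\<in>Basis. (G (\<Psi> y) \<bullet> D i y) *\<^sub>R i) \<le> DIM('a) * L * norm (G (\<Psi> y))"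
proof -
  have [measurable]: "u \<in> borel_measurable borel" "G \<in> borel_measurable borel"
    and lu: "locally_integrable_lborel u" and lG: "locally_integrable_lborel G"
    using uG by (auto simp: weak_gradient_lborel_def)
  define N where "N y = (\<Sum>i\<in>Basis. (G (\<Psi> y) \<bullet> D i y) *\<^sub>R i)" for y
  have [measurable]: "N \<in> borel_measurable borel" unfolding N_def[abs_def] by measurable
  have "AE y in lborel. \<forall>i\<in>Basis. norm (D i y) \<le> L"
    using AE_direction_derivative_bound[OF lim h(2)]
    by (intro AE_finite_allI) (auto simp: norm_Basis)
  then have bd: "AE y in lborel. norm (N y) \<le> DIM('a) * L * norm (G (\<Psi> y))"
    by eventually_elim (unfold N_def, rule norm_pullback_gradient_le, use L in auto)
  then show "AE y in lborel. norm (\<Sum>i\<in>Basis. (G (\<Psi> y) \<bullet> D i y) *\<^sub>R i) \<le> DIM('a) * L * norm (G (\<Psi> y))"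
    by (simp add: N_def)
  have lN: "locally_integrable_lborel N"
  proof
    fix R :: real
    have [measurable]: "cball 0 R \<in> sets borel" by simp
    have "set_integrable lborel (cball 0 R) (\<lambda>y. G (\<Psi> y))"
      using locally_integrable_compose[OF _ lG] by simp
    then have "integrable lborel (\<lambda>y. (DIM('a) * L) * norm (indicator (cball 0 R) y *\<^sub>R G (\<Psi> y)))"
      unfolding set_integrable_def by (intro integrable_mult_right integrable_norm)
    then show "set_integrable lborel (cball 0 R) N"
      unfolding set_integrable_def
    proof (rule Bochner_Integration.integrable_bound)
      show "AE y in lborel. norm (indicator (cball 0 R) y *\<^sub>R N y) \<le> norm ((DIM('a) * L) * norm (indicator (cball 0 R) y *\<^sub>R G (\<Psi> y)))"
        using bd by eventually_elim (use L in \<open>auto simp: indicator_def\<close>)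
    qed measurable
  qed
  have "(LINT y|lborel. u (\<Psi> y) * frechet_derivative \<phi> (at y) v) = - (LINT y|lborel. (N y \<bullet> v) * \<phi> y)"
    if \<phi>: "\<phi> \<in> test_functions" for \<phi> v
  proof -
    have iu: "integrable lborel (\<lambda>y. u (\<Psi> y) * frechet_derivative \<phi> (at y) i)" for i
      using integrable_test_scaleR[OF _ locally_integrable_compose[OF _ lu] test_derivative[OF \<phi>]]
      by (simp add: mult.commute)
    note ibp = composition_integration_by_parts[OF uG \<phi> h norm_Basis D lim]
    have "(LINT y|lborel. u (\<Psi> y) * frechet_derivative \<phi> (at y) v)
      = (LINT y|lborel. (\<Sum>i\<in>Basis. (v \<bullet> i) * (u (\<Psi> y) * frechet_derivative \<phi> (at y) i)))"
      by (subst test_linear_expansion[OF \<phi>]) (simp add: sum_distrib_left mult_ac)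
    also have "\<dots> = (\<Sum>i\<in>Basis. (v \<bullet> i) * (LINT y|lborel. u (\<Psi> y) * frechet_derivative \<phi> (at y) i))"
      by (subst Bochner_Integration.integral_sum) (auto intro: integrable_mult_right iu)
    also have "\<dots> = (\<Sum>i\<in>Basis. (v \<bullet> i) * - (LINT y|lborel. (G (\<Psi> y) \<bullet> D i y) * \<phi> y))"
      by (intro sum.cong refl) (simp add: ibp(2))
    also have "\<dots> = - (\<Sum>i\<in>Basis. (v \<bullet> i) * (LINT y|lborel. (G (\<Psi> y) \<bullet> D i y) * \<phi> y))"
      by (simp add: sum_negf)
    also have "(\<Sum>i\<in>Basis. (v \<bullet> i) * (LINT y|lborel. (G (\<Psi> y) \<bullet> D i y) * \<phi> y)) =
      (LINT y|lborel. (\<Sum>i\<in>Basis. (v \<bullet> i) * ((G (\<Psi> y) \<bullet> D i y) * \<phi> y)))"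
      by (subst Bochner_Integration.integral_sum) (auto intro: integrable_mult_right ibp(1))
    also have "\<dots> = (LINT y|lborel. (N y \<bullet> v) * \<phi> y)"
      by (simp add: N_def inner_sum_right sum_distrib_left inner_commute[of _ v] mult_ac)
    finally show ?thesis .
  qed
  then show "weak_gradient_lborel (\<lambda>y. u (\<Psi> y)) (\<lambda>y. \<Sum>i\<in>Basis. (G (\<Psi> y) \<bullet> D i y) *\<^sub>R i)"
    unfolding weak_gradient_lborel_def N_def[symmetric]
    using locally_integrable_compose[OF _ lu] lN by auto
qed

end

subsection \<open>Borel representatives\<close>

lemma lebesgue_measurable_ex_borel:
  fixes f :: "'c::euclidean_space \<Rightarrow> 'b::euclidean_space"
  assumes "f \<in> borel_measurable lebesgue"
  obtains g where "g \<in> borel_measurable borel" "AE x in lborel. f x = g x"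
proof -
  have "\<exists>g\<in>borel_measurable lborel. AE x in lborel. f x \<bullet> b = g x" for b
    by (intro completion_ex_borel_measurable_real borel_measurable_inner assms borel_measurable_const)
  then obtain g where g: "\<And>b. g b \<in> borel_measurable lborel" "\<And>b. AE x in lborel. f x \<bullet> b = g b x"
    by metis
  have [measurable]: "g b \<in> borel_measurable borel" for b using g(1)[of b] by simp
  have "AE x in lborel. \<forall>b\<in>Basis. f x \<bullet> b = g b x"
    by (intro AE_finite_allI g) simp
  then have "AE x in lborel. f x = (\<Sum>b\<in>Basis. g b x *\<^sub>R b)"
  proof eventually_elim
    case (elim x)
    have "f x = (\<Sum>b\<in>Basis. (f x \<bullet> b) *\<^sub>R b)" by (simp add: euclidean_representation)
    then show ?case using elim by simp
  qed
  moreover have "(\<lambda>x. \<Sum>b\<in>Basis. g b x *\<^sub>R b) \<in> borel_measurable borel" by measurable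
  ultimately show ?thesis using that by blast
qed

lemma lebesgue_measurable_AE_eq:
  fixes f g :: "'c::euclidean_space \<Rightarrow> 'b::euclidean_space"
  assumes "g \<in> borel_measurable borel" "AE x in lborel. f x = g x"
  shows "f \<in> borel_measurable lebesgue"
proof -
  obtain N where N: "{x. f x \<noteq> g x} \<subseteq> N" "N \<in> null_sets lborel"
    using assms(2) by (auto simp: eventually_ae_filter)
  show ?thesis
  proof (rule measurableI)
    fix S :: "'b set" assume S: "S \<in> sets borel"
    have "f -` S \<inter> space lebesgue = (g -` S - N) \<union> (f -` S \<inter> N)" using N(1) by auto
    moreover have "g -` S - N \<in> sets lebesgue"
      using measurable_sets_borel[OF assms(1) S] null_setsD2[OF N(2)] by (intro sets_completionI_sets sets.Diff) simp_all
    moreover have "f -` S \<inter> N \<in> null_sets lebesgue"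
      by (rule null_sets_completion_subset[OF Int_lower2 null_sets_completionI[OF N(2)]])
    ultimately show "f -` S \<inter> space lebesgue \<in> sets lebesgue" by (metis null_setsD2 sets.Un)
  qed simp
qed

lemma locally_integrable_measurable:
  fixes u :: "'a::euclidean_space \<Rightarrow> 'b::euclidean_space"
  assumes "locally_integrable u"
  shows "u \<in> borel_measurable lebesgue"
proof (rule borel_measurable_LIMSEQ_metric)
  fix n :: nat
  have "set_integrable lebesgue (cball 0 (real n)) u"
    using assms by (simp add: locally_integrable_def)
  then show "(\<lambda>x. indicator (cball 0 (real n)) x *\<^sub>R u x) \<in> borel_measurable lebesgue"
    unfolding set_integrable_def by (rule borel_measurable_integrable)
next
  fix x :: 'a
  obtain m :: nat where m: "norm x \<le> real m" using real_arch_simple by blast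
  have "\<forall>\<^sub>F n in sequentially. indicator (cball 0 (real n)) x *\<^sub>R u x = u x"
    using eventually_ge_at_top[of m] by eventually_elim (use m in \<open>auto simp: indicator_def\<close>)
  then show "(\<lambda>n. indicator (cball 0 (real n)) x *\<^sub>R u x) \<longlonglongrightarrow> u x"
    by (rule tendsto_eventually)
qed

lemma integrable_lebesgue_iff_lborel:
  fixes f g :: "'c::euclidean_space \<Rightarrow> 'b::{banach,second_countable_topology}"
  assumes g: "g \<in> borel_measurable borel" and f: "f \<in> borel_measurable lebesgue"
    and ae: "AE x in lborel. f x = g x"
  shows "integrable lebesgue f \<longleftrightarrow> integrable lborel g" "(LINT x|lebesgue. f x) = (LINT x|lborel. g x)"
proof -
  have g': "g \<in> borel_measurable lborel" "g \<in> borel_measurable lebesgue"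
    using g by (auto intro: measurable_completion)
  have "integrable lebesgue f \<longleftrightarrow> integrable lebesgue g"
    by (rule integrable_cong_AE[OF f g'(2) AE_completion[OF ae]])
  then show "integrable lebesgue f \<longleftrightarrow> integrable lborel g"
    using integrable_completion[OF g'(1)] by simp
  have "(LINT x|lebesgue. f x) = (LINT x|lebesgue. g x)"
    by (rule integral_cong_AE[OF f g'(2) AE_completion[OF ae]])
  then show "(LINT x|lebesgue. f x) = (LINT x|lborel. g x)"
    using integral_completion[OF g'(1)] by simp
qed

lemma locally_integrable_iff_lborel:
  fixes f g :: "'c::euclidean_space \<Rightarrow> 'b::euclidean_space"
  assumes g[measurable]: "g \<in> borel_measurable borel" and f[measurable]: "f \<in> borel_measurable lebesgue"
    and ae: "AE x in lborel. f x = g x"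
  shows "locally_integrable f \<longleftrightarrow> locally_integrable_lborel g"
proof -
  have eq: "set_integrable lebesgue K f \<longleftrightarrow> set_integrable lborel K g" if [measurable]: "K \<in> sets borel" for K
    unfolding set_integrable_def
  proof (rule integrable_lebesgue_iff_lborel(1))
    show "(\<lambda>x. indicator K x *\<^sub>R g x) \<in> borel_measurable borel" by measurable
    have "K \<in> sets lebesgue" using that by auto
    then show "(\<lambda>x. indicator K x *\<^sub>R f x) \<in> borel_measurable lebesgue"
      by (intro borel_measurable_scaleR borel_measurable_indicator f)
    show "AE x in lborel. indicator K x *\<^sub>R f x = indicator K x *\<^sub>R g x"
      using ae by eventually_elim simp
  qed
  show ?thesis
  proof
    assume "locally_integrable f"
    then show "locally_integrable_lborel g"
      using eq[of "cball 0 _"] by (simp add: locally_integrable_def)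
  next
    assume l: "locally_integrable_lborel g"
    show "locally_integrable f"
      unfolding locally_integrable_def
    proof (intro allI impI)
      fix K :: "'c set" assume K: "compact K"
      then obtain R where "\<forall>x\<in>K. norm x \<le> R" using compact_imp_bounded bounded_iff by blast
      then have "K \<subseteq> cball 0 R" by auto
      moreover have "K \<in> sets borel" using K by (simp add: compact_imp_closed borel_closed)
      ultimately have "set_integrable lborel K g"
        using l set_integrable_subset[of lborel "cball 0 R" g K] by auto
      then show "set_integrable lebesgue K f" using eq[OF \<open>K \<in> sets borel\<close>] by simp
    qed
  qed
qed

lemma has_weak_gradient_iff_lborel:
  assumes u: "u \<in> borel_measurable borel" and G: "G \<in> borel_measurable borel"
    and ae: "AE x in lborel. u0 x = u x" "AE x in lborel. G0 x = G x"
  shows "has_weak_gradient u0 G0 \<longleftrightarrow> weak_gradient_lborel u G"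
proof -
  have [measurable]: "u0 \<in> borel_measurable lebesgue" "G0 \<in> borel_measurable lebesgue"
    by (rule lebesgue_measurable_AE_eq[OF u ae(1)], rule lebesgue_measurable_AE_eq[OF G ae(2)])
  note [measurable] = u G
  have "(LINT x|lebesgue. u0 x * frechet_derivative \<phi> (at x) v) = (LINT x|lborel. u x * frechet_derivative \<phi> (at x) v)"
    "(LINT x|lebesgue. (G0 x \<bullet> v) * \<phi> x) = (LINT x|lborel. (G x \<bullet> v) * \<phi> x)"
    if \<phi>: "\<phi> \<in> test_functions" for \<phi> v
  proof -
    have m: "\<phi> \<in> borel_measurable borel" "(\<lambda>x. frechet_derivative \<phi> (at x) v) \<in> borel_measurable borel"
      using test_measurable[OF \<phi>] test_measurable[OF test_derivative[OF \<phi>]] by auto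
    then have m': "\<phi> \<in> borel_measurable lebesgue" "(\<lambda>x. frechet_derivative \<phi> (at x) v) \<in> borel_measurable lebesgue"
      by (auto intro: measurable_completion)
    show "(LINT x|lebesgue. u0 x * frechet_derivative \<phi> (at x) v) = (LINT x|lborel. u x * frechet_derivative \<phi> (at x) v)"
      using ae(1) by (intro integrable_lebesgue_iff_lborel(2) borel_measurable_times m m') (auto elim: eventually_mono)
    show "(LINT x|lebesgue. (G0 x \<bullet> v) * \<phi> x) = (LINT x|lborel. (G x \<bullet> v) * \<phi> x)"
      using ae(2) by (intro integrable_lebesgue_iff_lborel(2) borel_measurable_times m m' borel_measurable_inner)
        (auto elim: eventually_mono)
  qed
  then show ?thesis
    unfolding has_weak_gradient_def weak_gradient_lborel_def
    using u G locally_integrable_iff_lborel[OF u _ ae(1)] locally_integrable_iff_lborel[OF G _ ae(2)]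
    by simp
qed

subsection \<open>Time slices\<close>

lemma AE_time_slices:
  fixes P :: "'a::euclidean_space \<times> real \<Rightarrow> bool"
  assumes "AE z in lborel. P z"
  shows "AE t in lborel. AE y in lborel. P (y, t)"
proof -
  obtain N where N: "{z. \<not> P z} \<subseteq> N" "N \<in> sets borel" "emeasure lborel N = 0"
    using assms by (auto elim!: AE_E)
  have NN: "N \<in> sets (lborel \<Otimes>\<^sub>M (lborel :: real measure))"
    using N(2) by (simp only: lborel_prod sets_lborel)
  have "AE z in lborel. z \<notin> N" using N by (intro AE_not_in) (auto simp: null_sets_def)
  then have "AE z in lborel \<Otimes>\<^sub>M lborel. z \<notin> N" by (simp only: lborel_prod)
  then have "AE y in lborel. AE t in lborel. (y, t) \<notin> N" by (rule lborel_pair.AE_pair)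
  moreover have "{z \<in> space (lborel \<Otimes>\<^sub>M (lborel :: real measure)). (fst z, snd z) \<notin> N} = - N"
    by (auto simp: space_pair_measure)
  ultimately have "AE t in lborel. AE y in lborel. (y, t) \<notin> N"
    using lborel_pair.AE_commute[of "\<lambda>y t. (y, t) \<notin> N"] NN sets.compl_sets[OF NN]
    by (simp add: Compl_eq_Diff_UNIV space_pair_measure)
  then show ?thesis
    using N(1) by (auto elim!: eventually_mono)
qed

lemma slice_measurable: "f \<in> borel_measurable borel \<Longrightarrow> (\<lambda>y. f (y, t)) \<in> borel_measurable borel"
  for f :: "'a::euclidean_space \<times> real \<Rightarrow> 'b::topological_space"
  by (rule measurable_compose[of "\<lambda>y. (y, t)"])
     (auto intro!: borel_measurable_continuous_onI continuous_intros)

lemma nn_integral_time_slices: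
  fixes f :: "'a::euclidean_space \<times> real \<Rightarrow> ennreal"
  assumes "f \<in> borel_measurable borel"
  shows "(\<integral>\<^sup>+z. f z \<partial>lborel) = (\<integral>\<^sup>+t. \<integral>\<^sup>+y. f (y, t) \<partial>lborel \<partial>lborel)"
proof -
  have "f \<in> borel_measurable (lborel \<Otimes>\<^sub>M lborel)" using assms by (simp add: lborel_prod)
  then show ?thesis using lborel_pair.nn_integral_snd[of f] by (simp add: lborel_prod)
qed

locale time_biLipschitz =
  fixes \<Psi> \<Theta> :: "'a::euclidean_space \<times> real \<Rightarrow> 'a" and L :: real
  assumes slice: "\<And>t. biLipschitz (\<lambda>y. \<Psi> (y, t)) (\<lambda>x. \<Theta> (x, t)) L"
    and \<Psi>_measurable [measurable]: "\<Psi> \<in> borel_measurable borel"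
begin

lemma shift_measurable: "(\<lambda>z. (\<Psi> z, snd z)) \<in> borel_measurable borel"
  by (intro borel_measurable_Pair \<Psi>_measurable borel_measurable_continuous_onI continuous_intros)

lemma L_pos: "L > 0" using biLipschitz.L[OF slice] .

lemma nn_integral_compose:
  assumes [measurable]: "f \<in> borel_measurable borel"
  shows "(\<integral>\<^sup>+z. f (\<Psi> z, snd z) \<partial>lborel) \<le> ennreal (L ^ DIM('a)) * (\<integral>\<^sup>+z. f z \<partial>lborel)"
proof -
  have [measurable]: "f \<in> borel_measurable (borel \<Otimes>\<^sub>M borel)" by (simp add: borel_prod)
  have "(\<integral>\<^sup>+z. f (\<Psi> z, snd z) \<partial>lborel) = (\<integral>\<^sup>+t. \<integral>\<^sup>+y. f (\<Psi> (y, t), t) \<partial>lborel \<partial>lborel)"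
    by (subst nn_integral_time_slices[OF measurable_compose[OF shift_measurable assms]]) simp
  also have "\<dots> \<le> (\<integral>\<^sup>+t. ennreal (L ^ DIM('a)) * (\<integral>\<^sup>+y. f (y, t) \<partial>lborel) \<partial>lborel)"
    by (intro nn_integral_mono biLipschitz.nn_integral_compose_le[OF slice, where f = "\<lambda>y. f (y, _)"]
        slice_measurable assms)
  also have "\<dots> = ennreal (L ^ DIM('a)) * (\<integral>\<^sup>+t. \<integral>\<^sup>+y. f (y, t) \<partial>lborel \<partial>lborel)"
    by (rule nn_integral_cmult) measurable
  also have "(\<integral>\<^sup>+t. \<integral>\<^sup>+y. f (y, t) \<partial>lborel \<partial>lborel) = (\<integral>\<^sup>+z. f z \<partial>lborel)"
    by (rule nn_integral_time_slices[symmetric]) measurable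
  finally show ?thesis .
qed

lemma AE_compose:
  assumes "AE z in lborel. P z"
  shows "AE z in lborel. P (\<Psi> z, snd z)"
proof -
  obtain N where N: "{z. \<not> P z} \<subseteq> N" "N \<in> sets borel" "emeasure lborel N = 0"
    using assms by (auto elim!: AE_E)
  note [measurable] = N(2)
  have "(\<integral>\<^sup>+z. indicator N (\<Psi> z, snd z) \<partial>lborel) \<le> ennreal (L ^ DIM('a)) * (\<integral>\<^sup>+z. indicator N z \<partial>lborel)"
    by (rule nn_integral_compose) measurable
  then have "(\<integral>\<^sup>+z. indicator N (\<Psi> z, snd z) \<partial>lborel) = 0" using N by simp
  then have "AE z in lborel. indicator N (\<Psi> z, snd z) = (0::ennreal)"
    by (subst (asm) nn_integral_0_iff_AE) (auto intro!: measurable_compose[OF shift_measurable])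
  then show ?thesis
    using N(1) by (auto elim!: eventually_mono simp: indicator_def split: if_splits)
qed

lemma ex_direction_derivatives:
  obtains h D where "h \<longlonglongrightarrow> 0" "\<And>n::nat. h n > 0" "\<And>n. h n \<le> 1"
    "\<And>i. i \<in> Basis \<Longrightarrow> D i \<in> borel_measurable borel"
    "AE z in lborel. \<forall>i\<in>Basis. (\<lambda>n. (1 / h n) *\<^sub>R (\<Psi> (z + h n *\<^sub>R (i, 0)) - \<Psi> z)) \<longlonglongrightarrow> D i z"
proof -
  define J :: "('a \<times> 'a) set" where "J = Basis \<times> Basis"
  have fin: "finite J" by (simp add: J_def)
  have lip: "\<bar>\<Psi> (z + s *\<^sub>R (i, 0)) \<bullet> c - \<Psi> z \<bullet> c\<bar> \<le> L * \<bar>s\<bar>" if "c \<in> Basis" "i \<in> Basis" for c i :: 'a and z s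
  proof -
    obtain y t where z: "z = (y, t)" by (cases z)
    have "\<bar>(\<Psi> (y + s *\<^sub>R i, t) - \<Psi> (y, t)) \<bullet> c\<bar> \<le> norm (\<Psi> (y + s *\<^sub>R i, t) - \<Psi> (y, t))"
      using that by (intro Basis_le_norm)
    also have "\<dots> \<le> L * norm (y + s *\<^sub>R i - y)"
      by (rule biLipschitz.\<Psi>_Lipschitz[OF slice])
    finally show ?thesis using that by (simp add: z inner_diff_left)
  qed
  obtain h D where h: "h \<longlonglongrightarrow> 0" "\<And>n::nat. h n > 0" "\<And>n. h n \<le> 1"
    and D: "\<And>j. j \<in> J \<Longrightarrow> D j \<in> borel_measurable borel"
    and lim: "AE z in lborel. \<forall>j\<in>J. (\<lambda>n. (\<Psi> (z + h n *\<^sub>R (snd j, 0)) \<bullet> fst j - \<Psi> z \<bullet> fst j) / h n) \<longlonglongrightarrow> D j z"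
    by (rule direction_derivatives_exist[OF fin, of "\<lambda>j z. \<Psi> z \<bullet> fst j" L "\<lambda>j. (snd j, 0)"])
       (use lip L_pos in \<open>auto simp: J_def\<close>)
  show ?thesis
  proof (rule that[OF h, of "\<lambda>i z. \<Sum>c\<in>Basis. D (c, i) z *\<^sub>R c"])
    show "(\<lambda>z. \<Sum>c\<in>Basis. D (c, i) z *\<^sub>R c) \<in> borel_measurable borel" if "i \<in> Basis" for i
      using D that by (intro borel_measurable_sum borel_measurable_scaleR borel_measurable_const) (auto simp: J_def)
    show "AE z in lborel. \<forall>i\<in>Basis. (\<lambda>n. (1 / h n) *\<^sub>R (\<Psi> (z + h n *\<^sub>R (i, 0)) - \<Psi> z)) \<longlonglongrightarrow> (\<Sum>c\<in>Basis. D (c, i) z *\<^sub>R c)"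
      using lim
    proof eventually_elim
      case (elim z)
      show ?case
      proof
        fix i :: 'a assume i: "i \<in> Basis"
        have "(\<lambda>n. \<Sum>c\<in>Basis. ((\<Psi> (z + h n *\<^sub>R (i, 0)) \<bullet> c - \<Psi> z \<bullet> c) / h n) *\<^sub>R c) \<longlonglongrightarrow> (\<Sum>c\<in>Basis. D (c, i) z *\<^sub>R c)"
        proof (intro tendsto_sum tendsto_scaleR tendsto_const)
          fix c :: 'a assume c: "c \<in> Basis"
          then have "(c, i) \<in> J" using i by (simp add: J_def)
          then show "(\<lambda>n. (\<Psi> (z + h n *\<^sub>R (i, 0)) \<bullet> c - \<Psi> z \<bullet> c) / h n) \<longlonglongrightarrow> D (c, i) z"
            using bspec[OF elim, of "(c, i)"] by simp
        qed
        moreover have "(\<Sum>c\<in>Basis. ((\<Psi> (z + h n *\<^sub>R (i, 0)) \<bullet> c - \<Psi> z \<bullet> c) / h n) *\<^sub>R c)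
            = (1 / h n) *\<^sub>R (\<Psi> (z + h n *\<^sub>R (i, 0)) - \<Psi> z)" for n
        proof -
          have "(1 / h n) *\<^sub>R (\<Psi> (z + h n *\<^sub>R (i, 0)) - \<Psi> z)
            = (\<Sum>c\<in>Basis. (((1 / h n) *\<^sub>R (\<Psi> (z + h n *\<^sub>R (i, 0)) - \<Psi> z)) \<bullet> c) *\<^sub>R c)"
            by (rule euclidean_representation[symmetric])
          then show ?thesis by (simp add: inner_diff_left)
        qed
        ultimately show "(\<lambda>n. (1 / h n) *\<^sub>R (\<Psi> (z + h n *\<^sub>R (i, 0)) - \<Psi> z)) \<longlonglongrightarrow> (\<Sum>c\<in>Basis. D (c, i) z *\<^sub>R c)"
          by (simp only:)
      qed
    qed
  qed
qed

text \<open>The factor \<open>1 + L ^ DIM('a)\<close> dominates \<open>(L ^ DIM('a)) powr (1 / p)\<close> for every \<open>p \<ge> 1\<close>.\<close>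

lemma Lp_norm_compose_le:
  fixes F G :: "'a \<times> real \<Rightarrow> 'a"
  assumes p: "1 \<le> p" and K: "K > 0"
    and F: "F \<in> borel_measurable lebesgue" and G: "G \<in> borel_measurable lebesgue"
    and G'[measurable]: "G' \<in> borel_measurable borel" and GG': "AE z in lborel. G z = G' z"
    and le: "AE z in lborel. norm (F z) \<le> K * norm (G' (\<Psi> z, snd z))"
  shows "Lp_norm p F \<le> ennreal (K * (1 + L ^ DIM('a))) * Lp_norm p G"
proof (cases "p = \<infinity>")
  case True
  define S where "S = esssup lebesgue (\<lambda>x. ennreal (norm (G x)))"
  have "AE z in lborel. ennreal (norm (G z)) \<le> S"
    using esssup_AE[of "\<lambda>x. ennreal (norm (G x))" lebesgue] by (simp add: S_def AE_completion_iff)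
  then have "AE z in lborel. ennreal (norm (G' z)) \<le> S" using GG' by eventually_elim simp
  from AE_compose[OF this] le
  have "AE z in lborel. ennreal (norm (F z)) \<le> ennreal K * S"
  proof eventually_elim
    case (elim z)
    have "ennreal (norm (F z)) \<le> ennreal K * ennreal (norm (G' (\<Psi> z, snd z)))"
      using ennreal_leI[OF elim(2)] K by (simp add: ennreal_mult)
    also have "\<dots> \<le> ennreal K * S" using elim(1) by (intro mult_left_mono) auto
    finally show ?case .
  qed
  then have "esssup lebesgue (\<lambda>x. ennreal (norm (F x))) \<le> ennreal K * S"
    using F by (intro esssup_I AE_completion) measurable
  also have "\<dots> \<le> ennreal (K * (1 + L ^ DIM('a))) * S"
    using K L_pos by (intro mult_right_mono ennreal_leI) (auto simp: algebra_simps)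
  finally show ?thesis by (simp add: Lp_norm_def True S_def)
next
  case False
  define q where "q = enn2real p"
  have q: "q \<ge> 1"
  proof -
    have "enn2real 1 \<le> enn2real p" using p False by (intro enn2real_mono) (auto simp: less_top)
    then show ?thesis by (simp add: q_def)
  qed
  define IF where "IF = (\<integral>\<^sup>+ x. ennreal (norm (F x) powr q) \<partial>lborel)"
  define IG where "IG = (\<integral>\<^sup>+ x. ennreal (norm (G x) powr q) \<partial>lborel)"
  have IG': "IG = (\<integral>\<^sup>+ x. ennreal (norm (G' x) powr q) \<partial>lborel)"
    unfolding IG_def using GG' by (intro nn_integral_cong_AE) (auto elim: eventually_mono)
  have c: "0 \<le> K powr q * L ^ DIM('a)" using L_pos by simp
  have "IF \<le> (\<integral>\<^sup>+ z. ennreal (K powr q) * ennreal (norm (G' (\<Psi> z, snd z)) powr q) \<partial>lborel)"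
    unfolding IF_def
  proof (rule nn_integral_mono_AE)
    show "AE z in lborel. ennreal (norm (F z) powr q) \<le> ennreal (K powr q) * ennreal (norm (G' (\<Psi> z, snd z)) powr q)"
      using le
    proof eventually_elim
      case (elim z)
      have "norm (F z) powr q \<le> (K * norm (G' (\<Psi> z, snd z))) powr q"
        using elim q by (intro powr_mono2) auto
      also have "\<dots> = K powr q * norm (G' (\<Psi> z, snd z)) powr q"
        using K by (simp add: powr_mult)
      finally show ?case by (simp add: ennreal_mult[symmetric] ennreal_leI)
    qed
  qed
  also have "\<dots> = ennreal (K powr q) * (\<integral>\<^sup>+ z. ennreal (norm (G' (\<Psi> z, snd z)) powr q) \<partial>lborel)"
    using measurable_compose[OF shift_measurable G'] by (intro nn_integral_cmult) simp
  also have "\<dots> \<le> ennreal (K powr q) * (ennreal (L ^ DIM('a)) * IG)"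
    unfolding IG' by (intro mult_left_mono nn_integral_compose[of "\<lambda>z. ennreal (norm (G' z) powr q)"]) auto
  finally have main: "IF \<le> ennreal (K powr q * L ^ DIM('a)) * IG"
    using L_pos by (simp add: ennreal_mult mult.assoc)
  have pos: "0 < K * (1 + L ^ DIM('a))" using K L_pos by (simp add: add_pos_pos)
  have N: "Lp_norm p H = (if I = \<infinity> then \<infinity> else ennreal (enn2real I powr (1 / q)))"
    if "I = (\<integral>\<^sup>+ x. ennreal (norm (H x) powr q) \<partial>lborel)" for H :: "'a \<times> real \<Rightarrow> 'a" and I
    using False that by (simp add: Lp_norm_def q_def nn_integral_completion Let_def)
  show ?thesis
  proof (cases "IG = \<infinity>")
    case True
    then have "Lp_norm p G = top" using N[OF IG_def] by simp
    moreover have "ennreal (K * (1 + L ^ DIM('a))) * top = top"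
      using pos by (metis ennreal_mult_top ennreal_eq_0_iff not_le)
    ultimately show ?thesis by simp
  next
    case fin: False
    then have "IF \<noteq> \<infinity>"
      using main c by (metis ennreal_mult_eq_top_iff ennreal_neq_top infinity_ennreal_def top.extremum_uniqueI)
    have "enn2real IF \<le> enn2real (ennreal (K powr q * L ^ DIM('a)) * IG)"
      using main fin by (intro enn2real_mono) (auto simp: ennreal_mult_less_top less_top)
    also have "\<dots> = (K powr q * L ^ DIM('a)) * enn2real IG" using c by (simp add: enn2real_mult)
    finally have "enn2real IF powr (1 / q) \<le> ((K powr q * L ^ DIM('a)) * enn2real IG) powr (1 / q)"
      using q by (intro powr_mono2) auto
    also have "\<dots> = K * (L ^ DIM('a)) powr (1 / q) * enn2real IG powr (1 / q)"
      using q K L_pos by (simp add: powr_mult powr_powr)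
    also have "\<dots> \<le> K * (1 + L ^ DIM('a)) * enn2real IG powr (1 / q)"
    proof (intro mult_right_mono mult_left_mono)
      have "(L ^ DIM('a)) powr (1 / q) \<le> (1 + L ^ DIM('a)) powr (1 / q)"
        using q L_pos by (intro powr_mono2) auto
      also have "\<dots> \<le> (1 + L ^ DIM('a)) powr 1"
        using q L_pos by (intro powr_mono) auto
      finally show "(L ^ DIM('a)) powr (1 / q) \<le> 1 + L ^ DIM('a)" using L_pos by simp
    qed (use K in auto)
    finally have "ennreal (enn2real IF powr (1 / q)) \<le> ennreal (K * (1 + L ^ DIM('a))) * ennreal (enn2real IG powr (1 / q))"
      using pos by (simp add: ennreal_mult[symmetric] ennreal_leI)
    then show ?thesis
      using N[OF IF_def] N[OF IG_def] fin \<open>IF \<noteq> \<infinity>\<close> by simp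
  qed
qed

theorem spatial_grad_norm_compose_le:
  assumes p: "1 \<le> p"
  shows "spatial_grad_norm p (\<lambda>z. g (\<Psi> z, snd z))
    \<le> ennreal (DIM('a) * L * (1 + L ^ DIM('a))) * spatial_grad_norm p g"
proof -
  define C where "C = DIM('a) * L * (1 + L ^ DIM('a))"
  have C: "C > 0" using L_pos by (simp add: C_def add_pos_pos)
  have step: "spatial_grad_norm p (\<lambda>z. g (\<Psi> z, snd z)) \<le> ennreal C * Lp_norm p G"
    if G: "G \<in> borel_measurable lebesgue"
      and wG: "AE t in lebesgue. has_weak_gradient (\<lambda>y. g (y, t)) (\<lambda>y. G (y, t))" for G
  proof -
    obtain G' where G'[measurable]: "G' \<in> borel_measurable borel" and GG': "AE z in lborel. G z = G' z"
      using lebesgue_measurable_ex_borel[OF G] by blast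
    obtain h D where h: "h \<longlonglongrightarrow> 0" "\<And>n::nat. h n > 0" "\<And>n. h n \<le> 1"
      and D[measurable]: "\<And>i. i \<in> Basis \<Longrightarrow> D i \<in> borel_measurable borel"
      and lim: "AE z in lborel. \<forall>i\<in>Basis. (\<lambda>n. (1 / h n) *\<^sub>R (\<Psi> (z + h n *\<^sub>R (i, 0)) - \<Psi> z)) \<longlonglongrightarrow> D i z"
      using ex_direction_derivatives by blast
    define N where "N z = (\<Sum>i\<in>Basis. (G' (\<Psi> z, snd z) \<bullet> D i z) *\<^sub>R i)" for z
    have N_borel: "N \<in> borel_measurable borel"
      unfolding N_def[abs_def]
      by (intro borel_measurable_sum borel_measurable_scaleR borel_measurable_inner borel_measurable_const
          measurable_compose[OF shift_measurable G'] D)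
    have N_leb: "N \<in> borel_measurable lebesgue"
      by (rule measurable_completion) (use N_borel in simp)
    have bd: "AE z in lborel. norm (N z) \<le> (DIM('a) * L) * norm (G' (\<Psi> z, snd z))"
      using lim
    proof eventually_elim
      case (elim z)
      obtain y t where z: "z = (y, t)" by (cases z)
      have "norm (D i z) \<le> L" if i: "i \<in> Basis" for i
      proof (rule LIMSEQ_le_const2[OF tendsto_norm[OF bspec[OF elim i]]], intro exI allI impI)
        fix n
        have "norm (\<Psi> (y + h n *\<^sub>R i, t) - \<Psi> (y, t)) \<le> L * norm (y + h n *\<^sub>R i - y)"
          by (rule biLipschitz.\<Psi>_Lipschitz[OF slice])
        then have "norm (\<Psi> (z + h n *\<^sub>R (i, 0)) - \<Psi> z) \<le> L * h n"
          using i h(2)[of n] by (simp add: z)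
        moreover have "norm ((1 / h n) *\<^sub>R v) = norm v / h n" for v :: 'a using h(2)[of n] by simp
        ultimately show "norm ((1 / h n) *\<^sub>R (\<Psi> (z + h n *\<^sub>R (i, 0)) - \<Psi> z)) \<le> L"
          using h(2)[of n] by (simp only: pos_divide_le_eq)
      qed
      then show ?case unfolding N_def using L_pos by (intro norm_pullback_gradient_le) auto
    qed
    have "AE t in lborel. has_weak_gradient (\<lambda>y. g (\<Psi> (y, t), t)) (\<lambda>y. N (y, t))"
      using AE_time_slices[OF GG'] AE_time_slices[OF lim] wG[unfolded AE_completion_iff]
    proof eventually_elim
      case (elim t)
      interpret biLipschitz "\<lambda>y. \<Psi> (y, t)" "\<lambda>x. \<Theta> (x, t)" L by (rule slice)
      have "(\<lambda>y. g (y, t)) \<in> borel_measurable lebesgue"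
        using elim(3) by (intro locally_integrable_measurable) (simp add: has_weak_gradient_def)
      then obtain u where u[measurable]: "u \<in> borel_measurable borel" and gu: "AE y in lborel. g (y, t) = u y"
        by (rule lebesgue_measurable_ex_borel)
      note Gt = slice_measurable[OF G', of t] and Nt = slice_measurable[OF N_borel, of t]
      have w: "weak_gradient_lborel u (\<lambda>y. G' (y, t))"
        using has_weak_gradient_iff_lborel[OF u Gt gu elim(1)] elim(3) by simp
      have "weak_gradient_lborel (\<lambda>y. u (\<Psi> (y, t))) (\<lambda>y. \<Sum>i\<in>Basis. (G' (\<Psi> (y, t), t) \<bullet> D i (y, t)) *\<^sub>R i)"
      proof (rule composition_weak_gradient(1)[OF w h])
        show "(\<lambda>y. D i (y, t)) \<in> borel_measurable borel" if "i \<in> Basis" for i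
          by (rule slice_measurable[OF D[OF that]])
        show "AE y in lborel. (\<lambda>n. (1 / h n) *\<^sub>R (\<Psi> (y + h n *\<^sub>R i, t) - \<Psi> (y, t))) \<longlonglongrightarrow> D i (y, t)"
          if "i \<in> Basis" for i
          using elim(2) by eventually_elim (use that in simp)
      qed
      then have w': "weak_gradient_lborel (\<lambda>y. u (\<Psi> (y, t))) (\<lambda>y. N (y, t))"
        by (simp add: N_def)
      have "AE y in lborel. g (\<Psi> (y, t), t) = u (\<Psi> (y, t))"
        by (rule AE_Lipschitz_inverse[OF L \<Theta>_Lipschitz inverse measurable gu])
      then show ?case
        using has_weak_gradient_iff_lborel[of "\<lambda>y. u (\<Psi> (y, t))" "\<lambda>y. N (y, t)" "\<lambda>y. g (\<Psi> (y, t), t)" "\<lambda>y. N (y, t)"] w' Nt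
        by simp
    qed
    then have "AE t in lebesgue. has_weak_gradient (\<lambda>y. g (\<Psi> (y, t), snd (y, t))) (\<lambda>y. N (y, t))"
      by (simp add: AE_completion)
    then have "spatial_grad_norm p (\<lambda>z. g (\<Psi> z, snd z)) \<le> Lp_norm p N"
      unfolding spatial_grad_norm_def using N_leb by (intro INF_lower) auto
    also have "\<dots> \<le> ennreal C * Lp_norm p G"
      unfolding C_def using L_pos by (intro Lp_norm_compose_le[OF p _ N_leb G G' GG' bd]) simp
    finally show ?thesis .
  qed
  \<comment> \<open>The infimum is compared after dividing by the constant; if there is no weak gradient it is infinite.\<close>
  have "spatial_grad_norm p (\<lambda>z. g (\<Psi> z, snd z)) / ennreal C \<le> spatial_grad_norm p g"
    unfolding spatial_grad_norm_def[of p g]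
  proof (rule INF_greatest)
    fix G assume "G \<in> {G. G \<in> borel_measurable lebesgue \<and> (AE t in lebesgue. has_weak_gradient (\<lambda>y. g (y, t)) (\<lambda>y. G (y, t)))}"
    then have "spatial_grad_norm p (\<lambda>z. g (\<Psi> z, snd z)) \<le> ennreal C * Lp_norm p G" using step by blast
    then show "spatial_grad_norm p (\<lambda>z. g (\<Psi> z, snd z)) / ennreal C \<le> Lp_norm p G"
      using C by (subst divide_le_posI_ennreal) (auto simp: mult.commute)
  qed
  then have "ennreal C * (spatial_grad_norm p (\<lambda>z. g (\<Psi> z, snd z)) / ennreal C) \<le> ennreal C * spatial_grad_norm p g"
    by (rule mult_left_mono) simp
  moreover have "ennreal C * (x / ennreal C) = x" for x
    using C mult_divide_eq_ennreal[of "ennreal C" x] by (simp add: ennreal_times_divide mult.commute)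
  ultimately show ?thesis by (simp only: C_def[symmetric])
qed

end

section \<open>Graphs in admissible directions\<close>

lemma Lip_1_half_continuous:
  assumes "\<psi> \<in> Lip_1_half"
  shows "continuous_on UNIV \<psi>"
proof -
  obtain l where l: "\<And>y s u r. \<bar>\<psi> (y, s) - \<psi> (u, r)\<bar> \<le> l * (norm (y - u) + sqrt \<bar>s - r\<bar>)"
    using assms by (auto simp: Lip_1_half_def)
  have "(\<psi> \<longlongrightarrow> \<psi> (u, r)) (at (u, r))" for u r
  proof (rule LIM_zero_cancel, rule Lim_null_comparison)
    show "\<forall>\<^sub>F z in at (u, r). norm (\<psi> z - \<psi> (u, r)) \<le> l * (norm (fst z - u) + sqrt \<bar>snd z - r\<bar>)"
      using l by (intro always_eventually allI) (auto simp: split_paired_all)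
    have "((\<lambda>z. l * (norm (fst z - u) + sqrt \<bar>snd z - r\<bar>)) \<longlongrightarrow> l * (norm (fst (u, r) - u) + sqrt \<bar>snd (u, r) - r\<bar>)) (at (u, r))"
      by (intro tendsto_intros)
    then show "((\<lambda>z. l * (norm (fst z - u) + sqrt \<bar>snd z - r\<bar>)) \<longlongrightarrow> 0) (at (u, r))" by simp
  qed
  then show ?thesis by (auto simp: continuous_on_def intro: tendsto_within_subset)
qed

text \<open>The essential bound on the weak gradient holds on almost every time slice, and by continuity on all of them.\<close>

lemma spatial_grad_norm_imp_Lipschitz:
  assumes \<psi>: "continuous_on UNIV \<psi>" and K: "spatial_grad_norm \<infinity> \<psi> < ennreal K"
  shows "\<bar>\<psi> (y, t) - \<psi> (u, t)\<bar> \<le> K * norm (y - u)"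
proof -
  have m: "\<psi> \<in> borel_measurable borel" using \<psi> by (rule borel_measurable_continuous_onI)
  obtain G where G: "G \<in> borel_measurable lebesgue"
    "AE t in lebesgue. has_weak_gradient (\<lambda>y. \<psi> (y, t)) (\<lambda>y. G (y, t))" "Lp_norm \<infinity> G < ennreal K"
    using K unfolding spatial_grad_norm_def INF_less_iff by blast
  obtain G' where G': "G' \<in> borel_measurable borel" and GG': "AE z in lborel. G z = G' z"
    using lebesgue_measurable_ex_borel[OF G(1)] by blast
  have "AE z in lborel. ennreal (norm (G z)) \<le> Lp_norm \<infinity> G"
    using esssup_AE[of "\<lambda>x. ennreal (norm (G x))" lebesgue] by (simp add: Lp_norm_def AE_completion_iff)
  then have "AE z in lborel. G z = G' z \<and> norm (G' z) \<le> K"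
    using GG'
  proof eventually_elim
    case (elim z)
    have "ennreal (norm (G z)) < ennreal K" using elim(1) G(3) by (rule le_less_trans)
    then show ?case using elim(2) by (simp add: ennreal_less_iff)
  qed
  from AE_time_slices[OF this] G(2)[unfolded AE_completion_iff]
  have "AE t in lborel. \<forall>y u. \<bar>\<psi> (y, t) - \<psi> (u, t)\<bar> \<le> K * norm (y - u)"
  proof eventually_elim
    case (elim t)
    have eq: "AE y in lborel. G (y, t) = G' (y, t)" and le: "AE y in lborel. norm (G' (y, t)) \<le> K"
      using elim(1) by (auto elim: eventually_mono)
    have "weak_gradient_lborel (\<lambda>y. \<psi> (y, t)) (\<lambda>y. G' (y, t))"
      using has_weak_gradient_iff_lborel[OF slice_measurable[OF m] slice_measurable[OF G'] _ eq, of "\<lambda>y. \<psi> (y, t)"] elim(2)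
      by simp
    moreover have "continuous_on UNIV (\<lambda>y. \<psi> (y, t))"
      by (rule continuous_on_compose2[OF \<psi>]) (auto intro!: continuous_intros)
    ultimately show ?case using bounded_weak_gradient_imp_Lipschitz le by blast
  qed
  then have ae: "AE t in lebesgue. t \<in> {t. \<bar>\<psi> (y, t) - \<psi> (u, t)\<bar> \<le> K * norm (y - u)}"
    unfolding AE_completion_iff by eventually_elim simp
  have "closed {t. \<bar>\<psi> (y, t) - \<psi> (u, t)\<bar> \<le> K * norm (y - u)}"
    by (intro closed_Collect_le continuous_intros continuous_on_compose2[OF \<psi>]) auto
  from mem_closed_if_AE_lebesgue[OF this ae] show ?thesis by simp
qed

text \<open>
  The angle condition says that the tangent of the angle is less than \<open>1 / l\<^sub>0\<close>. As the inequality is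
  strict, there is room for a Lipschitz constant \<open>K\<close> above \<open>l\<^sub>0\<close>.
\<close>

lemma admissible_imp_cone:
  fixes \<nu> :: "'a::euclidean_space \<times> real"
  assumes "admissible \<psi> \<nu>"
  obtains K where "K > 0" "spatial_grad_norm \<infinity> \<psi> < ennreal K" "K * norm (fst \<nu>) < snd \<nu>"
proof -
  define c s where "c = snd \<nu>" and "s = norm (fst \<nu>)"
  define l0 where "l0 = spatial_grad_norm \<infinity> \<psi>"
  have n: "norm \<nu> = 1" and ang: "arccos c < (if l0 = 0 then pi / 2 else arctan (enn2real (1 / l0)))"
  proof -
    have "\<nu> \<bullet> e\<^sub>n = c" by (simp add: e\<^sub>n_def c_def inner_prod_def)
    with assms show "norm \<nu> = 1" "arccos c < (if l0 = 0 then pi / 2 else arctan (enn2real (1 / l0)))"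
      unfolding admissible_def Let_def l0_def by metis+
  qed
  have sc: "s\<^sup>2 + c\<^sup>2 = 1"
    using n by (simp add: norm_prod_def s_def c_def)
  have s0: "s \<ge> 0" by (simp add: s_def)
  have "c\<^sup>2 \<le> 1" using sc zero_le_power2[of s] by linarith
  then have c1: "-1 \<le> c" "c \<le> 1" by (auto simp: abs_square_le_1 abs_le_iff)
  have "arccos c < pi / 2"
  proof (cases "l0 = 0")
    case False
    then show ?thesis using ang arctan_ubound[of "enn2real (1 / l0)"] by simp
  qed (use ang in simp)
  moreover have a0: "0 \<le> arccos c" using c1 by (rule arccos_lbound)
  ultimately have "0 < cos (arccos c)" by (intro cos_gt_zero_pi) auto
  then have c0: "c > 0" using c1 by (simp add: cos_arccos)
  have "\<exists>K>0. l0 < ennreal K \<and> K * s < c"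
  proof (cases "l0 = 0")
    case True
    have "c / (2 * (s + 1)) * s < c" using c0 s0 by (simp add: field_simps add_nonneg_pos)
    then show ?thesis using True c0 s0 by (intro exI[of _ "c / (2 * (s + 1))"]) simp
  next
    case False
    have "l0 \<noteq> top"
    proof
      assume "l0 = top"
      then show False using ang a0 by simp
    qed
    then obtain l where l: "l0 = ennreal l" "l > 0"
      using False by (cases l0 rule: ennreal_cases) (auto simp: less_le)
    have "1 / l0 = ennreal (1 / l)" using l by (simp add: divide_ennreal ennreal_1[symmetric] del: ennreal_1)
    then have "arccos c < arctan (1 / l)" using ang False l by simp
    then have "tan (arccos c) < tan (arctan (1 / l))"
      using a0 arctan_ubound[of "1 / l"] by (intro tan_monotone) auto
    then have "tan (arccos c) < 1 / l" by (simp only: tan_arctan)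
    moreover have "tan (arccos c) = s / c"
    proof -
      have "sin (arccos c) = sqrt (1 - c\<^sup>2)" using c1 by (simp add: sin_arccos)
      also have "1 - c\<^sup>2 = s\<^sup>2" using sc by simp
      finally show ?thesis using c1 s0 by (simp add: tan_def cos_arccos)
    qed
    ultimately have sl: "s * l < c" using l c0 by (simp add: field_simps)
    define K where "K = l + (c - s * l) / (2 * (s + 1))"
    have "K > l" using sl s0 by (simp add: K_def)
    moreover have "K * s < c"
    proof -
      have "(c - s * l) / (2 * (s + 1)) * s \<le> (c - s * l) / 2"
        using sl s0 by (simp add: field_simps)
      then have "K * s \<le> l * s + (c - s * l) / 2" by (simp add: K_def distrib_right)
      also have "\<dots> < c"
      proof -
        have "a + (d - a) / 2 < d" if "a < d" for a d :: real using that by (simp add: field_simps)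
        then show ?thesis using sl unfolding mult.commute[of l s] .
      qed
      finally show ?thesis .
    qed
    ultimately show ?thesis using l by (intro exI[of _ K]) (simp add: ennreal_less_iff)
  qed
  then show ?thesis using that unfolding l0_def c_def s_def by blast
qed

locale graph_direction =
  fixes \<psi> :: "'a::euclidean_space \<times> real \<Rightarrow> real" and \<nu> :: "'a \<times> real" and Q :: "'a \<Rightarrow> 'a \<times> real" and K :: real
  assumes \<psi>_continuous: "continuous_on UNIV \<psi>"
    and \<psi>_Lipschitz: "\<And>y u t. \<bar>\<psi> (y, t) - \<psi> (u, t)\<bar> \<le> K * norm (y - u)"
    and K: "K > 0"
    and norm_\<nu>: "norm \<nu> = 1"
    and cone: "K * norm (fst \<nu>) < snd \<nu>"
    and Q: "isometry_onto_perp \<nu> Q"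
begin

definition \<delta> where "\<delta> = snd \<nu> - K * norm (fst \<nu>)"

lemma \<delta>_pos: "\<delta> > 0" using cone by (simp add: \<delta>_def)

lemma Q_linear: "linear Q" and Q_norm: "norm (Q y) = norm y" and Q_range: "range Q = {x. x \<bullet> \<nu> = 0}"
  using Q by (auto simp: isometry_onto_perp_def)

lemma Q_perp: "Q y \<bullet> \<nu> = 0" using Q_range by blast

lemma Q_perp': "\<nu> \<bullet> Q y = 0"
  by (subst inner_commute) (rule Q_perp)

lemma \<nu>_inner: "\<nu> \<bullet> \<nu> = 1" using norm_\<nu> by (simp add: dot_square_norm)

lemma Q_continuous: "continuous_on A Q"
  using Q_linear by (intro linear_continuous_on) (simp add: linear_conv_bounded_linear)

lemma decomposition: obtains y where "x = Q y + (x \<bullet> \<nu>) *\<^sub>R \<nu>"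
proof -
  have "(x - (x \<bullet> \<nu>) *\<^sub>R \<nu>) \<bullet> \<nu> = 0" by (simp add: inner_diff_left \<nu>_inner)
  then obtain y where "x - (x \<bullet> \<nu>) *\<^sub>R \<nu> = Q y" using Q_range by auto
  then have "x = Q y + (x \<bullet> \<nu>) *\<^sub>R \<nu>" by (simp add: algebra_simps)
  then show ?thesis using that by blast
qed

lemma decomposition_unique:
  assumes "Q y + r *\<^sub>R \<nu> = Q y' + r' *\<^sub>R \<nu>"
  shows "y = y' \<and> r = r'"
proof -
  have "(Q y + r *\<^sub>R \<nu>) \<bullet> \<nu> = (Q y' + r' *\<^sub>R \<nu>) \<bullet> \<nu>" using assms by simp
  then have r: "r = r'" by (simp add: inner_add_left Q_perp \<nu>_inner)
  then have "Q (y - y') = 0" using assms linear_diff[OF Q_linear] by simp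
  then have "norm (y - y') = 0" using Q_norm by (metis norm_zero)
  then show ?thesis using r by simp
qed

text \<open>
  The height above the graph strictly increases along every line in direction \<open>\<nu>\<close>; its zero is the
  value of the new graph function.
\<close>

definition height :: "'a \<times> real \<Rightarrow> real \<Rightarrow> real" where
  "height z r = snd (Q (fst z) + r *\<^sub>R \<nu>) - \<psi> (fst (Q (fst z) + r *\<^sub>R \<nu>), snd z)"

lemma height_increasing:
  assumes "r \<le> r'"
  shows "height z r' - height z r \<ge> \<delta> * (r' - r)"
proof -
  have "\<psi> (fst (Q (fst z) + r' *\<^sub>R \<nu>), snd z) - \<psi> (fst (Q (fst z) + r *\<^sub>R \<nu>), snd z)
     \<le> K * norm (fst (Q (fst z) + r' *\<^sub>R \<nu>) - fst (Q (fst z) + r *\<^sub>R \<nu>))"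
    using \<psi>_Lipschitz abs_le_D1 by blast
  also have "fst (Q (fst z) + r' *\<^sub>R \<nu>) - fst (Q (fst z) + r *\<^sub>R \<nu>) = (r' - r) *\<^sub>R fst \<nu>"
    by (simp add: scaleR_left_diff_distrib)
  also have "K * norm ((r' - r) *\<^sub>R fst \<nu>) = K * norm (fst \<nu>) * (r' - r)"
    using assms by simp
  finally show ?thesis by (simp add: height_def \<delta>_def algebra_simps)
qed

lemma height_continuous: "continuous_on UNIV (\<lambda>z. height z r)" "continuous_on UNIV (height z)"
  unfolding height_def[abs_def]
  by (intro continuous_intros continuous_on_compose2[OF \<psi>_continuous] continuous_on_compose2[OF Q_continuous]; auto)+

lemma height_zero: "\<exists>r. height z r = 0"
proof -
  define b where "b = \<bar>height z 0\<bar> / \<delta>"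
  have b: "b \<ge> 0" using \<delta>_pos by (simp add: b_def)
  have d: "\<delta> * b = \<bar>height z 0\<bar>" using \<delta>_pos by (simp add: b_def)
  have "height z (- b) \<le> 0" using height_increasing[of "- b" 0 z] b d by simp
  moreover have "0 \<le> height z b" using height_increasing[of 0 b z] b d by simp
  ultimately show ?thesis
    using IVT'[of "height z" "- b" 0 b] b continuous_on_subset[OF height_continuous(2)] by auto
qed

definition graph_fun :: "'a \<times> real \<Rightarrow> real" where "graph_fun z = (SOME r. height z r = 0)"

lemma height_graph_fun: "height z (graph_fun z) = 0"
  unfolding graph_fun_def using someI_ex[OF height_zero] .

lemma height_pos_iff: "height z r > 0 \<longleftrightarrow> r > graph_fun z"
proof
  assume "height z r > 0"
  then show "r > graph_fun z"
    using height_increasing[of r "graph_fun z" z] height_graph_fun[of z] \<delta>_pos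
    by (cases "r \<le> graph_fun z") (auto simp: mult_nonneg_nonneg, smt (verit) mult_nonneg_nonneg)
next
  assume r: "r > graph_fun z"
  then have "0 < \<delta> * (r - graph_fun z)" using \<delta>_pos by simp
  then show "height z r > 0"
    using height_increasing[of "graph_fun z" r z] height_graph_fun[of z] r by simp
qed

lemma height_zero_iff: "height z r = 0 \<longleftrightarrow> r = graph_fun z"
proof
  assume h: "height z r = 0"
  show "r = graph_fun z"
  proof (rule ccontr)
    assume "r \<noteq> graph_fun z"
    then consider "r < graph_fun z" | "r > graph_fun z" by linarith
    then show False
    proof cases
      case 1
      then have "0 < \<delta> * (graph_fun z - r)" using \<delta>_pos by simp
      then show False using height_increasing[of r "graph_fun z" z] height_graph_fun[of z] h 1 by simp
    next
      case 2
      then show False using height_pos_iff[of z r] h by simp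
    qed
  qed
qed (simp add: height_graph_fun)

lemma in_graph_domain_iff: "(Q y + r *\<^sub>R \<nu>, t) \<in> graph_domain \<psi> \<longleftrightarrow> r > graph_fun (y, t)"
  unfolding height_pos_iff[symmetric]
  by (simp add: graph_domain_def height_def case_prod_beta)

lemma graph_domain_eq: "graph_domain \<psi> = {(Q y + r *\<^sub>R \<nu>, t) | y r t. r > graph_fun (y, t)}"
proof (intro equalityI subsetI)
  fix p assume p: "p \<in> graph_domain \<psi>"
  obtain x t where xt: "p = (x, t)" by (cases p)
  obtain y where y: "x = Q y + (x \<bullet> \<nu>) *\<^sub>R \<nu>" using decomposition .
  then have "x \<bullet> \<nu> > graph_fun (y, t)"
    using in_graph_domain_iff[of y "x \<bullet> \<nu>" t] p xt by simp
  then show "p \<in> {(Q y + r *\<^sub>R \<nu>, t) | y r t. r > graph_fun (y, t)}" using xt y by blast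
qed (auto simp: in_graph_domain_iff)

lemma dir_graph_fun_eq: "dir_graph_fun \<psi> \<nu> Q = graph_fun"
  unfolding dir_graph_fun_def
proof (rule the_equality)
  show "graph_domain \<psi> = {(Q y + r *\<^sub>R \<nu>, t) | y r t. r > graph_fun (y, t)}" by (rule graph_domain_eq)
next
  fix g assume g: "graph_domain \<psi> = {(Q y + r *\<^sub>R \<nu>, t) | y r t. r > g (y, t)}"
  show "g = graph_fun"
  proof
    fix z :: "'a \<times> real"
    obtain y t where z: "z = (y, t)" by (cases z)
    have "r > g z \<longleftrightarrow> r > graph_fun z" for r
    proof -
      have "r > g z \<longleftrightarrow> (Q y + r *\<^sub>R \<nu>, t) \<in> graph_domain \<psi>"
        unfolding g z using decomposition_unique by blast
      then show ?thesis by (simp add: in_graph_domain_iff z)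
    qed
    then show "g z = graph_fun z" by (metis less_irrefl linorder_cases)
  qed
qed

text \<open>
  At a fixed time, \<open>\<Phi>\<close> takes the parameter of a boundary point over the hyperplane orthogonal to \<open>\<nu>\<close>
  to its parameter over the horizontal hyperplane, and \<open>\<Xi>\<close>, defined below, goes back.
\<close>

definition \<Phi> :: "'a \<times> real \<Rightarrow> 'a" where "\<Phi> z = fst (Q (fst z) + graph_fun z *\<^sub>R \<nu>)"

lemma point_eq: "Q (fst z) + graph_fun z *\<^sub>R \<nu> = (\<Phi> z, \<psi> (\<Phi> z, snd z))"
  using height_graph_fun[of z] by (intro prod_eqI) (simp_all add: \<Phi>_def height_def)

lemma dir_graph_map_eq: "dir_graph_map \<psi> \<nu> Q z = graph_map \<psi> (\<Phi> z, snd z)"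
  using point_eq[of z] by (simp add: dir_graph_map_def graph_map_def dir_graph_fun_eq case_prod_beta)

definition coord :: "'a \<times> real \<Rightarrow> 'a" where "coord x = (SOME y. x = Q y + (x \<bullet> \<nu>) *\<^sub>R \<nu>)"

lemma coord: "x = Q (coord x) + (x \<bullet> \<nu>) *\<^sub>R \<nu>"
  unfolding coord_def by (rule someI_ex) (metis decomposition)

lemma coord_eq: "coord (Q y + r *\<^sub>R \<nu>) = y"
  using coord[of "Q y + r *\<^sub>R \<nu>"] decomposition_unique by metis

lemma coord_Lipschitz: "norm (coord x - coord x') \<le> norm (x - x')"
proof -
  define w r where "w = coord x - coord x'" and "r = (x - x') \<bullet> \<nu>"
  have "x - x' = Q w + r *\<^sub>R \<nu>"
  proof -
    have "x - x' = (Q (coord x) + (x \<bullet> \<nu>) *\<^sub>R \<nu>) - (Q (coord x') + (x' \<bullet> \<nu>) *\<^sub>R \<nu>)"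
      by (simp only: coord[symmetric])
    also have "\<dots> = Q w + r *\<^sub>R \<nu>"
      unfolding w_def r_def linear_diff[OF Q_linear] by (simp add: algebra_simps inner_diff_left)
    finally show ?thesis .
  qed
  then have "(norm (x - x'))\<^sup>2 = (Q w + r *\<^sub>R \<nu>) \<bullet> (Q w + r *\<^sub>R \<nu>)"
    by (simp add: dot_square_norm)
  also have "\<dots> = Q w \<bullet> Q w + r * r"
    by (simp add: inner_add_left inner_add_right Q_perp Q_perp' \<nu>_inner)
  also have "Q w \<bullet> Q w = (norm w)\<^sup>2" by (simp add: dot_square_norm Q_norm)
  finally have "(norm (x - x'))\<^sup>2 = (norm w)\<^sup>2 + r * r" .
  then have "(norm w)\<^sup>2 \<le> (norm (x - x'))\<^sup>2" by simp
  then show ?thesis unfolding w_def by (rule power2_le_imp_le) simp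
qed

definition \<Xi> :: "'a \<times> real \<Rightarrow> 'a" where "\<Xi> z = coord (fst z, \<psi> z)"

lemma \<Xi>_\<Phi>: "\<Xi> (\<Phi> z, snd z) = fst z"
  unfolding \<Xi>_def fst_conv point_eq[symmetric] by (rule coord_eq)

lemma \<Phi>_\<Xi>: "\<Phi> (\<Xi> z, snd z) = fst z"
proof -
  define x where "x = (fst z, \<psi> z)"
  have x: "x = Q (\<Xi> z) + (x \<bullet> \<nu>) *\<^sub>R \<nu>" unfolding \<Xi>_def x_def[symmetric] by (rule coord)
  have "height (\<Xi> z, snd z) (x \<bullet> \<nu>) = 0"
    unfolding height_def fst_conv snd_conv x[symmetric] by (simp add: x_def)
  then have "graph_fun (\<Xi> z, snd z) = x \<bullet> \<nu>" by (simp add: height_zero_iff)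
  then have "\<Phi> (\<Xi> z, snd z) = fst x" unfolding \<Phi>_def fst_conv using x by simp
  then show ?thesis by (simp add: x_def)
qed

lemma \<Xi>_Lipschitz: "norm (\<Xi> (x, t) - \<Xi> (x', t)) \<le> (1 + K) * norm (x - x')"
proof -
  have "norm (\<Xi> (x, t) - \<Xi> (x', t)) \<le> norm ((x - x', \<psi> (x, t) - \<psi> (x', t)))"
    unfolding \<Xi>_def using coord_Lipschitz[of "(x, \<psi> (x, t))" "(x', \<psi> (x', t))"] by simp
  also have "\<dots> \<le> norm (x - x') + norm (\<psi> (x, t) - \<psi> (x', t))" by (rule norm_Pair_le)
  also have "\<dots> \<le> (1 + K) * norm (x - x')" using \<psi>_Lipschitz[of x t x'] by (simp add: distrib_right)
  finally show ?thesis .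
qed

lemma \<Phi>_Lipschitz: "norm (\<Phi> (y, t) - \<Phi> (y', t)) \<le> (1 + (1 + K) / \<delta>) * norm (y - y')"
proof -
  define w \<rho> where "w = y - y'" and "\<rho> = graph_fun (y, t) - graph_fun (y', t)"
  have d: "(\<Phi> (y, t), \<psi> (\<Phi> (y, t), t)) - (\<Phi> (y', t), \<psi> (\<Phi> (y', t), t)) = Q w + \<rho> *\<^sub>R \<nu>"
  proof -
    have p: "(\<Phi> (z, t), \<psi> (\<Phi> (z, t), t)) = Q z + graph_fun (z, t) *\<^sub>R \<nu>" for z
      using point_eq[of "(z, t)"] by simp
    show ?thesis
      unfolding p w_def \<rho>_def linear_diff[OF Q_linear] by (simp add: algebra_simps)
  qed
  have d1: "\<Phi> (y, t) - \<Phi> (y', t) = fst (Q w) + \<rho> *\<^sub>R fst \<nu>" using arg_cong[OF d, of fst] by simp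
  have d2: "\<psi> (\<Phi> (y, t), t) - \<psi> (\<Phi> (y', t), t) = snd (Q w) + \<rho> * snd \<nu>" using arg_cong[OF d, of snd] by simp
  have q: "norm (fst (Q w)) \<le> norm w" "\<bar>snd (Q w)\<bar> \<le> norm w"
    using norm_fst_le[of "fst (Q w)" "snd (Q w)"] norm_snd_le[of "snd (Q w)" "fst (Q w)"] Q_norm[of w] by auto
  have s0: "snd \<nu> > 0" using cone K by (smt (verit) mult_nonneg_nonneg norm_ge_zero)
  have n1: "norm (\<Phi> (y, t) - \<Phi> (y', t)) \<le> norm w + \<bar>\<rho>\<bar> * norm (fst \<nu>)"
    unfolding d1 using norm_triangle_ineq[of "fst (Q w)" "\<rho> *\<^sub>R fst \<nu>"] q(1) by simp
  have "\<bar>\<rho>\<bar> * snd \<nu> = \<bar>\<rho> * snd \<nu>\<bar>" using s0 by (simp add: abs_mult)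
  also have "\<dots> \<le> \<bar>snd (Q w) + \<rho> * snd \<nu>\<bar> + \<bar>snd (Q w)\<bar>" by simp
  also have "\<dots> \<le> K * norm (\<Phi> (y, t) - \<Phi> (y', t)) + norm w"
    using \<psi>_Lipschitz[of "\<Phi> (y, t)" t "\<Phi> (y', t)"] q(2) d2 by simp
  also have "\<dots> \<le> K * (norm w + \<bar>\<rho>\<bar> * norm (fst \<nu>)) + norm w"
    using n1 K by (intro add_right_mono mult_left_mono) auto
  finally have "\<bar>\<rho>\<bar> * \<delta> \<le> (1 + K) * norm w" by (simp add: \<delta>_def algebra_simps)
  then have \<rho>: "\<bar>\<rho>\<bar> \<le> (1 + K) / \<delta> * norm w" using \<delta>_pos by (simp add: pos_le_divide_eq)
  have "norm (fst \<nu>) \<le> 1" using norm_fst_le[of "fst \<nu>" "snd \<nu>"] norm_\<nu> by simp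
  then have "\<bar>\<rho>\<bar> * norm (fst \<nu>) \<le> \<bar>\<rho>\<bar>" by (simp add: mult_left_le)
  with n1 \<rho> show ?thesis by (simp add: w_def distrib_right)
qed

definition Lip where "Lip = max (1 + K) (1 + (1 + K) / \<delta>)"

lemma Lip_pos: "Lip > 0" using K by (simp add: Lip_def less_max_iff_disj)

lemma \<Phi>_biLipschitz: "biLipschitz (\<lambda>y. \<Phi> (y, t)) (\<lambda>x. \<Xi> (x, t)) Lip"
  and \<Xi>_biLipschitz: "biLipschitz (\<lambda>x. \<Xi> (x, t)) (\<lambda>y. \<Phi> (y, t)) Lip"
proof -
  have 1: "norm (\<Phi> (y, t) - \<Phi> (y', t)) \<le> Lip * norm (y - y')" for y y'
    by (rule order_trans[OF \<Phi>_Lipschitz]) (simp add: Lip_def mult_right_mono)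
  have 2: "norm (\<Xi> (y, t) - \<Xi> (y', t)) \<le> Lip * norm (y - y')" for y y'
    by (rule order_trans[OF \<Xi>_Lipschitz]) (simp add: Lip_def mult_right_mono)
  have 3: "\<Phi> (\<Xi> (x, t), t) = x" for x using \<Phi>_\<Xi>[of "(x, t)"] by simp
  have 4: "\<Xi> (\<Phi> (y, t), t) = y" for y using \<Xi>_\<Phi>[of "(y, t)"] by simp
  show "biLipschitz (\<lambda>y. \<Phi> (y, t)) (\<lambda>x. \<Xi> (x, t)) Lip"
    by unfold_locales (use 1 2 3 4 Lip_pos in auto)
  show "biLipschitz (\<lambda>x. \<Xi> (x, t)) (\<lambda>y. \<Phi> (y, t)) Lip"
    by unfold_locales (use 1 2 3 4 Lip_pos in auto)
qed

lemma graph_fun_measurable: "graph_fun \<in> borel_measurable borel"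
proof (rule borel_measurable_iff_less[THEN iffD2], intro allI)
  fix a
  have "{z. graph_fun z < a} = {z. 0 < height z a}" by (simp add: height_pos_iff)
  also have "\<dots> \<in> sets borel"
    by (intro borel_open open_Collect_less continuous_on_const height_continuous)
  finally show "{z \<in> space borel. graph_fun z < a} \<in> sets borel" by simp
qed

lemma \<Phi>_time_biLipschitz: "time_biLipschitz \<Phi> \<Xi> Lip"
proof (rule time_biLipschitz.intro)
  have "(\<lambda>z. fst (Q (fst z)) + graph_fun z *\<^sub>R fst \<nu>) \<in> borel_measurable borel"
    by (intro borel_measurable_add borel_measurable_scaleR graph_fun_measurable borel_measurable_const
        borel_measurable_continuous_onI continuous_intros continuous_on_compose2[OF Q_continuous]) auto
  then show "\<Phi> \<in> borel_measurable borel" by (simp add: \<Phi>_def[abs_def])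
qed (rule \<Phi>_biLipschitz)

lemma \<Xi>_time_biLipschitz: "time_biLipschitz \<Xi> \<Phi> Lip"
proof (rule time_biLipschitz.intro)
  have "1-lipschitz_on UNIV coord" using coord_Lipschitz by (intro lipschitz_onI) (auto simp: dist_norm)
  then have "continuous_on UNIV coord" by (rule lipschitz_on_continuous_on)
  then have "continuous_on UNIV \<Xi>"
    unfolding \<Xi>_def[abs_def] by (rule continuous_on_compose2) (auto intro!: continuous_intros \<psi>_continuous)
  then show "\<Xi> \<in> borel_measurable borel" by (rule borel_measurable_continuous_onI)
qed (rule \<Xi>_biLipschitz)

lemma pull_back_dir: "f \<circ> dir_graph_map \<psi> \<nu> Q = (\<lambda>z. (f \<circ> graph_map \<psi>) (\<Phi> z, snd z))"
  by (auto simp: dir_graph_map_eq)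

lemma pull_back_standard: "f \<circ> graph_map \<psi> = (\<lambda>z. (f \<circ> dir_graph_map \<psi> \<nu> Q) (\<Xi> z, snd z))"
  using \<Phi>_\<Xi> by (auto simp: dir_graph_map_eq)

theorem gradient_norms_comparable:
  assumes "1 \<le> p"
  shows "spatial_grad_norm p (f \<circ> dir_graph_map \<psi> \<nu> Q)
      \<le> ennreal (DIM('a) * Lip * (1 + Lip ^ DIM('a))) * spatial_grad_norm p (f \<circ> graph_map \<psi>)"
    and "spatial_grad_norm p (f \<circ> graph_map \<psi>)
      \<le> ennreal (DIM('a) * Lip * (1 + Lip ^ DIM('a))) * spatial_grad_norm p (f \<circ> dir_graph_map \<psi> \<nu> Q)"
  using time_biLipschitz.spatial_grad_norm_compose_le[OF \<Phi>_time_biLipschitz assms, of "f \<circ> graph_map \<psi>"]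
    time_biLipschitz.spatial_grad_norm_compose_le[OF \<Xi>_time_biLipschitz assms, of "f \<circ> dir_graph_map \<psi> \<nu> Q"]
  unfolding pull_back_dir[symmetric] pull_back_standard[symmetric] by simp_all

end

theorem gradient_norms_comparable_admissible:
  assumes \<psi>: "\<psi> \<in> Lip_1_half" and adm: "admissible \<psi> \<nu>" and Q: "isometry_onto_perp \<nu> Q" and p: "1 \<le> p"
  shows "\<exists>C>0::real. \<forall>f :: (('a::euclidean_space) \<times> real) \<times> real \<Rightarrow> real.
     spatial_grad_norm p (f \<circ> dir_graph_map \<psi> \<nu> Q) \<le> ennreal C * spatial_grad_norm p (f \<circ> graph_map \<psi>) \<and>
     spatial_grad_norm p (f \<circ> graph_map \<psi>) \<le> ennreal C * spatial_grad_norm p (f \<circ> dir_graph_map \<psi> \<nu> Q)"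
proof -
  note cont = Lip_1_half_continuous[OF \<psi>]
  obtain K where K: "K > 0" "spatial_grad_norm \<infinity> \<psi> < ennreal K" "K * norm (fst \<nu>) < snd \<nu>"
    using admissible_imp_cone[OF adm] .
  interpret graph_direction \<psi> \<nu> Q K
    by unfold_locales
       (use cont spatial_grad_norm_imp_Lipschitz[OF cont K(2)] K Q adm in \<open>auto simp: admissible_def\<close>)
  show ?thesis
    using gradient_norms_comparable[OF p] Lip_pos
    by (intro exI[of _ "DIM('a) * Lip * (1 + Lip ^ DIM('a))"]) (simp add: add_pos_pos)
qed

section \<open>The Fourier transform and the half-order derivative in one variable\<close>

lemma smooth_cos: "smooth (\<lambda>s::real. cos (a * s + b))"
proof
  fix k
  show "Ck k (\<lambda>s::real. cos (a * s + b))"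
  proof (induction k arbitrary: b)
    case 0
    show ?case by (simp, intro continuous_intros)
  next
    case (Suc k)
    have d: "((\<lambda>s::real. cos (a * s + b)) has_derivative (\<lambda>v. (a * v) * cos (a * x + (b + pi / 2)))) (at x)" for x
    proof -
      have "cos (a * x + (b + pi / 2)) = - sin (a * x + b)"
        using cos_add[of "a * x + b" "pi / 2"] by (simp add: add.assoc)
      then show ?thesis by (auto intro!: derivative_eq_intros simp: algebra_simps)
    qed
    show ?case
      by (rule Ck_SucI[OF d]) (rule Ck_mult[OF Ck_const Suc])
  qed
qed

lemma smooth_sin: "smooth (\<lambda>s::real. sin (a * s))"
proof -
  have "sin (a * s) = cos (a * s + - (pi / 2))" for s by (simp add: cos_diff)
  then show ?thesis using smooth_cos[of a "- (pi / 2)"] by simp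
qed

definition fourier :: "(real \<Rightarrow> real) \<Rightarrow> real \<Rightarrow> complex" where
  "fourier f \<tau> = (LINT s|lborel. cis (- \<tau> * s) * of_real (f s))"

definition half_deriv :: "(real \<Rightarrow> real) \<Rightarrow> real \<Rightarrow> real" where
  "half_deriv f t = Re (1 / (2 * of_real pi) *
     (LINT \<tau>|lborel. of_real (sqrt \<bar>\<tau>\<bar>) * cis (\<tau> * t) * fourier f \<tau>))"

lemma half_time_deriv_slice: "half_time_deriv \<phi> (y, t) = half_deriv (\<lambda>s. \<phi> (y, s)) t"
  by (simp add: half_time_deriv_def half_deriv_def fourier_def)

lemma cis_measurable [measurable]: "cis \<in> borel_measurable borel"
  by (intro borel_measurable_continuous_onI continuous_on_cis continuous_intros)

lemma fourier_integrable:
  assumes "integrable lborel f"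
  shows "integrable lborel (\<lambda>s. cis (- \<tau> * s) * of_real (f s) :: complex)"
proof (rule Bochner_Integration.integrable_bound[OF assms])
  have [measurable]: "f \<in> borel_measurable borel" using assms by simp
  show "(\<lambda>s. cis (- \<tau> * s) * of_real (f s) :: complex) \<in> borel_measurable lborel" by measurable
qed (simp add: norm_mult)

lemma norm_fourier_le:
  assumes "integrable lborel f"
  shows "norm (fourier f \<tau>) \<le> (LINT s|lborel. \<bar>f s\<bar>)"
  unfolding fourier_def
  by (rule order_trans[OF integral_norm_bound]) (simp add: norm_mult)

lemma fourier_measurable:
  assumes [measurable]: "f \<in> borel_measurable borel"
  shows "fourier f \<in> borel_measurable borel"
  unfolding fourier_def[abs_def] by measurable

lemma fourier_eq:
  assumes f: "integrable lborel f"
  shows "fourier f \<tau> = Complex (LINT s|lborel. cos (\<tau> * s) * f s) (- (LINT s|lborel. sin (\<tau> * s) * f s))"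
proof (rule complex_eqI)
  have "Re (fourier f \<tau>) = (LINT s|lborel. Re (cis (- \<tau> * s) * of_real (f s)))"
    unfolding fourier_def by (rule integral_Re[OF fourier_integrable[OF f], symmetric])
  then show "Re (fourier f \<tau>) = Re (Complex (LINT s|lborel. cos (\<tau> * s) * f s) (- (LINT s|lborel. sin (\<tau> * s) * f s)))"
    by simp
  have "Im (fourier f \<tau>) = (LINT s|lborel. Im (cis (- \<tau> * s) * of_real (f s)))"
    unfolding fourier_def by (rule integral_Im[OF fourier_integrable[OF f], symmetric])
  then show "Im (fourier f \<tau>) = Im (Complex (LINT s|lborel. cos (\<tau> * s) * f s) (- (LINT s|lborel. sin (\<tau> * s) * f s)))"
    by simp
qed

lemma fourier_derivative:
  assumes f: "f \<in> test_functions"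
  shows "fourier (\<lambda>s. frechet_derivative f (at s) 1) \<tau> = \<i> * of_real \<tau> * fourier f \<tau>"
proof -
  have dc: "frechet_derivative (\<lambda>s. cos (\<tau> * s)) (at s) 1 = - \<tau> * sin (\<tau> * s)" for s
  proof -
    have "((\<lambda>s. cos (\<tau> * s)) has_derivative (\<lambda>v. - sin (\<tau> * s) * (\<tau> * v))) (at s)"
      by (auto intro!: derivative_eq_intros)
    from frechet_derivative_at[OF this, symmetric] show ?thesis by simp
  qed
  have ds: "frechet_derivative (\<lambda>s. sin (\<tau> * s)) (at s) 1 = \<tau> * cos (\<tau> * s)" for s
  proof -
    have "((\<lambda>s. sin (\<tau> * s)) has_derivative (\<lambda>v. cos (\<tau> * s) * (\<tau> * v))) (at s)"
      by (auto intro!: derivative_eq_intros)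
    from frechet_derivative_at[OF this, symmetric] show ?thesis by simp
  qed
  have sc: "smooth (\<lambda>s. cos (\<tau> * s))" using smooth_cos[of \<tau> 0] by simp
  have "(LINT s|lborel. cos (\<tau> * s) * frechet_derivative f (at s) 1) = \<tau> * (LINT s|lborel. sin (\<tau> * s) * f s)"
    using smooth_integration_by_parts[OF sc f, of 1] by (simp add: dc mult.assoc)
  moreover have "(LINT s|lborel. sin (\<tau> * s) * frechet_derivative f (at s) 1) = - \<tau> * (LINT s|lborel. cos (\<tau> * s) * f s)"
    using smooth_integration_by_parts[OF smooth_sin f, of \<tau> 1] by (simp add: ds mult.assoc)
  ultimately show ?thesis
    using fourier_eq[OF test_integrable[OF f]] fourier_eq[OF test_integrable[OF test_derivative[OF f]]]
    by (simp add: complex_eq_iff)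
qed

text \<open>The symbol of this operator is \<open>1 + \<tau>\<^sup>2\<close>; two applications give all the decay that is needed.\<close>

definition bessel :: "'a::euclidean_space \<Rightarrow> ('a \<Rightarrow> real) \<Rightarrow> 'a \<Rightarrow> real" where
  "bessel e \<phi> = (\<lambda>z. \<phi> z + - 1 * frechet_derivative (\<lambda>z. frechet_derivative \<phi> (at z) e) (at z) e)"

lemma bessel_test: "\<phi> \<in> test_functions \<Longrightarrow> bessel e \<phi> \<in> test_functions"
  unfolding bessel_def by (intro test_add test_scale test_derivative)

lemma fourier_bessel:
  assumes f: "f \<in> test_functions"
  shows "fourier (bessel 1 f) \<tau> = of_real (1 + \<tau>\<^sup>2) * fourier f \<tau>"
proof -
  define g where "g = (\<lambda>z. frechet_derivative (\<lambda>z. frechet_derivative f (at z) 1) (at z) 1)"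
  have g: "g \<in> test_functions" unfolding g_def by (intro test_derivative f)
  have "fourier g \<tau> = (\<i> * of_real \<tau>) * ((\<i> * of_real \<tau>) * fourier f \<tau>)"
    unfolding g_def by (simp only: fourier_derivative[OF test_derivative[OF f]] fourier_derivative[OF f])
  also have "\<dots> = - of_real (\<tau>\<^sup>2) * fourier f \<tau>" by (simp add: complex_eq_iff power2_eq_square algebra_simps)
  finally have 1: "fourier g \<tau> = - of_real (\<tau>\<^sup>2) * fourier f \<tau>" .
  have "fourier (bessel 1 f) \<tau> = (LINT s|lborel. cis (- \<tau> * s) * of_real (f s) - cis (- \<tau> * s) * of_real (g s))"
    unfolding fourier_def bessel_def g_def by (simp add: algebra_simps)
  also have "\<dots> = fourier f \<tau> - fourier g \<tau>"
    unfolding fourier_def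
    by (intro Bochner_Integration.integral_diff fourier_integrable test_integrable f g)
  finally show ?thesis using 1 by (simp add: algebra_simps)
qed

lemma fourier_decay:
  assumes f: "f \<in> test_functions"
  shows "fourier f \<tau> = of_real (1 / (1 + \<tau>\<^sup>2)\<^sup>2) * fourier (bessel 1 (bessel 1 f)) \<tau>"
proof -
  have "fourier (bessel 1 (bessel 1 f)) \<tau> = of_real ((1 + \<tau>\<^sup>2)\<^sup>2) * fourier f \<tau>"
    by (simp only: fourier_bessel[OF bessel_test[OF f]] fourier_bessel[OF f] power2_eq_square[of "1 + \<tau>\<^sup>2"] of_real_mult mult.assoc)
  moreover have "(1 + \<tau>\<^sup>2)\<^sup>2 \<noteq> 0" using zero_le_power2[of \<tau>] by (simp add: add_nonneg_eq_0_iff)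
  ultimately show ?thesis by (simp add: of_real_mult[symmetric] mult.assoc[symmetric] del: of_real_mult of_real_add of_real_power)
qed

lemma integrable_inverse_1_plus_square': "integrable lborel (\<lambda>\<tau>::real. 1 / (1 + \<tau>\<^sup>2))"
  using integrable_inverse_1_plus_square by (simp add: set_integrable_def inverse_eq_divide)

lemma sqrt_le_1_plus_square: "sqrt \<bar>\<tau>\<bar> \<le> 1 + \<tau>\<^sup>2"
proof -
  have "sqrt \<bar>\<tau>\<bar> \<le> sqrt ((1 + \<tau>\<^sup>2)\<^sup>2)"
  proof (rule real_sqrt_le_mono)
    have "\<bar>\<tau>\<bar> \<le> 1 + \<tau>\<^sup>2"
      using zero_le_power2[of "\<bar>\<tau>\<bar> - 1 / 2"] by (simp add: power2_eq_square algebra_simps)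
    also have "1 + \<tau>\<^sup>2 \<le> (1 + \<tau>\<^sup>2)\<^sup>2" by (rule self_le_power) simp_all
    finally show "\<bar>\<tau>\<bar> \<le> (1 + \<tau>\<^sup>2)\<^sup>2" .
  qed
  then show ?thesis by simp
qed

text \<open>A dominating function for everything that is integrated against \<open>fourier f\<close> below.\<close>

lemma fourier_bound:
  assumes f: "f \<in> test_functions" and A: "(LINT s|lborel. \<bar>bessel 1 (bessel 1 f) s\<bar>) \<le> A"
  shows "(1 + \<tau>\<^sup>2) * norm (fourier f \<tau>) \<le> A * (1 / (1 + \<tau>\<^sup>2))"
proof -
  have p: "1 + \<tau>\<^sup>2 > 0" by (simp add: add_pos_nonneg)
  have "norm (fourier f \<tau>) = 1 / (1 + \<tau>\<^sup>2)\<^sup>2 * norm (fourier (bessel 1 (bessel 1 f)) \<tau>)"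
    by (subst fourier_decay[OF f]) (simp only: norm_mult norm_of_real, simp)
  also have "\<dots> \<le> 1 / (1 + \<tau>\<^sup>2)\<^sup>2 * A"
    using norm_fourier_le[OF test_integrable[OF bessel_test[OF bessel_test[OF f]]]] A
    by (intro mult_left_mono) (auto intro: order_trans)
  finally have "(1 + \<tau>\<^sup>2) * norm (fourier f \<tau>) \<le> (1 + \<tau>\<^sup>2) * (1 / (1 + \<tau>\<^sup>2)\<^sup>2 * A)"
    using p by (intro mult_left_mono) auto
  also have "\<dots> = A * (1 / (1 + \<tau>\<^sup>2))" using p by (simp add: power2_eq_square)
  finally show ?thesis .
qed

lemma fourier_weighted_integrable:
  assumes f: "f \<in> test_functions" and [measurable]: "m \<in> borel_measurable borel"
    and m: "\<And>\<tau>. norm (m \<tau>) \<le> 1 + \<tau>\<^sup>2"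
  shows "integrable lborel (\<lambda>\<tau>. (m \<tau> :: complex) * fourier f \<tau>)"
proof -
  define A where "A = (LINT s|lborel. \<bar>bessel 1 (bessel 1 f) s\<bar>)"
  have [measurable]: "fourier f \<in> borel_measurable borel" by (rule fourier_measurable[OF test_measurable[OF f]])
  have A: "A \<ge> 0" unfolding A_def by simp
  show ?thesis
  proof (rule Bochner_Integration.integrable_bound[of lborel "\<lambda>\<tau>. A * (1 / (1 + \<tau>\<^sup>2))"])
    show "integrable lborel (\<lambda>\<tau>. A * (1 / (1 + \<tau>\<^sup>2)))"
      by (intro integrable_mult_right integrable_inverse_1_plus_square')
    show "AE \<tau> in lborel. norm (m \<tau> * fourier f \<tau>) \<le> norm (A * (1 / (1 + \<tau>\<^sup>2)))"
    proof (rule AE_I2)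
      fix \<tau>
      have "norm (m \<tau> * fourier f \<tau>) \<le> (1 + \<tau>\<^sup>2) * norm (fourier f \<tau>)"
        unfolding norm_mult by (rule mult_right_mono[OF m]) simp
      also have "\<dots> \<le> A * (1 / (1 + \<tau>\<^sup>2))" by (rule fourier_bound[OF f]) (simp add: A_def)
      finally show "norm (m \<tau> * fourier f \<tau>) \<le> norm (A * (1 / (1 + \<tau>\<^sup>2)))" using A by simp
    qed
  qed measurable
qed

lemma half_deriv_integrable:
  assumes "f \<in> test_functions"
  shows "integrable lborel (\<lambda>\<tau>. of_real (sqrt \<bar>\<tau>\<bar>) * cis (\<tau> * t) * fourier f \<tau>)"
  by (rule fourier_weighted_integrable[OF assms]) (auto simp: norm_mult sqrt_le_1_plus_square)

lemma half_deriv_bound: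
  assumes f: "f \<in> test_functions" and A: "(LINT s|lborel. \<bar>bessel 1 (bessel 1 f) s\<bar>) \<le> A"
  shows "\<bar>half_deriv f t\<bar> \<le> A * (LINT \<tau>|lborel. 1 / (1 + \<tau>\<^sup>2))"
proof -
  have "\<bar>half_deriv f t\<bar> \<le> norm (1 / (2 * of_real pi) * (LINT \<tau>|lborel. of_real (sqrt \<bar>\<tau>\<bar>) * cis (\<tau> * t) * fourier f \<tau>))"
    unfolding half_deriv_def by (rule abs_Re_le_cmod)
  also have "\<dots> \<le> 1 * norm (LINT \<tau>|lborel. of_real (sqrt \<bar>\<tau>\<bar>) * cis (\<tau> * t) * fourier f \<tau>)"
    unfolding norm_mult using pi_ge_two by (intro mult_right_mono) (auto simp: norm_divide norm_mult field_simps)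
  also have "\<dots> \<le> (LINT \<tau>|lborel. A * (1 / (1 + \<tau>\<^sup>2)))"
    unfolding mult_1
  proof (rule Bochner_Integration.integral_norm_bound_integral[OF half_deriv_integrable[OF f]])
    show "integrable lborel (\<lambda>\<tau>. A * (1 / (1 + \<tau>\<^sup>2)))"
      by (intro integrable_mult_right integrable_inverse_1_plus_square')
    fix \<tau>
    have "norm (of_real (sqrt \<bar>\<tau>\<bar>) * cis (\<tau> * t) * fourier f \<tau>) \<le> (1 + \<tau>\<^sup>2) * norm (fourier f \<tau>)"
      by (simp add: norm_mult mult_right_mono sqrt_le_1_plus_square)
    also have "\<dots> \<le> A * (1 / (1 + \<tau>\<^sup>2))" by (rule fourier_bound[OF f A])
    finally show "norm (of_real (sqrt \<bar>\<tau>\<bar>) * cis (\<tau> * t) * fourier f \<tau>) \<le> A * (1 / (1 + \<tau>\<^sup>2))" .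
  qed
  also have "\<dots> = A * (LINT \<tau>|lborel. 1 / (1 + \<tau>\<^sup>2))" by (rule integral_mult_right_zero)
  finally show ?thesis .
qed

lemma half_deriv_measurable:
  assumes [measurable]: "f \<in> borel_measurable borel"
  shows "half_deriv f \<in> borel_measurable borel"
  unfolding half_deriv_def[abs_def] fourier_def by measurable

lemma half_deriv_linear_combination:
  assumes f: "f \<in> test_functions" and g: "g \<in> test_functions"
  shows "half_deriv (\<lambda>s. a * (f s + c * g s)) t = a * (half_deriv f t + c * half_deriv g t)"
proof -
  have lin: "complex_of_real a * (w * F + of_real c * (w * G)) = w * (of_real a * (F + of_real c * G))" for w F G
    by (simp add: algebra_simps)
  have F: "fourier (\<lambda>s. a * (f s + c * g s)) \<tau> = of_real a * (fourier f \<tau> + of_real c * fourier g \<tau>)" for \<tau>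
  proof -
    note i = fourier_integrable[OF test_integrable[OF f], of \<tau>] fourier_integrable[OF test_integrable[OF g], of \<tau>]
    have "of_real a * (fourier f \<tau> + of_real c * fourier g \<tau>)
      = (LINT s|lborel. of_real a * (cis (- \<tau> * s) * of_real (f s) + of_real c * (cis (- \<tau> * s) * of_real (g s))))"
      unfolding fourier_def
      by (simp only: integral_mult_right_zero Bochner_Integration.integral_add[OF i(1) integrable_mult_right[OF i(2)]])
    also have "\<dots> = fourier (\<lambda>s. a * (f s + c * g s)) \<tau>"
      unfolding fourier_def lin by (simp only: of_real_mult of_real_add)
    finally show ?thesis by (rule sym)
  qed
  note i = half_deriv_integrable[OF f, of t] half_deriv_integrable[OF g, of t]
  define I where "I f = (LINT \<tau>|lborel. of_real (sqrt \<bar>\<tau>\<bar>) * cis (\<tau> * t) * fourier f \<tau>)" for f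
  have "I (\<lambda>s. a * (f s + c * g s)) = of_real a * (I f + of_real c * I g)"
    unfolding I_def F lin[symmetric]
    by (simp only: integral_mult_right_zero Bochner_Integration.integral_add[OF i(1) integrable_mult_right[OF i(2)]])
  then have "half_deriv (\<lambda>s. a * (f s + c * g s)) t
    = Re (of_real a * (1 / (2 * of_real pi) * I f + of_real c * (1 / (2 * of_real pi) * I g)))"
    unfolding half_deriv_def I_def[symmetric] by (simp only: distrib_left mult.left_commute)
  moreover have "Re (of_real a * (w + of_real c * w')) = a * (Re w + c * Re w')" for w w' by simp
  ultimately show ?thesis by (simp only: half_deriv_def I_def)
qed

text \<open>By Fubini's theorem. Since \<open>sqrt \<bar>\<tau>\<bar>\<close> is even, the right-hand side is symmetric in the two functions.\<close>

lemma half_deriv_pairing: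
  assumes f: "f \<in> test_functions" and k: "k \<in> test_functions"
  shows "(LINT t|lborel. f t * half_deriv k t) =
    Re (1 / (2 * of_real pi) * (LINT \<tau>|lborel. of_real (sqrt \<bar>\<tau>\<bar>) * fourier f (- \<tau>) * fourier k \<tau>))"
proof -
  have [measurable]: "f \<in> borel_measurable borel" "k \<in> borel_measurable borel"
    using test_measurable f k by auto
  have [measurable]: "fourier k \<in> borel_measurable borel" by (rule fourier_measurable) measurable
  define F where "F = (\<lambda>t \<tau>. of_real (f t) * (of_real (sqrt \<bar>\<tau>\<bar>) * cis (\<tau> * t) * fourier k \<tau>) :: complex)"
  have int_ft: "integrable (lborel \<Otimes>\<^sub>M lborel) (case_prod F)"
  proof (rule lborel_pair.Fubini_integrable)
    show "case_prod F \<in> borel_measurable (lborel \<Otimes>\<^sub>M lborel)"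
      unfolding F_def by measurable
    have e: "(LINT \<tau>|lborel. norm (case_prod F (t, \<tau>))) = \<bar>f t\<bar> * (LINT \<tau>|lborel. norm (of_real (sqrt \<bar>\<tau>\<bar>) * fourier k \<tau>))" for t
      by (simp add: F_def norm_mult)
    show "integrable lborel (\<lambda>t. LINT \<tau>|lborel. norm (case_prod F (t, \<tau>)))"
      unfolding e using test_integrable[OF f] by simp
    show "AE t in lborel. integrable lborel (\<lambda>\<tau>. case_prod F (t, \<tau>))"
      unfolding F_def using half_deriv_integrable[OF k] by (intro AE_I2) simp
  qed
  have "(LINT t|lborel. f t * half_deriv k t) = (LINT t|lborel. Re (1 / (2 * of_real pi) * (LINT \<tau>|lborel. F t \<tau>)))"
  proof (intro Bochner_Integration.integral_cong refl)
    fix t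
    have "(LINT \<tau>|lborel. F t \<tau>) = of_real (f t) * (LINT \<tau>|lborel. of_real (sqrt \<bar>\<tau>\<bar>) * cis (\<tau> * t) * fourier k \<tau>)"
      unfolding F_def by (rule integral_mult_right_zero)
    then show "f t * half_deriv k t = Re (1 / (2 * of_real pi) * (LINT \<tau>|lborel. F t \<tau>))"
      by (simp add: half_deriv_def Re_divide_of_real mult.left_commute flip: of_real_mult)
  qed
  also have "\<dots> = Re (LINT t|lborel. 1 / (2 * of_real pi) * (LINT \<tau>|lborel. F t \<tau>))"
    using lborel_pair.integrable_fst[OF int_ft] by (intro integral_Re integrable_mult_right)
  also have "(LINT t|lborel. 1 / (2 * of_real pi) * (LINT \<tau>|lborel. F t \<tau>)) = 1 / (2 * of_real pi) * (LINT t|lborel. LINT \<tau>|lborel. F t \<tau>)"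
    by (rule integral_mult_right_zero)
  also have "(LINT t|lborel. LINT \<tau>|lborel. F t \<tau>) = (LINT \<tau>|lborel. LINT t|lborel. F t \<tau>)"
    by (rule lborel_pair.Fubini_integral[OF int_ft, symmetric])
  also have "\<dots> = (LINT \<tau>|lborel. of_real (sqrt \<bar>\<tau>\<bar>) * fourier f (- \<tau>) * fourier k \<tau>)"
  proof (intro Bochner_Integration.integral_cong refl)
    fix \<tau>
    have "(LINT t|lborel. F t \<tau>) = (LINT t|lborel. (of_real (sqrt \<bar>\<tau>\<bar>) * fourier k \<tau>) * (cis (- (- \<tau>) * t) * of_real (f t)))"
      unfolding F_def by (simp add: mult_ac)
    also have "\<dots> = (of_real (sqrt \<bar>\<tau>\<bar>) * fourier k \<tau>) * fourier f (- \<tau>)"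
      unfolding fourier_def[of f] by (rule integral_mult_right_zero)
    finally show "(LINT t|lborel. F t \<tau>) = of_real (sqrt \<bar>\<tau>\<bar>) * fourier f (- \<tau>) * fourier k \<tau>" by (simp add: mult_ac)
  qed
  finally show ?thesis .
qed

lemma half_deriv_self_adjoint:
  assumes f: "f \<in> test_functions" and k: "k \<in> test_functions"
  shows "(LINT t|lborel. f t * half_deriv k t) = (LINT t|lborel. half_deriv f t * k t)"
proof -
  have "(LINT \<tau>|lborel. of_real (sqrt \<bar>\<tau>\<bar>) * fourier f (- \<tau>) * fourier k \<tau>)
      = (LINT \<tau>|lborel. of_real (sqrt \<bar>\<tau>\<bar>) * fourier k (- \<tau>) * fourier f \<tau>)"
  proof -
    have [measurable]: "fourier f \<in> borel_measurable borel" "fourier k \<in> borel_measurable borel"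
      using fourier_measurable test_measurable f k by auto
    have "(LINT \<tau>|lborel. of_real (sqrt \<bar>\<tau>\<bar>) * fourier k (- \<tau>) * fourier f \<tau>)
      = (LINT \<tau>|lborel. of_real (sqrt \<bar>0 - \<tau>\<bar>) * fourier k (- (0 - \<tau>)) * fourier f (0 - \<tau>))"
      by (rule lborel_integral_reflection[symmetric, of "\<lambda>\<tau>. of_real (sqrt \<bar>\<tau>\<bar>) * fourier k (- \<tau>) * fourier f \<tau>" 0]) measurable
    then show ?thesis by (simp add: mult_ac)
  qed
  with half_deriv_pairing[OF f k] half_deriv_pairing[OF k f]
  have "(LINT t|lborel. f t * half_deriv k t) = (LINT t|lborel. k t * half_deriv f t)"
    by (simp only:)
  then show ?thesis by (simp add: mult.commute)
qed

subsection \<open>Fourier inversion\<close>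

lemma gaussian_fourier:
  assumes e: "\<epsilon> > 0"
  shows "(LINT \<tau>|lborel. of_real (exp (- (\<epsilon> * \<tau>)\<^sup>2 / 2)) * cis (\<tau> * u)) = (of_real (2 * pi / \<epsilon> * std_normal_density (u / \<epsilon>)) :: complex)"
proof -
  have "char std_normal_distribution (u / \<epsilon>) = (LINT x|lborel. std_normal_density x *\<^sub>R iexp (u / \<epsilon> * x))"
    unfolding char_def by (subst integral_density) (auto simp: normal_density_nonneg)
  also have "\<dots> = \<bar>\<epsilon>\<bar> *\<^sub>R (LINT x|lborel. std_normal_density (0 + \<epsilon> * x) *\<^sub>R iexp (u / \<epsilon> * (0 + \<epsilon> * x)))"
    by (rule lborel_integral_real_affine) (use e in simp)
  also have "\<dots> = \<epsilon> *\<^sub>R (LINT x|lborel. (1 / sqrt (2 * pi)) *\<^sub>R (of_real (exp (- (\<epsilon> * x)\<^sup>2 / 2)) * cis (x * u)))"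
    using e by (simp add: std_normal_density_def cis_conv_exp scaleR_conv_of_real mult_ac)
  also have "\<dots> = (\<epsilon> / sqrt (2 * pi)) *\<^sub>R (LINT x|lborel. of_real (exp (- (\<epsilon> * x)\<^sup>2 / 2)) * cis (x * u))"
    by (simp only: integral_scaleR_right scaleR_scaleR) simp
  finally have "(\<epsilon> / sqrt (2 * pi)) *\<^sub>R (LINT x|lborel. of_real (exp (- (\<epsilon> * x)\<^sup>2 / 2)) * cis (x * u)) = (of_real (exp (- (u / \<epsilon>)\<^sup>2 / 2)) :: complex)"
    by (simp add: char_std_normal_distribution)
  then have "(sqrt (2 * pi) / \<epsilon>) *\<^sub>R ((\<epsilon> / sqrt (2 * pi)) *\<^sub>R (LINT x|lborel. of_real (exp (- (\<epsilon> * x)\<^sup>2 / 2)) * cis (x * u)))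
     = (sqrt (2 * pi) / \<epsilon>) *\<^sub>R (of_real (exp (- (u / \<epsilon>)\<^sup>2 / 2)) :: complex)" by simp
  then have "(LINT x|lborel. of_real (exp (- (\<epsilon> * x)\<^sup>2 / 2)) * cis (x * u))
     = (sqrt (2 * pi) / \<epsilon>) *\<^sub>R (of_real (exp (- (u / \<epsilon>)\<^sup>2 / 2)) :: complex)"
    using e by simp
  also have "\<dots> = of_real (sqrt (2 * pi) / \<epsilon> * exp (- (u / \<epsilon>)\<^sup>2 / 2))" by (simp add: scaleR_conv_of_real)
  also have "sqrt (2 * pi) / \<epsilon> * exp (- (u / \<epsilon>)\<^sup>2 / 2) = 2 * pi / \<epsilon> * std_normal_density (u / \<epsilon>)"
  proof -
    define q where "q = sqrt (2 * pi)"
    have q: "2 * pi = q * q" "q > 0" by (simp_all add: q_def)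
    have "q / \<epsilon> * E = 2 * pi / \<epsilon> * (1 / q * E)" for E
      unfolding q(1) using q(2) by simp
    then show ?thesis by (simp only: std_normal_density_def q_def)
  qed
  finally show ?thesis .
qed

text \<open>
  A Gaussian factor makes Fubini's theorem applicable and turns the integral into an average of \<open>f\<close> over a
  shrinking Gaussian; then the factor is removed by dominated convergence.
\<close>

lemma fourier_inversion:
  assumes f: "f \<in> test_functions"
  shows "(LINT \<tau>|lborel. cis (\<tau> * t) * fourier f \<tau>) = of_real (2 * pi * f t)"
proof -
  have [measurable]: "f \<in> borel_measurable borel" using test_measurable[OF f] .
  have [measurable]: "fourier f \<in> borel_measurable borel" by (rule fourier_measurable) measurable
  define \<epsilon> where "\<epsilon> n = 1 / real (Suc n)" for n
  have \<epsilon>: "\<epsilon> n > 0" for n by (simp add: \<epsilon>_def)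
  have \<epsilon>0: "\<epsilon> \<longlonglongrightarrow> 0" unfolding \<epsilon>_def using LIMSEQ_inverse_real_of_nat by (simp add: inverse_eq_divide)
  obtain M where M: "M > 0" "\<And>x. \<bar>f x\<bar> \<le> M" using test_bounded[OF f] by blast
  have eq: "(LINT \<tau>|lborel. of_real (exp (- (\<epsilon> n * \<tau>)\<^sup>2 / 2)) * (cis (\<tau> * t) * fourier f \<tau>))
      = (of_real (2 * pi * (LINT x|lborel. std_normal_density x * f (t - \<epsilon> n * x))) :: complex)" for n
  proof -
    define F where "F = (\<lambda>\<tau> s. of_real (exp (- (\<epsilon> n * \<tau>)\<^sup>2 / 2)) * cis (\<tau> * (t - s)) * of_real (f s) :: complex)"
    have ig: "integrable lborel (\<lambda>\<tau>. exp (- (\<epsilon> n * \<tau>)\<^sup>2 / 2))"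
    proof -
      have "integrable lborel (\<lambda>x. sqrt (2 * pi) * std_normal_density (0 + \<epsilon> n * x))"
        using lborel_integrable_real_affine[of "std_normal_density" "\<epsilon> n" 0] \<epsilon>[of n]
          integrable_std_normal_moment[of 0] by (intro integrable_mult_right) simp
      then show ?thesis by (simp add: std_normal_density_def)
    qed
    have iF: "integrable (lborel \<Otimes>\<^sub>M lborel) (case_prod F)"
    proof (rule lborel_pair.Fubini_integrable)
      show "case_prod F \<in> borel_measurable (lborel \<Otimes>\<^sub>M lborel)" unfolding F_def by measurable
      have e: "(LINT s|lborel. norm (case_prod F (\<tau>, s))) = exp (- (\<epsilon> n * \<tau>)\<^sup>2 / 2) * (LINT s|lborel. \<bar>f s\<bar>)" for \<tau>
        by (simp add: F_def norm_mult)
      show "integrable lborel (\<lambda>\<tau>. LINT s|lborel. norm (case_prod F (\<tau>, s)))"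
        unfolding e using ig by simp
      show "AE \<tau> in lborel. integrable lborel (\<lambda>s. case_prod F (\<tau>, s))"
      proof (rule AE_I2)
        fix \<tau>
        show "integrable lborel (\<lambda>s. case_prod F (\<tau>, s))"
          by (rule Bochner_Integration.integrable_bound[OF test_integrable[OF f]])
             (auto simp: F_def norm_mult mult_left_le_one_le)
      qed
    qed
    have "(LINT \<tau>|lborel. of_real (exp (- (\<epsilon> n * \<tau>)\<^sup>2 / 2)) * (cis (\<tau> * t) * fourier f \<tau>)) = (LINT \<tau>|lborel. LINT s|lborel. F \<tau> s)"
    proof (intro Bochner_Integration.integral_cong refl)
      fix \<tau>
      have "F \<tau> s = (of_real (exp (- (\<epsilon> n * \<tau>)\<^sup>2 / 2)) * cis (\<tau> * t)) * (cis (- \<tau> * s) * of_real (f s))" for s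
        unfolding F_def by (simp add: cis_mult right_diff_distrib mult.assoc[symmetric])
      then have "(LINT s|lborel. F \<tau> s) = (of_real (exp (- (\<epsilon> n * \<tau>)\<^sup>2 / 2)) * cis (\<tau> * t)) * fourier f \<tau>"
        unfolding fourier_def by (simp only: integral_mult_right_zero)
      then show "of_real (exp (- (\<epsilon> n * \<tau>)\<^sup>2 / 2)) * (cis (\<tau> * t) * fourier f \<tau>) = (LINT s|lborel. F \<tau> s)"
        by (simp add: mult.assoc)
    qed
    also have "\<dots> = (LINT s|lborel. LINT \<tau>|lborel. F \<tau> s)"
      by (rule lborel_pair.Fubini_integral[OF iF, symmetric])
    also have "\<dots> = (LINT s|lborel. of_real (2 * pi / \<epsilon> n * (std_normal_density ((t - s) / \<epsilon> n) * f s)))"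
    proof (intro Bochner_Integration.integral_cong refl)
      fix s
      have "(LINT \<tau>|lborel. F \<tau> s) = of_real (2 * pi / \<epsilon> n * std_normal_density ((t - s) / \<epsilon> n)) * of_real (f s)"
        unfolding F_def by (simp only: integral_mult_left_zero gaussian_fourier[OF \<epsilon>])
      then show "(LINT \<tau>|lborel. F \<tau> s) = of_real (2 * pi / \<epsilon> n * (std_normal_density ((t - s) / \<epsilon> n) * f s))"
        by (simp add: mult.assoc)
    qed
    also have "\<dots> = of_real (2 * pi / \<epsilon> n * (LINT s|lborel. std_normal_density ((t - s) / \<epsilon> n) * f s))"
      by (simp only: integral_complex_of_real integral_mult_right_zero)
    also have "(LINT s|lborel. std_normal_density ((t - s) / \<epsilon> n) * f s) =
       \<bar>- \<epsilon> n\<bar> *\<^sub>R (LINT x|lborel. std_normal_density ((t - (t + - \<epsilon> n * x)) / \<epsilon> n) * f (t + - \<epsilon> n * x))"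
      by (rule lborel_integral_real_affine) (use \<epsilon>[of n] in simp)
    also have "2 * pi / \<epsilon> n * \<dots> = 2 * pi * (LINT x|lborel. std_normal_density x * f (t - \<epsilon> n * x))"
      using \<epsilon>[of n] by simp
    finally show ?thesis .
  qed
  have L1: "(\<lambda>n. LINT \<tau>|lborel. of_real (exp (- (\<epsilon> n * \<tau>)\<^sup>2 / 2)) * (cis (\<tau> * t) * fourier f \<tau>))
      \<longlonglongrightarrow> (LINT \<tau>|lborel. cis (\<tau> * t) * fourier f \<tau>)"
  proof (rule integral_dominated_convergence[where w = "\<lambda>\<tau>. norm (cis (\<tau> * t) * fourier f \<tau>)"])
    show "integrable lborel (\<lambda>\<tau>. norm (cis (\<tau> * t) * fourier f \<tau>))"
      by (intro integrable_norm fourier_weighted_integrable[OF f]) auto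
    show "AE \<tau> in lborel. (\<lambda>n. of_real (exp (- (\<epsilon> n * \<tau>)\<^sup>2 / 2)) * (cis (\<tau> * t) * fourier f \<tau>)) \<longlonglongrightarrow> cis (\<tau> * t) * fourier f \<tau>"
    proof (rule AE_I2)
      fix \<tau>
      have "(\<lambda>n. of_real (exp (- (\<epsilon> n * \<tau>)\<^sup>2 / 2)) * (cis (\<tau> * t) * fourier f \<tau>)) \<longlonglongrightarrow> of_real (exp (- (0 * \<tau>)\<^sup>2 / 2)) * (cis (\<tau> * t) * fourier f \<tau>)"
        by (intro tendsto_intros \<epsilon>0) simp
      then show "(\<lambda>n. of_real (exp (- (\<epsilon> n * \<tau>)\<^sup>2 / 2)) * (cis (\<tau> * t) * fourier f \<tau>)) \<longlonglongrightarrow> cis (\<tau> * t) * fourier f \<tau>" by simp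
    qed
  qed (auto simp: norm_mult mult_left_le_one_le)
  have L2: "(\<lambda>n. LINT x|lborel. std_normal_density x * f (t - \<epsilon> n * x)) \<longlonglongrightarrow> (LINT x|lborel. std_normal_density x * f t)"
  proof (rule integral_dominated_convergence[where w = "\<lambda>x. std_normal_density x * M"])
    show "integrable lborel (\<lambda>x. std_normal_density x * M)"
      using integrable_std_normal_moment[of 0] by simp
    show "AE x in lborel. (\<lambda>n. std_normal_density x * f (t - \<epsilon> n * x)) \<longlonglongrightarrow> std_normal_density x * f t"
    proof (rule AE_I2)
      fix x
      have "isCont f t" using test_continuous[OF f, of UNIV] by (simp add: continuous_on_eq_continuous_at)
      moreover have "(\<lambda>n. t - \<epsilon> n * x) \<longlonglongrightarrow> t - 0 * x" by (intro tendsto_intros \<epsilon>0)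
      ultimately have "(\<lambda>n. f (t - \<epsilon> n * x)) \<longlonglongrightarrow> f t" using isCont_tendsto_compose by auto
      then show "(\<lambda>n. std_normal_density x * f (t - \<epsilon> n * x)) \<longlonglongrightarrow> std_normal_density x * f t"
        by (intro tendsto_intros)
    qed
    show "AE x in lborel. norm (std_normal_density x * f (t - \<epsilon> n * x)) \<le> std_normal_density x * M" for n
      using M by (intro AE_I2) (auto simp: abs_mult normal_density_nonneg intro!: mult_mono)
  qed auto
  have one: "(LINT x|lborel. std_normal_density x) = 1"
    using integral_std_normal_moment_even[of 0] by simp
  have "(\<lambda>n. of_real (2 * pi * (LINT x|lborel. std_normal_density x * f (t - \<epsilon> n * x))) :: complex)
     \<longlonglongrightarrow> of_real (2 * pi * (LINT x|lborel. std_normal_density x * f t))"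
    by (intro tendsto_intros L2)
  then have "(\<lambda>n. of_real (2 * pi * (LINT x|lborel. std_normal_density x * f (t - \<epsilon> n * x))) :: complex)
     \<longlonglongrightarrow> of_real (2 * pi * f t)" using one by simp
  then show ?thesis using L1 unfolding eq by (rule LIMSEQ_unique[rotated])
qed

subsection \<open>Modulated test functions\<close>

lemma modulated_test: "\<omega> \<in> test_functions \<Longrightarrow> (\<lambda>s. \<omega> s * cos (N * s)) \<in> test_functions"
  using test_mult[of "\<lambda>s. cos (N * s)" \<omega>] smooth_cos[of N 0] by (simp add: mult.commute)

lemma fourier_modulated:
  assumes \<omega>: "\<omega> \<in> test_functions"
  shows "fourier (\<lambda>s. \<omega> s * cos (N * s)) \<tau> = (fourier \<omega> (\<tau> - N) + fourier \<omega> (\<tau> + N)) / 2"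
proof -
  have pt: "cis (- \<tau> * s) * of_real (\<omega> s * cos (N * s)) =
     1 / 2 * (cis (- (\<tau> - N) * s) * of_real (\<omega> s) + cis (- (\<tau> + N) * s) * of_real (\<omega> s))" for s
  proof -
    have "(of_real (cos (N * s)) :: complex) = 1 / 2 * (cis (N * s) + cis (- (N * s)))"
      by (simp add: complex_eq_iff)
    moreover have "cis (- (\<tau> - N) * s) = cis (- \<tau> * s) * cis (N * s)"
      "cis (- (\<tau> + N) * s) = cis (- \<tau> * s) * cis (- (N * s))"
      by (simp_all add: cis_mult algebra_simps)
    ultimately show ?thesis by (simp add: algebra_simps)
  qed
  show ?thesis
    unfolding fourier_def pt integral_mult_right_zero
    by (subst Bochner_Integration.integral_add[OF fourier_integrable fourier_integrable])
       (auto intro: test_integrable[OF \<omega>])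
qed

text \<open>
  On the frequencies near \<open>N\<close> and \<open>- N\<close>, where the transform of a modulated test function lives, the
  symbol \<open>sqrt \<bar>\<tau>\<bar>\<close> is nearly the constant \<open>sqrt N\<close>.
\<close>

lemma half_deriv_modulated:
  assumes \<omega>: "\<omega> \<in> test_functions"
  obtains C where "C \<ge> 0"
    "\<And>N t. N > 0 \<Longrightarrow> \<bar>half_deriv (\<lambda>s. \<omega> s * cos (N * s)) t - sqrt N * (\<omega> t * cos (N * t))\<bar> \<le> C / sqrt N"
proof -
  have [measurable]: "fourier \<omega> \<in> borel_measurable borel" by (rule fourier_measurable[OF test_measurable[OF \<omega>]])
  define C where "C = (LINT \<tau>|lborel. \<bar>\<tau>\<bar> * norm (fourier \<omega> \<tau>))"
  have abs_le: "\<bar>\<tau>\<bar> \<le> 1 + \<tau>\<^sup>2" for \<tau> :: real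
    using zero_le_power2[of "\<bar>\<tau>\<bar> - 1 / 2"] by (simp add: power2_eq_square algebra_simps)
  have iC: "integrable lborel (\<lambda>\<tau>. \<bar>\<tau>\<bar> * norm (fourier \<omega> \<tau>))"
    using integrable_norm[OF fourier_weighted_integrable[OF \<omega>, of "\<lambda>\<tau>. of_real \<tau>"]] abs_le
    by (simp add: norm_mult)
  have bound: "\<bar>half_deriv (\<lambda>s. \<omega> s * cos (N * s)) t - sqrt N * (\<omega> t * cos (N * t))\<bar> \<le> C / sqrt N" if N: "N > 0" for N t
  proof -
    define \<theta> where "\<theta> s = \<omega> s * cos (N * s)" for s
    have \<theta>: "\<theta> \<in> test_functions" unfolding \<theta>_def[abs_def] by (rule modulated_test[OF \<omega>])
    have i1: "integrable lborel (\<lambda>\<tau>. of_real (sqrt \<bar>\<tau>\<bar>) * cis (\<tau> * t) * fourier \<theta> \<tau>)"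
      by (rule half_deriv_integrable[OF \<theta>])
    have i2: "integrable lborel (\<lambda>\<tau>. cis (\<tau> * t) * fourier \<theta> \<tau>)"
      by (rule fourier_weighted_integrable[OF \<theta>]) auto
    have iS: "integrable lborel (\<lambda>\<tau>. \<bar>\<tau> + a\<bar> * norm (fourier \<omega> (\<tau> + a)))" for a
      by (rule lborel_integrable_translation[OF iC])
    have shift: "(LINT \<tau>|lborel. \<bar>\<tau> + a\<bar> * norm (fourier \<omega> (\<tau> + a))) = C" for a
      unfolding C_def by (rule lborel_integral_translation) measurable
    have sq: "\<bar>sqrt \<bar>\<tau>\<bar> - sqrt N\<bar> \<le> \<bar>\<tau> + a\<bar> / sqrt N" if "a = N \<or> a = - N" for \<tau> a
    proof -
      have "\<bar>sqrt \<bar>\<tau>\<bar> - sqrt N\<bar> * sqrt N \<le> \<bar>sqrt \<bar>\<tau>\<bar> - sqrt N\<bar> * (sqrt \<bar>\<tau>\<bar> + sqrt N)"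
        by (intro mult_left_mono) auto
      also have "\<dots> = \<bar>(sqrt \<bar>\<tau>\<bar> - sqrt N) * (sqrt \<bar>\<tau>\<bar> + sqrt N)\<bar>" using N by (simp add: abs_mult)
      also have "(sqrt \<bar>\<tau>\<bar> - sqrt N) * (sqrt \<bar>\<tau>\<bar> + sqrt N) = \<bar>\<tau>\<bar> - N" using N by (simp add: algebra_simps)
      also have "\<bar>\<bar>\<tau>\<bar> - N\<bar> \<le> \<bar>\<tau> + a\<bar>" using that N by auto
      finally show ?thesis using N by (simp add: pos_le_divide_eq)
    qed
    have "of_real (2 * pi) * of_real (sqrt N * \<theta> t) = of_real (sqrt N) * (LINT \<tau>|lborel. cis (\<tau> * t) * fourier \<theta> \<tau>)"
      by (simp add: fourier_inversion[OF \<theta>])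
    then have inv: "of_real (sqrt N * \<theta> t) = 1 / (2 * of_real pi) * (LINT \<tau>|lborel. of_real (sqrt N) * (cis (\<tau> * t) * fourier \<theta> \<tau>))"
      by (simp add: field_simps)
    have "half_deriv \<theta> t - sqrt N * \<theta> t = Re (1 / (2 * of_real pi) * (LINT \<tau>|lborel. of_real (sqrt \<bar>\<tau>\<bar>) * cis (\<tau> * t) * fourier \<theta> \<tau>)
        - of_real (sqrt N * \<theta> t))"
      by (simp add: half_deriv_def)
    also have "\<dots> = Re (1 / (2 * of_real pi) * (LINT \<tau>|lborel. of_real (sqrt \<bar>\<tau>\<bar>) * cis (\<tau> * t) * fourier \<theta> \<tau> - of_real (sqrt N) * (cis (\<tau> * t) * fourier \<theta> \<tau>)))"
      unfolding inv Bochner_Integration.integral_diff[OF i1 integrable_mult_right[OF i2]]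
      by (subst right_diff_distrib) (rule refl)
    finally have e: "half_deriv \<theta> t - sqrt N * \<theta> t = Re (1 / (2 * of_real pi) * (LINT \<tau>|lborel. of_real (sqrt \<bar>\<tau>\<bar>) * cis (\<tau> * t) * fourier \<theta> \<tau> - of_real (sqrt N) * (cis (\<tau> * t) * fourier \<theta> \<tau>)))" .
    have "\<bar>half_deriv \<theta> t - sqrt N * \<theta> t\<bar> \<le> norm (1 / (2 * of_real pi) * (LINT \<tau>|lborel. of_real (sqrt \<bar>\<tau>\<bar>) * cis (\<tau> * t) * fourier \<theta> \<tau> - of_real (sqrt N) * (cis (\<tau> * t) * fourier \<theta> \<tau>)))"
      unfolding e by (rule abs_Re_le_cmod)
    also have "\<dots> \<le> 1 * norm (LINT \<tau>|lborel. of_real (sqrt \<bar>\<tau>\<bar>) * cis (\<tau> * t) * fourier \<theta> \<tau> - of_real (sqrt N) * (cis (\<tau> * t) * fourier \<theta> \<tau>))"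
      unfolding norm_mult using pi_ge_two by (intro mult_right_mono) (auto simp: norm_divide norm_mult field_simps)
    also have "\<dots> \<le> (LINT \<tau>|lborel. (1 / (2 * sqrt N)) * (\<bar>\<tau> + - N\<bar> * norm (fourier \<omega> (\<tau> + - N)) + \<bar>\<tau> + N\<bar> * norm (fourier \<omega> (\<tau> + N))))"
      unfolding mult_1
    proof (rule Bochner_Integration.integral_norm_bound_integral)
      show "integrable lborel (\<lambda>\<tau>. of_real (sqrt \<bar>\<tau>\<bar>) * cis (\<tau> * t) * fourier \<theta> \<tau> - of_real (sqrt N) * (cis (\<tau> * t) * fourier \<theta> \<tau>))"
        by (intro Bochner_Integration.integrable_diff integrable_mult_right i1 i2)
      show "integrable lborel (\<lambda>\<tau>. (1 / (2 * sqrt N)) * (\<bar>\<tau> + - N\<bar> * norm (fourier \<omega> (\<tau> + - N)) + \<bar>\<tau> + N\<bar> * norm (fourier \<omega> (\<tau> + N))))"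
        by (intro integrable_mult_right Bochner_Integration.integrable_add iS)
      fix \<tau>
      have "of_real (sqrt \<bar>\<tau>\<bar>) * cis (\<tau> * t) * fourier \<theta> \<tau> - of_real (sqrt N) * (cis (\<tau> * t) * fourier \<theta> \<tau>) =
        of_real (sqrt \<bar>\<tau>\<bar> - sqrt N) * (cis (\<tau> * t) * fourier \<theta> \<tau>)" by (simp add: algebra_simps)
      then have "norm (of_real (sqrt \<bar>\<tau>\<bar>) * cis (\<tau> * t) * fourier \<theta> \<tau> - of_real (sqrt N) * (cis (\<tau> * t) * fourier \<theta> \<tau>))
         = \<bar>sqrt \<bar>\<tau>\<bar> - sqrt N\<bar> * norm (fourier \<theta> \<tau>)" by (simp only: norm_mult norm_of_real norm_cis mult_1)
      also have "\<dots> \<le> \<bar>sqrt \<bar>\<tau>\<bar> - sqrt N\<bar> * ((norm (fourier \<omega> (\<tau> + - N)) + norm (fourier \<omega> (\<tau> + N))) / 2)"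
        unfolding \<theta>_def[abs_def] fourier_modulated[OF \<omega>]
        by (intro mult_left_mono) (auto simp: norm_divide norm_triangle_ineq)
      also have "\<dots> = (\<bar>sqrt \<bar>\<tau>\<bar> - sqrt N\<bar> * norm (fourier \<omega> (\<tau> + - N)) + \<bar>sqrt \<bar>\<tau>\<bar> - sqrt N\<bar> * norm (fourier \<omega> (\<tau> + N))) / 2"
        by (simp add: distrib_left)
      also have "\<dots> \<le> (\<bar>\<tau> + - N\<bar> / sqrt N * norm (fourier \<omega> (\<tau> + - N)) + \<bar>\<tau> + N\<bar> / sqrt N * norm (fourier \<omega> (\<tau> + N))) / 2"
        using sq[of "- N" \<tau>] sq[of N \<tau>] by (intro divide_right_mono add_mono mult_right_mono) auto
      also have "\<dots> = (1 / (2 * sqrt N)) * (\<bar>\<tau> + - N\<bar> * norm (fourier \<omega> (\<tau> + - N)) + \<bar>\<tau> + N\<bar> * norm (fourier \<omega> (\<tau> + N)))"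
        using N by (simp add: field_simps)
      finally show "norm (of_real (sqrt \<bar>\<tau>\<bar>) * cis (\<tau> * t) * fourier \<theta> \<tau> - of_real (sqrt N) * (cis (\<tau> * t) * fourier \<theta> \<tau>))
        \<le> (1 / (2 * sqrt N)) * (\<bar>\<tau> + - N\<bar> * norm (fourier \<omega> (\<tau> + - N)) + \<bar>\<tau> + N\<bar> * norm (fourier \<omega> (\<tau> + N)))" .
    qed
    also have "\<dots> = (1 / (2 * sqrt N)) * (C + C)"
      by (simp only: integral_mult_right_zero Bochner_Integration.integral_add[OF iS iS] shift)
    also have "\<dots> = C / sqrt N" by simp
    finally show ?thesis by (simp add: \<theta>_def[abs_def])
  qed
  have "C \<ge> 0" unfolding C_def by simp
  then show ?thesis using that bound by blast
qed

subsection \<open>Decay of the half-order derivative\<close>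

lemma integrable_inverse_sqrt: "integrable lborel (\<lambda>\<tau>::real. indicator {-1..1} \<tau> * (1 / sqrt \<bar>\<tau>\<bar>))"
proof -
  define f where "f \<tau> = indicator {0..1} \<tau> * (1 / sqrt \<bar>\<tau>\<bar>)" for \<tau> :: real
  have "(\<lambda>\<tau>::real. \<tau> powr (- 1 / 2)) integrable_on {0..1}"
    using has_integral_powr_from_0[of "- 1 / 2" 1] by (auto simp: integrable_on_def)
  then have "(\<lambda>\<tau>::real. \<tau> powr (- 1 / 2)) absolutely_integrable_on {0..1}"
    by (intro nonnegative_absolutely_integrable_1) auto
  then have "integrable lebesgue (\<lambda>\<tau>::real. indicator {0..1} \<tau> *\<^sub>R \<tau> powr (- 1 / 2))"
    by (simp add: set_integrable_def)
  then have "integrable lborel (\<lambda>\<tau>::real. indicator {0..1} \<tau> *\<^sub>R \<tau> powr (- 1 / 2))"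
    by (subst (asm) integrable_completion) auto
  moreover have "indicator {0..1} \<tau> *\<^sub>R \<tau> powr (- 1 / 2) = f \<tau>" for \<tau>
    by (cases "\<tau> = 0") (auto simp: f_def indicator_def powr_minus_divide powr_half_sqrt)
  ultimately have i: "integrable lborel f" by simp
  have "integrable (distr lborel borel (\<lambda>x. 0 - x)) f" using i by (simp only: lborel_distr_reflection)
  then have i': "integrable lborel (\<lambda>\<tau>. f (0 - \<tau>))" by (subst (asm) integrable_distr_eq) (auto simp: f_def[abs_def])
  show ?thesis
    by (rule Bochner_Integration.integrable_bound[OF Bochner_Integration.integrable_add[OF i i']])
       (auto simp: f_def indicator_def)
qed

text \<open>
  The symbol is not smooth at the origin, but its translation modulus in \<open>L\<^sup>1\<close> is linear because
  \<open>1 / sqrt \<bar>\<tau>\<bar>\<close> is integrable there. Shifting the frequency by \<open>\<pi> / t\<close>, which changes the sign of the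
  exponential, turns this modulus into decay in \<open>t\<close>.
\<close>

lemma half_deriv_symbol_modulus:
  fixes h \<tau> :: real
  assumes h: "\<bar>h\<bar> \<le> 1" and \<tau>: "\<tau> \<noteq> 0"
  shows "\<bar>sqrt \<bar>\<tau> + h\<bar> / (1 + (\<tau> + h)\<^sup>2)\<^sup>2 - sqrt \<bar>\<tau>\<bar> / (1 + \<tau>\<^sup>2)\<^sup>2\<bar>
    \<le> \<bar>h\<bar> * (3 * (indicator {-1..1} \<tau> * (1 / sqrt \<bar>\<tau>\<bar>)) + 19 * (1 / (1 + \<tau>\<^sup>2)))"
proof -
  define k where "k \<tau> = sqrt \<bar>\<tau>\<bar> / (1 + \<tau>\<^sup>2)\<^sup>2" for \<tau> :: real
  define A B where "A = 1 + (\<tau> + h)\<^sup>2" and "B = 1 + \<tau>\<^sup>2"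
  have A: "A \<ge> 1" and B: "B \<ge> 1" by (simp_all add: A_def B_def)
  have h2: "h\<^sup>2 \<le> 1" using h by (simp add: abs_square_le_1)
  have BA: "B \<le> 3 * A"
  proof -
    \<comment> \<open>The square is \<open>6 * (\<tau> + h)\<^sup>2 + 3 * h\<^sup>2 - 2 * \<tau>\<^sup>2\<close>.\<close>
    have "0 \<le> (2 * \<tau> + 3 * h)\<^sup>2" by simp
    then have "2 * \<tau>\<^sup>2 \<le> 6 * (\<tau> + h)\<^sup>2 + 3 * h\<^sup>2" by (simp add: power2_eq_square algebra_simps)
    moreover have "1 + P \<le> 3 * (1 + S)" if "2 * P \<le> 6 * S + 3 * H" "H \<le> 1" for P S H :: real
      using that by argo
    ultimately show ?thesis using h2 unfolding A_def B_def by blast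
  qed
  then have iA: "1 / A \<le> 3 / B" using A B by (simp add: field_simps)
  have abs_le: "\<bar>x\<bar> \<le> 1 + x\<^sup>2" for x :: real
    using zero_le_power2[of "\<bar>x\<bar> - 1 / 2"] by (simp add: power2_eq_square algebra_simps)
  have s: "\<bar>sqrt \<bar>\<tau> + h\<bar> - sqrt \<bar>\<tau>\<bar>\<bar> \<le> \<bar>h\<bar> / sqrt \<bar>\<tau>\<bar>"
  proof -
    have "\<bar>sqrt \<bar>\<tau> + h\<bar> - sqrt \<bar>\<tau>\<bar>\<bar> * sqrt \<bar>\<tau>\<bar> \<le> \<bar>sqrt \<bar>\<tau> + h\<bar> - sqrt \<bar>\<tau>\<bar>\<bar> * (sqrt \<bar>\<tau> + h\<bar> + sqrt \<bar>\<tau>\<bar>)"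
      by (intro mult_left_mono) auto
    also have "\<dots> = \<bar>(sqrt \<bar>\<tau> + h\<bar> - sqrt \<bar>\<tau>\<bar>) * (sqrt \<bar>\<tau> + h\<bar> + sqrt \<bar>\<tau>\<bar>)\<bar>" by (simp add: abs_mult)
    also have "(sqrt \<bar>\<tau> + h\<bar> - sqrt \<bar>\<tau>\<bar>) * (sqrt \<bar>\<tau> + h\<bar> + sqrt \<bar>\<tau>\<bar>) = \<bar>\<tau> + h\<bar> - \<bar>\<tau>\<bar>"
      by (simp add: algebra_simps)
    also have "\<bar>\<bar>\<tau> + h\<bar> - \<bar>\<tau>\<bar>\<bar> \<le> \<bar>h\<bar>" by linarith
    finally show ?thesis using \<tau> by (simp add: pos_le_divide_eq)
  qed
  have s': "1 / sqrt \<bar>\<tau>\<bar> * (1 / B) \<le> indicator {-1..1} \<tau> * (1 / sqrt \<bar>\<tau>\<bar>) + 1 / B"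
  proof (cases "\<bar>\<tau>\<bar> \<le> 1")
    case True
    have le: "1 / sqrt \<bar>\<tau>\<bar> * (1 / B) \<le> 1 / sqrt \<bar>\<tau>\<bar> * 1" using B by (intro mult_left_mono) auto
    have ge: "0 \<le> 1 / B" using B by simp
    have ind: "indicator {-1..1} \<tau> = (1::real)" using True by (simp add: indicator_def abs_le_iff)
    show ?thesis
      using add_increasing2[OF ge le] unfolding ind by (simp only: mult_1 mult_1_right)
  next
    case False
    then have "1 / sqrt \<bar>\<tau>\<bar> \<le> 1" by simp
    then have le: "1 / sqrt \<bar>\<tau>\<bar> * (1 / B) \<le> 1 * (1 / B)" using B by (intro mult_right_mono) auto
    have ind: "indicator {-1..1} \<tau> = (0::real)" using False by (auto simp: indicator_def abs_le_iff)
    show ?thesis using le unfolding ind by (simp only: mult_1 mult_zero_left add_0)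
  qed
  have k: "k (\<tau> + h) - k \<tau> = (sqrt \<bar>\<tau> + h\<bar> - sqrt \<bar>\<tau>\<bar>) / A\<^sup>2 + sqrt \<bar>\<tau>\<bar> * (1 / A\<^sup>2 - 1 / B\<^sup>2)"
    unfolding k_def A_def B_def by (simp add: diff_divide_distrib algebra_simps)
  have t1: "\<bar>(sqrt \<bar>\<tau> + h\<bar> - sqrt \<bar>\<tau>\<bar>) / A\<^sup>2\<bar> \<le> \<bar>h\<bar> / sqrt \<bar>\<tau>\<bar> * (3 * (1 / B))"
  proof -
    have "\<bar>(sqrt \<bar>\<tau> + h\<bar> - sqrt \<bar>\<tau>\<bar>) / A\<^sup>2\<bar> = \<bar>sqrt \<bar>\<tau> + h\<bar> - sqrt \<bar>\<tau>\<bar>\<bar> * (1 / A\<^sup>2)" by (simp add: abs_mult)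
    also have "\<dots> \<le> \<bar>h\<bar> / sqrt \<bar>\<tau>\<bar> * (3 * (1 / B))"
    proof (rule mult_mono[OF s])
      have "1 / A\<^sup>2 \<le> 1 / A" using A by (simp add: field_simps power2_eq_square)
      then show "1 / A\<^sup>2 \<le> 3 * (1 / B)" using iA by simp
    qed (use A in auto)
    finally show ?thesis .
  qed
  have t2: "\<bar>sqrt \<bar>\<tau>\<bar> * (1 / A\<^sup>2 - 1 / B\<^sup>2)\<bar> \<le> 16 * \<bar>h\<bar> * (1 / B)"
  proof -
    have "\<bar>B - A\<bar> \<le> \<bar>h\<bar> * (A + B)"
    proof -
      have "B - A = - h * (\<tau> + (\<tau> + h))" by (simp add: A_def B_def power2_eq_square algebra_simps)
      then have "\<bar>B - A\<bar> = \<bar>h\<bar> * \<bar>\<tau> + (\<tau> + h)\<bar>" by (simp add: abs_mult)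
      also have "\<dots> \<le> \<bar>h\<bar> * (A + B)"
        using abs_le[of \<tau>] abs_le[of "\<tau> + h"] unfolding A_def B_def by (intro mult_left_mono) linarith+
      finally show ?thesis .
    qed
    moreover have "1 / A\<^sup>2 - 1 / B\<^sup>2 = (B - A) * ((A + B) / (A\<^sup>2 * B\<^sup>2))"
      using A B by (simp add: field_simps power2_eq_square)
    ultimately have "\<bar>1 / A\<^sup>2 - 1 / B\<^sup>2\<bar> \<le> \<bar>h\<bar> * (A + B) * ((A + B) / (A\<^sup>2 * B\<^sup>2))"
      using A B by (simp only: abs_mult) (intro mult_mono; simp)
    also have "\<dots> = \<bar>h\<bar> * (1 / A + 1 / B)\<^sup>2" using A B by (simp add: field_simps power2_eq_square)
    also have "\<dots> \<le> \<bar>h\<bar> * (4 / B)\<^sup>2"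
      using iA A B by (intro mult_left_mono power_mono) (auto simp: field_simps)
    finally have 1: "\<bar>1 / A\<^sup>2 - 1 / B\<^sup>2\<bar> \<le> 16 * \<bar>h\<bar> * (1 / B) * (1 / B)" by (simp add: power2_eq_square mult.commute)
    have "\<bar>sqrt \<bar>\<tau>\<bar> * (1 / A\<^sup>2 - 1 / B\<^sup>2)\<bar> = sqrt \<bar>\<tau>\<bar> * \<bar>1 / A\<^sup>2 - 1 / B\<^sup>2\<bar>" by (simp add: abs_mult)
    also have "\<dots> \<le> B * (16 * \<bar>h\<bar> * (1 / B) * (1 / B))"
      using sqrt_le_1_plus_square[of \<tau>] 1 B by (intro mult_mono) (auto simp: B_def)
    also have "\<dots> = 16 * \<bar>h\<bar> * (1 / B)" using B by simp
    finally show ?thesis .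
  qed
  have "\<bar>k (\<tau> + h) - k \<tau>\<bar> \<le> \<bar>h\<bar> / sqrt \<bar>\<tau>\<bar> * (3 * (1 / B)) + 16 * \<bar>h\<bar> * (1 / B)"
    unfolding k by (rule order_trans[OF abs_triangle_ineq add_mono[OF t1 t2]])
  also have "\<dots> = \<bar>h\<bar> * (3 * (1 / sqrt \<bar>\<tau>\<bar> * (1 / B)) + 16 * (1 / B))" by (simp add: algebra_simps)
  also have "\<dots> \<le> \<bar>h\<bar> * (3 * (indicator {-1..1} \<tau> * (1 / sqrt \<bar>\<tau>\<bar>) + 1 / B) + 16 * (1 / B))"
    using s' by (intro mult_left_mono add_right_mono) auto
  also have "\<dots> = \<bar>h\<bar> * (3 * (indicator {-1..1} \<tau> * (1 / sqrt \<bar>\<tau>\<bar>)) + 19 * (1 / B))"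
    by (simp add: algebra_simps)
  finally show ?thesis by (simp only: k_def B_def)
qed

lemma half_deriv_decay:
  assumes f: "f \<in> test_functions"
  obtains C where "C \<ge> 0" "\<And>t. \<bar>half_deriv f t\<bar> \<le> C / (1 + \<bar>t\<bar>)"
proof -
  define b where "b = bessel 1 (bessel 1 f)"
  have b: "b \<in> test_functions" unfolding b_def by (intro bessel_test f)
  define k where "k \<tau> = sqrt \<bar>\<tau>\<bar> / (1 + \<tau>\<^sup>2)\<^sup>2" for \<tau> :: real
  define J where "J \<tau> = 3 * (indicator {-1..1} \<tau> * (1 / sqrt \<bar>\<tau>\<bar>)) + 19 * (1 / (1 + \<tau>\<^sup>2))" for \<tau> :: real
  define B where "B = (LINT s|lborel. \<bar>b s\<bar>)"
  define B' where "B' = (LINT s|lborel. \<bar>s * b s\<bar>)"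
  have [measurable]: "fourier b \<in> borel_measurable borel" "k \<in> borel_measurable borel"
    unfolding k_def[abs_def] by (rule fourier_measurable[OF test_measurable[OF b]], measurable)
  have iJ: "integrable lborel J" unfolding J_def[abs_def]
    by (intro Bochner_Integration.integrable_add integrable_mult_right integrable_inverse_sqrt integrable_inverse_1_plus_square')
  have k0: "k \<tau> \<ge> 0" for \<tau> by (simp add: k_def)
  have kle: "k \<tau> \<le> 1 / (1 + \<tau>\<^sup>2)" for \<tau>
  proof -
    have p: "1 + \<tau>\<^sup>2 > 0" by (simp add: add_pos_nonneg)
    have "k \<tau> \<le> (1 + \<tau>\<^sup>2) / (1 + \<tau>\<^sup>2)\<^sup>2" unfolding k_def by (intro divide_right_mono sqrt_le_1_plus_square) simp
    then show ?thesis using p by (simp add: power2_eq_square)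
  qed
  have ik: "integrable lborel k"
    by (rule Bochner_Integration.integrable_bound[OF integrable_inverse_1_plus_square']) (use k0 kle in auto)
  have B0: "B \<ge> 0" "B' \<ge> 0" unfolding B_def B'_def by simp_all
  have Fb: "norm (fourier b \<tau>) \<le> B" for \<tau> unfolding B_def by (rule norm_fourier_le[OF test_integrable[OF b]])
  have sb: "(\<lambda>s. s * b s) \<in> test_functions"
    by (rule test_mult[OF _ b]) (auto intro: Ck_bounded_linear bounded_linear_ident)
  have Fb': "norm (fourier b (\<tau> + h) - fourier b \<tau>) \<le> \<bar>h\<bar> * B'" for \<tau> h
  proof -
    have "fourier b (\<tau> + h) - fourier b \<tau> = (LINT s|lborel. cis (- (\<tau> + h) * s) * of_real (b s) - cis (- \<tau> * s) * of_real (b s))"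
      unfolding fourier_def by (rule Bochner_Integration.integral_diff[symmetric]; rule fourier_integrable[OF test_integrable[OF b]])
    also have "norm \<dots> \<le> (LINT s|lborel. \<bar>h\<bar> * \<bar>s * b s\<bar>)"
    proof (rule Bochner_Integration.integral_norm_bound_integral)
      show "integrable lborel (\<lambda>s. cis (- (\<tau> + h) * s) * of_real (b s) - cis (- \<tau> * s) * of_real (b s) :: complex)"
        by (intro Bochner_Integration.integrable_diff fourier_integrable test_integrable b)
      show "integrable lborel (\<lambda>s. \<bar>h\<bar> * \<bar>s * b s\<bar>)"
        by (intro integrable_mult_right integrable_abs test_integrable sb)
      fix s
      have "cis (- (\<tau> + h) * s) * of_real (b s) - cis (- \<tau> * s) * of_real (b s) = cis (- \<tau> * s) * ((cis (- h * s) - 1) * of_real (b s))"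
        by (simp add: cis_mult algebra_simps)
      also have "norm \<dots> = norm (cis (- h * s) - 1) * \<bar>b s\<bar>" by (simp add: norm_mult)
      also have "norm (cis (- h * s) - 1) \<le> \<bar>- h * s\<bar>"
        using iexp_approx1[of "- h * s" 0] by (simp add: cis_conv_exp)
      finally show "norm (cis (- (\<tau> + h) * s) * of_real (b s) - cis (- \<tau> * s) * of_real (b s)) \<le> \<bar>h\<bar> * \<bar>s * b s\<bar>"
        by (simp add: abs_mult mult_right_mono mult.assoc)
    qed
    also have "\<dots> = \<bar>h\<bar> * B'" unfolding B'_def by (rule integral_mult_right_zero)
    finally show ?thesis .
  qed
  define I where "I t = (LINT \<tau>|lborel. cis (\<tau> * t) * (of_real (k \<tau>) * fourier b \<tau>))" for t
  have hd: "\<bar>half_deriv f t\<bar> \<le> norm (I t)" for t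
  proof -
    have "of_real (sqrt \<bar>\<tau>\<bar>) * cis (\<tau> * t) * fourier f \<tau> = cis (\<tau> * t) * (of_real (k \<tau>) * fourier b \<tau>)" for \<tau>
      unfolding fourier_decay[OF f] b_def[symmetric] k_def by (simp add: field_simps)
    then have "half_deriv f t = Re (1 / (2 * of_real pi) * I t)" by (simp only: half_deriv_def I_def)
    also have "\<bar>\<dots>\<bar> \<le> norm (1 / (2 * of_real pi) * I t)" by (rule abs_Re_le_cmod)
    also have "\<dots> \<le> 1 * norm (I t)"
      unfolding norm_mult using pi_ge_two by (intro mult_right_mono) (auto simp: norm_divide norm_mult field_simps)
    finally show ?thesis by simp
  qed
  have ikF: "integrable lborel (\<lambda>\<tau>. of_real (k \<tau>) * fourier b \<tau>)"
    by (rule Bochner_Integration.integrable_bound[OF integrable_mult_right[OF ik, of B]])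
       (use Fb k0 B0 in \<open>auto simp: norm_mult mult.commute[of B] intro!: mult_left_mono\<close>)
  have iI: "integrable lborel (\<lambda>\<tau>. cis (\<tau> * t) * (of_real (k \<tau>) * fourier b \<tau>))" for t
    by (rule Bochner_Integration.integrable_bound[OF integrable_norm[OF ikF]]) (auto simp: norm_mult)
  define D where "D = B * (LINT \<tau>|lborel. J \<tau>) + B' * (LINT \<tau>|lborel. k \<tau>)"
  have J0: "J \<tau> \<ge> 0" for \<tau> by (simp add: J_def add_nonneg_nonneg)
  have D0: "D \<ge> 0" unfolding D_def using B0 J0 k0 by (intro add_nonneg_nonneg mult_nonneg_nonneg integral_nonneg_AE AE_I2) auto
  have large: "norm (I t) \<le> pi * D / \<bar>t\<bar>" if t: "\<bar>t\<bar> \<ge> pi" for t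
  proof -
    have t0: "t \<noteq> 0" using t pi_gt_zero by (metis abs_zero not_le)
    define h where "h = pi / t"
    have h1: "\<bar>h\<bar> \<le> 1" using t t0 by (simp add: h_def abs_divide field_simps)
    have "cis (h * t) = -1" using t0 by (simp add: h_def)
    then have shift: "cis ((\<tau> + h) * t) = - cis (\<tau> * t)" for \<tau>
      using cis_mult[of "\<tau> * t" "h * t"] by (simp add: distrib_right)
    have "I t = (LINT \<tau>|lborel. cis ((\<tau> + h) * t) * (of_real (k (\<tau> + h)) * fourier b (\<tau> + h)))"
      unfolding I_def by (rule lborel_integral_translation[symmetric, of "\<lambda>\<tau>. cis (\<tau> * t) * (of_real (k \<tau>) * fourier b \<tau>)"]) measurable
    also have "\<dots> = (LINT \<tau>|lborel. - (cis (\<tau> * t) * (of_real (k (\<tau> + h)) * fourier b (\<tau> + h))))"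
      by (simp add: shift)
    finally have I2: "I t = (LINT \<tau>|lborel. - (cis (\<tau> * t) * (of_real (k (\<tau> + h)) * fourier b (\<tau> + h))))" .
    have i2: "integrable lborel (\<lambda>\<tau>. - (cis (\<tau> * t) * (of_real (k (\<tau> + h)) * fourier b (\<tau> + h))))"
      using lborel_integrable_translation[OF iI, of h t] by (simp add: shift)
    have II: "I t + I t = (LINT \<tau>|lborel. cis (\<tau> * t) * (of_real (k \<tau>) * fourier b \<tau>) + - (cis (\<tau> * t) * (of_real (k (\<tau> + h)) * fourier b (\<tau> + h))))"
      by (subst Bochner_Integration.integral_add[OF iI i2]) (simp only: I2[symmetric] I_def[symmetric])
    have nII: "norm (I t + I t) \<le> (LINT \<tau>|lborel. \<bar>h\<bar> * (B * J \<tau> + B' * k \<tau>))"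
      unfolding II
    proof -
      have "ennreal (norm (LINT \<tau>|lborel. cis (\<tau> * t) * (of_real (k \<tau>) * fourier b \<tau>) + - (cis (\<tau> * t) * (of_real (k (\<tau> + h)) * fourier b (\<tau> + h)))))
        \<le> (\<integral>\<^sup>+\<tau>. norm (cis (\<tau> * t) * (of_real (k \<tau>) * fourier b \<tau>) + - (cis (\<tau> * t) * (of_real (k (\<tau> + h)) * fourier b (\<tau> + h)))) \<partial>lborel)"
        by (intro integral_norm_bound_ennreal Bochner_Integration.integrable_add iI i2)
      also have "\<dots> \<le> (\<integral>\<^sup>+\<tau>. ennreal (\<bar>h\<bar> * (B * J \<tau> + B' * k \<tau>)) \<partial>lborel)"
      proof (rule nn_integral_mono_AE)
        show "AE \<tau> in lborel. ennreal (norm (cis (\<tau> * t) * (of_real (k \<tau>) * fourier b \<tau>) + - (cis (\<tau> * t) * (of_real (k (\<tau> + h)) * fourier b (\<tau> + h)))))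
           \<le> ennreal (\<bar>h\<bar> * (B * J \<tau> + B' * k \<tau>))"
          using AE_lborel_singleton[of "0::real"]
        proof eventually_elim
          case (elim \<tau>)
          have "cis (\<tau> * t) * (of_real (k \<tau>) * fourier b \<tau>) + - (cis (\<tau> * t) * (of_real (k (\<tau> + h)) * fourier b (\<tau> + h)))
            = cis (\<tau> * t) * (of_real (k \<tau>) * (fourier b \<tau> - fourier b (\<tau> + h)) + of_real (k \<tau> - k (\<tau> + h)) * fourier b (\<tau> + h))"
            by (simp add: algebra_simps)
          also have "norm \<dots> \<le> k \<tau> * norm (fourier b \<tau> - fourier b (\<tau> + h)) + \<bar>k \<tau> - k (\<tau> + h)\<bar> * norm (fourier b (\<tau> + h))"
            unfolding norm_mult norm_cis mult_1
            by (rule order_trans[OF norm_triangle_ineq]) (simp only: norm_mult norm_of_real abs_of_nonneg[OF k0] order_refl)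
          also have "\<dots> \<le> k \<tau> * (\<bar>h\<bar> * B') + (\<bar>h\<bar> * J \<tau>) * B"
          proof (intro add_mono mult_mono)
            show "norm (fourier b \<tau> - fourier b (\<tau> + h)) \<le> \<bar>h\<bar> * B'"
              using Fb'[of \<tau> h] by (simp add: norm_minus_commute)
            show "\<bar>k \<tau> - k (\<tau> + h)\<bar> \<le> \<bar>h\<bar> * J \<tau>"
              using half_deriv_symbol_modulus[OF h1 elim] unfolding k_def J_def by (simp only: abs_minus_commute)
          qed (use k0 J0 B0 Fb in auto)
          finally show ?case by (intro ennreal_leI) (simp add: algebra_simps)
        qed
      qed
      also have "\<dots> = ennreal (LINT \<tau>|lborel. \<bar>h\<bar> * (B * J \<tau> + B' * k \<tau>))"
        using B0 J0 k0 by (intro nn_integral_eq_integral integrable_mult_right Bochner_Integration.integrable_add iJ ik AE_I2) auto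
      finally show "norm (LINT \<tau>|lborel. cis (\<tau> * t) * (of_real (k \<tau>) * fourier b \<tau>) + - (cis (\<tau> * t) * (of_real (k (\<tau> + h)) * fourier b (\<tau> + h))))
          \<le> (LINT \<tau>|lborel. \<bar>h\<bar> * (B * J \<tau> + B' * k \<tau>))"
        using B0 J0 k0 by (subst (asm) ennreal_le_iff) (auto intro!: integral_nonneg_AE)
    qed
    have "(LINT \<tau>|lborel. \<bar>h\<bar> * (B * J \<tau> + B' * k \<tau>)) = \<bar>h\<bar> * D"
      unfolding D_def by (simp only: integral_mult_right_zero Bochner_Integration.integral_add[OF integrable_mult_right[OF iJ] integrable_mult_right[OF ik]])
    with nII have "2 * norm (I t) \<le> \<bar>h\<bar> * D" by (simp only: mult_2[symmetric] norm_mult norm_numeral)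
    then have "norm (I t) \<le> \<bar>h\<bar> * D" using norm_ge_zero[of "I t"] by linarith
    then show ?thesis by (simp add: h_def abs_divide)
  qed
  have small: "norm (I t) \<le> B * (LINT \<tau>|lborel. k \<tau>)" for t
  proof -
    have "norm (I t) \<le> (LINT \<tau>|lborel. B * k \<tau>)"
      unfolding I_def
      by (rule Bochner_Integration.integral_norm_bound_integral[OF iI integrable_mult_right[OF ik]])
         (use Fb k0 in \<open>auto simp: norm_mult mult.commute[of B] intro!: mult_left_mono\<close>)
    then show ?thesis by simp
  qed
  define E where "E = B * (LINT \<tau>|lborel. k \<tau>)"
  have E0: "E \<ge> 0" unfolding E_def using B0 k0 by (intro mult_nonneg_nonneg integral_nonneg_AE AE_I2) auto
  define C where "C = 2 * pi * D + (1 + pi) * E"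
  have "\<bar>half_deriv f t\<bar> \<le> C / (1 + \<bar>t\<bar>)" for t
  proof (cases "\<bar>t\<bar> \<ge> pi")
    case True
    have t1: "\<bar>t\<bar> \<ge> 1" using True pi_ge_two by linarith
    have "\<bar>half_deriv f t\<bar> * (1 + \<bar>t\<bar>) \<le> (pi * D / \<bar>t\<bar>) * (1 + \<bar>t\<bar>)"
      using hd[of t] large[OF True] by (intro mult_right_mono) auto
    also have "\<dots> \<le> (pi * D / \<bar>t\<bar>) * (2 * \<bar>t\<bar>)"
      using t1 D0 by (intro mult_left_mono) auto
    also have "\<dots> = 2 * pi * D" using t1 by simp
    also have "\<dots> \<le> C" using E0 by (simp add: C_def)
    finally show ?thesis by (simp add: pos_le_divide_eq)
  next
    case False
    have "\<bar>half_deriv f t\<bar> * (1 + \<bar>t\<bar>) \<le> E * (1 + pi)"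
      using hd[of t] small[of t] False E0 by (intro mult_mono) (auto simp: E_def)
    also have "\<dots> \<le> C" using D0 by (simp add: C_def mult.commute)
    finally show ?thesis by (simp add: pos_le_divide_eq)
  qed
  moreover have "C \<ge> 0" unfolding C_def using D0 E0 by (simp add: add_nonneg_nonneg)
  ultimately show ?thesis using that by blast
qed

section \<open>Test functions have finite norms\<close>

lemma slice_has_derivative:
  fixes \<phi> :: "'a::euclidean_space \<times> real \<Rightarrow> real"
  assumes "smooth \<phi>"
  shows "frechet_derivative (\<lambda>s. \<phi> (y, s)) (at s) 1 = frechet_derivative \<phi> (at (y, s)) (0, 1)"
    and "frechet_derivative (\<lambda>y. \<phi> (y, s)) (at y) v = frechet_derivative \<phi> (at (y, s)) (v, 0)"
proof -
  have "((\<lambda>s. (y, s)) has_derivative (\<lambda>h. (0, h))) (at s)" by (auto intro!: derivative_eq_intros)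
  from has_derivative_compose[OF this smooth_has_derivative[OF assms]]
  have "((\<lambda>s. \<phi> (y, s)) has_derivative (\<lambda>h. frechet_derivative \<phi> (at (y, s)) (0, h))) (at s)" .
  from frechet_derivative_at[OF this, symmetric]
  show "frechet_derivative (\<lambda>s. \<phi> (y, s)) (at s) 1 = frechet_derivative \<phi> (at (y, s)) (0, 1)" by simp
  have "((\<lambda>y. (y, s)) has_derivative (\<lambda>h. (h, 0))) (at y)" by (auto intro!: derivative_eq_intros)
  from has_derivative_compose[OF this smooth_has_derivative[OF assms]]
  have "((\<lambda>y. \<phi> (y, s)) has_derivative (\<lambda>h. frechet_derivative \<phi> (at (y, s)) (h, 0))) (at y)" .
  from frechet_derivative_at[OF this, symmetric]
  show "frechet_derivative (\<lambda>y. \<phi> (y, s)) (at y) v = frechet_derivative \<phi> (at (y, s)) (v, 0)" by simp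
qed

lemma slice_smooth:
  fixes \<phi> :: "'a::euclidean_space \<times> real \<Rightarrow> real"
  assumes "smooth \<phi>"
  shows "smooth (\<lambda>s. \<phi> (y, s))" "smooth (\<lambda>y. \<phi> (y, s))"
proof -
  have "Ck k (\<lambda>s. \<phi> ((y, 0) + (0, s)))" for k
    by (rule Ck_compose_affine[of "\<lambda>s. (0, s)" k \<phi> "(y, 0)"])
       (auto intro: bounded_linear_Pair bounded_linear_zero bounded_linear_ident simp: assms)
  then show "smooth (\<lambda>s. \<phi> (y, s))" by simp
  have "Ck k (\<lambda>y. \<phi> ((0, s) + (y, 0)))" for k
    by (rule Ck_compose_affine[of "\<lambda>y. (y, 0)" k \<phi> "(0, s)"])
       (auto intro: bounded_linear_Pair bounded_linear_zero bounded_linear_ident simp: assms)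
  then show "smooth (\<lambda>y. \<phi> (y, s))" by simp
qed

lemma norm_le_norm_Pair: "norm x \<le> norm (x, y)" "norm y \<le> norm (x, y)"
  using norm_fst_le[of x y] norm_snd_le[of y x] by auto

lemma slice_test:
  fixes \<phi> :: "'a::euclidean_space \<times> real \<Rightarrow> real"
  assumes "\<phi> \<in> test_functions"
  shows "(\<lambda>s. \<phi> (y, s)) \<in> test_functions" "(\<lambda>y. \<phi> (y, s)) \<in> test_functions"
proof -
  obtain R where R: "R > 0" "\<And>z. norm z > R \<Longrightarrow> \<phi> z = 0" using test_support[OF assms] by blast
  have "\<phi> (y, s) = 0" if "norm s > R" for s
    using R(2)[of "(y, s)"] that norm_le_norm_Pair(2)[of s y] by simp
  then show "(\<lambda>s. \<phi> (y, s)) \<in> test_functions"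
    using R(1) slice_smooth(1)[OF test_smooth[OF assms]] by (auto simp: test_functions_iff)
  have "\<phi> (y, s) = 0" if "norm y > R" for y
    using R(2)[of "(y, s)"] that norm_le_norm_Pair(1)[of y s] by simp
  then show "(\<lambda>y. \<phi> (y, s)) \<in> test_functions"
    using R(1) slice_smooth(2)[OF test_smooth[OF assms]] by (auto simp: test_functions_iff)
qed

lemma tensor_test:
  fixes X :: "'a::euclidean_space \<Rightarrow> real" and \<omega> :: "real \<Rightarrow> real"
  assumes X: "X \<in> test_functions" and \<omega>: "\<omega> \<in> test_functions"
  shows "(\<lambda>z. X (fst z) * \<omega> (snd z)) \<in> test_functions"
proof -
  obtain R where R: "R > 0" "\<And>x. norm x > R \<Longrightarrow> X x = 0" using test_support[OF X] by blast
  obtain S where S: "S > 0" "\<And>x. norm x > S \<Longrightarrow> \<omega> x = 0" using test_support[OF \<omega>] by blast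
  have "Ck k (\<lambda>z::'a \<times> real. X (0 + fst z))" "Ck k (\<lambda>z::'a \<times> real. \<omega> (0 + snd z))" for k
    by (intro Ck_compose_affine bounded_linear_fst bounded_linear_snd test_smooth[OF X, rule_format] test_smooth[OF \<omega>, rule_format])+
  then have "smooth (\<lambda>z::'a \<times> real. X (fst z) * \<omega> (snd z))" by (intro allI Ck_mult) simp_all
  moreover have "X (fst z) * \<omega> (snd z) = 0" if "norm z > R + S" for z :: "'a \<times> real"
  proof -
    have "norm z \<le> norm (fst z) + norm (snd z)" using norm_Pair_le[of "fst z" "snd z"] by simp
    then have "norm (fst z) > R \<or> norm (snd z) > S" using that by linarith
    then show ?thesis using R S by auto
  qed
  ultimately show ?thesis unfolding test_functions_iff using R(1) S(1) by (intro conjI exI[of _ "R + S"]) auto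
qed

lemma bessel_slice:
  fixes \<phi> :: "'a::euclidean_space \<times> real \<Rightarrow> real"
  assumes "\<phi> \<in> test_functions"
  shows "bessel 1 (\<lambda>s. \<phi> (y, s)) = (\<lambda>s. bessel (0, 1) \<phi> (y, s))"
proof -
  have s: "smooth \<phi>" by (rule test_smooth[OF assms])
  have s': "smooth (\<lambda>z. frechet_derivative \<phi> (at z) (0, 1))" by (rule smooth_derivative[OF s])
  have "(\<lambda>s. frechet_derivative (\<lambda>s. \<phi> (y, s)) (at s) 1) = (\<lambda>s. (\<lambda>z. frechet_derivative \<phi> (at z) (0, 1)) (y, s))"
    by (rule ext) (rule slice_has_derivative(1)[OF s])
  then show ?thesis
    unfolding bessel_def using slice_has_derivative(1)[OF s', of y] by simp
qed

lemma half_time_deriv_bounded: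
  fixes \<phi> :: "'a::euclidean_space \<times> real \<Rightarrow> real"
  assumes \<phi>: "\<phi> \<in> test_functions"
  obtains B where "\<And>z. \<bar>half_time_deriv \<phi> z\<bar> \<le> B"
proof -
  define b where "b = bessel (0, 1) (bessel (0, 1) \<phi>)"
  have b: "b \<in> test_functions" unfolding b_def by (intro bessel_test \<phi>)
  obtain R where R: "R > 0" "\<And>z. norm z > R \<Longrightarrow> b z = 0" using test_support[OF b] by blast
  obtain M where M: "M > 0" "\<And>z. \<bar>b z\<bar> \<le> M" using test_bounded[OF b] by blast
  define A where "A = (LINT s|lborel. M * indicator (cball 0 R) (s::real))"
  have A: "(LINT s|lborel. \<bar>bessel 1 (bessel 1 (\<lambda>s. \<phi> (y, s))) s\<bar>) \<le> A" for y
    unfolding bessel_slice[OF \<phi>] bessel_slice[OF bessel_test[OF \<phi>]] b_def[symmetric] A_def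
  proof (rule integral_mono)
    show "integrable lborel (\<lambda>s. \<bar>b (y, s)\<bar>)" by (intro integrable_abs test_integrable slice_test(1)[OF b])
    show "integrable lborel (\<lambda>s. M * indicator (cball 0 R) (s::real))"
      using emeasure_lborel_cball_finite[of "0::real" R] by (intro integrable_mult_right integrable_real_indicator) auto
    fix s :: real
    show "\<bar>b (y, s)\<bar> \<le> M * indicator (cball 0 R) s"
    proof (cases "norm s > R")
      case True
      then have "norm (y, s) > R" using norm_le_norm_Pair(2)[of s y] by simp
      then show ?thesis using R(2) True by simp
    qed (use M(2) in simp)
  qed
  have "\<bar>half_time_deriv \<phi> z\<bar> \<le> A * (LINT \<tau>|lborel. 1 / (1 + \<tau>\<^sup>2))" for z
  proof (cases z)
    case (Pair y t)
    then show ?thesis by (simp only: half_time_deriv_slice) (rule half_deriv_bound[OF slice_test(1)[OF \<phi>] A])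
  qed
  then show ?thesis by (rule that)
qed

lemma half_time_deriv_measurable:
  fixes \<phi> :: "'a::euclidean_space \<times> real \<Rightarrow> real"
  assumes "\<phi> \<in> borel_measurable borel"
  shows "half_time_deriv \<phi> \<in> borel_measurable borel"
proof -
  have [measurable]: "\<phi> \<in> borel_measurable (borel \<Otimes>\<^sub>M borel)" using assms by (simp add: borel_prod)
  have "half_time_deriv \<phi> \<in> borel_measurable (borel \<Otimes>\<^sub>M borel)"
    unfolding half_time_deriv_def by measurable
  then show ?thesis by (simp add: borel_prod)
qed

lemma integral_time_slices:
  fixes f :: "'a::euclidean_space \<times> real \<Rightarrow> real"
  assumes "integrable lborel f"
  shows "AE t in lborel. integrable lborel (\<lambda>y. f (y, t))"
    and "integrable lborel (\<lambda>t. LINT y|lborel. f (y, t))"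
    and "(LINT t|lborel. LINT y|lborel. f (y, t)) = (LINT z|lborel. f z)"
    and "(LINT y|lborel. LINT t|lborel. f (y, t)) = (LINT z|lborel. f z)"
proof -
  have i: "integrable (lborel \<Otimes>\<^sub>M lborel) f" "integrable (lborel \<Otimes>\<^sub>M lborel) (\<lambda>(y, t). f (y, t))"
    using assms by (simp_all add: lborel_prod case_prod_beta')
  show "AE t in lborel. integrable lborel (\<lambda>y. f (y, t))"
    using lborel_pair.AE_integrable_snd[of "\<lambda>y t. f (y, t)"] i by simp
  show "integrable lborel (\<lambda>t. LINT y|lborel. f (y, t))"
    using lborel_pair.integrable_snd[of "\<lambda>y t. f (y, t)"] i by simp
  show "(LINT t|lborel. LINT y|lborel. f (y, t)) = (LINT z|lborel. f z)"
    using lborel_pair.integral_snd[of "\<lambda>y t. f (y, t)"] i by (simp add: lborel_prod)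
  show "(LINT y|lborel. LINT t|lborel. f (y, t)) = (LINT z|lborel. f z)"
    using lborel_pair.integral_fst'[of f] i by (simp add: lborel_prod)
qed

text \<open>For Borel data the pairing that defines the weak half-order derivative may be computed with Borel measure.\<close>

lemma weak_half_time_derivI:
  fixes g h :: "'a::euclidean_space \<times> real \<Rightarrow> real"
  assumes h: "h \<in> borel_measurable borel" "locally_integrable_lborel h"
    and T: "T \<subseteq> test_functions"
    and int: "\<And>\<phi>. \<phi> \<in> T \<Longrightarrow> integrable lborel (\<lambda>z. g z * half_time_deriv \<phi> z)"
    and eq: "\<And>\<phi>. \<phi> \<in> T \<Longrightarrow> (LINT z|lborel. g z * half_time_deriv \<phi> z) = (LINT z|lborel. h z * \<phi> z)"
  shows "weak_half_time_deriv T g h"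
proof -
  have hl: "h \<in> borel_measurable lebesgue" using h(1) by (auto intro: measurable_completion)
  have "locally_integrable h"
    using locally_integrable_iff_lborel[OF h(1) hl] h(2) by simp
  moreover have "(AE t in lebesgue. integrable lebesgue (\<lambda>y. g (y, t) * half_time_deriv \<phi> (y, t))) \<and>
      integrable lebesgue (\<lambda>t. LINT y|lebesgue. g (y, t) * half_time_deriv \<phi> (y, t)) \<and>
      (LINT t|lebesgue. LINT y|lebesgue. g (y, t) * half_time_deriv \<phi> (y, t)) = (LINT z|lebesgue. h z * \<phi> z)"
    if \<phi>: "\<phi> \<in> T" for \<phi>
  proof -
    define f where "f z = g z * half_time_deriv \<phi> z" for z
    have f: "integrable lborel f" unfolding f_def[abs_def] by (rule int[OF \<phi>])
    have fm: "(\<lambda>y. f (y, t)) \<in> borel_measurable borel" for t using f by (intro slice_measurable) simp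
    have "AE t in lebesgue. integrable lebesgue (\<lambda>y. f (y, t))"
      using integral_time_slices(1)[OF f] fm by (simp add: AE_completion_iff integrable_completion)
    moreover have inner: "(LINT y|lebesgue. f (y, t)) = (LINT y|lborel. f (y, t))" for t
      using fm by (simp add: integral_completion)
    moreover have "integrable lebesgue (\<lambda>t. LINT y|lborel. f (y, t))"
      using integral_time_slices(2)[OF f] by (subst integrable_completion) auto
    moreover have "(LINT t|lebesgue. LINT y|lborel. f (y, t)) = (LINT z|lborel. f z)"
      using integral_time_slices(2,3)[OF f] by (subst integral_completion) auto
    moreover have "(LINT z|lebesgue. h z * \<phi> z) = (LINT z|lborel. h z * \<phi> z)"
      using h(1) test_measurable[of \<phi>] \<phi> T by (intro integral_completion) auto
    ultimately show ?thesis using eq[OF \<phi>] by (simp add: f_def)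
  qed
  ultimately show ?thesis unfolding weak_half_time_deriv_def by blast
qed

text \<open>The half-order derivative in one variable is self-adjoint; this is integrated over the space variable.\<close>

lemma weak_half_time_deriv_test:
  fixes g :: "'a::euclidean_space \<times> real \<Rightarrow> real"
  assumes g: "g \<in> test_functions"
  shows "weak_half_time_deriv test_functions g (half_time_deriv g)"
proof (rule weak_half_time_derivI)
  note [measurable] = test_measurable[OF g] half_time_deriv_measurable[OF test_measurable[OF g]]
  show "half_time_deriv g \<in> borel_measurable borel" by measurable
  obtain B where B: "\<And>z. \<bar>half_time_deriv g z\<bar> \<le> B" using half_time_deriv_bounded[OF g] by metis
  show "locally_integrable_lborel (half_time_deriv g)"
  proof
    fix S :: real
    have [measurable]: "cball (0 :: 'a \<times> real) S \<in> sets borel" by simp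
    show "set_integrable lborel (cball 0 S) (half_time_deriv g)"
      unfolding set_integrable_def by (rule integrable_bounded_ball_support[of _ S B]) (use B in auto)
  qed
  have int: "integrable lborel (\<lambda>z. f z * half_time_deriv k z)"
    if f: "f \<in> test_functions" and k: "k \<in> test_functions" for f k :: "'a \<times> real \<Rightarrow> real"
  proof -
    obtain B where B: "\<And>z. \<bar>half_time_deriv k z\<bar> \<le> B" using half_time_deriv_bounded[OF k] by metis
    show ?thesis
    proof (rule Bochner_Integration.integrable_bound[OF integrable_mult_right[OF test_integrable[OF f], of B]])
      show "(\<lambda>z. f z * half_time_deriv k z) \<in> borel_measurable lborel"
        using test_measurable[OF f] half_time_deriv_measurable[OF test_measurable[OF k]] by simp
      show "AE z in lborel. norm (f z * half_time_deriv k z) \<le> norm (B * f z)"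
      proof (rule AE_I2)
        fix z
        have "\<bar>half_time_deriv k z\<bar> \<le> \<bar>B\<bar>" using B[of z] by simp
        then show "norm (f z * half_time_deriv k z) \<le> norm (B * f z)"
          by (simp add: abs_mult mult.commute[of "\<bar>B\<bar>"] mult_left_mono)
      qed
    qed
  qed
  show "integrable lborel (\<lambda>z. g z * half_time_deriv \<phi> z)" if "\<phi> \<in> test_functions" for \<phi>
    by (rule int[OF g that])
  show "(LINT z|lborel. g z * half_time_deriv \<phi> z) = (LINT z|lborel. half_time_deriv g z * \<phi> z)"
    if \<phi>: "\<phi> \<in> test_functions" for \<phi>
  proof -
    have "(LINT z|lborel. g z * half_time_deriv \<phi> z) = (LINT y|lborel. LINT t|lborel. g (y, t) * half_time_deriv \<phi> (y, t))"
      by (rule integral_time_slices(4)[OF int[OF g \<phi>], symmetric])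
    also have "\<dots> = (LINT y|lborel. LINT t|lborel. \<phi> (y, t) * half_time_deriv g (y, t))"
      unfolding half_time_deriv_slice half_deriv_self_adjoint[OF slice_test(1)[OF g] slice_test(1)[OF \<phi>]]
      by (simp only: mult.commute)
    also have "\<dots> = (LINT z|lborel. \<phi> z * half_time_deriv g z)"
      by (rule integral_time_slices(4)[OF int[OF \<phi> g]])
    finally show ?thesis by (simp add: mult.commute)
  qed
qed simp

subsection \<open>Finite norms\<close>

lemma Lp_norm_finite:
  fixes F :: "'c::euclidean_space \<Rightarrow> 'b::euclidean_space"
  assumes "p < \<infinity>" "(\<integral>\<^sup>+x. ennreal (norm (F x) powr enn2real p) \<partial>lborel) < \<infinity>"
  shows "Lp_norm p F < \<infinity>"
  using assms by (auto simp: Lp_norm_def nn_integral_completion Let_def)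

lemma integrable_inverse_power:
  fixes q :: real
  assumes q: "q > 1"
  shows "integrable lborel (\<lambda>t::real. (1 / (1 + \<bar>t\<bar>)) powr q)"
proof -
  define f where "f x = indicator {1..} x * x powr (- q)" for x :: real
  have "(\<lambda>x::real. x powr (- q)) integrable_on {1..}"
    using has_integral_powr_to_inf[of "- q" 1] q by (auto simp: integrable_on_def)
  then have "(\<lambda>x::real. x powr (- q)) absolutely_integrable_on {1..}"
    by (intro nonnegative_absolutely_integrable_1) auto
  then have "integrable lebesgue f"
    unfolding f_def[abs_def] by (simp add: set_integrable_def)
  then have f: "integrable lborel f"
    by (subst (asm) integrable_completion) (auto simp: f_def[abs_def])
  have f1: "integrable lborel (\<lambda>t. f (t + 1))" by (rule lborel_integrable_translation[OF f])
  have "integrable (distr lborel borel (\<lambda>x. 1 - x)) f" using f by (simp only: lborel_distr_reflection)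
  then have f2: "integrable lborel (\<lambda>t. f (1 - t))" by (subst (asm) integrable_distr_eq) (auto simp: f_def[abs_def])
  have [measurable]: "f \<in> borel_measurable borel" unfolding f_def[abs_def] by measurable
  show ?thesis
  proof (rule Bochner_Integration.integrable_bound[OF Bochner_Integration.integrable_add[OF f1 f2]])
    show "AE t in lborel. norm ((1 / (1 + \<bar>t\<bar>)) powr q) \<le> norm (f (t + 1) + f (1 - t))"
    proof (rule AE_I2)
      fix t :: real
      have e: "(1 / (1 + \<bar>t\<bar>)) powr q = (1 + \<bar>t\<bar>) powr (- q)"
        by (simp add: powr_minus powr_divide inverse_eq_divide)
      have nn: "f x \<ge> 0" for x by (simp add: f_def)
      have "(1 / (1 + \<bar>t\<bar>)) powr q \<le> f (t + 1) + f (1 - t)"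
      proof (cases "t \<ge> 0")
        case True
        then have "f (t + 1) = (1 / (1 + \<bar>t\<bar>)) powr q" unfolding e by (simp add: f_def add.commute)
        then show ?thesis using nn[of "1 - t"] by simp
      next
        case False
        then have "f (1 - t) = (1 / (1 + \<bar>t\<bar>)) powr q" unfolding e by (simp add: f_def)
        then show ?thesis using nn[of "t + 1"] by simp
      qed
      then show "norm ((1 / (1 + \<bar>t\<bar>)) powr q) \<le> norm (f (t + 1) + f (1 - t))" by simp
    qed
  qed measurable
qed

lemma spatial_grad_norm_test_finite:
  fixes g :: "'a::euclidean_space \<times> real \<Rightarrow> real"
  assumes g: "g \<in> test_functions" and p: "p < \<infinity>"
  shows "spatial_grad_norm p g < \<infinity>"
proof -
  define G where "G z = (\<Sum>i\<in>Basis. frechet_derivative g (at z) (i, 0) *\<^sub>R i)" for z :: "'a \<times> real"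
  have dm: "(\<lambda>z. frechet_derivative g (at z) v) \<in> borel_measurable borel" for v
    by (rule test_measurable[OF test_derivative[OF g]])
  have Gm: "G \<in> borel_measurable borel" unfolding G_def[abs_def]
    by (intro borel_measurable_sum borel_measurable_scaleR borel_measurable_const dm)
  have "has_weak_gradient (\<lambda>y. g (y, t)) (\<lambda>y. G (y, t))" for t
  proof -
    define u where "u = (\<lambda>y. g (y, t))"
    have u: "u \<in> test_functions" unfolding u_def by (rule slice_test(2)[OF g])
    have Gu: "G (y, t) = (\<Sum>i\<in>Basis. frechet_derivative u (at y) i *\<^sub>R i)" for y
      by (simp add: G_def u_def slice_has_derivative(2)[OF test_smooth[OF g]])
    have inner: "G (y, t) \<bullet> v = frechet_derivative u (at y) v" for y v
      unfolding Gu test_linear_expansion[OF u, of y v]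
      by (simp add: inner_commute[of _ v] inner_sum_right mult.commute)
    have Gtm: "(\<lambda>y. G (y, t)) \<in> borel_measurable borel" by (rule slice_measurable[OF Gm])
    have iG: "integrable lborel (\<lambda>y. G (y, t))"
      unfolding Gu by (intro Bochner_Integration.integrable_sum integrable_scaleR_left test_integrable test_derivative u)
    have "weak_gradient_lborel u (\<lambda>y. G (y, t))"
      unfolding weak_gradient_lborel_def
    proof (intro conjI ballI allI)
      show "set_integrable lborel (cball 0 R) u" for R
        unfolding set_integrable_def by (intro integrable_mult_indicator test_integrable u) simp
      show "set_integrable lborel (cball 0 R) (\<lambda>y. G (y, t))" for R
        unfolding set_integrable_def by (intro integrable_mult_indicator iG) simp
      show "(LINT x|lborel. u x * frechet_derivative \<phi> (at x) v) = - (LINT x|lborel. G (x, t) \<bullet> v * \<phi> x)"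
        if "\<phi> \<in> test_functions" for \<phi> v
        unfolding inner by (rule smooth_integration_by_parts[OF test_smooth[OF u] that])
    qed (use Gtm test_measurable[OF u] in auto)
    then show ?thesis
      using has_weak_gradient_iff_lborel[OF test_measurable[OF u] Gtm, of u "\<lambda>y. G (y, t)"] by (simp add: u_def)
  qed
  then have "spatial_grad_norm p g \<le> Lp_norm p G"
    unfolding spatial_grad_norm_def using Gm by (intro INF_lower) (auto intro: measurable_completion)
  also have "\<dots> < \<infinity>"
  proof (rule Lp_norm_finite[OF p])
    define q where "q = enn2real p"
    have "\<forall>i. \<exists>R. \<forall>z. norm z > R \<longrightarrow> frechet_derivative g (at z) (i, 0) = 0"
      using test_support[OF test_derivative[OF g]] by metis
    then obtain R where R: "\<And>i z. norm z > R i \<Longrightarrow> frechet_derivative g (at z) (i, 0) = 0" by metis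
    define S where "S = Max (R ` Basis)"
    have S: "G z = 0" if "norm z > S" for z
    proof -
      have le: "R i \<le> S" if "i \<in> Basis" for i using that by (simp add: S_def)
      have "frechet_derivative g (at z) (i, 0) = 0" if "i \<in> Basis" for i
        using R[of i z] le[OF that] \<open>norm z > S\<close> by simp
      then show ?thesis unfolding G_def by simp
    qed
    have "\<forall>i. \<exists>M. \<forall>z. \<bar>frechet_derivative g (at z) (i, 0)\<bar> \<le> M"
      using test_bounded[OF test_derivative[OF g]] by metis
    then obtain M where M: "\<And>i z. \<bar>frechet_derivative g (at z) (i, 0)\<bar> \<le> M i" by metis
    define N where "N = (\<Sum>i\<in>Basis. M i)"
    have N: "norm (G z) \<le> N" for z
    proof -
      have "norm (G z) \<le> (\<Sum>i\<in>Basis. norm (frechet_derivative g (at z) (i, 0) *\<^sub>R i))"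
        unfolding G_def by (rule norm_sum)
      also have "\<dots> \<le> N" unfolding N_def using M by (intro sum_mono) simp
      finally show ?thesis .
    qed
    have "integrable lborel (\<lambda>z. norm (G z) powr q)"
    proof (rule integrable_bounded_ball_support[of _ S "N powr q"])
      show "(\<lambda>z. norm (G z) powr q) \<in> borel_measurable borel" using Gm by measurable
      show "norm (norm (G z) powr q) \<le> N powr q" for z
        using N[of z] by (simp add: powr_mono2 q_def)
    qed (use S in simp)
    then show "(\<integral>\<^sup>+x. ennreal (norm (G x) powr enn2real p) \<partial>lborel) < \<infinity>"
      unfolding q_def integrable_iff_bounded by simp
  qed
  finally show ?thesis .
qed

text \<open>
  The half-order derivative acts on the second factor alone. It is not compactly supported, but it
  decays like \<open>1 / \<bar>t\<bar>\<close>, which lies in \<open>L\<^sup>p\<close> for \<open>p > 1\<close>.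
\<close>

lemma half_time_deriv_norm_product_finite:
  fixes X :: "'a::euclidean_space \<Rightarrow> real"
  assumes X: "X \<in> test_functions" and \<beta>: "\<beta> \<in> test_functions" and p: "1 < p" "p < \<infinity>"
  shows "half_time_deriv_norm p (\<lambda>z. X (fst z) * \<beta> (snd z)) < \<infinity>"
proof -
  define h where "h = half_time_deriv (\<lambda>z. X (fst z) * \<beta> (snd z))"
  define q where "q = enn2real p"
  have q: "q > 1"
  proof -
    have "enn2real 1 < enn2real p" using p by (intro enn2real_less_iff[THEN iffD2]; simp add: less_top)
    then show ?thesis by (simp add: q_def)
  qed
  have g: "(\<lambda>z. X (fst z) * \<beta> (snd z)) \<in> test_functions" by (rule tensor_test[OF X \<beta>])
  have heq: "h (y, t) = X y * half_deriv \<beta> t" for y t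
    using half_deriv_linear_combination[OF \<beta> \<beta>, of "X y" 0 t] by (simp add: h_def half_time_deriv_slice)
  obtain C where C: "C \<ge> 0" "\<And>t. \<bar>half_deriv \<beta> t\<bar> \<le> C / (1 + \<bar>t\<bar>)" using half_deriv_decay[OF \<beta>] by blast
  obtain M where M: "M > 0" "\<And>y. \<bar>X y\<bar> \<le> M" using test_bounded[OF X] by blast
  obtain R where R: "R > 0" "\<And>y. norm y > R \<Longrightarrow> X y = 0" using test_support[OF X] by blast
  have hm: "h \<in> borel_measurable borel" unfolding h_def by (rule half_time_deriv_measurable[OF test_measurable[OF g]])
  have "half_time_deriv_norm p (\<lambda>z. X (fst z) * \<beta> (snd z)) \<le> Lp_norm p h"
    unfolding half_time_deriv_norm_def h_def using weak_half_time_deriv_test[OF g] by (intro INF_lower) auto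
  also have "\<dots> < \<infinity>"
  proof (rule Lp_norm_finite[OF p(2)])
    have "(\<integral>\<^sup>+z. ennreal (norm (h z) powr q) \<partial>lborel) = (\<integral>\<^sup>+t. \<integral>\<^sup>+y. ennreal (norm (h (y, t)) powr q) \<partial>lborel \<partial>lborel)"
      using hm by (intro nn_integral_time_slices) simp
    also have "\<dots> \<le> (\<integral>\<^sup>+t. \<integral>\<^sup>+y. ennreal ((C / (1 + \<bar>t\<bar>)) powr q) * (ennreal (M powr q) * indicator (cball 0 R) (y::'a)) \<partial>lborel \<partial>lborel)"
    proof (intro nn_integral_mono)
      fix t :: real and y :: 'a
      show "ennreal (norm (h (y, t)) powr q) \<le> ennreal ((C / (1 + \<bar>t\<bar>)) powr q) * (ennreal (M powr q) * indicator (cball 0 R) y)"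
      proof (cases "norm y > R")
        case False
        have "norm (h (y, t)) = \<bar>X y\<bar> * \<bar>half_deriv \<beta> t\<bar>" by (simp add: heq abs_mult)
        also have "\<dots> \<le> M * (C / (1 + \<bar>t\<bar>))" by (intro mult_mono M C) (use M(1) in auto)
        finally have "norm (h (y, t)) powr q \<le> (M * (C / (1 + \<bar>t\<bar>))) powr q"
          using q by (intro powr_mono2) auto
        also have "\<dots> = (C / (1 + \<bar>t\<bar>)) powr q * M powr q"
          using powr_mult[of M "C / (1 + \<bar>t\<bar>)" q] by (simp only: mult.commute[of "M powr q"])
        finally show ?thesis using False by (simp add: ennreal_mult[symmetric] ennreal_leI)
      qed (use R(2) in \<open>simp add: heq\<close>)
    qed
    also have "\<dots> = (\<integral>\<^sup>+t. ennreal ((C / (1 + \<bar>t\<bar>)) powr q) * (ennreal (M powr q) * emeasure lborel (cball (0::'a) R)) \<partial>lborel)"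
      proof -
      have [measurable]: "cball (0::'a) R \<in> sets borel" by simp
      have "(\<integral>\<^sup>+y. a * (b * indicator (cball 0 R) (y::'a)) \<partial>lborel) = a * (b * emeasure lborel (cball (0::'a) R))"
        for a b :: ennreal
        by (subst nn_integral_cmult) (measurable, subst nn_integral_cmult_indicator, simp_all only: sets_lborel borel_closed closed_cball)
      then show ?thesis by (simp only:)
    qed
    also have "\<dots> = (\<integral>\<^sup>+t. ennreal ((C / (1 + \<bar>t\<bar>)) powr q) \<partial>lborel) * (ennreal (M powr q) * emeasure lborel (cball (0::'a) R))"
      by (rule nn_integral_multc) measurable
    also have "\<dots> < \<infinity>"
    proof -
      have split: "(C / (1 + \<bar>t\<bar>)) powr q = C powr q * (1 / (1 + \<bar>t\<bar>)) powr q" for t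
        using powr_mult[of C "1 / (1 + \<bar>t\<bar>)" q] C(1) by simp
      have "(\<integral>\<^sup>+t. ennreal ((C / (1 + \<bar>t\<bar>)) powr q) \<partial>lborel) = (\<integral>\<^sup>+t. ennreal (C powr q * (1 / (1 + \<bar>t\<bar>)) powr q) \<partial>lborel)"
        by (simp only: split)
      also have "\<dots> < \<infinity>"
        using integrable_mult_right[OF integrable_inverse_power[OF q], of "C powr q"]
        unfolding integrable_iff_bounded by simp
      finally show ?thesis
        using emeasure_lborel_cball_finite[of "0::'a" R] by (simp add: ennreal_mult_less_top)
    qed
    finally show "(\<integral>\<^sup>+z. ennreal (norm (h z) powr enn2real p) \<partial>lborel) < \<infinity>" by (simp add: q_def)
  qed
  finally show ?thesis .
qed

section \<open>A lacunary series with no half-order derivative\<close>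

text \<open>
  The coefficients are the frequencies to the power \<open>- 1 / 2\<close>: this is a Weierstrass function that is
  Hoelder continuous of order one half and no better.
\<close>

definition lacunary :: "real \<Rightarrow> real" where
  "lacunary t = (\<Sum>j. (1 / 2 :: real) ^ j * cos (4 ^ j * t))"

lemma summable_half_power: "summable (\<lambda>j. (1 / 2 :: real) ^ j)"
  by (rule summable_geometric) simp

lemma lacunary_summable: "summable (\<lambda>j. (1 / 2 :: real) ^ j * cos (4 ^ j * t))"
  by (rule summable_comparison_test'[OF summable_half_power, of 0])
     (simp add: abs_mult mult_left_le)

lemma suminf_half_power: "(\<Sum>j. (1 / 2 :: real) ^ j) = 2"
  using suminf_geometric[of "1 / 2 :: real"] by simp

lemma lacunary_bounded: "\<bar>lacunary t\<bar> \<le> 2"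
proof -
  have s: "summable (\<lambda>j. \<bar>(1 / 2) ^ j * cos (4 ^ j * t)\<bar>)"
    by (rule summable_comparison_test'[OF summable_half_power, of 0]) (simp add: abs_mult mult_left_le)
  have "\<bar>lacunary t\<bar> \<le> (\<Sum>j. \<bar>(1 / 2) ^ j * cos (4 ^ j * t)\<bar>)"
    unfolding lacunary_def by (rule summable_rabs[OF s])
  also have "\<dots> \<le> (\<Sum>j. (1 / 2) ^ j)"
    by (intro suminf_le s summable_half_power) (simp add: abs_mult mult_left_le)
  finally show ?thesis by (simp add: suminf_half_power)
qed

text \<open>
  Terms with frequency below \<open>1 / \<bar>t - s\<bar>\<close> are estimated by their Lipschitz constants, the others by
  their size; both geometric sums are dominated by the term at the crossover.
\<close>

lemma lacunary_Hoelder: "\<bar>lacunary t - lacunary s\<bar> \<le> 6 * sqrt \<bar>t - s\<bar>"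
proof -
  define d where "d = \<bar>t - s\<bar>"
  define a where "a j = (1 / 2) ^ j * cos (4 ^ j * t) - (1 / 2) ^ j * cos (4 ^ j * s)" for j :: nat
  have a_eq: "a j = (1 / 2) ^ j * (cos (4 ^ j * t) - cos (4 ^ j * s))" for j by (simp add: a_def right_diff_distrib)
  have a1: "\<bar>a j\<bar> \<le> 2 * (1 / 2) ^ j" for j
  proof -
    have "\<bar>cos (4 ^ j * t) - cos (4 ^ j * s)\<bar> \<le> 2"
      using abs_cos_le_one[of "4 ^ j * t"] abs_cos_le_one[of "4 ^ j * s"] by linarith
    then have "(1 / 2) ^ j * \<bar>cos (4 ^ j * t) - cos (4 ^ j * s)\<bar> \<le> (1 / 2) ^ j * 2" by (intro mult_left_mono) auto
    then show ?thesis by (simp add: a_eq abs_mult mult.commute)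
  qed
  have a2: "\<bar>a j\<bar> \<le> 2 ^ j * d" for j
  proof -
    have "\<bar>cos x - cos y\<bar> \<le> \<bar>x - y\<bar>" for x y :: real
    proof -
      have "norm (cos x - cos y) \<le> 1 * norm (x - y)"
        by (rule differentiable_bound[of UNIV cos "\<lambda>z h. - sin z * h"])
           (auto intro!: derivative_eq_intros onorm_le simp: abs_mult mult_left_le_one_le)
      then show ?thesis by simp
    qed
    then have "\<bar>cos (4 ^ j * t) - cos (4 ^ j * s)\<bar> \<le> \<bar>4 ^ j * t - 4 ^ j * s\<bar>" .
    also have "\<dots> = 4 ^ j * d" by (simp add: d_def right_diff_distrib[symmetric] abs_mult)
    finally have "\<bar>a j\<bar> \<le> (1 / 2) ^ j * (4 ^ j * d)" by (simp add: a_eq abs_mult mult_left_mono)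
    also have "\<dots> = 2 ^ j * d" by (simp add: mult.assoc[symmetric] power_mult_distrib[symmetric])
    finally show ?thesis .
  qed
  have sa: "summable (\<lambda>j. \<bar>a j\<bar>)"
    by (rule summable_comparison_test'[OF summable_mult[OF summable_half_power, of 2], of 0]) (simp add: a1)
  have "lacunary t - lacunary s = suminf a"
    unfolding lacunary_def a_def by (rule suminf_diff[OF lacunary_summable lacunary_summable])
  then have main: "\<bar>lacunary t - lacunary s\<bar> \<le> (\<Sum>j. \<bar>a j\<bar>)"
    using summable_rabs[OF sa] by simp
  have total: "(\<Sum>j. \<bar>a (j + n)\<bar>) \<le> 4 * (1 / 2) ^ n" for n
  proof -
    have "(\<Sum>j. \<bar>a (j + n)\<bar>) \<le> (\<Sum>j. 2 * (1 / 2) ^ n * (1 / 2) ^ j)"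
    proof (intro suminf_le)
      show "\<bar>a (j + n)\<bar> \<le> 2 * (1 / 2) ^ n * (1 / 2) ^ j" for j using a1[of "j + n"] by (simp add: power_add mult_ac)
      show "summable (\<lambda>j. \<bar>a (j + n)\<bar>)" using sa by (simp add: summable_iff_shift[of "\<lambda>j. \<bar>a j\<bar>"])
      show "summable (\<lambda>j. 2 * (1 / 2) ^ n * (1 / 2 :: real) ^ j)" by (intro summable_mult summable_half_power)
    qed
    also have "\<dots> = 2 * (1 / 2) ^ n * 2"
      unfolding suminf_mult[OF summable_half_power] suminf_half_power by simp
    finally show ?thesis by simp
  qed
  consider "d \<ge> 1" | "d = 0" | "0 < d" "d < 1" by (force simp: d_def)
  then show ?thesis
  proof cases
    case 1
    have "(\<Sum>j. \<bar>a j\<bar>) \<le> 4" using total[of 0] by simp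
    moreover have "1 \<le> sqrt d" using 1 by simp
    ultimately show ?thesis using main unfolding d_def[symmetric] by linarith
  next
    case 2
    then show ?thesis using main by (simp add: d_def)
  next
    case 3
    define P where "P n \<longleftrightarrow> (1 / 4 :: real) ^ Suc n \<le> d" for n
    have "\<exists>n. P n"
    proof -
      obtain n where "(1 / 4 :: real) ^ n < d" using real_arch_pow_inv[of d "1 / 4"] 3 by auto
      moreover have "(1 / 4 :: real) ^ Suc n \<le> (1 / 4) ^ n" by simp
      ultimately show ?thesis unfolding P_def by (meson less_imp_le order_trans)
    qed
    then have Pn: "P (LEAST n. P n)" and least: "\<And>m. m < (LEAST n. P n) \<Longrightarrow> \<not> P m"
      by (auto intro: LeastI_ex dest: not_less_Least)
    define n where "n = (LEAST n. P n)"
    have lower: "(1 / 4) ^ Suc n \<le> d" using Pn by (simp add: P_def n_def)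
    have upper: "d \<le> (1 / 4) ^ n"
    proof (cases n)
      case 0
      then show ?thesis using 3 by simp
    next
      case (Suc m)
      then show ?thesis using least[of m] by (simp add: P_def n_def)
    qed
    have sq: "sqrt ((1 / 4) ^ k) = (1 / 2 :: real) ^ k" for k
      by (simp add: real_sqrt_power real_sqrt_divide)
    have s1: "(1 / 2) ^ Suc n \<le> sqrt d" using real_sqrt_le_mono[OF lower] unfolding sq .
    have s2: "sqrt d \<le> (1 / 2) ^ n" using real_sqrt_le_mono[OF upper] unfolding sq .
    have "(\<Sum>j<Suc n. \<bar>a j\<bar>) \<le> (\<Sum>j<Suc n. 2 ^ j * d)" by (intro sum_mono a2)
    also have "\<dots> = (\<Sum>j<Suc n. 2 ^ j) * d" by (simp only: sum_distrib_right)
    also have "(\<Sum>j<Suc n. (2::real) ^ j) = 2 ^ Suc n - 1" using geometric_sum[of "2::real" "Suc n"] by simp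
    also have "(2 ^ Suc n - 1) * d \<le> 2 ^ Suc n * (sqrt d * sqrt d)"
      using 3 by (intro mult_mono) auto
    also have "\<dots> \<le> 2 ^ Suc n * (sqrt d * (1 / 2) ^ n)"
      using s2 3 by (intro mult_left_mono) auto
    also have "\<dots> = 2 * sqrt d" by (simp add: power_one_over field_simps)
    finally have first: "(\<Sum>j<Suc n. \<bar>a j\<bar>) \<le> 2 * sqrt d" .
    have "(\<Sum>j. \<bar>a (j + Suc n)\<bar>) \<le> 4 * sqrt d"
      using total[of "Suc n"] s1 by linarith
    then have "(\<Sum>j. \<bar>a j\<bar>) \<le> 6 * sqrt d"
      using suminf_split_initial_segment[OF sa, of "Suc n"] first by linarith
    then show ?thesis using main unfolding d_def[symmetric] by linarith
  qed
qed

lemma lacunary_continuous: "continuous_on UNIV lacunary"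
proof (rule continuous_at_imp_continuous_on, rule ballI)
  fix t :: real
  show "isCont lacunary t"
    unfolding isCont_def
  proof (rule LIM_zero_cancel, rule Lim_null_comparison)
    show "\<forall>\<^sub>F s in at t. norm (lacunary s - lacunary t) \<le> 6 * sqrt \<bar>s - t\<bar>"
      using lacunary_Hoelder by simp
    have "((\<lambda>s. 6 * sqrt \<bar>s - t\<bar>) \<longlongrightarrow> 6 * sqrt \<bar>t - t\<bar>) (at t)" by (intro tendsto_intros)
    then show "((\<lambda>s. 6 * sqrt \<bar>s - t\<bar>) \<longlongrightarrow> 0) (at t)" by simp
  qed
qed

lemma lacunary_measurable [measurable]: "lacunary \<in> borel_measurable borel"
  by (rule borel_measurable_continuous_onI[OF lacunary_continuous])

lemma test_cosine_coefficient:
  assumes \<eta>: "\<eta> \<in> test_functions"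
  obtains E where "E \<ge> 0" "\<And>m. \<bar>m\<bar> * \<bar>LINT t|lborel. \<eta> t * cos (m * t)\<bar> \<le> E"
proof -
  define E where "E = (LINT s|lborel. \<bar>frechet_derivative \<eta> (at s) 1\<bar>)"
  have "\<bar>m\<bar> * \<bar>LINT t|lborel. \<eta> t * cos (m * t)\<bar> \<le> E" for m
  proof -
    have "(LINT t|lborel. \<eta> t * cos (m * t)) = Re (fourier \<eta> m)"
      by (simp add: fourier_eq[OF test_integrable[OF \<eta>]] mult.commute)
    then have "\<bar>m\<bar> * \<bar>LINT t|lborel. \<eta> t * cos (m * t)\<bar> \<le> \<bar>m\<bar> * norm (fourier \<eta> m)"
      using abs_Re_le_cmod by (simp add: mult_left_mono)
    also have "\<dots> = norm (fourier (\<lambda>s. frechet_derivative \<eta> (at s) 1) m)"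
      by (simp add: fourier_derivative[OF \<eta>] norm_mult)
    also have "\<dots> \<le> E" unfolding E_def by (rule norm_fourier_le[OF test_integrable[OF test_derivative[OF \<eta>]]])
    finally show ?thesis .
  qed
  moreover have "E \<ge> 0" unfolding E_def by simp
  ultimately show ?thesis using that by blast
qed

text \<open>
  Only the \<open>k\<close>-th term resonates with \<open>cos (4 ^ k * t)\<close>, and the mean value of the squared cosine is one
  half. All other terms contribute frequencies of size at least \<open>4 ^ k / 2\<close>, at which the transform of
  \<open>\<eta>\<close> is \<open>O(4\<^sup>-\<^sup>k)\<close>.
\<close>

lemma lacunary_oscillation:
  assumes \<eta>: "\<eta> \<in> test_functions"
  shows "(\<lambda>k. 2 ^ k * (LINT t|lborel. \<eta> t * lacunary t * cos (4 ^ k * t))) \<longlonglongrightarrow> (LINT t|lborel. \<eta> t) / 2"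
proof -
  have [measurable]: "\<eta> \<in> borel_measurable borel" using test_measurable[OF \<eta>] .
  define c where "c m = (LINT t|lborel. \<eta> t * cos (m * t))" for m
  obtain E where E: "E \<ge> 0" "\<And>m. \<bar>m\<bar> * \<bar>c m\<bar> \<le> E"
    using test_cosine_coefficient[OF \<eta>] unfolding c_def by blast
  have ic: "integrable lborel (\<lambda>t. \<eta> t * cos (m * t))" for m by (rule test_integrable[OF modulated_test[OF \<eta>]])
  define b where "b k j = 2 ^ k * ((1 / 2) ^ j * ((c (4 ^ j - 4 ^ k) + c (4 ^ j + 4 ^ k)) / 2))" for k j :: nat
  have int: "(\<lambda>j. b k j) sums (2 ^ k * (LINT t|lborel. \<eta> t * lacunary t * cos (4 ^ k * t)))" for k
  proof -
    define f where "f j t = (1 / 2) ^ j * ((\<eta> t * cos ((4 ^ j - 4 ^ k) * t) + \<eta> t * cos ((4 ^ j + 4 ^ k) * t)) / 2)" for j t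
    have f_alt: "f j t = \<eta> t * ((1 / 2) ^ j * cos (4 ^ j * t)) * cos (4 ^ k * t)" for j t
    proof -
      have "cos (4 ^ j * t) * cos (4 ^ k * t) = (cos ((4 ^ j - 4 ^ k) * t) + cos ((4 ^ j + 4 ^ k) * t)) / 2"
        unfolding cos_times_cos by (simp add: algebra_simps)
      then have "\<eta> t * ((1 / 2) ^ j * cos (4 ^ j * t)) * cos (4 ^ k * t)
        = (1 / 2) ^ j * (\<eta> t * ((cos ((4 ^ j - 4 ^ k) * t) + cos ((4 ^ j + 4 ^ k) * t)) / 2))"
        by (simp only: mult_ac)
      then show ?thesis by (simp add: f_def distrib_left)
    qed
    have fi: "integrable lborel (f j)" for j
      unfolding f_def[abs_def]
      by (intro integrable_mult_right integrable_divide Bochner_Integration.integrable_add ic)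
    have fb: "norm (f j t) \<le> (1 / 2) ^ j * \<bar>\<eta> t\<bar>" for j t
    proof -
      have "norm (f j t) = (1 / 2) ^ j * \<bar>\<eta> t\<bar> * (\<bar>cos (4 ^ j * t)\<bar> * \<bar>cos (4 ^ k * t)\<bar>)"
        by (simp add: f_alt abs_mult mult_ac)
      also have "\<dots> \<le> (1 / 2) ^ j * \<bar>\<eta> t\<bar> * 1"
        by (intro mult_left_mono mult_le_one) auto
      finally show ?thesis by simp
    qed
    have fsum: "(\<lambda>j. f j t) sums (\<eta> t * lacunary t * cos (4 ^ k * t))" for t
      unfolding f_alt lacunary_def
      by (intro sums_mult2 sums_mult summable_sums lacunary_summable)
    have "(\<lambda>j. LINT t|lborel. f j t) sums (LINT t|lborel. (\<Sum>j. f j t))"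
    proof (rule sums_integral[OF fi])
      show "AE t in lborel. summable (\<lambda>j. norm (f j t))"
      proof (rule AE_I2)
        fix t
        show "summable (\<lambda>j. norm (f j t))"
          by (rule summable_comparison_test'[OF summable_mult2[OF summable_half_power, of "\<bar>\<eta> t\<bar>"], of 0]) (use fb[of _ t] in simp)
      qed
      show "summable (\<lambda>j. LINT t|lborel. norm (f j t))"
      proof (rule summable_comparison_test'[OF summable_mult2[OF summable_half_power, of "LINT t|lborel. \<bar>\<eta> t\<bar>"], of 0])
        fix j :: nat
        have "(LINT t|lborel. norm (f j t)) \<le> (LINT t|lborel. (1 / 2) ^ j * \<bar>\<eta> t\<bar>)"
          by (intro integral_mono integrable_norm fi integrable_mult_right integrable_abs test_integrable \<eta> fb)
        then show "norm (LINT t|lborel. norm (f j t)) \<le> (1 / 2) ^ j * (LINT t|lborel. \<bar>\<eta> t\<bar>)" by simp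
      qed
    qed
    then have "(\<lambda>j. LINT t|lborel. f j t) sums (LINT t|lborel. \<eta> t * lacunary t * cos (4 ^ k * t))"
      using sums_unique[OF fsum] by simp
    moreover have "(LINT t|lborel. f j t) = (1 / 2) ^ j * ((c (4 ^ j - 4 ^ k) + c (4 ^ j + 4 ^ k)) / 2)" for j
      unfolding f_def c_def
      by (simp only: integral_mult_right_zero integral_divide_zero Bochner_Integration.integral_add[OF ic ic])
    ultimately show ?thesis unfolding b_def by (intro sums_mult) simp
  qed
  have c_bound: "\<bar>c m\<bar> \<le> 2 * E / 4 ^ k" if m: "\<bar>m\<bar> \<ge> 4 ^ k / 2" for m and k :: nat
  proof -
    have "4 ^ k / 2 * \<bar>c m\<bar> \<le> \<bar>m\<bar> * \<bar>c m\<bar>" using m by (intro mult_right_mono) auto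
    also have "\<dots> \<le> E" by (rule E)
    finally show ?thesis by (simp add: field_simps)
  qed
  have gap: "\<bar>4 ^ j - 4 ^ k :: real\<bar> \<ge> 4 ^ k / 2" if "j \<noteq> k" for j k :: nat
  proof (cases "j < k")
    case True
    then have "(4::real) ^ Suc j \<le> 4 ^ k" by (intro power_increasing) auto
    then have "4 * (4::real) ^ j \<le> 4 ^ k" by simp
    moreover have "0 < (4::real) ^ j" by simp
    ultimately show ?thesis by linarith
  next
    case False
    then have "(4::real) ^ Suc k \<le> 4 ^ j" using that by (intro power_increasing) auto
    then have "4 * (4::real) ^ k \<le> 4 ^ j" by simp
    moreover have "0 < (4::real) ^ k" by simp
    ultimately show ?thesis by linarith
  qed
  have plus: "\<bar>4 ^ j + 4 ^ k :: real\<bar> \<ge> 4 ^ k / 2" for j k :: nat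
  proof -
    have "0 < (4::real) ^ k" "0 < (4::real) ^ j" by simp_all
    then show ?thesis by simp
  qed
  have dev: "\<bar>2 ^ k * (LINT t|lborel. \<eta> t * lacunary t * cos (4 ^ k * t)) - (LINT t|lborel. \<eta> t) / 2\<bar> \<le> 4 * E * (1 / 2) ^ k" for k
  proof -
    define b' where "b' j = b k j - (if j = k then c 0 / 2 else 0)" for j
    have "(\<lambda>j. if j = k then c 0 / 2 else 0) sums (c 0 / 2)" by (rule sums_single)
    from sums_diff[OF int[of k] this]
    have b'_sums: "b' sums (2 ^ k * (LINT t|lborel. \<eta> t * lacunary t * cos (4 ^ k * t)) - c 0 / 2)"
      unfolding b'_def[abs_def] .
    have b'_bound: "\<bar>b' j\<bar> \<le> (2 * E * (1 / 2) ^ k) * (1 / 2) ^ j" for j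
    proof -
      define w where "w = 2 ^ k * ((1 / 2) ^ j * (1 / 2 :: real))"
      have w: "w \<ge> 0" by (simp add: w_def)
      have "b' j = w * ((if j = k then 0 else c (4 ^ j - 4 ^ k)) + c (4 ^ j + 4 ^ k))"
        by (auto simp: b'_def b_def w_def power_one_over field_simps)
      also have "\<bar>\<dots>\<bar> \<le> w * (2 * E / 4 ^ k + 2 * E / 4 ^ k)"
        unfolding abs_mult using w E(1) c_bound[OF gap[of j k]] c_bound[OF plus[of k j]]
        by (intro mult_mono order_trans[OF abs_triangle_ineq] add_mono) auto
      also have "\<dots> = (2 * E * (1 / 2) ^ k) * (1 / 2) ^ j"
      proof -
        have "(4::real) ^ k = 2 ^ k * 2 ^ k" by (simp add: power_mult_distrib[symmetric])
        then show ?thesis by (simp add: w_def power_one_over field_simps)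
      qed
      finally show ?thesis .
    qed
    have sb: "summable (\<lambda>j. \<bar>b' j\<bar>)"
      by (rule summable_comparison_test'[OF summable_mult[OF summable_half_power], of 0]) (use b'_bound in simp)
    have "\<bar>suminf b'\<bar> \<le> (\<Sum>j. \<bar>b' j\<bar>)" by (rule summable_rabs[OF sb])
    also have "\<dots> \<le> (\<Sum>j. (2 * E * (1 / 2) ^ k) * (1 / 2) ^ j)"
      by (intro suminf_le b'_bound sb summable_mult summable_half_power)
    also have "\<dots> = 4 * E * (1 / 2) ^ k"
      unfolding suminf_mult[OF summable_half_power] suminf_half_power by simp
    finally show ?thesis using sums_unique[OF b'_sums] by (simp add: c_def)
  qed
  show ?thesis
  proof (rule LIM_zero_cancel, rule Lim_null_comparison)
    show "\<forall>\<^sub>F k in sequentially. norm (2 ^ k * (LINT t|lborel. \<eta> t * lacunary t * cos (4 ^ k * t)) - (LINT t|lborel. \<eta> t) / 2) \<le> 4 * E * (1 / 2) ^ k"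
      using dev by simp
    have "(\<lambda>k. 4 * E * (1 / 2) ^ k) \<longlonglongrightarrow> 4 * E * 0" by (intro tendsto_intros LIMSEQ_power_zero) simp
    then show "(\<lambda>k. 4 * E * (1 / 2) ^ k) \<longlonglongrightarrow> 0" by simp
  qed
qed

lemma half_deriv_test_bounded:
  assumes "f \<in> test_functions"
  obtains B where "\<And>t. \<bar>half_deriv f t\<bar> \<le> B"
  using half_deriv_bound[OF assms order_refl] by blast

lemma lacunary_pairing_integrable:
  assumes \<eta>: "\<eta> \<in> test_functions" and f: "f \<in> test_functions"
  shows "integrable lborel (\<lambda>t. \<eta> t * lacunary t * half_deriv f t)"
proof -
  note [measurable] = test_measurable[OF \<eta>] half_deriv_measurable[OF test_measurable[OF f]]
  obtain B where B: "\<And>t. \<bar>half_deriv f t\<bar> \<le> B" using half_deriv_test_bounded[OF f] by blast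
  have B0: "B \<ge> 0" using B[of 0] by simp
  show ?thesis
  proof (rule Bochner_Integration.integrable_bound[OF integrable_mult_right[OF test_integrable[OF \<eta>], of "2 * B"]])
    show "AE t in lborel. norm (\<eta> t * lacunary t * half_deriv f t) \<le> norm (2 * B * \<eta> t)"
    proof (rule AE_I2)
      fix t
      have "\<bar>\<eta> t\<bar> * (\<bar>lacunary t\<bar> * \<bar>half_deriv f t\<bar>) \<le> \<bar>\<eta> t\<bar> * (2 * B)"
        by (intro mult_left_mono mult_mono lacunary_bounded B) auto
      then show "norm (\<eta> t * lacunary t * half_deriv f t) \<le> norm (2 * B * \<eta> t)"
        using B0 by (simp add: abs_mult mult_ac)
    qed
  qed measurable
qed

text \<open>
  At frequency \<open>4 ^ k\<close> the half-order derivative is multiplication by \<open>sqrt (4 ^ k) = 2 ^ k\<close>, up to an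
  error that tends to zero.
\<close>

lemma lacunary_pairing:
  assumes \<eta>: "\<eta> \<in> test_functions" and \<omega>: "\<omega> \<in> test_functions"
  shows "(\<lambda>k. LINT t|lborel. \<eta> t * lacunary t * half_deriv (\<lambda>s. \<omega> s * cos (4 ^ k * s)) t)
    \<longlonglongrightarrow> (LINT t|lborel. \<eta> t * \<omega> t) / 2"
proof -
  note [measurable] = test_measurable[OF \<eta>] test_measurable[OF \<omega>]
  obtain C where C: "C \<ge> 0"
    "\<And>N t. N > 0 \<Longrightarrow> \<bar>half_deriv (\<lambda>s. \<omega> s * cos (N * s)) t - sqrt N * (\<omega> t * cos (N * t))\<bar> \<le> C / sqrt N"
    using half_deriv_modulated[OF \<omega>] by blast
  have sq: "sqrt (4 ^ k) = 2 ^ k" for k by (simp add: real_sqrt_power)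
  have \<eta>\<omega>: "(\<lambda>t. \<eta> t * \<omega> t) \<in> test_functions" by (rule test_mult[OF test_smooth[OF \<eta>] \<omega>])
  define M where "M = (LINT t|lborel. 2 * \<bar>\<eta> t\<bar>)"
  have dev: "norm ((LINT t|lborel. \<eta> t * lacunary t * half_deriv (\<lambda>s. \<omega> s * cos (4 ^ k * s)) t)
      - 2 ^ k * (LINT t|lborel. (\<eta> t * \<omega> t) * lacunary t * cos (4 ^ k * t))) \<le> (C * M) * (1 / 2) ^ k" for k
  proof -
    define \<theta> where "\<theta> s = \<omega> s * cos (4 ^ k * s)" for s
    have \<theta>: "\<theta> \<in> test_functions" unfolding \<theta>_def[abs_def] by (rule modulated_test[OF \<omega>])
    have i1: "integrable lborel (\<lambda>t. \<eta> t * lacunary t * half_deriv \<theta> t)"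
      by (rule lacunary_pairing_integrable[OF \<eta> \<theta>])
    have i2: "integrable lborel (\<lambda>t. 2 ^ k * ((\<eta> t * \<omega> t) * lacunary t * cos (4 ^ k * t)))"
    proof (rule integrable_mult_right, rule Bochner_Integration.integrable_bound[OF integrable_mult_right[OF test_integrable[OF \<eta>\<omega>], of 2]])
      show "AE t in lborel. norm ((\<eta> t * \<omega> t) * lacunary t * cos (4 ^ k * t)) \<le> norm (2 * (\<eta> t * \<omega> t))"
      proof (rule AE_I2)
        fix t
        have "\<bar>\<eta> t * \<omega> t\<bar> * (\<bar>lacunary t\<bar> * \<bar>cos (4 ^ k * t)\<bar>) \<le> \<bar>\<eta> t * \<omega> t\<bar> * (2 * 1)"
          by (intro mult_left_mono mult_mono lacunary_bounded) auto
        then show "norm ((\<eta> t * \<omega> t) * lacunary t * cos (4 ^ k * t)) \<le> norm (2 * (\<eta> t * \<omega> t))"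
          by (simp add: abs_mult mult_ac)
      qed
    qed measurable
    have diff: "(LINT t|lborel. \<eta> t * lacunary t * half_deriv \<theta> t) - 2 ^ k * (LINT t|lborel. (\<eta> t * \<omega> t) * lacunary t * cos (4 ^ k * t))
      = (LINT t|lborel. \<eta> t * lacunary t * half_deriv \<theta> t - 2 ^ k * ((\<eta> t * \<omega> t) * lacunary t * cos (4 ^ k * t)))"
      by (simp only: Bochner_Integration.integral_diff[OF i1 i2] integral_mult_right_zero)
    have "norm (LINT t|lborel. \<eta> t * lacunary t * half_deriv \<theta> t - 2 ^ k * ((\<eta> t * \<omega> t) * lacunary t * cos (4 ^ k * t)))
        \<le> (LINT t|lborel. (C * (1 / 2) ^ k) * (2 * \<bar>\<eta> t\<bar>))"
    proof (rule Bochner_Integration.integral_norm_bound_integral[OF Bochner_Integration.integrable_diff[OF i1 i2]])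
      show "integrable lborel (\<lambda>t. (C * (1 / 2) ^ k) * (2 * \<bar>\<eta> t\<bar>))"
        by (intro integrable_mult_right integrable_abs test_integrable \<eta>)
      fix t
      have "\<eta> t * lacunary t * half_deriv \<theta> t - 2 ^ k * ((\<eta> t * \<omega> t) * lacunary t * cos (4 ^ k * t))
        = (\<eta> t * lacunary t) * (half_deriv \<theta> t - sqrt (4 ^ k) * (\<omega> t * cos (4 ^ k * t)))"
        unfolding sq by (simp add: algebra_simps)
      also have "norm \<dots> = \<bar>\<eta> t\<bar> * \<bar>lacunary t\<bar> * \<bar>half_deriv \<theta> t - sqrt (4 ^ k) * (\<omega> t * cos (4 ^ k * t))\<bar>"
        by (simp add: abs_mult)
      also have "\<dots> \<le> \<bar>\<eta> t\<bar> * 2 * (C / sqrt (4 ^ k))"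
        using C(2)[of "4 ^ k" t] unfolding \<theta>_def[abs_def]
        by (intro mult_mono lacunary_bounded order_refl) auto
      also have "\<dots> = (C * (1 / 2) ^ k) * (2 * \<bar>\<eta> t\<bar>)" unfolding sq by (simp add: power_one_over field_simps)
      finally show "norm (\<eta> t * lacunary t * half_deriv \<theta> t - 2 ^ k * ((\<eta> t * \<omega> t) * lacunary t * cos (4 ^ k * t)))
        \<le> (C * (1 / 2) ^ k) * (2 * \<bar>\<eta> t\<bar>)" .
    qed
    also have "\<dots> = (C * M) * (1 / 2) ^ k" unfolding M_def integral_mult_right_zero by simp
    finally show ?thesis unfolding diff[unfolded \<theta>_def[abs_def]] unfolding \<theta>_def[abs_def] .
  qed
  have "(\<lambda>k. (LINT t|lborel. \<eta> t * lacunary t * half_deriv (\<lambda>s. \<omega> s * cos (4 ^ k * s)) t)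
      - 2 ^ k * (LINT t|lborel. (\<eta> t * \<omega> t) * lacunary t * cos (4 ^ k * t))) \<longlonglongrightarrow> 0"
  proof (rule Lim_null_comparison[OF always_eventually[OF allI[OF dev]]])
    have "(\<lambda>k. (C * M) * (1 / 2) ^ k) \<longlonglongrightarrow> (C * M) * 0" by (intro tendsto_intros LIMSEQ_power_zero) simp
    then show "(\<lambda>k. (C * M) * (1 / 2) ^ k) \<longlonglongrightarrow> 0" by simp
  qed
  from tendsto_add[OF this lacunary_oscillation[OF \<eta>\<omega>]] show ?thesis by simp
qed

text \<open>The Riemann-Lebesgue lemma: a translation by half a period changes the sign of the oscillating factor.\<close>

lemma Riemann_Lebesgue_time:
  fixes F :: "'a::euclidean_space \<times> real \<Rightarrow> real"
  assumes F: "integrable lborel F"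
  shows "(\<lambda>k. LINT z|lborel. F z * cos (4 ^ k * snd z)) \<longlonglongrightarrow> 0"
proof -
  have [measurable]: "F \<in> borel_measurable borel" using F by simp
  have cm: "(\<lambda>z :: 'a \<times> real. cos (4 ^ k * snd z)) \<in> borel_measurable borel" for k :: nat
    by (intro borel_measurable_continuous_onI continuous_intros)
  define v where "v k = ((0, pi / 4 ^ k) :: 'a \<times> real)" for k :: nat
  have "(\<lambda>k. pi * (1 / 4) ^ k) \<longlonglongrightarrow> pi * 0" by (intro tendsto_intros LIMSEQ_power_zero) simp
  then have "(\<lambda>k. pi / 4 ^ k) \<longlonglongrightarrow> 0" by (simp add: power_one_over)
  then have "v \<longlonglongrightarrow> (0, 0)" unfolding v_def by (intro tendsto_intros)
  moreover have "v k \<noteq> 0" for k using pi_gt_zero by (simp add: v_def zero_prod_def)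
  ultimately have "filterlim v (at 0) sequentially" by (simp add: filterlim_at zero_prod_def)
  from filterlim_compose[OF translation_L1_continuous[OF F] this]
  have lim: "(\<lambda>k. LINT z|lborel. norm (F (z + v k) - F z)) \<longlonglongrightarrow> 0" .
  have bound: "norm (LINT z|lborel. F z * cos (4 ^ k * snd z)) \<le> (LINT z|lborel. norm (F (z + v k) - F z))" for k
  proof -
    define I where "I = (LINT z|lborel. F z * cos (4 ^ k * snd z))"
    have i1: "integrable lborel (\<lambda>z. F z * cos (4 ^ k * snd z))"
      by (rule Bochner_Integration.integrable_bound[OF F]) (use cm in \<open>auto simp: abs_mult mult_left_le\<close>)
    have sh: "cos (4 ^ k * snd (z + v k)) = - cos (4 ^ k * snd z)" for z
      by (simp add: v_def distrib_left)
    have i2: "integrable lborel (\<lambda>z. F (z + v k) * cos (4 ^ k * snd z))"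
      using lborel_integrable_translation[OF i1, of "v k"] unfolding sh by simp
    have "I = (LINT z|lborel. F (z + v k) * cos (4 ^ k * snd (z + v k)))"
      unfolding I_def
      by (rule lborel_integral_translation[symmetric, of "\<lambda>z. F z * cos (4 ^ k * snd z)"]) (use cm in measurable)
    also have "\<dots> = - (LINT z|lborel. F (z + v k) * cos (4 ^ k * snd z))" unfolding sh by simp
    finally have I2: "- I = (LINT z|lborel. F (z + v k) * cos (4 ^ k * snd z))" by simp
    have "- (2 * I) = (LINT z|lborel. F (z + v k) * cos (4 ^ k * snd z)) - (LINT z|lborel. F z * cos (4 ^ k * snd z))"
      unfolding I2[symmetric] I_def[symmetric] by simp
    also have "\<dots> = (LINT z|lborel. F (z + v k) * cos (4 ^ k * snd z) - F z * cos (4 ^ k * snd z))"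
      by (rule Bochner_Integration.integral_diff[OF i2 i1, symmetric])
    also have "norm \<dots> \<le> (LINT z|lborel. norm (F (z + v k) - F z))"
    proof (rule Bochner_Integration.integral_norm_bound_integral[OF Bochner_Integration.integrable_diff[OF i2 i1]])
      show "integrable lborel (\<lambda>z. norm (F (z + v k) - F z))"
        by (intro integrable_norm Bochner_Integration.integrable_diff lborel_integrable_translation F)
      fix z
      show "norm (F (z + v k) * cos (4 ^ k * snd z) - F z * cos (4 ^ k * snd z)) \<le> norm (F (z + v k) - F z)"
        by (simp add: left_diff_distrib[symmetric] abs_mult mult_left_le)
    qed
    finally have "2 * \<bar>I\<bar> \<le> (LINT z|lborel. norm (F (z + v k) - F z))" by (simp add: abs_mult)
    then show ?thesis unfolding I_def[symmetric] by simp
  qed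
  show ?thesis by (rule Lim_null_comparison[OF always_eventually[OF allI[OF bound]] lim])
qed

subsection \<open>Functions that resemble the lacunary series have no half-order derivative\<close>

text \<open>
  Tested against functions oscillating at the frequency of the \<open>k\<close>-th term, the half-order derivative
  multiplies that term by \<open>2\<^sup>k\<close>, which undoes its coefficient: the pairing has a nonzero limit. For a
  locally integrable \<open>h\<close> the same pairings tend to zero by the Riemann-Lebesgue lemma. The correction
  \<open>c k\<close> makes room for test functions with integral zero.
\<close>

lemma no_weak_half_time_deriv:
  fixes X :: "'a::euclidean_space \<Rightarrow> real"
  assumes X: "X \<in> test_functions" and \<eta>: "\<eta> \<in> test_functions" and \<omega>: "\<omega> \<in> test_functions"
    and K: "K \<noteq> 0" and \<eta>\<omega>: "(LINT t|lborel. \<eta> t * \<omega> t) \<noteq> 0"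
    and u: "\<And>t. (LINT y|lebesgue. u (y, t) * X y) = K * (\<eta> t * lacunary t)"
    and c: "c \<longlonglongrightarrow> 0"
    and T: "\<And>k. (\<lambda>z. X (fst z) * (\<omega> (snd z) * cos (4 ^ k * snd z) + c k * \<omega> (snd z))) \<in> T"
  shows "\<not> weak_half_time_deriv T u h"
proof
  assume w: "weak_half_time_deriv T u h"
  then have lh: "locally_integrable h" by (simp add: weak_half_time_deriv_def)
  note hm = locally_integrable_measurable[OF lh]
  obtain h' where h'[measurable]: "h' \<in> borel_measurable borel" and hh': "AE z in lborel. h z = h' z"
    using lebesgue_measurable_ex_borel[OF hm] .
  have lh': "locally_integrable_lborel h'" using locally_integrable_iff_lborel[OF h' hm hh'] lh by simp
  define F where "F z = h' z * (X (fst z) * \<omega> (snd z))" for z :: "'a \<times> real"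
  have F: "integrable lborel F"
    using integrable_test_scaleR[OF h' lh' tensor_test[OF X \<omega>]] by (simp add: F_def[abs_def] mult.commute)
  define P where "P k t = \<omega> t * cos (4 ^ k * t)" for k :: nat and t
  have P: "P k \<in> test_functions" for k unfolding P_def[abs_def] by (rule modulated_test[OF \<omega>])
  define A where "A f = (LINT t|lborel. \<eta> t * lacunary t * half_deriv f t)" for f
  have eq: "K * (A (P k) + c k * A \<omega>) = (LINT z|lborel. F z * cos (4 ^ k * snd z)) + c k * (LINT z|lborel. F z)" for k
  proof -
    define \<phi> where "\<phi> z = X (fst z) * (P k (snd z) + c k * \<omega> (snd z))" for z :: "'a \<times> real"
    have \<phi>m: "\<phi> \<in> borel_measurable borel"
      using tensor_test[OF X test_add[OF P[of k] test_scale[OF \<omega>, of "c k"]]] unfolding \<phi>_def[abs_def]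
      by (rule test_measurable)
    have eqw: "(LINT t|lebesgue. LINT y|lebesgue. u (y, t) * half_time_deriv \<phi> (y, t)) = (LINT z|lebesgue. h z * \<phi> z)"
      using w T[of k] unfolding weak_half_time_deriv_def \<phi>_def[abs_def] P_def by blast
    have "(LINT y|lebesgue. u (y, t) * half_time_deriv \<phi> (y, t))
      = K * (\<eta> t * lacunary t * half_deriv (P k) t + c k * (\<eta> t * lacunary t * half_deriv \<omega> t))" for t
    proof -
      have "u (y, t) * half_time_deriv \<phi> (y, t) = (u (y, t) * X y) * (half_deriv (P k) t + c k * half_deriv \<omega> t)" for y
        unfolding half_time_deriv_slice \<phi>_def fst_conv snd_conv half_deriv_linear_combination[OF P \<omega>]
        by (rule mult.assoc[symmetric])
      then show ?thesis by (simp only: integral_mult_left_zero u) (simp add: algebra_simps)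
    qed
    then have "(LINT z|lebesgue. h z * \<phi> z)
      = (LINT t|lebesgue. K * (\<eta> t * lacunary t * half_deriv (P k) t + c k * (\<eta> t * lacunary t * half_deriv \<omega> t)))"
      unfolding eqw[symmetric] by (simp only:)
    also have "\<dots> = (LINT t|lborel. K * (\<eta> t * lacunary t * half_deriv (P k) t + c k * (\<eta> t * lacunary t * half_deriv \<omega> t)))"
      by (intro integral_completion borel_measurable_integrable integrable_mult_right Bochner_Integration.integrable_add
          lacunary_pairing_integrable \<eta> P \<omega>)
    also have "\<dots> = K * (A (P k) + c k * A \<omega>)"
      unfolding A_def
      by (simp only: integral_mult_right_zero Bochner_Integration.integral_add[OF lacunary_pairing_integrable[OF \<eta> P]
          integrable_mult_right[OF lacunary_pairing_integrable[OF \<eta> \<omega>]]])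
    finally have 1: "K * (A (P k) + c k * A \<omega>) = (LINT z|lebesgue. h z * \<phi> z)" by (rule sym)
    have "(LINT z|lebesgue. h z * \<phi> z) = (LINT z|lborel. h' z * \<phi> z)"
    proof (rule integrable_lebesgue_iff_lborel(2))
      show "(\<lambda>z. h' z * \<phi> z) \<in> borel_measurable borel" using \<phi>m by measurable
      show "(\<lambda>z. h z * \<phi> z) \<in> borel_measurable lebesgue"
        using hm \<phi>m by (intro borel_measurable_times) (auto intro: measurable_completion)
      show "AE z in lborel. h z * \<phi> z = h' z * \<phi> z" using hh' by eventually_elim simp
    qed
    also have "\<dots> = (LINT z|lborel. F z * cos (4 ^ k * snd z) + c k * F z)"
    proof -
      have "h' z * \<phi> z = F z * cos (4 ^ k * snd z) + c k * F z" for z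
        by (simp add: \<phi>_def F_def P_def algebra_simps)
      then show ?thesis by (simp only:)
    qed
    also have "\<dots> = (LINT z|lborel. F z * cos (4 ^ k * snd z)) + c k * (LINT z|lborel. F z)"
    proof -
      have cm: "(\<lambda>z :: 'a \<times> real. cos (4 ^ k * snd z)) \<in> borel_measurable borel"
        by (intro borel_measurable_continuous_onI continuous_intros)
      have "integrable lborel (\<lambda>z. F z * cos (4 ^ k * snd z))"
        by (rule Bochner_Integration.integrable_bound[OF F]) (use cm F in \<open>auto simp: abs_mult mult_left_le\<close>)
      from Bochner_Integration.integral_add[OF this integrable_mult_right[OF F]]
      show ?thesis by (simp only: integral_mult_right_zero)
    qed
    finally show ?thesis unfolding 1 .
  qed
  have "(\<lambda>k. K * (A (P k) + c k * A \<omega>)) \<longlonglongrightarrow> K * ((LINT t|lborel. \<eta> t * \<omega> t) / 2 + 0 * A \<omega>)"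
    using lacunary_pairing[OF \<eta> \<omega>] unfolding A_def P_def[abs_def] by (intro tendsto_intros c)
  moreover have "(\<lambda>k. K * (A (P k) + c k * A \<omega>)) \<longlonglongrightarrow> 0 + 0 * (LINT z|lborel. F z)"
    unfolding eq by (intro tendsto_intros c Riemann_Lebesgue_time[OF F])
  ultimately have "K * ((LINT t|lborel. \<eta> t * \<omega> t) / 2 + 0 * A \<omega>) = 0 + 0 * (LINT z|lborel. F z)"
    by (rule LIMSEQ_unique)
  then show False using K \<eta>\<omega> by simp
qed

section \<open>A graph that oscillates in time only\<close>

definition wave :: "'a::euclidean_space \<times> real \<Rightarrow> real" where
  "wave z = bump 1 (snd z) * lacunary (snd z)"

lemma wave_bound: "\<bar>wave z\<bar> \<le> 2"
proof -
  have "\<bar>bump 1 (snd z)\<bar> * \<bar>lacunary (snd z)\<bar> \<le> 1 * 2"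
    by (intro mult_mono lacunary_bounded) (auto simp: bump_nonneg bump_le_1)
  then show ?thesis by (simp add: wave_def abs_mult)
qed

lemma wave_Lip_1_half: "wave \<in> Lip_1_half"
proof -
  define b :: "real \<Rightarrow> real" where "b = bump 1"
  obtain M where M: "M > 0" "\<And>x v. \<bar>b (x + v) - b x\<bar> \<le> M * norm v"
    using test_lipschitz[OF bump_test[of 1]] unfolding b_def by (metis zero_less_one)
  have b01: "0 \<le> b t" "b t \<le> 1" for t by (simp_all add: b_def bump_nonneg bump_le_1)
  have b: "\<bar>b t - b s\<bar> \<le> (1 + M) * sqrt \<bar>t - s\<bar>" for t s
  proof (cases "\<bar>t - s\<bar> \<le> 1")
    case True
    have "\<bar>t - s\<bar> * \<bar>t - s\<bar> \<le> \<bar>t - s\<bar> * 1" using True by (intro mult_left_mono) auto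
    then have "\<bar>t - s\<bar> \<le> sqrt \<bar>t - s\<bar>" by (intro real_le_rsqrt) (simp add: power2_eq_square)
    then have "M * \<bar>t - s\<bar> \<le> M * sqrt \<bar>t - s\<bar>" using M(1) by simp
    moreover have "\<bar>b t - b s\<bar> \<le> M * \<bar>t - s\<bar>" using M(2)[of s "t - s"] by simp
    moreover have "0 \<le> sqrt \<bar>t - s\<bar>" by simp
    ultimately show ?thesis unfolding distrib_right by linarith
  next
    case False
    then have "1 * 1 \<le> (1 + M) * sqrt \<bar>t - s\<bar>" using M(1) by (intro mult_mono) auto
    moreover have "\<bar>b t - b s\<bar> \<le> 1" using b01[of t] b01[of s] by linarith
    ultimately show ?thesis by linarith
  qed
  have "\<bar>wave (y, s) - wave (u, r)\<bar> \<le> (6 + 2 * (1 + M)) * (norm (y - u) + sqrt \<bar>s - r\<bar>)" for y u :: 'a and s r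
  proof -
    have "wave (y, s) - wave (u, r) = b s * (lacunary s - lacunary r) + (b s - b r) * lacunary r"
      by (simp add: wave_def b_def algebra_simps)
    also have "\<bar>\<dots>\<bar> \<le> \<bar>b s\<bar> * \<bar>lacunary s - lacunary r\<bar> + \<bar>b s - b r\<bar> * \<bar>lacunary r\<bar>"
      unfolding abs_mult[symmetric] by (rule abs_triangle_ineq)
    also have "\<dots> \<le> 1 * (6 * sqrt \<bar>s - r\<bar>) + ((1 + M) * sqrt \<bar>s - r\<bar>) * 2"
      using b01[of s] M(1) by (intro add_mono mult_mono lacunary_Hoelder lacunary_bounded b) auto
    also have "\<dots> = (6 + 2 * (1 + M)) * sqrt \<bar>s - r\<bar>" by (simp add: algebra_simps)
    also have "\<dots> \<le> (6 + 2 * (1 + M)) * (norm (y - u) + sqrt \<bar>s - r\<bar>)"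
      using M(1) by (intro mult_left_mono) auto
    finally show ?thesis .
  qed
  then show ?thesis unfolding Lip_1_half_def by blast
qed

lemma wave_spatial_grad_norm: "spatial_grad_norm \<infinity> (wave :: 'a::euclidean_space \<times> real \<Rightarrow> real) = 0"
proof -
  have w: "has_weak_gradient (\<lambda>y::'a. c) (\<lambda>y. 0)" for c :: real
  proof -
    have "set_integrable lborel (cball 0 R) (\<lambda>y::'a. c)" for R
      unfolding set_integrable_def real_scaleR_def
      by (intro integrable_mult_left integrable_real_indicator emeasure_lborel_cball_finite) simp
    moreover have "set_integrable lborel (cball 0 R) (\<lambda>y::'a. 0::'a)" for R by (simp add: set_integrable_def)
    ultimately have "weak_gradient_lborel (\<lambda>y::'a. c) (\<lambda>y. 0)"
      by (simp add: weak_gradient_lborel_def test_derivative_integral_0)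
    then show ?thesis
      using has_weak_gradient_iff_lborel[of "\<lambda>y::'a. c" "\<lambda>y. 0" "\<lambda>y. c" "\<lambda>y. 0"] by simp
  qed
  have "spatial_grad_norm \<infinity> (wave :: 'a \<times> real \<Rightarrow> real) \<le> Lp_norm \<infinity> (\<lambda>z::'a \<times> real. 0::'a)"
    unfolding spatial_grad_norm_def by (intro INF_lower) (simp add: wave_def w)
  also have "\<dots> \<le> 0"
  proof -
    have "esssup lebesgue (\<lambda>z::'a \<times> real. 0::ennreal) \<le> 0" by (intro esssup_I) auto
    then show ?thesis by (simp add: Lp_norm_def)
  qed
  finally show ?thesis by simp
qed

lemma lacunary_test_coefficient_LIMSEQ:
  assumes \<omega>: "\<omega> \<in> test_functions"
  shows "(\<lambda>k. LINT t|lborel. \<omega> t * cos (4 ^ k * t)) \<longlonglongrightarrow> 0"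
proof -
  obtain E where E: "E \<ge> 0" "\<And>m. \<bar>m\<bar> * \<bar>LINT t|lborel. \<omega> t * cos (m * t)\<bar> \<le> E"
    using test_cosine_coefficient[OF \<omega>] by blast
  have "norm (LINT t|lborel. \<omega> t * cos (4 ^ k * t)) \<le> E * (1 / 4) ^ k" for k
    using E(2)[of "4 ^ k"] by (simp add: power_one_over field_simps)
  then show ?thesis
  proof (rule Lim_null_comparison[OF always_eventually[OF allI]])
    have "(\<lambda>k. E * (1 / 4) ^ k) \<longlonglongrightarrow> E * 0" by (intro tendsto_intros LIMSEQ_power_zero) simp
    then show "(\<lambda>k. E * (1 / 4) ^ k) \<longlonglongrightarrow> 0" by simp
  qed
qed

lemma test_integral_lebesgue: "\<phi> \<in> test_functions \<Longrightarrow> (LINT x|lebesgue. \<phi> x) = (LINT x|lborel. \<phi> x)"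
  by (intro integral_completion) (simp add: test_measurable)

lemma wave_half_time_deriv: "\<not> half_time_deriv_in_BMO_par (wave :: 'a::euclidean_space \<times> real \<Rightarrow> real)"
proof
  assume "half_time_deriv_in_BMO_par (wave :: 'a \<times> real \<Rightarrow> real)"
  then obtain h where w: "weak_half_time_deriv {\<phi> \<in> test_functions. (LINT z|lebesgue. \<phi> z) = 0} (wave :: 'a \<times> real \<Rightarrow> real) h"
    by (auto simp: half_time_deriv_in_BMO_par_def)
  define X :: "'a \<Rightarrow> real" where "X = bump 1"
  define b :: "real \<Rightarrow> real" where "b = bump 1"
  have X: "X \<in> test_functions" and b: "b \<in> test_functions" by (simp_all add: X_def b_def bump_test)
  have bb: "(\<lambda>t. b t * b t) \<in> test_functions" by (rule test_mult[OF test_smooth[OF b] b])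
  have at0: "X 0 = 1" "b 0 = 1" by (simp_all add: X_def b_def bump_eq_1)
  have X_pos: "(LINT y|lborel. X y) > 0" by (rule test_integral_pos[OF X]) (use at0 in \<open>simp_all add: X_def bump_nonneg\<close>)
  have b_pos: "(LINT t|lborel. b t) > 0" by (rule test_integral_pos[OF b]) (use at0 in \<open>simp_all add: b_def bump_nonneg\<close>)
  have bb_pos: "(LINT t|lborel. b t * b t) > 0" by (rule test_integral_pos[OF bb]) (use at0 in simp_all)
  \<comment> \<open>With this choice the test functions have integral zero.\<close>
  define c where "c k = - (LINT t|lborel. b t * cos (4 ^ k * t)) / (LINT t|lborel. b t)" for k :: nat
  have "(LINT y|lborel. X y) \<noteq> 0" "(LINT t|lborel. b t * b t) \<noteq> 0" using X_pos bb_pos by simp_all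
  from no_weak_half_time_deriv[OF X b b this, where u = wave and c = c] w
  show False
  proof (elim notE[rotated], goal_cases)
    case 1
    show ?case
    proof (rule 1)
      show "(LINT y|lebesgue. wave (y, t) * X y) = (LINT y|lborel. X y) * (b t * lacunary t)" for t
        by (simp add: wave_def b_def test_integral_lebesgue[OF X])
      have "c \<longlonglongrightarrow> - 0 / (LINT t|lborel. b t)"
        unfolding c_def[abs_def] by (intro tendsto_intros lacunary_test_coefficient_LIMSEQ b) (use b_pos in simp)
      then show "c \<longlonglongrightarrow> 0" by simp
      fix k
      define v where "v t = b t * cos (4 ^ k * t) + c k * b t" for t
      note m = modulated_test[OF b, of "4 ^ k"]
      have v: "v \<in> test_functions" unfolding v_def[abs_def] by (intro test_add m test_scale b)
      have "(LINT t|lborel. v t) = (LINT t|lborel. b t * cos (4 ^ k * t)) + c k * (LINT t|lborel. b t)"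
        unfolding v_def by (simp only: Bochner_Integration.integral_add[OF test_integrable[OF m] integrable_mult_right[OF test_integrable[OF b]]] integral_mult_right_zero)
      then have v0: "(LINT t|lborel. v t) = 0" using b_pos by (simp add: c_def)
      have Xv: "(\<lambda>z. X (fst z) * v (snd z)) \<in> test_functions" by (rule tensor_test[OF X v])
      have "(LINT z|lebesgue. X (fst z) * v (snd z)) = (LINT y|lborel. LINT t|lborel. X y * v t)"
        using integral_time_slices(4)[OF test_integrable[OF Xv]] test_integral_lebesgue[OF Xv] by simp
      then have "(LINT z|lebesgue. X (fst z) * v (snd z)) = 0" using v0 by simp
      then show "(\<lambda>z. X (fst z) * (b (snd z) * cos (4 ^ k * snd z) + c k * b (snd z)))
        \<in> {\<phi> \<in> test_functions. (LINT z|lebesgue. \<phi> z) = 0}"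
        using Xv by (simp add: v_def)
    qed
  qed
qed

text \<open>
  In the tilted direction the points of the graph move horizontally by a multiple of \<open>wave\<close>, so a function
  that is linear in space near the origin picks up \<open>wave\<close> itself.
\<close>

definition tilted :: "'a::euclidean_space \<Rightarrow> 'a \<times> real" where
  "tilted e = ((3 / 5) *\<^sub>R e, 4 / 5)"

lemma tilted_admissible:
  assumes "norm e = 1"
  shows "norm (tilted e) = 1" "admissible wave (tilted e)"
proof -
  show n: "norm (tilted e) = 1" using assms by (simp add: tilted_def norm_Pair power2_eq_square)
  have "arccos (4 / 5) < arccos 0" by (rule arccos_less_arccos) auto
  then show "admissible wave (tilted e)"
    using n unfolding admissible_def wave_spatial_grad_norm Let_def by (simp add: tilted_def e\<^sub>n_def)
qed

text \<open>
  The linear function \<open>\<lambda>x. x \<bullet> e\<close>, cut off outside the ball of radius 4: as \<open>wave\<close> is bounded by 2, this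
  ball contains the horizontal positions of all boundary points with tilted parameter in the unit ball.
\<close>

definition profile :: "'a::euclidean_space \<Rightarrow> 'a \<Rightarrow> real" where
  "profile e x = (x \<bullet> e) * bump (1 / 16) x"

lemma profile_test: "profile e \<in> test_functions"
  unfolding profile_def[abs_def]
  by (intro test_mult bump_test allI Ck_bounded_linear bounded_linear_inner_left) simp

lemma profile_tilted:
  fixes e :: "'a::euclidean_space"
  assumes e: "norm e = 1" and Q: "isometry_onto_perp (tilted e) Q"
    and f: "f \<circ> graph_map wave = (\<lambda>z. profile e (fst z) * bump 1 (snd z))" and y: "norm y \<le> 1"
  shows "(f \<circ> dir_graph_map wave (tilted e) Q) (y, t)
    = (fst (Q y) \<bullet> e - 3 / 4 * snd (Q y) + 3 / 4 * wave (y, t)) * bump 1 t"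
proof -
  interpret graph_direction wave "tilted e" Q 1
  proof unfold_locales
    show "continuous_on UNIV wave" by (rule Lip_1_half_continuous[OF wave_Lip_1_half])
  qed (use e Q tilted_admissible[OF e] in \<open>auto simp: wave_def tilted_def\<close>)
  define w where "w = wave (y, t)"
  define g where "g = graph_fun (y, t)"
  have "snd (Q y) + g * (4 / 5) = w"
    using height_graph_fun[of "(y, t)"] unfolding height_def fst_conv snd_conv g_def[symmetric]
    by (simp add: tilted_def w_def wave_def)
  then have g: "g = 5 / 4 * (w - snd (Q y))" by simp
  have \<Phi>: "\<Phi> (y, t) = fst (Q y) + (g * (3 / 5)) *\<^sub>R e"
    unfolding \<Phi>_def fst_conv g_def[symmetric] by (simp add: tilted_def)
  have ee: "e \<bullet> e = 1" using e by (simp add: dot_square_norm)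
  have q: "norm (fst (Q y)) \<le> 1" "\<bar>snd (Q y)\<bar> \<le> 1"
    using norm_le_norm_Pair[of "fst (Q y)" "snd (Q y)"] Q_norm[of y] y norm_le_norm_Pair(2)[of "snd (Q y)" "fst (Q y)"] by auto
  have w: "\<bar>w\<bar> \<le> 2" unfolding w_def by (rule wave_bound)
  have "\<bar>g * (3 / 5)\<bar> \<le> 3" using w q(2) unfolding g by (simp add: abs_le_iff)
  moreover have "norm (\<Phi> (y, t)) \<le> norm (fst (Q y)) + \<bar>g * (3 / 5)\<bar>"
    unfolding \<Phi> using norm_triangle_ineq[of "fst (Q y)" "(g * (3 / 5)) *\<^sub>R e"] e by simp
  ultimately have "norm (\<Phi> (y, t)) \<le> 4" using q(1) by linarith
  then have "(norm (\<Phi> (y, t)))\<^sup>2 \<le> 4\<^sup>2" by (intro power_mono) auto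
  then have "bump (1 / 16) (\<Phi> (y, t)) = 1" by (intro bump_eq_1) simp
  moreover have "\<Phi> (y, t) \<bullet> e = fst (Q y) \<bullet> e - 3 / 4 * snd (Q y) + 3 / 4 * w"
  proof -
    have "\<Phi> (y, t) \<bullet> e = fst (Q y) \<bullet> e + g * (3 / 5)" unfolding \<Phi> by (simp add: inner_add_left ee)
    then show ?thesis unfolding g by (simp add: field_simps)
  qed
  ultimately show ?thesis unfolding pull_back_dir f by (simp add: profile_def w_def)
qed

text \<open>
  Integration against an even function of \<open>y\<close> supported in the unit ball removes the part of the
  pull-back that is linear in \<open>y\<close>, and leaves a multiple of \<open>(bump 1 t)\<^sup>2 * lacunary t\<close>.
\<close>

lemma tilted_half_time_deriv_norm:
  fixes e :: "'a::euclidean_space"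
  assumes e: "norm e = 1" and Q: "isometry_onto_perp (tilted e) Q"
    and f: "f \<circ> graph_map wave = (\<lambda>z. profile e (fst z) * bump 1 (snd z))"
  shows "half_time_deriv_norm 2 (f \<circ> dir_graph_map wave (tilted e) Q) = \<infinity>"
proof -
  define u where "u = f \<circ> dir_graph_map wave (tilted e) Q"
  define X :: "'a \<Rightarrow> real" where "X = bump 4"
  define b :: "real \<Rightarrow> real" where "b = bump 1"
  define l where "l y = fst (Q y) \<bullet> e - 3 / 4 * snd (Q y)" for y
  define \<eta> where "\<eta> t = b t * b t" for t
  have X: "X \<in> test_functions" and b: "b \<in> test_functions" by (simp_all add: X_def b_def bump_test)
  have \<eta>: "\<eta> \<in> test_functions" unfolding \<eta>_def[abs_def] by (rule test_mult[OF test_smooth[OF b] b])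
  have \<eta>b: "(\<lambda>t. \<eta> t * b t) \<in> test_functions" by (rule test_mult[OF test_smooth[OF \<eta>] b])
  have at0: "X 0 = 1" "b 0 = 1" by (simp_all add: X_def b_def bump_eq_1)
  have X_pos: "(LINT y|lborel. X y) > 0" by (rule test_integral_pos[OF X]) (use at0 in \<open>simp_all add: X_def bump_nonneg\<close>)
  have \<eta>b_pos: "(LINT t|lborel. \<eta> t * b t) > 0"
    by (rule test_integral_pos[OF \<eta>b]) (use at0 in \<open>simp_all add: \<eta>_def b_def bump_nonneg\<close>)
  have linQ: "linear Q" using Q by (simp add: isometry_onto_perp_def)
  have bQ: "bounded_linear Q" using linQ by (simp add: linear_conv_bounded_linear)
  have l: "bounded_linear l"
    unfolding l_def[abs_def]
    by (intro bounded_linear_sub bounded_linear_const_mult bounded_linear_compose[OF bounded_linear_inner_left]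
        bounded_linear_compose[OF bounded_linear_fst bQ] bounded_linear_compose[OF bounded_linear_snd bQ])
  have lX: "(\<lambda>y. l y * X y) \<in> test_functions" by (intro test_mult X allI Ck_bounded_linear l)
  have lX0: "(LINT y|lborel. l y * X y) = 0"
  proof -
    have "(LINT y|lborel. l (0 - y) * X (0 - y)) = (LINT y|lborel. l y * X y)"
      by (rule lborel_integral_reflection[OF test_measurable[OF lX]])
    moreover have "l (- y) * X (- y) = - (l y * X y)" for y
      using linear_neg[OF bounded_linear.linear[OF l]] by (simp add: X_def bump_minus)
    ultimately show ?thesis by simp
  qed
  have ux: "u (y, t) * X y = b t * (l y * X y) + (3 / 4 * (\<eta> t * lacunary t)) * X y" for y t
  proof (cases "norm y \<le> 1")
    case True
    show ?thesis
      unfolding u_def profile_tilted[OF e Q f True]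
      by (simp add: l_def \<eta>_def b_def wave_def algebra_simps)
  next
    case False
    then have "1\<^sup>2 \<le> (norm y)\<^sup>2" by (intro power_mono) auto
    then have "X y = 0" by (simp add: X_def bump_def plateau_eq_0)
    then show ?thesis by simp
  qed
  have "(LINT y|lebesgue. u (y, t) * X y) = 3 / 4 * (LINT y|lborel. X y) * (\<eta> t * lacunary t)" for t
  proof -
    have "(LINT y|lebesgue. u (y, t) * X y) = (LINT y|lborel. b t * (l y * X y) + (3 / 4 * (\<eta> t * lacunary t)) * X y)"
      unfolding ux
      by (intro integral_completion borel_measurable_integrable integrable_mult_right Bochner_Integration.integrable_add
          test_integrable X lX)
    also have "\<dots> = 3 / 4 * (LINT y|lborel. X y) * (\<eta> t * lacunary t)"
      by (simp only: Bochner_Integration.integral_add[OF integrable_mult_right[OF test_integrable[OF lX]] integrable_mult_right[OF test_integrable[OF X]]]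
          integral_mult_right_zero lX0) (simp only: mult_zero_right add_0 mult_ac)
    finally show ?thesis .
  qed
  moreover have "3 / 4 * (LINT y|lborel. X y) \<noteq> 0" "(LINT t|lborel. \<eta> t * b t) \<noteq> 0" using X_pos \<eta>b_pos by simp_all
  moreover have "(\<lambda>z. X (fst z) * (b (snd z) * cos (4 ^ k * snd z) + 0 * b (snd z))) \<in> test_functions" for k :: nat
    using tensor_test[OF X modulated_test[OF b, of "4 ^ k"]] by simp
  ultimately have "\<not> weak_half_time_deriv test_functions u h" for h
    by (intro no_weak_half_time_deriv[OF X \<eta> b, where c = "\<lambda>k. 0"] tendsto_const)
  then show ?thesis unfolding half_time_deriv_norm_def u_def[symmetric] by simp
qed

section \<open>Dependence of the half-order derivative on the direction\<close>

theorem theorem1p8: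
  shows
    "(\<exists>\<psi> \<in> (Lip_1_half :: ((real ^ 'm) \<times> real \<Rightarrow> real) set).
      \<not> half_time_deriv_in_BMO_par \<psi> \<and>
      (\<exists>\<nu> (f :: ((real ^ 'm) \<times> real) \<times> real \<Rightarrow> real).
        admissible \<psi> \<nu> \<and>
        f \<circ> graph_map \<psi> \<in> test_functions \<and>
        (\<forall>p. 1 < p \<and> p < \<infinity> \<longrightarrow>
           spatial_grad_norm p (f \<circ> graph_map \<psi>) + half_time_deriv_norm p (f \<circ> graph_map \<psi>) < \<infinity>) \<and>
        (\<forall>Q. isometry_onto_perp \<nu> Q \<longrightarrow>
           spatial_grad_norm 2 (f \<circ> dir_graph_map \<psi> \<nu> Q) +
           half_time_deriv_norm 2 (f \<circ> dir_graph_map \<psi> \<nu> Q) = \<infinity>)))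
    \<and>
    (\<forall>\<psi> \<in> (Lip_1_half :: ((real ^ 'm) \<times> real \<Rightarrow> real) set).
      \<forall>\<nu> Q. admissible \<psi> \<nu> \<and> isometry_onto_perp \<nu> Q \<longrightarrow>
        (\<forall>p. 1 \<le> p \<longrightarrow>
          (\<exists>C>0::real. \<forall>f :: ((real ^ 'm) \<times> real) \<times> real \<Rightarrow> real.
             f \<circ> graph_map \<psi> \<in> borel_measurable lebesgue \<longrightarrow>
             spatial_grad_norm p (f \<circ> dir_graph_map \<psi> \<nu> Q)
               \<le> ennreal C * spatial_grad_norm p (f \<circ> graph_map \<psi>) \<and>
             spatial_grad_norm p (f \<circ> graph_map \<psi>)
               \<le> ennreal C * spatial_grad_norm p (f \<circ> dir_graph_map \<psi> \<nu> Q))))"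
proof (rule conjI)
  obtain e :: "real ^ 'm" where "e \<in> Basis" using nonempty_Basis by blast
  then have e: "norm e = 1" by simp
  define g :: "(real ^ 'm) \<times> real \<Rightarrow> real" where "g = (\<lambda>z. profile e (fst z) * bump 1 (snd z))"
  have b: "(bump 1 :: real \<Rightarrow> real) \<in> test_functions" by (rule bump_test) simp
  have g: "g \<in> test_functions" unfolding g_def by (rule tensor_test[OF profile_test b])
  have fin: "spatial_grad_norm p g + half_time_deriv_norm p g < \<infinity>" if p: "1 < p" "p < \<infinity>" for p
    using spatial_grad_norm_test_finite[OF g p(2)]
      half_time_deriv_norm_product_finite[OF profile_test b p]
    by (simp add: g_def)
  define f :: "((real ^ 'm) \<times> real) \<times> real \<Rightarrow> real" where "f p = g (fst (fst p), snd p)" for p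
  have f: "f \<circ> graph_map wave = g" by (auto simp: f_def graph_map_def)
  have inf: "spatial_grad_norm 2 (f \<circ> dir_graph_map wave (tilted e) Q) +
      half_time_deriv_norm 2 (f \<circ> dir_graph_map wave (tilted e) Q) = \<infinity>" if "isometry_onto_perp (tilted e) Q" for Q
    using tilted_half_time_deriv_norm[OF e that f[unfolded g_def]] by simp
  show "\<exists>\<psi> \<in> (Lip_1_half :: ((real ^ 'm) \<times> real \<Rightarrow> real) set).
      \<not> half_time_deriv_in_BMO_par \<psi> \<and>
      (\<exists>\<nu> (f :: ((real ^ 'm) \<times> real) \<times> real \<Rightarrow> real).
        admissible \<psi> \<nu> \<and>
        f \<circ> graph_map \<psi> \<in> test_functions \<and>
        (\<forall>p. 1 < p \<and> p < \<infinity> \<longrightarrow>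
           spatial_grad_norm p (f \<circ> graph_map \<psi>) + half_time_deriv_norm p (f \<circ> graph_map \<psi>) < \<infinity>) \<and>
        (\<forall>Q. isometry_onto_perp \<nu> Q \<longrightarrow>
           spatial_grad_norm 2 (f \<circ> dir_graph_map \<psi> \<nu> Q) +
           half_time_deriv_norm 2 (f \<circ> dir_graph_map \<psi> \<nu> Q) = \<infinity>))"
    using wave_Lip_1_half wave_half_time_deriv tilted_admissible(2)[OF e] g fin inf
    by (intro bexI[of _ wave] conjI exI[of _ "tilted e"] exI[of _ f]) (simp_all add: f)
qed (use gradient_norms_comparable_admissible in blast)

end
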